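(* Let $F:\Sigma\to\Sigma$, $F(x,y)=(f(x),G(x,y))$, be a transformation with $f\in\mathcal{T}$ and $G$ satisfying (H1). Then the operator $F_*:S^1\to S^1$ can be written as $F_*=P+N$, where: (a) $P$ is a projection, i.e. $P^2=P$, and $\dim\operatorname{Im}(P)=1$; (b) there are $0\le\lambda_0<1$ and $U\ge0$ such that for all $\mu\in S^1$ and all $n\geq 1$, $\|N^n(\mu)\|_{S^1}\le \|\mu\|_{S^1}\,\lambda_0^n\,U$; (c) $PN=NP=0$.
   Context: Setting. $I=[0,1]$, $m$ is Lebesgue measure on $I$, $d_1$ the Euclidean distance on $I$; $(K,d_2)$ is a compact metric space with $\operatorname{diam}(K)=1$; $\Sigma=I\times K$ with metric $d_1+d_2$. The map $F=(f,G)$ is assumed Borel measurable, with $f:I\to I$, $G:\Sigma\to K$. Class $\mathcal{T}$. There is a countably infinite family $\mathcal P=\{I_i=(a_i,b_i)\}_{i\ge1}$ of pairwise disjoint open subintervals of $I$ with $m(I\setminus\bigcup_i I_i)=0$. $f\in\mathcal T$ means that $f:\bigcup_i I_i\to I$ satisfies: (1) each $f_i=f|_{I_i}$ is increasing, convex and differentiable with $\lim_{x\to a_i^+}f_i(x)=0$ (the values $f_i(a_i)=0$, $f_i(b_i)$ and $f_i'(a_i)$ are defined by continuity); (2) $\sum_{i\ge1}1/f_i'(a_i)<\infty$; (3) if $0$ is not a limit point of the partition points, then $f'(0)=1/\beta>1$ for some $0<\beta<1$. On the $m$-null set $I\setminus\bigcup_i I_i$, $f$ is given arbitrary (Borel)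 values. (H1): there is $0\le\alpha<1$ such that for $m$-a.e. $x\in I$, $d_2(G(x,z_1),G(x,z_2))\le\alpha d_2(z_1,z_2)$ for all $z_1,z_2\in K$. Measures. $\pi_1(x,y)=x$. $\mathcal{AB}$ is the set of finite signed Borel measures $\mu$ on $\Sigma$, with Jordan decomposition $\mu=\mu^+-\mu^-$, such that $\pi_{1*}\mu^{\pm}\ll m$. For positive $\mu\in\mathcal{AB}$, disintegrate (Rokhlin) along the fibers $\gamma=\{x\}\times K$ (identified with $x\in I$) as $\mu=\int\mu_\gamma\,\phi_1(\gamma)\,dm(\gamma)$ with $\mu_\gamma$ probabilities on $\gamma$ and $\phi_1=d(\pi_{1*}\mu)/dm$; let $\mu|_\gamma$ be the positive measure on $K$ obtained by projecting $\phi_1(\gamma)\mu_\gamma$ to $K$. For signed $\mu\in\mathcal{AB}$, $\mu|_\gamma=\mu^+|_\gamma-\mu^-|_\gamma$ and $\phi_1=\phi_1^+-\phi_1^-=d(\pi_{1*}\mu)/dm$. For a signed measure $\nu$ on $K$, $\|\nu\|_W=\sup\{|\int h\,d\nu|: h:K\to\mathbb R \text{ Lipschitz}, L(h)\le1, |h|_\infty\le1\}$, $L(h)$ being the best Lipschitz constant. $\mathcal L^1=\{\mu\in\mathcal{AB}:\|\mu\|_1:=\int\|\mu|_\gamma\|_W\,dm(\gamma)<\infty\}$. $BV_m$: for $h\in L^1_m$, $V(h)$ is the infimum, over all representatives $h^*$ of $h$, of the total variation of $h^*$ on $I$; $BV_m=\{h\in L^1_m: V(h)<\infty\}$ and $|h|_v=\int|h|\,dm+V(h)$.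 $S^1=\{\mu\in\mathcal L^1:\phi_1\in BV_m\}$ with norm $\|\mu\|_{S^1}=|\phi_1|_v+\|\mu\|_1$. The transfer operator is $[F_*\mu](E)=\mu(F^{-1}(E))$. *)

theory Defs
  imports "HOL-Probability.Probability" "HOL-Library.Function_Algebras"
begin

text \<open>
  A finite signed measure on a measurable space S is represented by a set function
  \<^typ>\<open>'a set \<Rightarrow> real\<close> that is countably additive on \<open>sets S\<close> and, so that equality of
  signed measures is equality of functions, vanishes outside \<open>sets S\<close>. Only \<open>space S\<close> and
  \<open>sets S\<close> matter, not the measure carried by S. The vector space operations are pointwise.
\<close>

instantiation "fun" :: (type, real_vector) real_vector
begin

definition "scaleR c f = (\<lambda>x. c *\<^sub>R f x)"

instance
  by standard (auto simp: scaleR_fun_def scaleR_add_right scaleR_add_left)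

end

definition linear_operator_on :: "'v::real_vector set \<Rightarrow> ('v \<Rightarrow> 'v) \<Rightarrow> bool" where
  "linear_operator_on S T \<longleftrightarrow>
     (\<forall>v\<in>S. T v \<in> S) \<and>
     (\<forall>v\<in>S. \<forall>w\<in>S. T (v + w) = T v + T w) \<and>
     (\<forall>c. \<forall>v\<in>S. T (c *\<^sub>R v) = c *\<^sub>R T v)"


section \<open>Signed measures\<close>

definition signed_measure :: "'a measure \<Rightarrow> ('a set \<Rightarrow> real) \<Rightarrow> bool" where
  "signed_measure S \<mu> \<longleftrightarrow>
     (\<forall>E. E \<notin> sets S \<longrightarrow> \<mu> E = 0) \<and>
     (\<forall>A :: nat \<Rightarrow> 'a set. range A \<subseteq> sets S \<longrightarrow> disjoint_family A \<longrightarrow>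
        (\<lambda>n. \<mu> (A n)) sums \<mu> (\<Union>n. A n))"

definition hahn_set :: "'a measure \<Rightarrow> ('a set \<Rightarrow> real) \<Rightarrow> 'a set" where
  "hahn_set S \<mu> = (SOME H. H \<in> sets S \<and>
     (\<forall>E\<in>sets S. E \<subseteq> H \<longrightarrow> \<mu> E \<ge> 0) \<and>
     (\<forall>E\<in>sets S. E \<subseteq> space S - H \<longrightarrow> \<mu> E \<le> 0))"

text \<open>
  The Jordan decomposition, read off a Hahn decomposition of the space; it does not depend on
  which Hahn decomposition is chosen.
\<close>

definition pos_part :: "'a measure \<Rightarrow> ('a set \<Rightarrow> real) \<Rightarrow> 'a measure" where
  "pos_part S \<mu> = measure_of (space S) (sets S) (\<lambda>E. ennreal (\<mu> (E \<inter> hahn_set S \<mu>)))"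

definition neg_part :: "'a measure \<Rightarrow> ('a set \<Rightarrow> real) \<Rightarrow> 'a measure" where
  "neg_part S \<mu> = measure_of (space S) (sets S) (\<lambda>E. ennreal (- \<mu> (E - hahn_set S \<mu>)))"

definition signed_integral :: "'a measure \<Rightarrow> ('a set \<Rightarrow> real) \<Rightarrow> ('a \<Rightarrow> real) \<Rightarrow> real" where
  "signed_integral S \<nu> h =
     integral\<^sup>L (pos_part S \<nu>) h - integral\<^sup>L (neg_part S \<nu>) h"

definition push_forward ::
    "'a measure \<Rightarrow> ('a \<Rightarrow> 'a) \<Rightarrow> ('a set \<Rightarrow> real) \<Rightarrow> 'a set \<Rightarrow> real" where
  "push_forward S T \<mu> = (\<lambda>E. if E \<in> sets S then \<mu> (T -` E \<inter> space S) else 0)"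

definition W_norm :: "'k::metric_space set \<Rightarrow> ('k set \<Rightarrow> real) \<Rightarrow> ennreal" where
  "W_norm K \<nu> = (SUP h \<in> {h :: 'k \<Rightarrow> real. 1-lipschitz_on K h \<and> (\<forall>y\<in>K. \<bar>h y\<bar> \<le> 1)}.
     ennreal \<bar>signed_integral (restrict_space borel K) \<nu> h\<bar>)"


section \<open>Bounded variation on the unit interval\<close>

definition unit_leb :: "real measure" where
  "unit_leb = restrict_space lborel {0..1}"

definition total_variation :: "(real \<Rightarrow> real) \<Rightarrow> ennreal" where
  "total_variation h = (SUP (n, t) \<in> {(n :: nat, t :: nat \<Rightarrow> real).
       mono_on {..n} t \<and> t ` {..n} \<subseteq> {0..1}}.
     ennreal (\<Sum>i<n. \<bar>h (t (Suc i)) - h (t i)\<bar>))"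

definition ess_variation :: "(real \<Rightarrow> real) \<Rightarrow> ennreal" where
  "ess_variation h = (INF h' \<in> {h'. AE x in unit_leb. h' x = h x}. total_variation h')"

definition BV_m :: "(real \<Rightarrow> real) set" where
  "BV_m = {h. integrable unit_leb h \<and> ess_variation h < \<infinity>}"

definition BV_norm :: "(real \<Rightarrow> real) \<Rightarrow> real" where
  "BV_norm h = (LINT x|unit_leb. \<bar>h x\<bar>) + enn2real (ess_variation h)"


section \<open>Measures on the product and their restrictions to fibres\<close>

text \<open>
  The product topology of \<open>{0..1} \<times> K\<close> is the topology of the sum of the two metrics, so the
  following is its Borel sigma-algebra.
\<close>

definition Sigma_borel :: "'k::metric_space set \<Rightarrow> (real \<times> 'k) measure" where
  "Sigma_borel K = restrict_space borel ({0..1} \<times> K)"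

definition marginal :: "(real \<times> 'k::metric_space) measure \<Rightarrow> real measure" where
  "marginal M = distr M unit_leb fst"

definition marginal_density :: "(real \<times> 'k::metric_space) measure \<Rightarrow> real \<Rightarrow> real" where
  "marginal_density M x = enn2real (RN_deriv unit_leb (marginal M) x)"

definition AB :: "'k::metric_space set \<Rightarrow> ((real \<times> 'k) set \<Rightarrow> real) set" where
  "AB K = {\<mu>. signed_measure (Sigma_borel K) \<mu> \<and>
     absolutely_continuous unit_leb (marginal (pos_part (Sigma_borel K) \<mu>)) \<and>
     absolutely_continuous unit_leb (marginal (neg_part (Sigma_borel K) \<mu>))}"

text \<open>
  Rokhlin disintegration of a positive measure M along the fibres \<open>{x} \<times> K\<close>. It is determined
  for almost every x with respect to the marginal of M, so the choice made in \<open>fibre_measure\<close>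
  affects \<open>fibre_restr_pos\<close> on a Lebesgue null set of fibres only.
\<close>

definition is_disintegration ::
    "'k::metric_space set \<Rightarrow> (real \<times> 'k) measure \<Rightarrow> (real \<Rightarrow> (real \<times> 'k) measure) \<Rightarrow> bool" where
  "is_disintegration K M \<kappa> \<longleftrightarrow>
     \<kappa> \<in> measurable unit_leb (prob_algebra (Sigma_borel K)) \<and>
     (\<forall>x\<in>{0..1}. emeasure (\<kappa> x) ({x} \<times> K) = 1) \<and>
     (\<forall>E\<in>sets (Sigma_borel K).
        emeasure M E = (\<integral>\<^sup>+x. emeasure (\<kappa> x) E * ennreal (marginal_density M x) \<partial>unit_leb))"

definition fibre_measure ::
    "'k::metric_space set \<Rightarrow> (real \<times> 'k) measure \<Rightarrow> real \<Rightarrow> (real \<times> 'k) measure" where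
  "fibre_measure K M = (SOME \<kappa>. is_disintegration K M \<kappa>)"

definition fibre_restr_pos ::
    "'k::metric_space set \<Rightarrow> (real \<times> 'k) measure \<Rightarrow> real \<Rightarrow> 'k set \<Rightarrow> real" where
  "fibre_restr_pos K M x =
     (\<lambda>A. marginal_density M x *
        measure (distr (fibre_measure K M x) (restrict_space borel K) snd) A)"

definition fibre_restr ::
    "'k::metric_space set \<Rightarrow> ((real \<times> 'k) set \<Rightarrow> real) \<Rightarrow> real \<Rightarrow> 'k set \<Rightarrow> real" where
  "fibre_restr K \<mu> x = fibre_restr_pos K (pos_part (Sigma_borel K) \<mu>) x
     - fibre_restr_pos K (neg_part (Sigma_borel K) \<mu>) x"

definition signed_density ::
    "'k::metric_space set \<Rightarrow> ((real \<times> 'k) set \<Rightarrow> real) \<Rightarrow> real \<Rightarrow> real" where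
  "signed_density K \<mu> x = marginal_density (pos_part (Sigma_borel K) \<mu>) x
     - marginal_density (neg_part (Sigma_borel K) \<mu>) x"

definition L1_enorm :: "'k::metric_space set \<Rightarrow> ((real \<times> 'k) set \<Rightarrow> real) \<Rightarrow> ennreal" where
  "L1_enorm K \<mu> = (\<integral>\<^sup>+x. W_norm K (fibre_restr K \<mu> x) \<partial>unit_leb)"

definition L1_space :: "'k::metric_space set \<Rightarrow> ((real \<times> 'k) set \<Rightarrow> real) set" where
  "L1_space K = {\<mu> \<in> AB K. L1_enorm K \<mu> < \<infinity>}"

definition S1_space :: "'k::metric_space set \<Rightarrow> ((real \<times> 'k) set \<Rightarrow> real) set" where
  "S1_space K = {\<mu> \<in> L1_space K. signed_density K \<mu> \<in> BV_m}"

definition S1_norm :: "'k::metric_space set \<Rightarrow> ((real \<times> 'k) set \<Rightarrow> real) \<Rightarrow> real" where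
  "S1_norm K \<mu> = BV_norm (signed_density K \<mu>) + enn2real (L1_enorm K \<mu>)"


section \<open>The class of maps\<close>

text \<open>
  The value at the left endpoint of the derivative of a branch is the right limit of
  \<open>deriv f\<close>. The series of its reciprocals is taken in \<^typ>\<open>ennreal\<close>, where \<open>1 / 0 = \<infinity>\<close>,
  so that a vanishing derivative makes it diverge.
\<close>

definition right_deriv_lim :: "(real \<Rightarrow> real) \<Rightarrow> real \<Rightarrow> real" where
  "right_deriv_lim f a = Lim (at_right a) (deriv f)"

definition class_T :: "(real \<Rightarrow> real) \<Rightarrow> bool" where
  "class_T f \<longleftrightarrow> (\<exists>a b :: nat \<Rightarrow> real.
     (\<forall>i. a i < b i \<and> {a i<..<b i} \<subseteq> {0..1}) \<and>
     disjoint_family (\<lambda>i. {a i<..<b i}) \<and>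
     emeasure unit_leb ({0..1} - (\<Union>i. {a i<..<b i})) = 0 \<and>
     (\<forall>i. f ` {a i<..<b i} \<subseteq> {0..1} \<and>
        mono_on {a i<..<b i} f \<and>
        convex_on {a i<..<b i} f \<and>
        f differentiable_on {a i<..<b i} \<and>
        (f \<longlongrightarrow> 0) (at_right (a i))) \<and>
     (\<Sum>i. 1 / ennreal (right_deriv_lim f (a i))) < \<infinity> \<and>
     (\<not> 0 islimpt (range a \<union> range b) \<longrightarrow>
        (\<exists>\<beta>. 0 < \<beta> \<and> \<beta> < 1 \<and> right_deriv_lim f 0 = 1 / \<beta>)))"

definition H1 :: "'k::metric_space set \<Rightarrow> (real \<times> 'k \<Rightarrow> 'k) \<Rightarrow> bool" where
  "H1 K G \<longleftrightarrow> (\<exists>\<alpha>. 0 \<le> \<alpha> \<and> \<alpha> < 1 \<and>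
     (AE x in unit_leb. \<forall>z1\<in>K. \<forall>z2\<in>K. dist (G (x, z1)) (G (x, z2)) \<le> \<alpha> * dist z1 z2))"

end

theory Submission imports Defs begin

text \<open>
  The spectral gap has two sources. On densities, convexity makes the transfer operator of \<open>f\<close> preserve
  decreasing functions, and a function of bounded variation is a difference of decreasing ones. For
  decreasing densities the supremum contracts up to a multiple of the mass, and an iterate of a
  decreasing density dominates a fixed multiple of its mass on one branch interval. Subtracting this
  common part and applying the operator once gives a decreasing function again, so two densities of
  equal mass share a fixed proportion of their mass after a fixed time; this yields exponential
  convergence without quasi-compactness. On fibres, the norm of \<open>L\<^sup>1\<close> is the supremum of the
  integrals of measurable functions that are 1-Lipschitz and bounded by 1 on each fibre. Composing
  such a function with \<open>F\<close> gives \<open>\<alpha>\<close> times a function of this kind plus a function of the base point,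
  so the norm of the image is at most \<open>\<alpha>\<close> times the norm plus the \<open>L\<^sup>1\<close> norm of the density, which
  decays when the total mass is zero. The invariant measure is the law of the limit of the fibre
  maps along a stationary random backward orbit of \<open>f\<close>.
\<close>

section \<open>The transfer operator of the base map on densities\<close>

text \<open>Branches need not be onto and their slopes may be unbounded, so no fixed piece of the
  interval is covered by every image. What all images share is the endpoint 0, where a decreasing
  density is largest; the behaviour at 0 therefore decides both estimates. Away from 0 a decreasing
  density is controlled by its mass, since \<open>h x\<close> is at most the mass over
  \<open>x\<close>. Hence only a branch starting at 0 and the tail of small branches can sustain the
  supremum, and their total weight is below 1 by condition (3) and the summability of the inverse
  slopes. The lower bound has two sources: if partition points accumulate at 0, a whole branch
  interval lies where the density is large; otherwise the branch at 0 expands, and its inverse pulls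
  its interval towards 0. On measures, \<open>P \<mu>\<close> is the total mass of
  \<open>\<mu>\<close> times the invariant measure, and \<open>N \<mu>\<close> is the push-forward
  of \<open>\<mu> - P \<mu>\<close>, which has mass zero. Jordan parts and disintegrations do not
  commute with sums or push-forwards, so measures are compared only through their values on vertical
  sets and through test functions.\<close>

lemma space_unit_leb [simp]: "space unit_leb = {0..1}"
  by (simp add: unit_leb_def)

lemma sets_unit_leb: "sets unit_leb = sets (restrict_space borel {0..1})"
  unfolding unit_leb_def by (rule sets_restrict_space_cong) simp

lemma nn_integral_unit_leb:
  "(\<integral>\<^sup>+x. h x \<partial>unit_leb) = (\<integral>\<^sup>+x. h x * indicator {0..1} x \<partial>lborel)"
  unfolding unit_leb_def by (rule nn_integral_restrict_space) simp

lemma emeasure_unit_leb: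
  "A \<in> sets borel \<Longrightarrow> A \<subseteq> {0..1} \<Longrightarrow> emeasure unit_leb A = emeasure lborel A"
  unfolding unit_leb_def by (rule emeasure_restrict_space) auto

lemma borel_measurable_unit_lebI: "h \<in> borel_measurable borel \<Longrightarrow> h \<in> borel_measurable unit_leb"
  unfolding unit_leb_def by (rule measurable_restrict_space1) simp

lemma prob_space_unit_leb: "prob_space unit_leb"
proof
  show "emeasure unit_leb (space unit_leb) = 1"
    by (simp add: emeasure_unit_leb)
qed

section \<open>Slopes of convex branches and their inverses\<close>

lemma convex_differentiable_slopes:
  fixes h :: "real \<Rightarrow> real"
  assumes "convex_on {a<..<b} h" "h differentiable_on {a<..<b}" "x \<in> {a<..<b}" "y \<in> {a<..<b}"
  shows "deriv h x * (y - x) \<le> h y - h x"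
proof -
  have "(h has_field_derivative deriv h x) (at x)"
    using assms(2,3) by (metis DERIV_deriv_iff_real_differentiable at_within_open
        differentiable_on_def open_greaterThanLessThan)
  then have "(h has_field_derivative deriv h x) (at x within {a<..<b})"
    by (rule has_field_derivative_at_within)
  then show ?thesis
    using convex_on_imp_above_tangent[of "{a<..<b}" h x y "deriv h x"] assms
    by (simp add: interior_open)
qed

lemma divide_left_mono_ennreal:
  assumes "0 < c" "c \<le> d"
  shows "x / ennreal d \<le> x / ennreal c"
  unfolding divide_ennreal_def using assms
  by (intro mult_left_mono) (simp_all add: inverse_ennreal ennreal_leI)

text \<open>The endpoint sequences are fixed so that branches can be named. Measurability of
  \<open>f\<close> is listed separately; in the end it is read off from a horizontal section of
  \<open>F\<close>.\<close>

locale class_T_map =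
  fixes f :: "real \<Rightarrow> real" and a b :: "nat \<Rightarrow> real"
  assumes ab: "\<And>i. a i < b i" and branch_sub: "\<And>i. {a i<..<b i} \<subseteq> {0..1}"
    and disj: "disjoint_family (\<lambda>i. {a i<..<b i})"
    and full: "emeasure unit_leb ({0..1} - (\<Union>i. {a i<..<b i})) = 0"
    and maps: "\<And>i. f ` {a i<..<b i} \<subseteq> {0..1}"
    and mono: "\<And>i. mono_on {a i<..<b i} f"
    and conv: "\<And>i. convex_on {a i<..<b i} f"
    and diff: "\<And>i. f differentiable_on {a i<..<b i}"
    and lim0: "\<And>i. (f \<longlongrightarrow> 0) (at_right (a i))"
    and summ: "(\<Sum>i. 1 / ennreal (right_deriv_lim f (a i))) < \<infinity>"
    and fix0: "\<not> 0 islimpt (range a \<union> range b) \<Longrightarrow>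
        \<exists>\<beta>. 0 < \<beta> \<and> \<beta> < 1 \<and> right_deriv_lim f 0 = 1 / \<beta>"
    and f_meas: "f \<in> measurable unit_leb unit_leb"
begin

definition I :: "nat \<Rightarrow> real set" where "I i = {a i<..<b i}"
text \<open>The slope at the left end of branch \<open>i\<close>. By convexity it is the infimum of
  the slopes on the branch, so \<open>1 / L i\<close> bounds the weight of the branch in the
  transfer operator.\<close>

definition L :: "nat \<Rightarrow> real" where "L i = right_deriv_lim f (a i)"
definition g :: "nat \<Rightarrow> real \<Rightarrow> real" where "g i = the_inv_into (I i) f"

lemma a_ge0: "0 \<le> a i" and b_le1: "b i \<le> 1"
proof -
  have "closure {a i<..<b i} \<subseteq> {0..1}"
    using branch_sub[of i] by (intro closure_minimal) auto
  then have "{a i..b i} \<subseteq> {0..1}"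
    using ab[of i] by simp
  then show "0 \<le> a i" "b i \<le> 1"
    using ab[of i] by auto
qed

lemma I_sub: "I i \<subseteq> {0<..<1}"
  using a_ge0[of i] b_le1[of i] by (auto simp: I_def)

lemma has_deriv: "x \<in> I i \<Longrightarrow> (f has_real_derivative deriv f x) (at x)"
  using diff[of i] unfolding I_def by (metis DERIV_deriv_iff_real_differentiable at_within_open
        differentiable_on_def open_greaterThanLessThan)

lemma slope: "x \<in> I i \<Longrightarrow> y \<in> I i \<Longrightarrow> deriv f x * (y - x) \<le> f y - f x"
  using convex_differentiable_slopes[OF conv diff] by (simp add: I_def)

lemma deriv_mono: assumes "x \<in> I i" "y \<in> I i" "x \<le> y" shows "deriv f x \<le> deriv f y"
proof (cases "x = y")
  case False
  have "deriv f x * (y - x) \<le> deriv f y * (y - x)"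
    using slope[OF assms(1,2)] slope[OF assms(2,1)] by (simp add: algebra_simps)
  then show ?thesis
    using False assms(3) by simp
qed simp

lemma deriv_nonneg: assumes "x \<in> I i" shows "0 \<le> deriv f x"
proof -
  define y where "y = (a i + x) / 2"
  have y: "y \<in> I i" "y < x" using assms by (auto simp: I_def y_def)
  have "f y \<le> f x"
    using mono[of i] y assms by (auto simp: I_def mono_on_def)
  moreover have "f x - f y \<le> deriv f x * (x - y)"
    using slope[OF assms y(1)] by (simp add: algebra_simps)
  ultimately have "0 \<le> deriv f x * (x - y)" by linarith
  then show ?thesis using y(2) by (simp add: zero_le_mult_iff)
qed

text \<open>The derivative is monotone and nonnegative on a branch, so its right limit at the left
  endpoint exists and is its infimum. Only with this existence does the value of \<open>Lim\<close>
  in \<open>right_deriv_lim\<close> carry information.\<close>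

lemma deriv_ge_L: "x \<in> I i \<Longrightarrow> L i \<le> deriv f x"
  and L_nonneg: "0 \<le> L i"
proof -
  define l where "l = Inf (deriv f ` I i)"
  have ne: "I i \<noteq> {}" using ab[of i] by (simp add: I_def)
  have bb: "bdd_below (deriv f ` I i)"
    using deriv_nonneg by (intro bdd_belowI[of _ 0]) auto
  have le: "l \<le> deriv f x" if "x \<in> I i" for x
    unfolding l_def using that bb by (intro cInf_lower) auto
  have "(deriv f \<longlongrightarrow> l) (at_right (a i))"
  proof (rule order_tendstoI)
    fix c assume "c < l"
    moreover have "\<forall>\<^sub>F x in at_right (a i). x \<in> I i"
      using ab[of i] unfolding I_def by (rule eventually_at_right_real)
    ultimately show "\<forall>\<^sub>F x in at_right (a i). c < deriv f x"
      using le by (auto elim!: eventually_mono intro: less_le_trans)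
  next
    fix c assume "l < c"
    then obtain y where y: "y \<in> I i" "deriv f y < c"
      using ne bb unfolding l_def by (subst (asm) cInf_less_iff) auto
    have "\<forall>\<^sub>F x in at_right (a i). x \<in> {a i<..<y}"
      using y by (intro eventually_at_right_real) (auto simp: I_def)
    then show "\<forall>\<^sub>F x in at_right (a i). deriv f x < c"
    proof eventually_elim
      case (elim x)
      then have "x \<in> I i" using y by (auto simp: I_def)
      then show ?case using deriv_mono[of x i y] y elim by auto
    qed
  qed
  then have "L i = l"
    unfolding L_def right_deriv_lim_def by (intro tendsto_Lim) auto
  show "x \<in> I i \<Longrightarrow> L i \<le> deriv f x" using le \<open>L i = l\<close> by simp
  show "0 \<le> L i" unfolding \<open>L i = l\<close> l_def using ne deriv_nonneg by (intro cInf_greatest) auto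
qed

lemma summable_L: "(\<Sum>i. 1 / ennreal (L i)) < \<infinity>"
  using summ by (simp add: L_def)

lemma L_pos: "0 < L i"
proof (rule ccontr)
  assume "\<not> 0 < L i"
  then have "L i = 0" using L_nonneg[of i] by simp
  then have "1 / ennreal (L i) = \<top>" by simp
  moreover have "1 / ennreal (L i) \<le> (\<Sum>i. 1 / ennreal (L i))"
    using sum_le_suminf[of "\<lambda>i. 1 / ennreal (L i)" "{i}"] by simp
  ultimately show False using summable_L by (simp add: top_unique)
qed

lemma deriv_pos: "x \<in> I i \<Longrightarrow> 0 < deriv f x"
  using deriv_ge_L[of x i] L_pos[of i] by linarith

lemma f_strict: assumes "x \<in> I i" "y \<in> I i" "x < y" shows "f x < f y"
proof -
  have "0 < deriv f x * (y - x)" using deriv_pos assms by simp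
  then show ?thesis using slope[OF assms(1,2)] by linarith
qed

lemma f_less_iff: "x \<in> I i \<Longrightarrow> y \<in> I i \<Longrightarrow> f x < f y \<longleftrightarrow> x < y"
  by (metis f_strict linorder_neqE_linordered_idom order_less_asym)

lemma inj_f: "inj_on f (I i)"
  by (rule inj_onI) (metis f_strict linorder_neqE_linordered_idom order_less_irrefl)

text \<open>The tangent inequality at \<open>z\<close>, with \<open>z\<close> tending to
  \<open>a i\<close> from the right, where \<open>f z\<close> tends to 0.\<close>

lemma f_ge: assumes "x \<in> I i" shows "L i * (x - a i) \<le> f x"
proof (rule tendsto_le)
  have "((\<lambda>z. f z + L i * (x - z)) \<longlongrightarrow> 0 + L i * (x - a i)) (at_right (a i))"
    by (intro tendsto_intros lim0)
  then show "((\<lambda>z. f z + L i * (x - z)) \<longlongrightarrow> L i * (x - a i)) (at_right (a i))" by simp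
  show "((\<lambda>z. f x) \<longlongrightarrow> f x) (at_right (a i))" by simp
  have "\<forall>\<^sub>F z in at_right (a i). z \<in> {a i<..<x}"
    using assms by (intro eventually_at_right_real) (auto simp: I_def)
  then show "\<forall>\<^sub>F z in at_right (a i). f z + L i * (x - z) \<le> f x"
  proof eventually_elim
    case (elim z)
    then have z: "z \<in> I i" using assms by (auto simp: I_def)
    have "L i * (x - z) \<le> deriv f z * (x - z)"
      using deriv_ge_L[OF z] elim by (intro mult_right_mono) auto
    then show ?case using slope[OF z assms] by linarith
  qed
qed simp

lemma f_pos: "x \<in> I i \<Longrightarrow> 0 < f x"
  using f_ge[of x i] L_pos[of i] by (smt (verit) I_def greaterThanLessThan_iff mult_pos_pos)

text \<open>By the intermediate value theorem between a point near \<open>a i\<close>, where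
  \<open>f\<close> is below \<open>x\<close>, and the preimage of \<open>y\<close>. Every branch
  image is thus an interval starting at 0, which is the only covering property that the branches
  have in common.\<close>

lemma f_image_downclosed: assumes "y \<in> f ` I i" "0 < x" "x \<le> y" shows "x \<in> f ` I i"
proof -
  obtain t where t: "t \<in> I i" "y = f t" using assms by auto
  have "\<forall>\<^sub>F z in at_right (a i). f z < x"
    using lim0 assms(2) by (rule order_tendstoD)
  moreover have "\<forall>\<^sub>F z in at_right (a i). z \<in> {a i<..<t}"
    using t by (intro eventually_at_right_real) (auto simp: I_def)
  ultimately have "\<forall>\<^sub>F z in at_right (a i). f z < x \<and> z \<in> {a i<..<t}"
    by eventually_elim auto
  then obtain z where z: "f z < x" "z \<in> {a i<..<t}"
    using eventually_happens'[of "at_right (a i)"] by auto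
  have cont: "continuous_on {z..t} f"
    using has_deriv t z by (intro continuous_at_imp_continuous_on ballI)
      (auto intro!: DERIV_isCont has_deriv[of _ i] simp: I_def)
  obtain s where "s \<ge> z" "s \<le> t" "f s = x"
    using IVT'[of f z x t] cont z t assms by auto
  then show ?thesis using z t by (intro image_eqI[of _ _ s]) (auto simp: I_def)
qed

lemma f_image_sub: "f ` I i \<subseteq> {0<..<1}"
proof
  fix y assume "y \<in> f ` I i"
  then obtain x where x: "x \<in> I i" "y = f x" by auto
  define z where "z = (x + b i) / 2"
  have z: "z \<in> I i" "x < z" using x by (auto simp: z_def I_def)
  have "f x < f z" using f_strict x z by auto
  moreover have "f z \<le> 1" using maps[of i] z by (fastforce simp: I_def)
  ultimately show "y \<in> {0<..<1}" using f_pos x by auto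
qed

lemma g_f [simp]: "x \<in> I i \<Longrightarrow> g i (f x) = x"
  unfolding g_def by (rule the_inv_into_f_f[OF inj_f])

lemma f_g: "y \<in> f ` I i \<Longrightarrow> f (g i y) = y" and g_in: "y \<in> f ` I i \<Longrightarrow> g i y \<in> I i"
  by auto

lemma g_le: assumes "x \<in> f ` I i" "y \<in> f ` I i" "x \<le> y" shows "g i x \<le> g i y"
  using assms by (metis f_g f_less_iff g_in linorder_not_less)

section \<open>Measurability of branches and change of variables\<close>

lemma image_I_borel [measurable]: "f ` I i \<in> sets borel"
proof -
  have "is_interval (f ` I i)"
    unfolding is_interval_1
    by (smt (verit, best) f_image_downclosed f_image_sub greaterThanLessThan_iff subsetD)
  then show ?thesis by (rule real_interval_borel_measurable)
qed

lemma I_borel [measurable]: "I i \<in> sets borel" by (simp add: I_def)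

lemma g_measurable [measurable]: "(\<lambda>x. if x \<in> f ` I i then g i x else 0) \<in> borel_measurable borel"
proof -
  have "mono_on (f ` I i) (g i)" using g_le by (intro mono_onI)
  then have "g i \<in> borel_measurable (restrict_space borel (f ` I i))"
    by (rule borel_measurable_mono_on_fnc)
  then show ?thesis by (subst (asm) measurable_restrict_space_iff[of _ _ 0]) auto
qed

lemma deriv_measurable [measurable]: "(\<lambda>x. if x \<in> I i then deriv f x else 0) \<in> borel_measurable borel"
proof -
  have "mono_on (I i) (deriv f)" using deriv_mono by (intro mono_onI)
  then have "deriv f \<in> borel_measurable (restrict_space borel (I i))"
    by (rule borel_measurable_mono_on_fnc)
  then show ?thesis by (subst (asm) measurable_restrict_space_iff[of _ _ 0]) auto
qed

lemma branch_measurable [measurable]: "(\<lambda>x. if x \<in> I i then f x else 0) \<in> borel_measurable borel"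
proof -
  have "mono_on (I i) f" using f_strict by (intro mono_onI) (metis less_eq_real_def)
  then have "f \<in> borel_measurable (restrict_space borel (I i))"
    by (rule borel_measurable_mono_on_fnc)
  then show ?thesis by (subst (asm) measurable_restrict_space_iff[of _ _ 0]) auto
qed

text \<open>The change of variables formula for absolutely integrable functions is applied to an
  indicator. The image lies in the unit interval, so the integral is finite and the result can be
  carried back to the nonnegative integral.\<close>

lemma change_of_variables_set:
  assumes A [measurable]: "A \<in> sets borel"
  shows "(\<integral>\<^sup>+x. indicator (I i) x * (ennreal (deriv f x) * indicator A (f x)) \<partial>lborel) =
    emeasure lborel (A \<inter> f ` I i)"
proof -
  define r where "r = measure lborel (A \<inter> f ` I i)"
  have fin: "emeasure lborel (A \<inter> f ` I i) < \<infinity>"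
  proof -
    have "emeasure lborel (A \<inter> f ` I i) \<le> emeasure lborel {0..1::real}"
      using f_image_sub[of i] by (intro emeasure_mono) auto
    then show ?thesis by (simp add: order_le_less_trans)
  qed
  have lm: "(\<lambda>x. if x \<in> I i then deriv f x * indicator A (f x) else 0) \<in> borel_measurable borel"
  proof -
    have "(\<lambda>x. (if x \<in> I i then deriv f x else 0) * indicator A (if x \<in> I i then f x else 0))
      \<in> borel_measurable borel" by measurable
    also have "(\<lambda>x. (if x \<in> I i then deriv f x else 0) * indicator A (if x \<in> I i then f x else 0))
      = (\<lambda>x. if x \<in> I i then deriv f x * indicator A (f x) else (0::real))" by auto
    finally show ?thesis .
  qed
  have S: "(indicat_real A has_integral r) (f ` I i)"
  proof -
    have "set_integrable lborel (f ` I i) (indicat_real A)"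
      unfolding set_integrable_def using fin
      by (simp add: indicator_inter_arith[symmetric] Int_commute)
    moreover have "(LINT x:f ` I i|lborel. indicat_real A x) = r"
      unfolding set_lebesgue_integral_def r_def by (simp add: indicator_inter_arith[symmetric] Int_commute)
    moreover note set_borel_integral_eq_integral[OF calculation(1)]
    ultimately show ?thesis by (simp add: has_integral_integral)
  qed
  then have "indicat_real A absolutely_integrable_on (f ` I i) \<and> integral (f ` I i) (indicat_real A) = r"
    using nonnegative_absolutely_integrable_1[of "indicat_real A" "f ` I i"] by auto
  then have *: "(\<lambda>x. \<bar>deriv f x\<bar> * indicat_real A (f x)) absolutely_integrable_on I i \<and>
      integral (I i) (\<lambda>x. \<bar>deriv f x\<bar> * indicat_real A (f x)) = r"
    using has_absolute_integral_change_of_variables_1'[of "I i" f "deriv f" "indicat_real A" r,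
        OF _ has_field_derivative_at_within[OF has_deriv[of _ i]] inj_f]
    by (simp add: I_def)
  have "((\<lambda>x. \<bar>deriv f x\<bar> * indicat_real A (f x)) has_integral r) (I i)"
    using * by (metis absolutely_integrable_on_def integrable_integral)
  then have "((\<lambda>x. if x \<in> I i then deriv f x * indicat_real A (f x) else 0) has_integral r) (I i)"
    by (rule has_integral_eq[rotated]) (auto simp: deriv_nonneg)
  then have "((\<lambda>x. if x \<in> I i then deriv f x * indicat_real A (f x) else 0) has_integral r) UNIV"
    by (subst (asm) has_integral_restrict_UNIV[symmetric]) (auto elim!: has_integral_eq[rotated])
  then have "(\<integral>\<^sup>+x. ennreal (if x \<in> I i then deriv f x * indicat_real A (f x) else 0) \<partial>lborel) = ennreal r"
    by (intro nn_integral_has_integral_lborel lm) (auto simp: deriv_nonneg)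
  moreover have "ennreal (if x \<in> I i then deriv f x * indicat_real A (f x) else 0) =
     indicator (I i) x * (ennreal (deriv f x) * indicator A (f x))" for x
    by (auto simp: indicator_def)
  ultimately show ?thesis using fin by (simp add: r_def emeasure_eq_ennreal_measure)
qed

text \<open>By the version for sets, \<open>f\<close> maps the measure with density
  \<open>deriv f\<close> on the branch to Lebesgue measure on the image; integrating
  \<open>w\<close> against both gives the formula.\<close>

lemma change_of_variables:
  assumes w [measurable]: "w \<in> borel_measurable borel"
  shows "(\<integral>\<^sup>+x. indicator (I i) x * (ennreal (deriv f x) * w (f x)) \<partial>lborel) =
    (\<integral>\<^sup>+y. indicator (f ` I i) y * w y \<partial>lborel)"
proof -
  let ?d = "\<lambda>x. ennreal (if x \<in> I i then deriv f x else 0)"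
  let ?f = "\<lambda>x. if x \<in> I i then f x else 0"
  have eq: "distr (density lborel ?d) borel ?f = density lborel (indicator (f ` I i))"
  proof (rule measure_eqI)
    fix A assume "A \<in> sets (distr (density lborel ?d) borel ?f)"
    then have [measurable]: "A \<in> sets borel" by simp
    have "emeasure (distr (density lborel ?d) borel ?f) A =
        (\<integral>\<^sup>+x. ?d x * indicator (?f -` A) x \<partial>lborel)"
      by (subst emeasure_distr) (simp_all add: emeasure_density measurable_sets_borel[OF branch_measurable])
    also have "\<dots> = (\<integral>\<^sup>+x. indicator (I i) x * (ennreal (deriv f x) * indicator A (f x)) \<partial>lborel)"
      by (intro nn_integral_cong) (auto simp: indicator_def)
    also have "\<dots> = emeasure lborel (A \<inter> f ` I i)" by (rule change_of_variables_set) simp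
    also have "\<dots> = emeasure (density lborel (indicator (f ` I i))) A"
      by (simp add: emeasure_density indicator_inter_arith[symmetric] Int_commute)
    finally show "emeasure (distr (density lborel ?d) borel ?f) A =
      emeasure (density lborel (indicator (f ` I i))) A" .
  qed simp
  have "(\<integral>\<^sup>+y. indicator (f ` I i) y * w y \<partial>lborel) = (\<integral>\<^sup>+y. w y \<partial>density lborel (indicator (f ` I i)))"
    by (simp add: nn_integral_density)
  also have "\<dots> = (\<integral>\<^sup>+x. ?d x * w (?f x) \<partial>lborel)"
    unfolding eq[symmetric] by (simp add: nn_integral_distr nn_integral_density)
  also have "\<dots> = (\<integral>\<^sup>+x. indicator (I i) x * (ennreal (deriv f x) * w (f x)) \<partial>lborel)"
    by (intro nn_integral_cong) (auto simp: indicator_def)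
  finally show ?thesis by simp
qed

text \<open>The Perron-Frobenius operator of \<open>f\<close>. Extended nonnegative values make the
  countable sum meaningful for every \<open>h\<close>. Off the image of a branch
  \<open>g i x\<close> is an arbitrary value, which the indicator removes.\<close>

definition T :: "(real \<Rightarrow> ennreal) \<Rightarrow> real \<Rightarrow> ennreal" where
  "T h x = (\<Sum>i. indicator (f ` I i) x * (h (g i x) / ennreal (deriv f (g i x))))"

lemma T_term_measurable [measurable]:
  assumes [measurable]: "h \<in> borel_measurable borel"
  shows "(\<lambda>x. indicator (f ` I i) x * (h (g i x) / ennreal (deriv f (g i x)))) \<in> borel_measurable borel"
proof -
  let ?g = "\<lambda>x. if x \<in> f ` I i then g i x else 0"
  let ?d = "\<lambda>x. if x \<in> I i then deriv f x else 0"
  have "(\<lambda>x. indicator (f ` I i) x * (h (?g x) / ennreal (?d (?g x)))) \<in> borel_measurable borel"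
    using measurable_compose[OF g_measurable deriv_measurable] by measurable
  also have "(\<lambda>x. indicator (f ` I i) x * (h (?g x) / ennreal (?d (?g x)))) =
     (\<lambda>x. indicator (f ` I i) x * (h (g i x) / ennreal (deriv f (g i x))))"
    using g_in by (auto simp: indicator_def)
  finally show ?thesis .
qed

lemma T_measurable [measurable]:
  assumes [measurable]: "h \<in> borel_measurable borel"
  shows "T h \<in> borel_measurable borel"
  unfolding T_def by measurable

lemma AE_in_branch: "AE x in unit_leb. x \<in> (\<Union>i. I i)"
proof (rule AE_I)
  show "emeasure unit_leb ({0..1} - (\<Union>i. I i)) = 0" using full by (simp add: I_def)
  show "{0..1} - (\<Union>i. I i) \<in> sets unit_leb"
    unfolding sets_unit_leb by (subst sets_restrict_space_iff) auto
qed auto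

text \<open>\<open>T\<close> is the adjoint of composition with \<open>f\<close>: change variables
  on each branch, sum, and use that the branches are disjoint and cover almost all of the interval.
  The arbitrary values of \<open>f\<close> on the remaining null set do not affect the right
  side.\<close>

theorem nn_integral_T:
  assumes [measurable]: "h \<in> borel_measurable borel" "u \<in> borel_measurable borel"
  shows "(\<integral>\<^sup>+x. u x * T h x \<partial>unit_leb) = (\<integral>\<^sup>+x. u (f x) * h x \<partial>unit_leb)"
proof -
  have eq: "(\<integral>\<^sup>+x. indicator (f ` I i) x * (u x * (h (g i x) / ennreal (deriv f (g i x)))) \<partial>lborel) =
      (\<integral>\<^sup>+x. indicator (I i) x * (u (f x) * h x) \<partial>lborel)" for i
  proof -
    let ?w = "\<lambda>x. indicator (f ` I i) x * (h (g i x) / ennreal (deriv f (g i x)))"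
    have "(\<integral>\<^sup>+x. indicator (f ` I i) x * (u x * ?w x) \<partial>lborel) =
       (\<integral>\<^sup>+x. indicator (I i) x * (ennreal (deriv f x) * (u (f x) * ?w (f x))) \<partial>lborel)"
      by (rule change_of_variables[symmetric]) simp
    also have "\<dots> = (\<integral>\<^sup>+x. indicator (I i) x * (u (f x) * h x) \<partial>lborel)"
    proof (intro nn_integral_cong)
      fix x
      show "indicator (I i) x * (ennreal (deriv f x) * (u (f x) * ?w (f x))) = indicator (I i) x * (u (f x) * h x)"
      proof (cases "x \<in> I i")
        case True
        have "ennreal (deriv f x) * (h x / ennreal (deriv f x)) = h x"
          using deriv_pos[OF True] by (metis ennreal_eq_0_iff ennreal_neq_top ennreal_times_divide
            mult.commute mult_divide_eq_ennreal not_less)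
        then show ?thesis using True by (simp add: mult.left_commute)
      qed simp
    qed
    also have "(\<lambda>x. indicator (f ` I i) x * (u x * ?w x)) =
       (\<lambda>x. indicator (f ` I i) x * (u x * (h (g i x) / ennreal (deriv f (g i x)))))"
      by (auto simp: indicator_def)
    finally show ?thesis .
  qed
  have "(\<integral>\<^sup>+x. u x * T h x \<partial>unit_leb) =
      (\<integral>\<^sup>+x. (\<Sum>i. indicator (f ` I i) x * (u x * (h (g i x) / ennreal (deriv f (g i x))))) \<partial>lborel)"
    unfolding nn_integral_unit_leb
  proof (intro nn_integral_cong)
    fix x
    have *: "indicator (f ` I i) x * indicator {0..1} x = (indicator (f ` I i) x :: ennreal)" for i
      using f_image_sub[of i] by (auto simp: indicator_def)
    have "u x * T h x * indicator {0..1} x = (\<Sum>i. u x * indicator {0..1} x * (indicator (f ` I i) x * (h (g i x) / ennreal (deriv f (g i x)))))"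
      unfolding T_def by (simp add: ennreal_suminf_cmult mult_ac)
    also have "\<dots> = (\<Sum>i. (indicator (f ` I i) x * indicator {0..1} x) * (u x * (h (g i x) / ennreal (deriv f (g i x)))))"
      by (simp add: mult_ac)
    finally show "u x * T h x * indicator {0..1} x = (\<Sum>i. indicator (f ` I i) x * (u x * (h (g i x) / ennreal (deriv f (g i x)))))"
      unfolding * .
  qed
  also have "\<dots> = (\<Sum>i. \<integral>\<^sup>+x. indicator (f ` I i) x * (u x * (h (g i x) / ennreal (deriv f (g i x)))) \<partial>lborel)"
  proof (rule nn_integral_suminf)
    fix i
    have "(\<lambda>x. u x * (indicator (f ` I i) x * (h (g i x) / ennreal (deriv f (g i x))))) \<in> borel_measurable borel"
      by measurable
    then show "(\<lambda>x. indicator (f ` I i) x * (u x * (h (g i x) / ennreal (deriv f (g i x))))) \<in> borel_measurable lborel"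
      by (simp add: mult.left_commute)
  qed
  also have "\<dots> = (\<Sum>i. \<integral>\<^sup>+x. indicator (I i) x * (u (f x) * h x) \<partial>lborel)"
    unfolding eq ..
  also have "\<dots> = (\<integral>\<^sup>+x. (\<Sum>i. indicator (I i) x * (u (f x) * h x)) \<partial>lborel)"
  proof (rule nn_integral_suminf[symmetric])
    fix i
    \<comment> \<open>\<open>f\<close> itself is measurable only on the unit interval; cut off
      outside one branch it is Borel on the whole line.\<close>
    have "(\<lambda>x. indicator (I i) x * (u (if x \<in> I i then f x else 0) * h x)) \<in> borel_measurable borel"
      by measurable
    also have "(\<lambda>x. indicator (I i) x * (u (if x \<in> I i then f x else 0) * h x)) = (\<lambda>x. indicator (I i) x * (u (f x) * h x))"
      by (auto simp: indicator_def)
    finally show "(\<lambda>x. indicator (I i) x * (u (f x) * h x)) \<in> borel_measurable lborel" by simp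
  qed
  also have "\<dots> = (\<integral>\<^sup>+x. (\<Sum>i. indicator (I i) x * (u (f x) * h x)) \<partial>unit_leb)"
    unfolding nn_integral_unit_leb
  proof (intro nn_integral_cong)
    fix x
    have "indicator (I i) x * indicator {0..1} x = (indicator (I i) x :: ennreal)" for i
      using I_sub[of i] by (auto simp: indicator_def)
    then have "(\<Sum>i. indicator (I i) x * (u (f x) * h x)) = (\<Sum>i. indicator {0..1} x * (indicator (I i) x * (u (f x) * h x)))"
      by (metis mult.assoc mult.commute)
    then show "(\<Sum>i. indicator (I i) x * (u (f x) * h x)) = (\<Sum>i. indicator (I i) x * (u (f x) * h x)) * indicator {0..1} x"
      by (simp add: ennreal_suminf_cmult mult.commute)
  qed
  also have "\<dots> = (\<integral>\<^sup>+x. u (f x) * h x \<partial>unit_leb)"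
  proof (rule nn_integral_cong_AE, use AE_in_branch in eventually_elim)
    case (elim x)
    then obtain j where j: "x \<in> I j" by auto
    have "(\<Sum>i. indicator (I i) x :: ennreal) = 1"
    proof -
      have "disjoint_family I" using disj by (simp add: I_def disjoint_family_on_def)
      from suminf_indicator[OF this] have "(\<Sum>i. indicator (I i) x) = (indicator (\<Union>i. I i) x :: ennreal)" .
      then show ?thesis using j by (auto simp: indicator_def)
    qed
    then show ?case by (simp add: ennreal_suminf_multc)
  qed
  finally show ?thesis .
qed

section \<open>Linearity and monotonicity of the transfer operator\<close>

lemma T_add: "T (\<lambda>x. h x + k x) x = T h x + T k x"
  unfolding T_def
  by (subst suminf_add[OF summableI summableI]) (simp add: add_divide_distrib_ennreal distrib_left)

lemma T_cmult: "T (\<lambda>x. c * h x) x = c * T h x"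
  unfolding T_def
  by (subst ennreal_suminf_cmult[symmetric]) (simp add: ennreal_times_divide[symmetric] mult_ac)

text \<open>Inverse branches take values in the open interval, so the values of a density at 0 and 1
  never enter. Pointwise statements about densities are therefore made on (0,1) only.\<close>

lemma T_mono:
  assumes "\<And>y. y \<in> {0<..<1} \<Longrightarrow> h y \<le> k y"
  shows "T h x \<le> T k x"
  unfolding T_def
proof (intro suminf_le summableI)
  fix i
  show "indicator (f ` I i) x * (h (g i x) / ennreal (deriv f (g i x))) \<le>
      indicator (f ` I i) x * (k (g i x) / ennreal (deriv f (g i x)))"
  proof (cases "x \<in> f ` I i")
    case True
    then have "h (g i x) \<le> k (g i x)" using g_in I_sub[of i] by (intro assms) blast
    then show ?thesis by (auto intro!: divide_right_mono_ennreal mult_left_mono)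
  qed simp
qed

lemma T_pow_mono:
  assumes "\<And>y. y \<in> {0<..<1} \<Longrightarrow> h y \<le> k y" "x \<in> {0<..<1}"
  shows "(T ^^ n) h x \<le> (T ^^ n) k x"
  using assms(2)
proof (induction n arbitrary: x)
  case (Suc n)
  show ?case using T_mono[of "(T ^^ n) h" "(T ^^ n) k" x] Suc.IH by simp
qed (simp add: assms(1))

lemma T_pow_cong:
  assumes "\<And>y. y \<in> {0<..<1} \<Longrightarrow> h y = k y" "x \<in> {0<..<1}"
  shows "(T ^^ n) h x = (T ^^ n) k x"
  using T_pow_mono[of h k x n] T_pow_mono[of k h x n] assms by (simp add: order_antisym)

lemma T_pow_add: "(T ^^ n) (\<lambda>x. h x + k x) = (\<lambda>x. (T ^^ n) h x + (T ^^ n) k x)"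
proof (induction n)
  case (Suc n)
  show ?case by (simp add: Suc T_add)
qed simp

lemma T_pow_cmult: "(T ^^ n) (\<lambda>x. c * h x) = (\<lambda>x. c * (T ^^ n) h x)"
proof (induction n)
  case (Suc n)
  show ?case by (simp add: Suc T_cmult)
qed simp

lemma T_pow_measurable [measurable]:
  "h \<in> borel_measurable borel \<Longrightarrow> (T ^^ n) h \<in> borel_measurable borel"
  by (induction n) simp_all

lemma mass_T:
  assumes "h \<in> borel_measurable borel"
  shows "(\<integral>\<^sup>+x. T h x \<partial>unit_leb) = (\<integral>\<^sup>+x. h x \<partial>unit_leb)"
  using nn_integral_T[OF assms, of "\<lambda>_. 1"] by simp

section \<open>Decreasing densities\<close>

lemma I_unique: "x \<in> I i \<Longrightarrow> x \<in> I j \<Longrightarrow> i = j"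
  using disj unfolding disjoint_family_on_def I_def by blast

definition decreasing :: "(real \<Rightarrow> ennreal) \<Rightarrow> bool" where
  "decreasing h \<longleftrightarrow> (\<forall>x y. 0 < x \<longrightarrow> x \<le> y \<longrightarrow> y < 1 \<longrightarrow> h y \<le> h x)"

text \<open>Convexity of the branches makes both factors of each term decreasing. The function need not
  be monotone across branches, which is what allows subtracting a multiple of an indicator below.\<close>

lemma decreasing_T:
  assumes h: "\<And>i x y. x \<in> I i \<Longrightarrow> y \<in> I i \<Longrightarrow> x \<le> y \<Longrightarrow> h y \<le> h x"
  shows "decreasing (T h)"
  unfolding decreasing_def
proof (intro allI impI)
  fix x y :: real assume xy: "0 < x" "x \<le> y" "y < 1"
  show "T h y \<le> T h x"
    unfolding T_def
  proof (intro suminf_le summableI)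
    fix i
    show "indicator (f ` I i) y * (h (g i y) / ennreal (deriv f (g i y))) \<le>
      indicator (f ` I i) x * (h (g i x) / ennreal (deriv f (g i x)))"
    proof (cases "y \<in> f ` I i")
      case True
      then have x: "x \<in> f ` I i" using f_image_downclosed xy by blast
      have gg: "g i x \<in> I i" "g i y \<in> I i" "g i x \<le> g i y" using g_in x True g_le xy by blast+
      have "h (g i y) / ennreal (deriv f (g i y)) \<le> h (g i x) / ennreal (deriv f (g i y))"
        by (intro divide_right_mono_ennreal h[OF gg])
      also have "\<dots> \<le> h (g i x) / ennreal (deriv f (g i x))"
        using deriv_mono[OF gg] deriv_pos[OF gg(1)] by (intro divide_left_mono_ennreal) auto
      finally show ?thesis using True x by simp
    qed simp
  qed
qed

text \<open>The supremum bound \<open>s\<close> and the mass \<open>m\<close> are recorded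
  separately, because one iteration contracts the supremum only up to a multiple of the mass. Both
  are required to be nonnegative since \<open>ennreal\<close> sends negative numbers to 0.\<close>

definition dens :: "real \<Rightarrow> real \<Rightarrow> (real \<Rightarrow> ennreal) \<Rightarrow> bool" where
  "dens s m h \<longleftrightarrow> h \<in> borel_measurable borel \<and> decreasing h \<and>
     (\<forall>x\<in>{0<..<1}. h x \<le> ennreal s) \<and> (\<integral>\<^sup>+x. h x \<partial>unit_leb) = ennreal m \<and> 0 \<le> s \<and> 0 \<le> m"

lemma AE_unit_leb_interior: "AE x in unit_leb. x \<in> {0<..<1}"
  using AE_in_branch I_sub by (elim eventually_mono) blast

lemma dens_measurable: "dens s m h \<Longrightarrow> h \<in> borel_measurable borel"
  by (simp add: dens_def)

lemma dens_antimono: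
  assumes "dens s m h" "x \<in> I i" "y \<in> I i" "x \<le> y"
  shows "h y \<le> h x"
proof -
  have "0 < x" "y < 1" using assms(2,3) I_sub by (auto simp: subset_eq)
  then show ?thesis using assms by (simp add: dens_def decreasing_def)
qed

lemma dens_mass_le: assumes "dens s m h" shows "m \<le> s"
proof -
  have "ennreal m = (\<integral>\<^sup>+x. h x \<partial>unit_leb)" using assms by (simp add: dens_def)
  also have "\<dots> \<le> (\<integral>\<^sup>+x. ennreal s \<partial>unit_leb)"
    by (rule nn_integral_mono_AE, use AE_unit_leb_interior in eventually_elim)
       (use assms in \<open>auto simp: dens_def\<close>)
  also have "\<dots> = ennreal s" by (simp add: emeasure_unit_leb)
  finally show ?thesis using assms by (simp add: dens_def)
qed

lemma dens_mono: "dens s m h \<Longrightarrow> s \<le> s' \<Longrightarrow> dens s' m h"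
  unfolding dens_def by (auto intro: order_trans ennreal_leI)

text \<open>On (0,x] a decreasing density is at least \<open>h x\<close>, so \<open>x * h x\<close>
  is at most the mass.\<close>

lemma dens_le_inverse:
  assumes "dens s m h" "x \<in> {0<..<1}"
  shows "h x \<le> ennreal (m / x)"
proof -
  have hx: "h x \<le> ennreal s" using assms by (auto simp: dens_def)
  then obtain v where v: "h x = ennreal v" "0 \<le> v" by (cases "h x") (auto simp: top_unique)
  have "(\<integral>\<^sup>+y. h x * indicator {0<..x} y \<partial>unit_leb) \<le> (\<integral>\<^sup>+y. h y \<partial>unit_leb)"
    using assms by (intro nn_integral_mono) (auto simp: dens_def decreasing_def indicator_def)
  moreover have "(\<integral>\<^sup>+y. h x * indicator {0<..x} y \<partial>unit_leb) = h x * ennreal x"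
  proof -
    have "{0<..x} \<in> sets unit_leb" unfolding sets_unit_leb using assms(2)
      by (subst sets_restrict_space_iff) auto
    moreover have "emeasure unit_leb {0<..x} = ennreal x"
      using assms(2) by (subst emeasure_unit_leb) auto
    ultimately show ?thesis by (simp add: nn_integral_cmult_indicator)
  qed
  ultimately have "ennreal (v * x) \<le> ennreal m" using assms v by (simp add: dens_def ennreal_mult)
  then show ?thesis using assms v by (simp add: dens_def pos_le_divide_eq)
qed

lemma dens_const: "0 \<le> s \<Longrightarrow> dens s s (\<lambda>_. ennreal s)"
  by (simp add: dens_def decreasing_def emeasure_unit_leb)

lemma dens_add: "dens s m h \<Longrightarrow> dens s' m' k \<Longrightarrow> dens (s + s') (m + m') (\<lambda>x. h x + k x)"
  unfolding dens_def decreasing_def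
  by (auto intro!: add_mono simp: nn_integral_add borel_measurable_unit_lebI)

section \<open>The Lasota-Yorke inequality for supremum and mass\<close>

lemma L_at_zero: "\<exists>\<beta>. 0 \<le> \<beta> \<and> \<beta> < 1 \<and> (\<forall>i. a i = 0 \<longrightarrow> 1 / L i \<le> \<beta>)"
proof (cases "\<exists>i. a i = 0")
  case True
  then obtain i where i: "a i = 0" by blast
  have far: "b i \<le> a j" if "j \<noteq> i" for j
  proof (rule ccontr)
    assume "\<not> b i \<le> a j"
    then have "(a j + min (b i) (b j)) / 2 \<in> I i" "(a j + min (b i) (b j)) / 2 \<in> I j"
      using i a_ge0[of j] ab[of j] ab[of i] by (auto simp: min_def I_def)
    then show False using I_unique that by blast
  qed
  \<comment> \<open>When a branch starts at 0, every other branch lies to the right of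
    \<open>b i\<close>. No endpoint other than 0 is then smaller than \<open>b i\<close>, and the
    expansion condition at 0 becomes available.\<close>
  have "\<not> 0 islimpt (range a \<union> range b)"
  proof
    assume "0 islimpt (range a \<union> range b)"
    then obtain t where "t \<in> range a \<union> range b" "t \<in> {-b i<..<b i}" "t \<noteq> 0"
      using ab[of i] i unfolding islimpt_def by (metis greaterThanLessThan_iff neg_less_0_iff_less open_greaterThanLessThan)
    then obtain j where "t = a j \<or> t = b j" by auto
    then show False using far[of j] ab[of j] \<open>t \<in> {-b i<..<b i}\<close> \<open>t \<noteq> 0\<close> i by (cases "j = i") auto
  qed
  from fix0[OF this] obtain \<beta> where \<beta>: "0 < \<beta>" "\<beta> < 1" "right_deriv_lim f 0 = 1 / \<beta>" by blast
  have "1 / L j \<le> \<beta>" if "a j = 0" for j using \<beta> that by (simp add: L_def)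
  then show ?thesis using \<beta> by (intro exI[of _ \<beta>]) auto
qed (auto intro!: exI[of _ 0])

lemma at_most_one_zero: "a i = 0 \<Longrightarrow> a j = 0 \<Longrightarrow> i = j"
proof (rule ccontr)
  assume "a i = 0" "a j = 0" "i \<noteq> j"
  moreover have "min (b i) (b j) / 2 \<in> I i" "min (b i) (b j) / 2 \<in> I j"
    using \<open>a i = 0\<close> \<open>a j = 0\<close> ab[of i] ab[of j] by (auto simp: min_def I_def)
  ultimately show False using I_unique by blast
qed

text \<open>\<open>J\<close> consists of the indices below some \<open>N\<close>, without the branch
  starting at 0 if there is one. The indices left out carry the tail of the series of inverse
  slopes, at most \<open>(1 - \<beta>) / 2\<close>, and the weight at 0, at most
  \<open>\<beta>\<close>; hence \<open>\<theta>\<close> is \<open>(1 + \<beta>) / 2\<close>.\<close>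

lemma tail_weights:
  "\<exists>J \<theta>. finite J \<and> 0 \<le> \<theta> \<and> \<theta> < 1 \<and> (\<forall>i\<in>J. 0 < a i) \<and>
     (\<Sum>i. indicator (- J) i * ennreal (1 / L i)) \<le> ennreal \<theta>"
proof -
  obtain \<beta> where \<beta>: "0 \<le> \<beta>" "\<beta> < 1" "\<And>i. a i = 0 \<Longrightarrow> 1 / L i \<le> \<beta>" using L_at_zero by blast
  have inv: "1 / ennreal (L i) = ennreal (1 / L i)" for i
    using L_pos[of i] by (simp add: divide_ennreal[symmetric])
  define r where "r i = 1 / L i" for i
  have r0: "0 \<le> r i" for i using L_pos[of i] by (simp add: r_def)
  have "(\<Sum>i. ennreal (r i)) < \<infinity>" using summable_L by (simp add: inv r_def)
  then have sr: "summable r" by (intro summable_suminf_not_top r0) auto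
  obtain N where "norm (\<Sum>i. r (i + N)) < (1 - \<beta>) / 2"
    using suminf_exist_split[of "(1-\<beta>)/2" r] sr \<beta> by auto
  then have tail: "(\<Sum>i. r (i + N)) \<le> (1 - \<beta>) / 2" by simp
  define J where "J = {..<N} - {i. a i = 0}"
  have s1: "(\<lambda>i. if i < N then 0 else r i) sums (\<Sum>i. r (i + N))"
  proof -
    have "(\<lambda>i. r (i + N)) sums (\<Sum>i. r (i + N))" using sr by (simp add: summable_sums)
    then show ?thesis using sums_iff_shift[of "\<lambda>i. if i < N then 0 else r i" N] by simp
  qed
  define Z where "Z = {i. a i = 0}"
  have Z: "finite Z" "(\<Sum>i\<in>Z. r i) \<le> \<beta>"
  proof -
    have "Z = {} \<or> (\<exists>z. Z = {z} \<and> a z = 0)" unfolding Z_def using at_most_one_zero by blast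
    then show "finite Z" "(\<Sum>i\<in>Z. r i) \<le> \<beta>" using \<beta> by (auto simp: r_def)
  qed
  have s2: "(\<lambda>i. if i \<in> Z then r i else 0) sums (\<Sum>i\<in>Z. r i)"
    by (rule sums_If_finite_set[OF Z(1)])
  have s3: "(\<lambda>i. (if i < N then 0 else r i) + (if i \<in> Z then r i else 0)) sums ((\<Sum>i. r (i + N)) + (\<Sum>i\<in>Z. r i))"
    by (rule sums_add[OF s1 s2])
  have "(\<Sum>i. indicator (- J) i * ennreal (1 / L i)) \<le>
      (\<Sum>i. ennreal ((if i < N then 0 else r i) + (if i \<in> Z then r i else 0)))"
  proof (intro suminf_le summableI)
    fix i
    have "indicator (- J) i * ennreal (r i) \<le> ennreal ((if i < N then 0 else r i) + (if i \<in> Z then r i else 0))"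
      using r0[of i] by (auto simp: J_def Z_def indicator_def intro!: ennreal_leI)
    then show "indicator (- J) i * ennreal (1 / L i) \<le> ennreal ((if i < N then 0 else r i) + (if i \<in> Z then r i else 0))"
      by (simp add: r_def)
  qed
  also have "\<dots> = ennreal ((\<Sum>i. r (i + N)) + (\<Sum>i\<in>Z. r i))"
    using s3 r0 by (intro sums_unique[symmetric] sums_ennreal[THEN iffD2])
      (auto intro!: add_nonneg_nonneg sum_nonneg suminf_nonneg summable_ignore_initial_segment sr)
  also have "\<dots> \<le> ennreal ((1 + \<beta>) / 2)" using tail Z \<beta> by (intro ennreal_leI) (simp add: field_simps)
  finally have "(\<Sum>i. indicator (- J) i * ennreal (1 / L i)) \<le> ennreal ((1 + \<beta>) / 2)" .
  moreover have "0 < a i" if "i \<in> J" for i using that a_ge0[of i] by (auto simp: J_def)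
  ultimately show ?thesis using \<beta> by (intro exI[of _ J] exI[of _ "(1 + \<beta>) / 2"]) (auto simp: J_def)
qed

text \<open>For \<open>i\<close> in \<open>J\<close> the inverse branch lands beyond
  \<open>a i > 0\<close>, where the density is at most \<open>m / a i\<close>; these finitely many
  terms give \<open>C * m\<close>. All other terms are estimated by the supremum \<open>s\<close>
  times their total weight, at most \<open>\<theta>\<close>.\<close>

lemma Lasota_Yorke:
  "\<exists>\<theta> C. 0 \<le> \<theta> \<and> \<theta> < 1 \<and> 0 \<le> C \<and>
     (\<forall>s m h. dens s m h \<longrightarrow> dens (\<theta> * s + C * m) m (T h))"
proof -
  obtain J \<theta> where J: "finite J" "0 \<le> \<theta>" "\<theta> < 1" "\<And>i. i \<in> J \<Longrightarrow> 0 < a i"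
    and tail: "(\<Sum>i. indicator (- J) i * ennreal (1 / L i)) \<le> ennreal \<theta>"
    using tail_weights by blast
  define C where "C = (\<Sum>i\<in>J. 1 / (a i * L i))"
  have C0: "0 \<le> C" unfolding C_def using J L_pos by (intro sum_nonneg) (simp add: less_imp_le)
  have "dens (\<theta> * s + C * m) m (T h)" if d: "dens s m h" for s m h
  proof -
    have sm: "0 \<le> s" "0 \<le> m" using d by (auto simp: dens_def)
    have "T h x \<le> ennreal (\<theta> * s + C * m)" for x
    proof -
      have "T h x \<le> (\<Sum>i. ennreal s * (indicator (- J) i * ennreal (1 / L i)) +
          (if i \<in> J then ennreal (m * (1 / (a i * L i))) else 0))"
        unfolding T_def
      proof (intro suminf_le summableI)
        fix i
        show "indicator (f ` I i) x * (h (g i x) / ennreal (deriv f (g i x))) \<le>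
          ennreal s * (indicator (- J) i * ennreal (1 / L i)) +
          (if i \<in> J then ennreal (m * (1 / (a i * L i))) else 0)"
        proof (cases "x \<in> f ` I i")
          case True
          then have gi: "g i x \<in> I i" by (rule g_in)
          then have g01: "g i x \<in> {0<..<1}" using I_sub by blast
          have dL: "h (g i x) / ennreal (deriv f (g i x)) \<le> h (g i x) / ennreal (L i)"
            using deriv_ge_L[OF gi] L_pos by (intro divide_left_mono_ennreal) auto
          show ?thesis
          proof (cases "i \<in> J")
            case iJ: True
            have "h (g i x) \<le> ennreal (m / g i x)" by (rule dens_le_inverse[OF d g01])
            also have "\<dots> \<le> ennreal (m / a i)"
              using gi J(4)[OF iJ] sm by (intro ennreal_leI divide_left_mono) (auto simp: I_def)
            finally have "h (g i x) / ennreal (L i) \<le> ennreal (m / a i) / ennreal (L i)"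
              by (rule divide_right_mono_ennreal)
            also have "\<dots> = ennreal (m * (1 / (a i * L i)))"
              using J(4)[OF iJ] L_pos[of i] sm by (simp add: divide_ennreal)
            finally show ?thesis using dL True iJ by (auto intro: order_trans)
          next
            case iJ: False
            have "h (g i x) / ennreal (L i) \<le> ennreal s / ennreal (L i)"
              using d g01 by (intro divide_right_mono_ennreal) (auto simp: dens_def)
            also have "\<dots> = ennreal s * ennreal (1 / L i)"
              using L_pos[of i] sm by (simp add: divide_ennreal ennreal_mult[symmetric])
            finally show ?thesis using dL True iJ by (auto intro: order_trans)
          qed
        qed simp
      qed
      also have "\<dots> = ennreal s * (\<Sum>i. indicator (- J) i * ennreal (1 / L i)) +
          (\<Sum>i. if i \<in> J then ennreal (m * (1 / (a i * L i))) else 0)"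
        by (subst suminf_add[OF summableI summableI, symmetric]) simp
      also have "(\<Sum>i. if i \<in> J then ennreal (m * (1 / (a i * L i))) else 0) =
          (\<Sum>i\<in>J. ennreal (m * (1 / (a i * L i))))"
        by (rule sums_unique[symmetric]) (rule sums_If_finite_set[OF J(1)])
      also have "\<dots> = ennreal (C * m)"
        using J(4) L_pos sm by (subst sum_ennreal) (auto simp: C_def sum_distrib_left mult.commute less_imp_le)
      also have "ennreal s * (\<Sum>i. indicator (- J) i * ennreal (1 / L i)) + ennreal (C * m) \<le>
         ennreal s * ennreal \<theta> + ennreal (C * m)"
        by (intro add_right_mono mult_left_mono tail) simp
      also have "\<dots> = ennreal (\<theta> * s + C * m)"
        using sm J C0 by (simp add: ennreal_mult[symmetric] mult.commute)
      finally show ?thesis .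
    qed
    moreover have "decreasing (T h)"
    proof (rule decreasing_T)
      fix i x y assume "x \<in> I i" "y \<in> I i" "x \<le> y"
      then show "h y \<le> h x" by (rule dens_antimono[OF d])
    qed
    moreover have "(\<integral>\<^sup>+x. T h x \<partial>unit_leb) = ennreal m"
      using d by (simp add: mass_T dens_def)
    ultimately show ?thesis using d sm J C0 by (auto simp: dens_def)
  qed
  then show ?thesis using J C0 by blast
qed

lemma Lasota_Yorke_pow:
  "\<exists>\<theta> C. 0 \<le> \<theta> \<and> \<theta> < 1 \<and> 0 \<le> C \<and>
     (\<forall>s m h n. dens s m h \<longrightarrow> dens (\<theta> ^ n * s + C * m) m ((T ^^ n) h))"
proof -
  obtain \<theta> C where C: "0 \<le> \<theta>" "\<theta> < 1" "0 \<le> C" "\<And>s m h. dens s m h \<Longrightarrow> dens (\<theta> * s + C * m) m (T h)"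
    using Lasota_Yorke by blast
  \<comment> \<open>\<open>C / (1 - \<theta>)\<close> is the fixed point of
    \<open>c \<mapsto> \<theta> * c + C\<close>, so the coefficient of the mass does not grow under
    iteration.\<close>
  have "dens (\<theta> ^ n * s + C / (1 - \<theta>) * m) m ((T ^^ n) h)" if d: "dens s m h" for s m h n
  proof (induction n)
    case 0
    have "0 \<le> C / (1 - \<theta>) * m" using C d by (simp add: dens_def)
    then show ?case using dens_mono[OF d, of "s + C / (1 - \<theta>) * m"] by simp
  next
    case (Suc n)
    have "\<theta> * (\<theta> ^ n * s + C / (1 - \<theta>) * m) + C * m = \<theta> ^ Suc n * s + C / (1 - \<theta>) * m"
      using C by (simp add: field_simps)
    then show ?case using C(4)[OF Suc] by simp
  qed
  then show ?thesis using C by (intro exI[of _ \<theta>] exI[of _ "C / (1 - \<theta>)"]) auto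
qed

lemma dens_T_pow: "dens s m h \<Longrightarrow> \<exists>s'. dens s' m ((T ^^ n) h)"
  using Lasota_Yorke_pow by blast

section \<open>Lower bounds near zero and the common part of two densities\<close>

lemma dens_ge_half:
  assumes d: "dens (M * m) m h" and M: "0 < M" and x: "0 < x" "x < 1" "x \<le> 1 / (2 * M)"
  shows "ennreal (m / 2) \<le> h x"
proof -
  have m: "0 \<le> m" "0 \<le> M * m" using d by (auto simp: dens_def)
  have s: "{0..x} \<in> sets unit_leb" unfolding sets_unit_leb using x
      by (subst sets_restrict_space_iff) auto
  have "h x \<le> ennreal (M * m)" using d x by (auto simp: dens_def)
  then obtain v where v: "h x = ennreal v" "0 \<le> v" by (cases "h x") (auto simp: top_unique)
  \<comment> \<open>Left of \<open>x\<close> the density is at most \<open>M * m\<close>, which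
    accounts for at most half of the mass. Right of \<open>x\<close> it is at most
    \<open>h x\<close>, on a set of length at most 1, so \<open>h x\<close> must supply the other
    half.\<close>
  have "ennreal m = (\<integral>\<^sup>+y. h y \<partial>unit_leb)" using d by (simp add: dens_def)
  also have "\<dots> \<le> (\<integral>\<^sup>+y. ennreal (M * m) * indicator {0..x} y + h x \<partial>unit_leb)"
  proof (rule nn_integral_mono_AE, use AE_unit_leb_interior in eventually_elim)
    case (elim y)
    show ?case
    proof (cases "y \<le> x")
      case True
      then have "h y \<le> ennreal (M * m)" using d elim by (auto simp: dens_def)
      then show ?thesis using True elim by (auto intro: add_increasing2)
    next
      case False
      then have "h y \<le> h x" using d x elim by (auto simp: dens_def decreasing_def)
      then show ?thesis by (simp add: add_increasing)
    qed
  qed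
  also have "\<dots> = ennreal (M * m) * ennreal x + ennreal v"
    using s x v by (subst nn_integral_add) (auto simp: nn_integral_cmult_indicator emeasure_unit_leb)
  also have "\<dots> = ennreal (M * m * x + v)" using m v x by (simp add: ennreal_mult ennreal_plus)
  finally have "m \<le> M * m * x + v" using m v x by (subst (asm) ennreal_le_iff) auto
  moreover have "M * m * x \<le> m / 2"
  proof -
    have "M * x \<le> 1 / 2" using x M by (simp add: field_simps)
    then have "m * (M * x) \<le> m * (1 / 2)" using m by (intro mult_left_mono) auto
    then show ?thesis by (simp add: mult_ac)
  qed
  ultimately show ?thesis using v by (auto intro!: ennreal_leI)
qed

lemma T_ge_branch:
  assumes "x \<in> f ` I i"
  shows "h (g i x) / ennreal (deriv f (g i x)) \<le> T h x"
proof -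
  have "h (g i x) / ennreal (deriv f (g i x)) =
    (\<Sum>i\<in>{i}. indicator (f ` I i) x * (h (g i x) / ennreal (deriv f (g i x))))" using assms by simp
  also have "\<dots> \<le> T h x" unfolding T_def by (intro sum_le_suminf) auto
  finally show ?thesis .
qed

text \<open>Up to \<open>\<delta> = 1 / (2 * M)\<close> the density is at least half its mass. If
  endpoints accumulate at 0, a whole branch interval lies below \<open>\<delta>\<close> and
  \<open>j = 0\<close> will do. Otherwise a branch starts at 0 with slope above 1, and its inverse,
  applied \<open>n\<close> times, brings its whole interval below \<open>\<delta>\<close>. Branch,
  time and constant depend on \<open>M\<close> alone, not on the density.\<close>

lemma minorization:
  assumes M: "1 \<le> M"
  shows "\<exists>i j c. 0 < c \<and> (\<forall>m h. dens (M * m) m h \<longrightarrow> (\<forall>x\<in>I i. ennreal (c * m) \<le> (T ^^ j) h x))"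
proof -
  define \<delta> where "\<delta> = 1 / (2 * M)"
  have \<delta>: "0 < \<delta>" "\<delta> < 1" using M by (auto simp: \<delta>_def field_simps)
  have half: "ennreal (m / 2) \<le> h x" if "dens (M * m) m h" "0 < x" "x \<le> \<delta>" for m h x
    using dens_ge_half[OF that(1), of x] that \<delta> M by (simp add: \<delta>_def)
  show ?thesis
  proof (cases "0 islimpt (range a \<union> range b)")
    case True
    then obtain t where "t \<in> range a \<union> range b" "t \<in> {-\<delta><..<\<delta>}" "t \<noteq> 0"
      using \<delta> unfolding islimpt_def by (metis greaterThanLessThan_iff neg_less_0_iff_less open_greaterThanLessThan)
    then obtain i0 where "t = a i0 \<or> t = b i0" by auto
    then have "\<exists>i. b i \<le> \<delta>"
    proof
      assume "t = b i0" then show ?thesis using \<open>t \<in> {-\<delta><..<\<delta>}\<close> by (intro exI[of _ i0]) auto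
    next
      assume t: "t = a i0"
      have t0: "0 < t" "t < 1" "t < \<delta>" using t a_ge0[of i0] \<open>t \<noteq> 0\<close> \<open>t \<in> {-\<delta><..<\<delta>}\<close> \<delta> by auto
      \<comment> \<open>A left endpoint \<open>t\<close> close to 0 gives no short branch by itself.
        But some branch meets (0,t), since the branches have full measure, and it must end by
        \<open>t\<close>, where branch \<open>i0\<close> begins.\<close>
      have "\<exists>x\<in>{0<..<t}. x \<in> (\<Union>i. I i)"
      proof (rule ccontr)
        assume "\<not> ?thesis"
        then have sub: "{0<..<t} \<subseteq> {0..1} - (\<Union>i. I i)" using t0 by auto
        have "emeasure unit_leb {0<..<t} \<le> emeasure unit_leb ({0..1} - (\<Union>i. I i))"
          by (rule emeasure_mono[OF sub]) (subst sets_unit_leb, subst sets_restrict_space_iff, auto)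
        then show False using full t0 by (simp add: I_def emeasure_unit_leb subset_eq)
      qed
      then obtain x i where x: "x \<in> I i" "0 < x" "x < t" by auto
      have "b i \<le> t"
      proof (rule ccontr)
        assume "\<not> b i \<le> t"
        then have "i \<noteq> i0" "(t + min (b i) (b i0)) / 2 \<in> I i" "(t + min (b i) (b i0)) / 2 \<in> I i0"
          using x t ab[of i0] by (auto simp: I_def min_def)
        then show False using I_unique by blast
      qed
      then show ?thesis using t0 by (intro exI[of _ i]) auto
    qed
    then obtain i where i: "b i \<le> \<delta>" by blast
    have "ennreal (1/2 * m) \<le> (T ^^ 0) h x" if "dens (M * m) m h" "x \<in> I i" for m h x
      using half[OF that(1), of x] that(2) i I_sub[of i] by (auto simp: I_def)
    then show ?thesis by (intro exI[of _ i] exI[of _ 0] exI[of _ "1/2"]) auto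
  next
    case False
    from fix0[OF False] obtain \<beta> where \<beta>: "0 < \<beta>" "\<beta> < 1" "right_deriv_lim f 0 = 1 / \<beta>" by blast
    obtain e where e: "0 < e" "\<And>t. t \<in> range a \<union> range b \<Longrightarrow> t \<noteq> 0 \<Longrightarrow> e \<le> \<bar>t\<bar>"
      using False unfolding islimpt_approachable by (auto simp: dist_real_def not_less)
    define e' where "e' = min e (1/2)"
    have e': "0 < e'" "e' \<le> e" "e' < 1" using e by (auto simp: e'_def)
    have "\<exists>x\<in>{0<..<e'}. x \<in> (\<Union>i. I i)"
    proof (rule ccontr)
      assume "\<not> ?thesis"
      then have sub: "{0<..<e'} \<subseteq> {0..1} - (\<Union>i. I i)" using e' by auto
      have "emeasure unit_leb {0<..<e'} \<le> emeasure unit_leb ({0..1} - (\<Union>i. I i))"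
        by (rule emeasure_mono[OF sub]) (subst sets_unit_leb, subst sets_restrict_space_iff, auto)
      then show False using full e' by (simp add: I_def emeasure_unit_leb subset_eq)
    qed
    then obtain x i where x: "x \<in> I i" "0 < x" "x < e'" by auto
    have a0: "a i = 0"
    proof (rule ccontr)
      assume "a i \<noteq> 0"
      then have "e \<le> \<bar>a i\<bar>" by (intro e) auto
      then show False using x e' a_ge0[of i] by (auto simp: I_def)
    qed
    have L: "L i = 1 / \<beta>" using \<beta> a0 by (simp add: L_def)
    have bi: "0 < b i" using ab[of i] a0 by simp
    have fge: "y / \<beta> \<le> f y" if "y \<in> I i" for y using f_ge[OF that] L a0 by simp
    \<comment> \<open>Slopes may be unbounded towards \<open>b i\<close>, so they are controlled
      only up to \<open>y0\<close>. Since \<open>y0\<close> exceeds \<open>\<beta> * b i\<close>,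
      its image reaches \<open>b i\<close>; inverse images of points of the interval therefore stay
      left of \<open>y0\<close>, where the slope is at most \<open>D\<close>.\<close>
    define y0 where "y0 = (\<beta> * b i + b i) / 2"
    have y0: "y0 \<in> I i" using \<beta> bi mult_strict_right_mono[OF \<beta>(2) bi]
      by (auto simp: y0_def I_def a0 intro!: add_pos_pos)
    have fy0: "b i \<le> f y0"
    proof -
      have "\<beta> * b i \<le> y0" using mult_strict_right_mono[OF \<beta>(2) bi] by (simp add: y0_def)
      then have "b i \<le> y0 / \<beta>" using \<beta> by (simp add: field_simps)
      then show ?thesis using fge[OF y0] by linarith
    qed
    define D where "D = deriv f y0"
    have D: "0 < D" using deriv_pos y0 by (simp add: D_def)
    have step: "z \<in> f ` I i \<and> g i z \<le> \<beta> * z \<and> deriv f (g i z) \<le> D" if "z \<in> I i" for z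
    proof -
      have z: "z \<in> f ` I i"
        using f_image_downclosed[of "f y0" i z] y0 fy0 that by (auto simp: I_def a0)
      moreover have "g i z / \<beta> \<le> z" using fge[OF g_in[OF z]] f_g[OF z] by simp
      moreover have "g i z \<le> y0"
        using g_le[of z i "f y0"] z y0 fy0 that by (auto simp: I_def)
      ultimately show ?thesis using \<beta> deriv_mono[OF g_in[OF z] y0] by (auto simp: D_def field_simps)
    qed
    \<comment> \<open>Each inverse step multiplies the point by at most \<open>\<beta>\<close> and
      costs at most a factor \<open>D\<close> in the density.\<close>
    have pow: "ennreal (1 / (2 * D ^ n) * m) \<le> (T ^^ n) h z"
      if d: "dens (M * m) m h" and z: "z \<in> I i" "z * \<beta> ^ n \<le> \<delta>" for m h n z
      using z
    proof (induction n arbitrary: z)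
      case 0
      then show ?case using half[OF d, of z] I_sub[of i] by auto
    next
      case (Suc n)
      have m: "0 \<le> m" using d by (simp add: dens_def)
      note st = step[OF Suc.prems(1)]
      have gz: "g i z \<in> I i" using st g_in by blast
      have "g i z * \<beta> ^ n \<le> (\<beta> * z) * \<beta> ^ n" using st \<beta> by (intro mult_right_mono) auto
      also have "\<dots> \<le> \<delta>" using Suc.prems(2) by (simp add: mult_ac)
      finally have IH: "ennreal (1 / (2 * D ^ n) * m) \<le> (T ^^ n) h (g i z)" using Suc.IH gz by blast
      have "ennreal (1 / (2 * D ^ Suc n) * m) = ennreal (1 / (2 * D ^ n) * m) / ennreal D"
        using D m by (simp add: divide_ennreal field_simps)
      also have "\<dots> \<le> (T ^^ n) h (g i z) / ennreal D" by (rule divide_right_mono_ennreal[OF IH])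
      also have "\<dots> \<le> (T ^^ n) h (g i z) / ennreal (deriv f (g i z))"
        using st g_in deriv_pos by (intro divide_left_mono_ennreal) auto
      also have "\<dots> \<le> T ((T ^^ n) h) z" using st by (intro T_ge_branch) auto
      finally show ?case by simp
    qed
    obtain n where n: "\<beta> ^ n < \<delta>" using real_arch_pow_inv[of \<delta> \<beta>] \<delta> \<beta> by auto
    have "ennreal (1 / (2 * D ^ n) * m) \<le> (T ^^ n) h z" if "dens (M * m) m h" "z \<in> I i" for m h z
    proof (rule pow[OF that])
      have "z * \<beta> ^ n \<le> 1 * \<beta> ^ n" using that I_sub[of i] \<beta> by (intro mult_right_mono) auto
      then show "z * \<beta> ^ n \<le> \<delta>" using n by simp
    qed
    then show ?thesis using D by (intro exI[of _ i] exI[of _ n] exI[of _ "1 / (2 * D ^ n)"]) auto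
  qed
qed

text \<open>The function \<open>k\<close> does not depend on the density: two densities of equal
  mass lose the same \<open>m * k\<close>, which cancels in their difference. The remainder again
  has supremum at most \<open>M\<close> times its mass, so the step can be repeated.\<close>

lemma minorized_step:
  "\<exists>M n \<epsilon> k. 2 \<le> M \<and> 0 < n \<and> 0 < \<epsilon> \<and> \<epsilon> < 1 \<and> k \<in> borel_measurable borel \<and>
     (\<forall>m h. dens (M * m) m h \<longrightarrow> (\<exists>h'. dens (M * ((1 - \<epsilon>) * m)) ((1 - \<epsilon>) * m) h' \<and>
        (\<forall>x\<in>{0<..<1}. (T ^^ n) h x = h' x + ennreal m * k x)))"
proof -
  obtain \<theta> C where C: "0 \<le> \<theta>" "\<theta> < 1" "0 \<le> C"
    and LY: "\<And>s m h n. dens s m h \<Longrightarrow> dens (\<theta> ^ n * s + C * m) m ((T ^^ n) h)"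
    using Lasota_Yorke_pow by blast
  \<comment> \<open>The term \<open>C\<close> times the mass is not removed by iteration, so
    \<open>M\<close> must leave room for it: \<open>M - C\<close> is at least 1 and at least half of
    the mass remains, hence it is enough to push \<open>\<theta> ^ l * (M + C)\<close> below
    1/2.\<close>
  define M where "M = 2 * C + 2"
  have M: "1 \<le> M" "2 \<le> M" using C by (auto simp: M_def)
  obtain i j c0 where c0: "0 < c0"
    and low0: "\<And>m h x. dens (M * m) m h \<Longrightarrow> x \<in> I i \<Longrightarrow> ennreal (c0 * m) \<le> (T ^^ j) h x"
    using minorization[OF M(1)] by blast
  \<comment> \<open>Lowering the constant keeps \<open>\<epsilon>\<close> at most 1/2, so that a
    definite part of the mass survives the subtraction.\<close>
  define c where "c = min c0 (1/2)"
  have c: "0 < c" "c \<le> 1/2" using c0 by (auto simp: c_def)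
  have low: "ennreal (c * m) \<le> (T ^^ j) h x" if d: "dens (M * m) m h" "x \<in> I i" for m h x
  proof -
    have "c * m \<le> c0 * m" using d by (intro mult_right_mono) (auto simp: c_def dens_def)
    then show ?thesis using low0[OF d] by (meson ennreal_leI order_trans)
  qed
  define \<epsilon> where "\<epsilon> = c * (b i - a i)"
  have \<epsilon>: "0 < \<epsilon>" "\<epsilon> \<le> 1/2"
  proof -
    have "b i - a i \<le> 1" using a_ge0[of i] b_le1[of i] by simp
    then have "c * (b i - a i) \<le> 1/2 * 1" using c ab[of i] by (intro mult_mono) auto
    then show "0 < \<epsilon>" "\<epsilon> \<le> 1/2" using c ab[of i] by (simp_all add: \<epsilon>_def)
  qed
  obtain l where l: "\<theta> ^ l < 1 / (2 * (M + C))"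
    using real_arch_pow_inv[of "1 / (2 * (M + C))" \<theta>] C M by auto
  define k where "k = (\<lambda>x. ennreal c * (T ^^ Suc l) (indicator (I i)) x)"
  have k: "k \<in> borel_measurable borel" unfolding k_def by measurable
  have "\<exists>h'. dens (M * ((1 - \<epsilon>) * m)) ((1 - \<epsilon>) * m) h' \<and>
        (\<forall>x\<in>{0<..<1}. (T ^^ (Suc l + j)) h x = h' x + ennreal m * k x)" if d: "dens (M * m) m h" for m h
  proof -
    have m: "0 \<le> m" using d by (simp add: dens_def)
    have hm[measurable]: "h \<in> borel_measurable borel" using d by (rule dens_measurable)
    define u where "u = (T ^^ j) h"
    define w where "w = (\<lambda>x. u x - ennreal (c * m) * indicator (I i) x)"
    have du: "dens (\<theta> ^ j * (M * m) + C * m) m u" unfolding u_def by (rule LY[OF d])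
    have um[measurable]: "u \<in> borel_measurable borel" by (simp add: u_def)
    have wm[measurable]: "w \<in> borel_measurable borel" unfolding w_def by measurable
    have uw: "u x = w x + ennreal (c * m) * indicator (I i) x" for x
    proof (cases "x \<in> I i")
      case True
      then show ?thesis using low[OF d True] by (simp add: w_def u_def diff_add_cancel_ennreal)
    qed (simp add: w_def)
    have wu: "w x \<le> u x" for x by (simp add: w_def diff_le_self_ennreal)
    have mass_w: "(\<integral>\<^sup>+x. w x \<partial>unit_leb) = ennreal ((1 - \<epsilon>) * m)"
    proof -
      have Is: "I i \<in> sets unit_leb" unfolding sets_unit_leb using I_sub[of i]
        by (subst sets_restrict_space_iff) auto
      have Ie: "emeasure unit_leb (I i) = ennreal (b i - a i)"
        using ab[of i] I_sub[of i] by (subst emeasure_unit_leb) (auto simp: I_def)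
      have "ennreal m = (\<integral>\<^sup>+x. u x \<partial>unit_leb)" using du by (simp add: dens_def)
      also have "\<dots> = (\<integral>\<^sup>+x. w x \<partial>unit_leb) + ennreal (c * m) * ennreal (b i - a i)"
        unfolding uw using Is Ie
        by (subst nn_integral_add) (auto simp: nn_integral_cmult_indicator borel_measurable_unit_lebI)
      also have "ennreal (c * m) * ennreal (b i - a i) = ennreal (\<epsilon> * m)"
        using c m ab[of i] by (simp add: ennreal_mult[symmetric] \<epsilon>_def mult_ac)
      finally have "ennreal m - ennreal (\<epsilon> * m) = (\<integral>\<^sup>+x. w x \<partial>unit_leb)"
        by simp
      then show ?thesis using m \<epsilon> by (simp add: ennreal_minus algebra_simps)
    qed
    have dTw: "dens ((M + C) * m) ((1 - \<epsilon>) * m) (T w)"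
      unfolding dens_def
    proof (intro conjI ballI)
      show "T w \<in> borel_measurable borel" by measurable
      \<comment> \<open>On a single branch the subtracted indicator is constant, so \<open>w\<close>
        decreases there as \<open>u\<close> does.\<close>
      show "decreasing (T w)"
      proof (rule decreasing_T)
        fix i' x y assume xy: "x \<in> I i'" "y \<in> I i'" "x \<le> y"
        then have "indicator (I i) x = (indicator (I i) y :: ennreal)"
          using I_unique by (auto simp: indicator_def)
        moreover have "u y \<le> u x" using dens_antimono[OF du xy] .
        ultimately show "w y \<le> w x" by (simp add: w_def ennreal_minus_mono)
      qed
      show "(\<integral>\<^sup>+x. T w x \<partial>unit_leb) = ennreal ((1 - \<epsilon>) * m)" by (simp add: mass_T mass_w)
      show "0 \<le> (M + C) * m" "0 \<le> (1 - \<epsilon>) * m" using M C m \<epsilon> by simp_all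
      fix x :: real assume x: "x \<in> {0<..<1}"
      have "T w x \<le> T u x" by (rule T_mono[OF wu])
      also have "\<dots> = (T ^^ Suc j) h x" by (simp add: u_def)
      also have "\<dots> \<le> ennreal (\<theta> ^ Suc j * (M * m) + C * m)" using LY[OF d, of "Suc j"] x by (simp add: dens_def)
      also have "\<dots> \<le> ennreal ((M + C) * m)"
      proof (rule ennreal_leI)
        have "\<theta> ^ Suc j * (M * m) \<le> 1 * (M * m)"
          using C M m power_le_one[of \<theta> "Suc j"] by (intro mult_right_mono) auto
        then show "\<theta> ^ Suc j * (M * m) + C * m \<le> (M + C) * m" by (simp add: algebra_simps)
      qed
      finally show "T w x \<le> ennreal ((M + C) * m)" .
    qed
    have "dens (\<theta> ^ l * ((M + C) * m) + C * ((1 - \<epsilon>) * m)) ((1 - \<epsilon>) * m) ((T ^^ l) (T w))"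
      by (rule LY[OF dTw])
    then have d': "dens (M * ((1 - \<epsilon>) * m)) ((1 - \<epsilon>) * m) ((T ^^ l) (T w))"
    proof (rule dens_mono)
      have "\<theta> ^ l * (M + C) \<le> 1/2" using l M C by (simp add: field_simps)
      then have "\<theta> ^ l * (M + C) * m \<le> 1/2 * m" using m by (intro mult_right_mono)
      moreover have "(M - C) * (1 - \<epsilon>) \<ge> 1 * (1/2)" using \<epsilon> C by (intro mult_mono) (auto simp: M_def)
      then have "1/2 * m \<le> (M - C) * (1 - \<epsilon>) * m" using m by (intro mult_right_mono) auto
      ultimately show "\<theta> ^ l * ((M + C) * m) + C * ((1 - \<epsilon>) * m) \<le> M * ((1 - \<epsilon>) * m)"
        by (simp add: algebra_simps)
    qed
    have "(T ^^ (Suc l + j)) h x = (T ^^ l) (T w) x + ennreal m * k x" for x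
    proof -
      have u_eq: "u = (\<lambda>x. w x + ennreal (c * m) * indicator (I i) x)" by (rule ext) (rule uw)
      have "(T ^^ (Suc l + j)) h x = (T ^^ Suc l) u x" by (simp add: funpow_add u_def)
      also have "\<dots> = (T ^^ Suc l) (\<lambda>x. w x + ennreal (c * m) * indicator (I i) x) x"
        by (subst u_eq) (rule refl)
      also have "\<dots> = (T ^^ Suc l) w x + ennreal (c * m) * (T ^^ Suc l) (indicator (I i)) x"
        by (simp only: T_pow_add T_pow_cmult)
      also have "(T ^^ Suc l) w x = (T ^^ l) (T w) x" by (simp add: funpow_swap1)
      finally show ?thesis using c m by (simp add: k_def ennreal_mult mult_ac)
    qed
    then show ?thesis using d' by blast
  qed
  then show ?thesis using M \<epsilon> k
    by (intro exI[of _ M] exI[of _ "Suc l + j"] exI[of _ \<epsilon>] exI[of _ k]) auto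
qed

section \<open>Exponential contraction and the invariant density\<close>

lemma power_div_bound:
  fixes \<rho> :: real
  assumes "0 < \<rho>" "\<rho> < 1" "0 < (l::nat)"
  shows "\<rho> ^ (n div l) \<le> (1 / \<rho>) * (root l \<rho>) ^ n"
proof -
  define r where "r = root l \<rho>"
  have r: "0 < r" "r \<le> 1" "r ^ l = \<rho>" using assms by (auto simp: r_def real_root_le_1_iff)
  \<comment> \<open>Contraction by \<open>\<rho>\<close> per block of \<open>l\<close> steps is a
    rate \<open>root l \<rho>\<close> per step; the factor \<open>1 / \<rho>\<close> pays for the
    unfinished block, as \<open>n \<le> l * Suc (n div l)\<close>.\<close>
  have "\<rho> * \<rho> ^ (n div l) = r ^ (l * Suc (n div l))" by (simp add: r(3)[symmetric] power_add power_mult[symmetric])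
  also have "\<dots> \<le> r ^ n"
  proof (rule power_decreasing)
    show "n \<le> l * Suc (n div l)"
      using mult_div_mod_eq[of l n] mod_less_divisor[OF assms(3), of n] unfolding mult_Suc_right by linarith
  qed (use r in auto)
  finally show ?thesis using assms by (simp add: r_def field_simps)
qed

text \<open>The mass of the densities may be small compared with \<open>s\<close>, so the constant
  \<open>s\<close> is added to both. Then the supremum is at most \<open>2 * s\<close>, hence at
  most \<open>M\<close> times the new mass \<open>m + s\<close>, and the constant cancels in the
  difference. The difference is returned as one of two small decreasing densities, which bounds its
  variation as well as its size.\<close>

theorem density_contraction:
  "\<exists>\<eta> C. 0 < \<eta> \<and> \<eta> < 1 \<and> 0 \<le> C \<and>
    (\<forall>p q s m n. dens s m p \<longrightarrow> dens s m q \<longrightarrow>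
      (\<exists>p' q' m'. dens (C * \<eta> ^ n * s) m' p' \<and> dens (C * \<eta> ^ n * s) m' q' \<and>
        (\<forall>x\<in>{0<..<1}. enn2real ((T ^^ n) p x) - enn2real ((T ^^ n) q x) =
            enn2real (p' x) - enn2real (q' x))))"
proof -
  obtain M l \<epsilon> k where M: "2 \<le> M" "0 < l" "0 < \<epsilon>" "\<epsilon> < 1" and km: "k \<in> borel_measurable borel"
    and step: "\<And>m h. dens (M * m) m h \<Longrightarrow> \<exists>h'. dens (M * ((1 - \<epsilon>) * m)) ((1 - \<epsilon>) * m) h' \<and>
        (\<forall>x\<in>{0<..<1}. (T ^^ l) h x = h' x + ennreal m * k x)"
    using minorized_step by blast
  obtain \<theta> C where C: "0 \<le> \<theta>" "\<theta> < 1" "0 \<le> C"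
    and LY: "\<And>s m h n. dens s m h \<Longrightarrow> dens (\<theta> ^ n * s + C * m) m ((T ^^ n) h)"
    using Lasota_Yorke_pow by blast
  define \<rho> where "\<rho> = 1 - \<epsilon>"
  have \<rho>: "0 < \<rho>" "\<rho> < 1" using M by (auto simp: \<rho>_def)
  \<comment> \<open>\<open>r\<close> collects the parts subtracted so far, transported forward; it
    is the same function for \<open>p\<close> and \<open>q\<close>.\<close>
  have iter: "\<exists>p' q' r. dens (M * (\<rho> ^ n * m)) (\<rho> ^ n * m) p' \<and> dens (M * (\<rho> ^ n * m)) (\<rho> ^ n * m) q' \<and>
      (\<forall>x\<in>{0<..<1}. (T ^^ (l * n)) p x = p' x + r x \<and> (T ^^ (l * n)) q x = q' x + r x)"
    if "dens (M * m) m p" "dens (M * m) m q" for p q m n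
  proof (induction n)
    case 0
    show ?case using that by (intro exI[of _ p] exI[of _ q] exI[of _ "\<lambda>_. 0"]) simp
  next
    case (Suc n)
    then obtain p' q' r where *: "dens (M * (\<rho> ^ n * m)) (\<rho> ^ n * m) p'" "dens (M * (\<rho> ^ n * m)) (\<rho> ^ n * m) q'"
      "\<And>x. x \<in> {0<..<1} \<Longrightarrow> (T ^^ (l * n)) p x = p' x + r x \<and> (T ^^ (l * n)) q x = q' x + r x" by blast
    obtain p'' where p'': "dens (M * (\<rho> * (\<rho> ^ n * m))) (\<rho> * (\<rho> ^ n * m)) p''"
       "\<And>x. x \<in> {0<..<1} \<Longrightarrow> (T ^^ l) p' x = p'' x + ennreal (\<rho> ^ n * m) * k x"
      using step[OF *(1)] by (auto simp: \<rho>_def)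
    obtain q'' where q'': "dens (M * (\<rho> * (\<rho> ^ n * m))) (\<rho> * (\<rho> ^ n * m)) q''"
       "\<And>x. x \<in> {0<..<1} \<Longrightarrow> (T ^^ l) q' x = q'' x + ennreal (\<rho> ^ n * m) * k x"
      using step[OF *(2)] by (auto simp: \<rho>_def)
    let ?r = "\<lambda>x. ennreal (\<rho> ^ n * m) * k x + (T ^^ l) r x"
    have ln: "l * Suc n = l + l * n" by simp
    have "(T ^^ (l * Suc n)) p x = p'' x + ?r x" if x: "x \<in> {0<..<1}" for x
    proof -
      have "(T ^^ (l * Suc n)) p x = (T ^^ l) ((T ^^ (l * n)) p) x" unfolding ln by (simp add: funpow_add)
      also have "\<dots> = (T ^^ l) (\<lambda>x. p' x + r x) x" by (rule T_pow_cong[OF _ x]) (simp add: *)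
      finally show ?thesis using p''(2)[OF x] by (simp add: T_pow_add add.assoc)
    qed
    moreover have "(T ^^ (l * Suc n)) q x = q'' x + ?r x" if x: "x \<in> {0<..<1}" for x
    proof -
      have "(T ^^ (l * Suc n)) q x = (T ^^ l) ((T ^^ (l * n)) q) x" unfolding ln by (simp add: funpow_add)
      also have "\<dots> = (T ^^ l) (\<lambda>x. q' x + r x) x" by (rule T_pow_cong[OF _ x]) (simp add: *)
      finally show ?thesis using q''(2)[OF x] by (simp add: T_pow_add add.assoc)
    qed
    ultimately show ?case using p''(1) q''(1)
      by (intro exI[of _ p''] exI[of _ q''] exI[of _ ?r]) (simp add: mult.assoc)
  qed
  define \<eta> where "\<eta> = root l \<rho>"
  have \<eta>: "0 < \<eta>" "\<eta> < 1" using \<rho> M by (auto simp: \<eta>_def real_root_lt_1_iff)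
  \<comment> \<open>\<open>M + C\<close> bounds the ratio of supremum to mass after the last
    incomplete block, 2 comes from \<open>m + s \<le> 2 * s\<close>, and \<open>1 / \<rho>\<close>
    from rounding \<open>n\<close> down to full blocks.\<close>
  define C' where "C' = (M + C) * 2 / \<rho>"
  have C': "0 \<le> C'" using M C \<rho> by (simp add: C'_def)
  have "\<exists>p' q' m'. dens (C' * \<eta> ^ n * s) m' p' \<and> dens (C' * \<eta> ^ n * s) m' q' \<and>
        (\<forall>x\<in>{0<..<1}. enn2real ((T ^^ n) p x) - enn2real ((T ^^ n) q x) =
            enn2real (p' x) - enn2real (q' x))"
    if d: "dens s m p" "dens s m q" for p q s m n
  proof -
    have sm: "0 \<le> s" "0 \<le> m" "m \<le> s" using d dens_mass_le by (auto simp: dens_def)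
    have add: "dens (M * (m + s)) (m + s) (\<lambda>x. h x + ennreal s)" if h: "dens s m h" for h
    proof (rule dens_mono)
      show "dens (s + s) (m + s) (\<lambda>x. h x + ennreal s)" using h sm by (intro dens_add dens_const)
      have "2 * (m + s) \<le> M * (m + s)" using sm M by (intro mult_right_mono) auto
      then show "s + s \<le> M * (m + s)" using sm by simp
    qed
    define n0 where "n0 = n div l"
    define t where "t = n mod l"
    have n: "n = t + l * n0" by (simp add: t_def n0_def)
    obtain p' q' r where *: "dens (M * (\<rho> ^ n0 * (m + s))) (\<rho> ^ n0 * (m + s)) p'"
       "dens (M * (\<rho> ^ n0 * (m + s))) (\<rho> ^ n0 * (m + s)) q'"
      "\<And>x. x \<in> {0<..<1} \<Longrightarrow> (T ^^ (l * n0)) (\<lambda>x. p x + ennreal s) x = p' x + r x \<and>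
          (T ^^ (l * n0)) (\<lambda>x. q x + ennreal s) x = q' x + r x"
      using iter[OF add[OF d(1)] add[OF d(2)], of n0] by blast
    have bound: "\<theta> ^ t * (M * (\<rho> ^ n0 * (m + s))) + C * (\<rho> ^ n0 * (m + s)) \<le> C' * \<eta> ^ n * s"
    proof -
      have "\<theta> ^ t * (M * (\<rho> ^ n0 * (m + s))) \<le> 1 * (M * (\<rho> ^ n0 * (m + s)))"
        using C M \<rho> sm power_le_one[of \<theta> t] by (intro mult_right_mono) auto
      then have "\<theta> ^ t * (M * (\<rho> ^ n0 * (m + s))) + C * (\<rho> ^ n0 * (m + s)) \<le> (M + C) * (\<rho> ^ n0 * (m + s))"
        by (simp add: algebra_simps)
      also have "\<dots> \<le> (M + C) * (((1 / \<rho>) * \<eta> ^ n) * (2 * s))"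
        using power_div_bound[OF \<rho> M(2), of n] M C sm \<rho> \<eta>
        by (intro mult_left_mono mult_mono) (auto simp: n0_def \<eta>_def)
      also have "\<dots> = C' * \<eta> ^ n * s" by (simp add: C'_def)
      finally show ?thesis .
    qed
    have fin: "\<exists>v\<ge>0. (T ^^ n) h x = ennreal v" if "dens s1 m1 h" "x \<in> {0<..<1}" for s1 m1 h n x
    proof -
      have "(T ^^ n) h x \<le> ennreal (\<theta> ^ n * s1 + C * m1)" using LY[OF that(1), of n] that(2) by (simp add: dens_def)
      then show ?thesis by (cases "(T ^^ n) h x") (auto simp: top_unique)
    qed
    have split: "(T ^^ n) h x + (T ^^ n) (\<lambda>_. ennreal s) x = (T ^^ t) h' x + (T ^^ t) r x"
      if "x \<in> {0<..<1}" "\<And>x. x \<in> {0<..<1} \<Longrightarrow> (T ^^ (l * n0)) (\<lambda>x. h x + ennreal s) x = h' x + r x" for h h' x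
    proof -
      have "(T ^^ n) h x + (T ^^ n) (\<lambda>_. ennreal s) x = (T ^^ n) (\<lambda>x. h x + ennreal s) x"
        by (simp add: T_pow_add)
      also have "\<dots> = (T ^^ t) ((T ^^ (l * n0)) (\<lambda>x. h x + ennreal s)) x" unfolding n by (simp add: funpow_add)
      also have "\<dots> = (T ^^ t) (\<lambda>x. h' x + r x) x" by (rule T_pow_cong) (use that in auto)
      finally show ?thesis by (simp add: T_pow_add)
    qed
    have "enn2real ((T ^^ n) p x) - enn2real ((T ^^ n) q x) =
        enn2real ((T ^^ t) p' x) - enn2real ((T ^^ t) q' x)" if x: "x \<in> {0<..<1}" for x
    proof -
      have e1: "(T ^^ n) p x + (T ^^ n) (\<lambda>_. ennreal s) x = (T ^^ t) p' x + (T ^^ t) r x"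
        by (rule split[OF x]) (simp add: *)
      have e2: "(T ^^ n) q x + (T ^^ n) (\<lambda>_. ennreal s) x = (T ^^ t) q' x + (T ^^ t) r x"
        by (rule split[OF x]) (simp add: *)
      obtain p1 q1 s1 p2 q2 where v: "(T ^^ n) p x = ennreal p1" "(T ^^ n) q x = ennreal q1"
        "(T ^^ n) (\<lambda>_. ennreal s) x = ennreal s1" "(T ^^ t) p' x = ennreal p2" "(T ^^ t) q' x = ennreal q2"
        "0 \<le> p1" "0 \<le> q1" "0 \<le> s1" "0 \<le> p2" "0 \<le> q2"
        using fin[OF d(1) x, of n] fin[OF d(2) x, of n] fin[OF dens_const[OF sm(1)] x, of n]
          fin[OF *(1) x, of t] fin[OF *(2) x, of t] by metis
      \<comment> \<open>Cancelling the common part requires finite values; \<open>r\<close> inherits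
        finiteness from the sum on the left.\<close>
      have "(T ^^ t) r x \<noteq> \<top>" using e1 v by (metis ennreal_add_eq_top ennreal_neq_top)
      then obtain r1 where r1: "(T ^^ t) r x = ennreal r1" "0 \<le> r1" by (cases "(T ^^ t) r x") auto
      have "p1 + s1 = p2 + r1" "q1 + s1 = q2 + r1"
        using e1 e2 v r1 by (auto simp: ennreal_plus[symmetric] simp del: ennreal_plus)
      then show ?thesis using v by simp
    qed
    moreover have "dens (C' * \<eta> ^ n * s) (\<rho> ^ n0 * (m + s)) ((T ^^ t) p')"
      "dens (C' * \<eta> ^ n * s) (\<rho> ^ n0 * (m + s)) ((T ^^ t) q')"
      using dens_mono[OF LY[OF *(1)] bound] dens_mono[OF LY[OF *(2)] bound] by auto
    ultimately show ?thesis by blast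
  qed
  then show ?thesis using \<eta> C' by blast
qed

text \<open>The iterates of the constant density converge uniformly, and their limit is the invariant density.\<close>

lemma invariant_density: "\<exists>s h. dens s 1 h \<and> (\<forall>x\<in>{0<..<1}. T h x = h x)"
proof -
  obtain \<eta> C where \<eta>: "0 < \<eta>" "\<eta> < 1" "0 \<le> C" and
    contr: "\<And>p q s m n. dens s m p \<Longrightarrow> dens s m q \<Longrightarrow>
      \<exists>p' q' m'. dens (C * \<eta> ^ n * s) m' p' \<and> dens (C * \<eta> ^ n * s) m' q' \<and>
        (\<forall>x\<in>{0<..<1}. enn2real ((T ^^ n) p x) - enn2real ((T ^^ n) q x) =
            enn2real (p' x) - enn2real (q' x))"
    using density_contraction by blast
  obtain \<theta> C0 where C0: "0 \<le> \<theta>" "\<theta> < 1" "0 \<le> C0"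
    and LY: "\<And>s m h n. dens s m h \<Longrightarrow> dens (\<theta> ^ n * s + C0 * m) m ((T ^^ n) h)"
    using Lasota_Yorke_pow by blast
  define s where "s = 1 + C0"
  define u where "u n = (T ^^ n) (\<lambda>_. 1)" for n :: nat
  have du: "dens s 1 (u n)" for n
  proof (rule dens_mono)
    have "dens 1 1 (\<lambda>_. ennreal 1)" by (rule dens_const) simp
    then show "dens (\<theta> ^ n * 1 + C0 * 1) 1 (u n)" unfolding u_def using LY[of 1 1 "\<lambda>_. 1" n] by simp
    show "\<theta> ^ n * 1 + C0 * 1 \<le> s" using power_le_one[OF C0(1), of n] C0 by (simp add: s_def)
  qed
  have s: "1 \<le> s" using C0 by (simp add: s_def)
  have Tu: "T (u n) = u (Suc n)" for n by (simp add: u_def)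
  define v where "v n x = enn2real (u n x)" for n x
  have uv: "u n x = ennreal (v n x)" if "x \<in> {0<..<1}" for n x
  proof -
    have "u n x \<le> ennreal s" using du[of n] that by (simp add: dens_def)
    then have "u n x < \<top>" by (simp add: order_le_less_trans)
    then show ?thesis by (simp add: v_def)
  qed
  define D where "D = C * s"
  have D: "0 \<le> D" using \<eta> s by (simp add: D_def)
  \<comment> \<open>\<open>u (n + k)\<close> and \<open>u n\<close> are \<open>T ^^ n\<close>
    applied to \<open>u k\<close> and \<open>u 0\<close>, two densities of mass 1 with the same
    bound \<open>s\<close>; the contraction gives a Cauchy estimate uniform in \<open>x\<close> and
    \<open>k\<close>.\<close>
  have diff: "\<bar>v (n + k) x - v n x\<bar> \<le> D * \<eta> ^ n" if x: "x \<in> {0<..<1}" for n k x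
  proof -
    obtain p' q' m' where *: "dens (C * \<eta> ^ n * s) m' p'" "dens (C * \<eta> ^ n * s) m' q'"
      "enn2real ((T ^^ n) (u k) x) - enn2real ((T ^^ n) (u 0) x) = enn2real (p' x) - enn2real (q' x)"
      using contr[OF du[of k] du[of 0], of n] x by blast
    have "(T ^^ n) (u k) = u (n + k)" "(T ^^ n) (u 0) = u n" by (simp_all add: u_def funpow_add)
    then have e: "v (n + k) x - v n x = enn2real (p' x) - enn2real (q' x)" using *(3) by (simp add: v_def)
    have "enn2real (p' x) \<le> C * \<eta> ^ n * s" "enn2real (q' x) \<le> C * \<eta> ^ n * s"
      using *(1,2) x by (auto simp: dens_def intro!: enn2real_leI)
    moreover have "0 \<le> enn2real (p' x)" "0 \<le> enn2real (q' x)" by simp_all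
    moreover have "D * \<eta> ^ n = C * \<eta> ^ n * s" by (simp add: D_def)
    ultimately show ?thesis unfolding e by linarith
  qed
  have pow0: "(\<lambda>n. D * \<eta> ^ n) \<longlonglongrightarrow> 0"
    using \<eta> by (auto intro!: tendsto_mult_right_zero LIMSEQ_realpow_zero)
  have conv: "convergent (\<lambda>n. v n x)" if x: "x \<in> {0<..<1}" for x
  proof -
    have "Cauchy (\<lambda>n. v n x)"
    proof (rule metric_CauchyI)
      fix e :: real assume "0 < e"
      then obtain N where N: "\<And>n. n \<ge> N \<Longrightarrow> D * \<eta> ^ n < e / 2"
        using order_tendstoD(2)[OF pow0, of "e / 2"] by (auto simp: eventually_sequentially)
      have "dist (v m x) (v N x) < e / 2" if "m \<ge> N" for m
        using diff[OF x, of N "m - N"] N[of N] that by (simp add: dist_real_def)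
      then show "\<exists>N. \<forall>m\<ge>N. \<forall>n\<ge>N. dist (v m x) (v n x) < e"
        by (intro exI[of _ N]) (meson dist_triangle_half_r dist_commute_lessI order_refl dist_triangle_half_l)
    qed
    then show ?thesis by (rule Cauchy_convergent)
  qed
  define w where "w x = (if x \<in> {0<..<1} then lim (\<lambda>n. v n x) else 0)" for x
  have lim: "(\<lambda>n. v n x) \<longlonglongrightarrow> w x" if "x \<in> {0<..<1}" for x
    using conv[OF that] that by (simp add: w_def convergent_LIMSEQ_iff)
  have wv: "\<bar>w x - v n x\<bar> \<le> D * \<eta> ^ n" if x: "x \<in> {0<..<1}" for x n
  proof (rule LIMSEQ_le_const2)
    show "(\<lambda>k. \<bar>v (k + n) x - v n x\<bar>) \<longlonglongrightarrow> \<bar>w x - v n x\<bar>"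
      by (intro tendsto_intros LIMSEQ_ignore_initial_segment lim x)
    show "\<exists>N. \<forall>k\<ge>N. \<bar>v (k + n) x - v n x\<bar> \<le> D * \<eta> ^ n" using diff[OF x, of n] by (simp add: add.commute)
  qed
  have v0: "0 \<le> v n x" for n x by (simp add: v_def)
  have w0: "0 \<le> w x" if "x \<in> {0<..<1}" for x
    using lim[OF that] v0 by (intro LIMSEQ_le_const) auto
  define h where "h x = ennreal (w x)" for x
  have [measurable]: "u n \<in> borel_measurable borel" for n using du by (rule dens_measurable)
  have wmeas: "w \<in> borel_measurable borel"
  proof (rule borel_measurable_LIMSEQ_real)
    show "(\<lambda>x. if x \<in> {0<..<1} then v n x else 0) \<in> borel_measurable borel" for n
      unfolding v_def by measurable
    show "(\<lambda>n. if x \<in> {0<..<1} then v n x else 0) \<longlonglongrightarrow> w x" for x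
      using lim[of x] by (cases "x \<in> {0<..<1}") (auto simp: w_def)
  qed
  have hu: "h x \<le> u n x + ennreal (D * \<eta> ^ n)" "u n x \<le> h x + ennreal (D * \<eta> ^ n)" if x: "x \<in> {0<..<1}" for x n
  proof -
    have "w x \<le> v n x + D * \<eta> ^ n" "v n x \<le> w x + D * \<eta> ^ n" using wv[OF x, of n] by linarith+
    then show "h x \<le> u n x + ennreal (D * \<eta> ^ n)" "u n x \<le> h x + ennreal (D * \<eta> ^ n)"
      unfolding uv[OF x] h_def using D \<eta> v0 w0[OF x]
      by (simp_all add: ennreal_plus[symmetric] ennreal_leI del: ennreal_plus)
  qed
  have e0: "(\<lambda>n. ennreal (D * \<eta> ^ n)) \<longlonglongrightarrow> 0" using tendsto_ennrealI[OF pow0] by simp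
  have "dens s 1 h"
    unfolding dens_def
  proof (intro conjI ballI)
    show "h \<in> borel_measurable borel" unfolding h_def using wmeas by measurable
    show "decreasing h"
      unfolding decreasing_def h_def
    proof (intro allI impI ennreal_leI)
      fix x y :: real assume xy: "0 < x" "x \<le> y" "y < 1"
      have "v n y \<le> v n x" for n
      proof -
        have "u n y \<le> u n x" using du[of n] xy by (auto simp: dens_def decreasing_def)
        then show ?thesis using uv[of x n] uv[of y n] v0 xy by auto
      qed
      then show "w y \<le> w x" using xy by (intro LIMSEQ_le[OF lim lim]) auto
    qed
    fix x :: real assume x: "x \<in> {0<..<1}"
    have "v n x \<le> s" for n
    proof -
      have "u n x \<le> ennreal s" using du[of n] x by (simp add: dens_def)
      then show ?thesis using uv[OF x, of n] s by simp
    qed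
    then have "w x \<le> s" by (intro LIMSEQ_le_const2[OF lim[OF x]]) auto
    then show "h x \<le> ennreal s" by (simp add: h_def ennreal_leI)
  next
    have int_u: "(\<integral>\<^sup>+x. u n x \<partial>unit_leb) = 1" for n using du[of n] by (simp add: dens_def)
    have [measurable]: "h \<in> borel_measurable borel" unfolding h_def using wmeas by measurable
    have le1: "(\<integral>\<^sup>+x. h x \<partial>unit_leb) \<le> 1 + ennreal (D * \<eta> ^ n)" for n
    proof -
      have "(\<integral>\<^sup>+x. h x \<partial>unit_leb) \<le> (\<integral>\<^sup>+x. u n x + ennreal (D * \<eta> ^ n) \<partial>unit_leb)"
        by (rule nn_integral_mono_AE, use AE_unit_leb_interior in eventually_elim) (rule hu)
      also have "\<dots> = 1 + ennreal (D * \<eta> ^ n)"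
        by (subst nn_integral_add) (auto simp: borel_measurable_unit_lebI int_u emeasure_unit_leb)
      finally show ?thesis .
    qed
    have le2: "1 \<le> (\<integral>\<^sup>+x. h x \<partial>unit_leb) + ennreal (D * \<eta> ^ n)" for n
    proof -
      have "1 = (\<integral>\<^sup>+x. u n x \<partial>unit_leb)" using int_u by simp
      also have "\<dots> \<le> (\<integral>\<^sup>+x. h x + ennreal (D * \<eta> ^ n) \<partial>unit_leb)"
        by (rule nn_integral_mono_AE, use AE_unit_leb_interior in eventually_elim) (rule hu)
      also have "\<dots> = (\<integral>\<^sup>+x. h x \<partial>unit_leb) + ennreal (D * \<eta> ^ n)"
        by (subst nn_integral_add) (auto simp: borel_measurable_unit_lebI emeasure_unit_leb)
      finally show ?thesis .
    qed
    have "(\<integral>\<^sup>+x. h x \<partial>unit_leb) \<le> 1 + 0"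
      using le1 by (intro LIMSEQ_le_const[OF tendsto_add[OF tendsto_const e0]]) auto
    moreover have "1 \<le> (\<integral>\<^sup>+x. h x \<partial>unit_leb) + 0"
      using le2 by (intro LIMSEQ_le_const[OF tendsto_add[OF tendsto_const e0]]) auto
    ultimately show "(\<integral>\<^sup>+x. h x \<partial>unit_leb) = ennreal 1" by simp
  qed (use s in auto)
  moreover have "T h x = h x" if x: "x \<in> {0<..<1}" for x
  proof (rule antisym)
    \<comment> \<open>A uniform error passes through \<open>T\<close> multiplied by the value of
      \<open>T\<close> on the constant 1, which is finite on (0,1); this allows exchanging
      \<open>T\<close> with the uniform limit.\<close>
    define t where "t = T (\<lambda>_. 1) x"
    have t: "t < \<top>"
    proof -
      have "t \<le> ennreal s" using du[of 1] x by (simp add: t_def u_def dens_def)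
      then show ?thesis by (simp add: order_le_less_trans)
    qed
    have te0: "(\<lambda>n. ennreal (D * \<eta> ^ n) * t) \<longlonglongrightarrow> 0"
      using tendsto_mult_ennreal[OF e0 tendsto_const[of t]] t by (simp add: less_top)
    have e1: "(\<lambda>n. ennreal (D * \<eta> ^ Suc n)) \<longlonglongrightarrow> 0" using LIMSEQ_Suc[OF e0] by simp
    have Tc: "T (\<lambda>y. k y + ennreal (D * \<eta> ^ n)) x = T k x + ennreal (D * \<eta> ^ n) * t" for k n
      using T_cmult[of "ennreal (D * \<eta> ^ n)" "\<lambda>_. 1" x] by (simp add: T_add t_def)
    have "T h x \<le> h x + (ennreal (D * \<eta> ^ Suc n) + ennreal (D * \<eta> ^ n) * t)" for n
    proof -
      have "T h x \<le> T (\<lambda>y. u n y + ennreal (D * \<eta> ^ n)) x" by (intro T_mono hu)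
      also have "\<dots> = u (Suc n) x + ennreal (D * \<eta> ^ n) * t" by (simp add: Tc Tu)
      also have "\<dots> \<le> h x + ennreal (D * \<eta> ^ Suc n) + ennreal (D * \<eta> ^ n) * t"
        by (intro add_right_mono hu x)
      finally show ?thesis by (simp add: add.assoc)
    qed
    then have "T h x \<le> h x + (0 + 0)"
      by (intro LIMSEQ_le_const[OF tendsto_add[OF tendsto_const tendsto_add[OF e1 te0]]]) auto
    then show "T h x \<le> h x" by simp
    have "h x \<le> T h x + (ennreal (D * \<eta> ^ n) * t + ennreal (D * \<eta> ^ Suc n))" for n
    proof -
      have "h x \<le> u (Suc n) x + ennreal (D * \<eta> ^ Suc n)" by (intro hu x)
      also have "u (Suc n) x \<le> T (\<lambda>y. h y + ennreal (D * \<eta> ^ n)) x" unfolding Tu[symmetric] by (intro T_mono hu)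
      finally show ?thesis by (simp add: Tc add.assoc add_right_mono)
    qed
    then have "h x \<le> T h x + (0 + 0)"
      by (intro LIMSEQ_le_const[OF tendsto_add[OF tendsto_const tendsto_add[OF te0 e1]]]) auto
    then show "h x \<le> T h x" by simp
  qed
  ultimately show ?thesis by blast
qed

end

section \<open>Hahn and Jordan decompositions\<close>

lemma signed_measure_empty: assumes "signed_measure S \<mu>" shows "\<mu> {} = 0"
proof -
  have "(\<lambda>n::nat. \<mu> {}) sums \<mu> (\<Union>n::nat. {})"
    using assms unfolding signed_measure_def by (auto simp: disjoint_family_on_def)
  then have "summable (\<lambda>n::nat. \<mu> {})" by (rule sums_summable)
  then show ?thesis by (simp add: summable_const_iff)
qed

lemma signed_measure_sums:
  fixes A :: "nat \<Rightarrow> 'a set"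
  assumes "signed_measure S \<mu>" "range A \<subseteq> sets S" "disjoint_family A"
  shows "(\<lambda>n. \<mu> (A n)) sums \<mu> (\<Union>n. A n)"
  using assms unfolding signed_measure_def by blast

lemma signed_measure_Un:
  assumes "signed_measure S \<mu>" "A \<in> sets S" "B \<in> sets S" "A \<inter> B = {}"
  shows "\<mu> (A \<union> B) = \<mu> A + \<mu> B"
proof -
  have "(\<lambda>n. \<mu> (binaryset A B n)) sums \<mu> (\<Union>n. binaryset A B n)"
    using assms by (intro signed_measure_sums)
      (auto simp: range_binaryset_eq disjoint_family_on_def binaryset_def)
  moreover have "(\<lambda>n. \<mu> (binaryset A B n)) sums (\<mu> A + \<mu> B)"
    by (rule binaryset_sums) (rule signed_measure_empty[OF assms(1)])
  ultimately show ?thesis by (metis UN_binaryset_eq sums_unique2)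
qed

lemma signed_measure_Diff:
  assumes "signed_measure S \<mu>" "A \<in> sets S" "B \<in> sets S" "B \<subseteq> A"
  shows "\<mu> (A - B) = \<mu> A - \<mu> B"
proof -
  have "\<mu> ((A - B) \<union> B) = \<mu> (A - B) + \<mu> B"
    using assms by (intro signed_measure_Un) auto
  moreover have "(A - B) \<union> B = A" using assms(4) by auto
  ultimately show ?thesis by simp
qed

text \<open>Removing sets of nonpositive measure can only raise the measure. If a subset of the
  remainder had measure at most \<open>- e\<close>, each removal would have taken at least
  \<open>e / 2\<close>, whereas the removed measures form a convergent series. Depths are cut off at
  1 because at this stage the measures of subsets are not known to be bounded below.\<close>

lemma exists_positive_subset:
  assumes s: "signed_measure S \<mu>" and A: "A \<in> sets S"
  shows "\<exists>P\<in>sets S. P \<subseteq> A \<and> \<mu> A \<le> \<mu> P \<and> (\<forall>E\<in>sets S. E \<subseteq> P \<longrightarrow> 0 \<le> \<mu> E)"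
proof -
  define neg where "neg X e \<longleftrightarrow> (\<exists>B\<in>sets S. B \<subseteq> X \<and> \<mu> B \<le> - e)" for X and e :: real
  \<comment> \<open>Greedy removal: the piece removed from \<open>X\<close> is at least half as negative as possible,
    or of measure at most \<open>-1\<close>.\<close>
  have choice: "\<exists>B. B \<in> sets S \<and> B \<subseteq> X \<and> \<mu> B \<le> 0 \<and> (\<forall>e. 0 \<le> e \<longrightarrow> e \<le> 1 \<longrightarrow> neg X e \<longrightarrow> \<mu> B \<le> - (e/2))" for X
  proof (cases "neg X 1")
    case True
    then obtain B where "B \<in> sets S" "B \<subseteq> X" "\<mu> B \<le> -1" unfolding neg_def by auto
    then show ?thesis by (intro exI[of _ B]) auto
  next
    case False
    define E where "E = {e. 0 \<le> e \<and> e \<le> 1 \<and> neg X e}"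
    have E0: "0 \<in> E" using signed_measure_empty[OF s] by (auto simp: E_def neg_def intro!: bexI[of _ "{}"])
    have bdd: "bdd_above E" by (auto simp: E_def intro!: bdd_aboveI[of _ 1])
    have "Sup E / 2 < Sup E \<or> Sup E = 0"
      using cSup_upper[OF E0 bdd] by auto
    then obtain e where e: "e \<in> E" "Sup E / 2 \<le> e"
    proof
      assume "Sup E / 2 < Sup E"
      then obtain e where "e \<in> E" "Sup E / 2 < e" using E0 bdd by (subst (asm) less_cSup_iff) auto
      then show ?thesis using that by auto
    next
      assume "Sup E = 0" then show ?thesis using that E0 by auto
    qed
    then obtain B where B: "B \<in> sets S" "B \<subseteq> X" "\<mu> B \<le> -e" "0 \<le> e" by (auto simp: E_def neg_def)
    have "\<mu> B \<le> - (e'/2)" if "0 \<le> e'" "e' \<le> 1" "neg X e'" for e'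
    proof -
      have "e' \<le> Sup E" using that bdd by (intro cSup_upper) (auto simp: E_def)
      then show ?thesis using B e by auto
    qed
    then show ?thesis using B by (intro exI[of _ B]) auto
  qed
  then obtain b where b: "\<And>X. b X \<in> sets S" "\<And>X. b X \<subseteq> X" "\<And>X. \<mu> (b X) \<le> 0"
    "\<And>X e. 0 \<le> e \<Longrightarrow> e \<le> 1 \<Longrightarrow> neg X e \<Longrightarrow> \<mu> (b X) \<le> - (e/2)" by metis
  define X where "X = rec_nat A (\<lambda>_ Y. Y - b Y)"
  have X0: "X 0 = A" and XS: "X (Suc n) = X n - b (X n)" for n by (simp_all add: X_def)
  have dec: "X n \<subseteq> X m" if "m \<le> n" for m n
    using that by (induction rule: dec_induct) (auto simp: XS)
  have Xs: "X n \<in> sets S" for n by (induction n) (auto simp: X0 XS A b)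
  define P where "P = A - (\<Union>n. b (X n))"
  have Ps: "P \<in> sets S" using A b by (auto simp: P_def)
  have "P \<subseteq> X n" for n by (induction n) (auto simp: X0 XS P_def)
  have disj: "disjoint_family (\<lambda>n. b (X n))"
  proof -
    have "b (X m) \<inter> b (X n) = {}" if "m < n" for m n
    proof -
      have "b (X n) \<subseteq> X (Suc m)" using b(2)[of "X n"] dec[of "Suc m" n] that by auto
      then show ?thesis by (auto simp: XS)
    qed
    then show ?thesis unfolding disjoint_family_on_def by (metis Int_commute linorder_neqE_nat)
  qed
  have sums: "(\<lambda>n. \<mu> (b (X n))) sums \<mu> (\<Union>n. b (X n))"
    using b disj by (intro signed_measure_sums[OF s]) auto
  have bA: "(\<Union>n. b (X n)) \<subseteq> A" using b(2) dec[of 0] X0 by blast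
  have "\<mu> (\<Union>n. b (X n)) \<le> 0"
    using sums_le[OF _ sums sums_zero] b(3) by auto
  moreover have "\<mu> P = \<mu> A - \<mu> (\<Union>n. b (X n))"
    unfolding P_def using bA b by (intro signed_measure_Diff[OF s A]) auto
  moreover have "0 \<le> \<mu> E" if E: "E \<in> sets S" "E \<subseteq> P" for E
  proof (rule ccontr)
    assume "\<not> 0 \<le> \<mu> E"
    define e where "e = min 1 (- \<mu> E)"
    have e: "0 < e" "e \<le> 1" "\<mu> E \<le> - e" using \<open>\<not> 0 \<le> \<mu> E\<close> by (auto simp: e_def)
    have "neg (X n) e" for n
      unfolding neg_def using E e \<open>\<And>n. P \<subseteq> X n\<close> by blast
    then have "\<mu> (b (X n)) \<le> - (e/2)" for n using b(4) e by auto
    moreover have "(\<lambda>n. \<mu> (b (X n))) \<longlonglongrightarrow> 0" using sums sums_summable summable_LIMSEQ_zero by blast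
    ultimately have "0 \<le> - (e/2)" by (intro LIMSEQ_le_const2[of _ 0]) auto
    then show False using e by auto
  qed
  ultimately show ?thesis using Ps by (intro bexI[of _ P]) (auto simp: P_def)
qed

text \<open>\<open>H\<close> is a countable union of positive sets whose measures approach the
  supremum over all positive sets. The supremum is finite, since the union of positive sets of
  unbounded measure would be a positive set exceeding every real number. A set of positive measure
  outside \<open>H\<close> would contain a positive set, and adding it to \<open>H\<close> would
  exceed the supremum.\<close>

lemma Hahn_decomposition:
  assumes s: "signed_measure S \<mu>"
  shows "\<exists>H. H \<in> sets S \<and> (\<forall>E\<in>sets S. E \<subseteq> H \<longrightarrow> \<mu> E \<ge> 0) \<and>
     (\<forall>E\<in>sets S. E \<subseteq> space S - H \<longrightarrow> \<mu> E \<le> 0)"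
proof -
  define pos where "pos P \<longleftrightarrow> P \<in> sets S \<and> (\<forall>E\<in>sets S. E \<subseteq> P \<longrightarrow> 0 \<le> \<mu> E)" for P
  have pos_mono: "\<mu> P \<le> \<mu> Q" if "pos Q" "P \<subseteq> Q" "P \<in> sets S" for P Q
    using signed_measure_Diff[OF s, of Q P] that unfolding pos_def
    by (smt (verit, best) Diff_subset sets.Diff)
  have pos_UN: "pos (\<Union>n. P n)" if P: "\<And>n. pos (P n)" for P :: "nat \<Rightarrow> 'a set"
    unfolding pos_def
  proof (intro conjI ballI impI)
    show "(\<Union>n. P n) \<in> sets S" using P by (auto simp: pos_def)
    fix E assume E: "E \<in> sets S" "E \<subseteq> (\<Union>n. P n)"
    have m: "range (\<lambda>n. E \<inter> disjointed P n) \<subseteq> sets S"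
      using E P sets.range_disjointed_sets[of P S] by (auto simp: pos_def)
    have d: "disjoint_family (\<lambda>n. E \<inter> disjointed P n)"
      using disjoint_family_disjointed[of P] by (auto simp: disjoint_family_on_def)
    have "(\<lambda>n. \<mu> (E \<inter> disjointed P n)) sums \<mu> (\<Union>n. E \<inter> disjointed P n)"
      by (rule signed_measure_sums[OF s m d])
    also have "(\<Union>n. E \<inter> disjointed P n) = E" using E UN_disjointed_eq[of P] by auto
    finally have "(\<lambda>n. \<mu> (E \<inter> disjointed P n)) sums \<mu> E" .
    moreover have "0 \<le> \<mu> (E \<inter> disjointed P n)" for n
    proof -
      have "E \<inter> disjointed P n \<in> sets S" using m by auto
      then show ?thesis using P[of n] disjointed_subset[of P n] by (auto simp: pos_def)
    qed
    ultimately show "0 \<le> \<mu> E"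
      using sums_le[OF _ sums_zero, of "\<lambda>n. \<mu> (E \<inter> disjointed P n)" "\<mu> E"] by simp
  qed
  define V where "V = \<mu> ` {P. pos P}"
  have "pos {}" using signed_measure_empty[OF s] by (auto simp: pos_def)
  have bdd: "bdd_above V"
  proof (rule ccontr)
    assume "\<not> bdd_above V"
    then have "\<exists>P. pos P \<and> real n < \<mu> P" for n
      unfolding bdd_above_def V_def by (metis (mono_tags, lifting) image_iff linorder_not_le mem_Collect_eq)
    then obtain P where P: "\<And>n. pos (P n)" "\<And>n. real n < \<mu> (P n)" by metis
    have "real n < \<mu> (\<Union>n. P n)" for n
    proof -
      have "\<mu> (P n) \<le> \<mu> (\<Union>n. P n)"
        using P(1) by (intro pos_mono pos_UN) (auto simp: pos_def)
      then show ?thesis using P(2)[of n] by linarith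
    qed
    then show False using reals_Archimedean2[of "\<mu> (\<Union>n. P n)"] by (auto dest: less_asym)
  qed
  have "\<exists>P. pos P \<and> Sup V - 1 / real (Suc n) < \<mu> P" for n
  proof -
    have "\<exists>v\<in>V. Sup V - 1 / real (Suc n) < v"
      using \<open>pos {}\<close> bdd by (subst less_cSup_iff[symmetric]) (auto simp: V_def)
    then show ?thesis by (auto simp: V_def)
  qed
  then obtain P where P: "\<And>n. pos (P n)" "\<And>n. Sup V - 1 / real (Suc n) < \<mu> (P n)" by metis
  define H where "H = (\<Union>n. P n)"
  have posH: "pos H" using pos_UN P by (simp add: H_def)
  have "Sup V - 1 / real (Suc n) \<le> \<mu> H" for n
  proof -
    have "\<mu> (P n) \<le> \<mu> H"
      using P(1) by (intro pos_mono posH) (auto simp: pos_def H_def)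
    then show ?thesis using P(2)[of n] by linarith
  qed
  moreover have "(\<lambda>n. Sup V - 1 / real (Suc n)) \<longlonglongrightarrow> Sup V - 0"
    by (intro tendsto_diff tendsto_const LIMSEQ_Suc[OF lim_1_over_n])
  ultimately have SupH: "Sup V \<le> \<mu> H" by (intro LIMSEQ_le_const2[of _ "Sup V"]) auto
  have "\<mu> E \<le> 0" if E: "E \<in> sets S" "E \<subseteq> space S - H" for E
  proof (rule ccontr)
    assume "\<not> \<mu> E \<le> 0"
    obtain Q where Q: "Q \<in> sets S" "Q \<subseteq> E" "\<mu> E \<le> \<mu> Q" "\<forall>E\<in>sets S. E \<subseteq> Q \<longrightarrow> 0 \<le> \<mu> E"
      using exists_positive_subset[OF s E(1)] by auto
    have "pos (\<Union>n. case n of 0 \<Rightarrow> H | Suc _ \<Rightarrow> Q)"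
      using posH Q by (intro pos_UN) (auto simp: pos_def split: nat.split)
    also have "(\<Union>n. case n of 0 \<Rightarrow> H | Suc _ \<Rightarrow> Q) = H \<union> Q"
      by (auto split: nat.splits)
    finally have "\<mu> (H \<union> Q) \<le> Sup V" using bdd by (auto simp: V_def intro!: cSup_upper)
    moreover have "\<mu> (H \<union> Q) = \<mu> H + \<mu> Q"
      using Q E posH by (intro signed_measure_Un[OF s]) (auto simp: pos_def)
    ultimately show False using SupH Q \<open>\<not> \<mu> E \<le> 0\<close> by auto
  qed
  then show ?thesis using posH by (intro exI[of _ H]) (auto simp: pos_def)
qed

lemma
  assumes "signed_measure S \<mu>"
  shows hahn_set_sets: "hahn_set S \<mu> \<in> sets S"
    and hahn_set_pos: "E \<in> sets S \<Longrightarrow> E \<subseteq> hahn_set S \<mu> \<Longrightarrow> 0 \<le> \<mu> E"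
    and hahn_set_neg: "E \<in> sets S \<Longrightarrow> E \<subseteq> space S - hahn_set S \<mu> \<Longrightarrow> \<mu> E \<le> 0"
  using someI_ex[OF Hahn_decomposition[OF assms]] unfolding hahn_set_def by blast+

lemma sets_pos_part [simp]: "sets (pos_part S \<mu>) = sets S"
  and sets_neg_part [simp]: "sets (neg_part S \<mu>) = sets S"
  and space_pos_part [simp]: "space (pos_part S \<mu>) = space S"
  and space_neg_part [simp]: "space (neg_part S \<mu>) = space S"
  by (simp_all add: pos_part_def neg_part_def)

lemma measurable_pos_part [simp]: "measurable (pos_part S \<mu>) N = measurable S N"
  and measurable_neg_part [simp]: "measurable (neg_part S \<mu>) N = measurable S N"
  by (rule measurable_cong_sets; simp)+

text \<open>The factor \<open>c\<close> is 1 for the positive part and -1 for the negative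
  part.\<close>

lemma signed_measure_restrict_countably_additive:
  assumes s: "signed_measure S \<mu>" and C: "C \<in> sets S"
    and nonneg: "\<And>E. E \<in> sets S \<Longrightarrow> E \<subseteq> C \<Longrightarrow> 0 \<le> c * \<mu> E"
  shows "countably_additive (sets S) (\<lambda>E. ennreal (c * \<mu> (E \<inter> C)))"
proof (rule countably_additiveI)
  fix A :: "nat \<Rightarrow> 'a set" assume A: "range A \<subseteq> sets S" "disjoint_family A" "(\<Union>i. A i) \<in> sets S"
  have "(\<lambda>n. \<mu> (A n \<inter> C)) sums \<mu> (\<Union>n. A n \<inter> C)"
    using A C by (intro signed_measure_sums[OF s]) (auto simp: disjoint_family_on_def)
  then have "(\<lambda>n. c * \<mu> (A n \<inter> C)) sums (c * \<mu> ((\<Union>n. A n) \<inter> C))"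
    by (intro sums_mult) simp
  then show "(\<Sum>i. ennreal (c * \<mu> (A i \<inter> C))) = ennreal (c * \<mu> ((\<Union>n. A n) \<inter> C))"
    using A C by (intro sums_unique[symmetric] sums_ennreal[THEN iffD2] nonneg) auto
qed

lemma emeasure_pos_part:
  assumes s: "signed_measure S \<mu>" and E: "E \<in> sets S"
  shows "emeasure (pos_part S \<mu>) E = ennreal (\<mu> (E \<inter> hahn_set S \<mu>))"
proof (rule emeasure_measure_of[OF pos_part_def])
  show "positive (sets (pos_part S \<mu>)) (\<lambda>E. ennreal (\<mu> (E \<inter> hahn_set S \<mu>)))"
    by (simp add: positive_def signed_measure_empty[OF s])
  show "countably_additive (sets (pos_part S \<mu>)) (\<lambda>E. ennreal (\<mu> (E \<inter> hahn_set S \<mu>)))"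
    using signed_measure_restrict_countably_additive[OF s hahn_set_sets[OF s], of 1] hahn_set_pos[OF s]
    by simp
qed (use E sets.space_closed in auto)

lemma emeasure_neg_part:
  assumes s: "signed_measure S \<mu>" and E: "E \<in> sets S"
  shows "emeasure (neg_part S \<mu>) E = ennreal (- \<mu> (E - hahn_set S \<mu>))"
proof (rule emeasure_measure_of[OF neg_part_def])
  show "positive (sets (neg_part S \<mu>)) (\<lambda>E. ennreal (- \<mu> (E - hahn_set S \<mu>)))"
    by (simp add: positive_def signed_measure_empty[OF s])
  have "countably_additive (sets S) (\<lambda>E. ennreal (- 1 * \<mu> (E \<inter> (space S - hahn_set S \<mu>))))"
    using hahn_set_sets[OF s] hahn_set_neg[OF s]
    by (intro signed_measure_restrict_countably_additive[OF s]) auto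
  moreover have "E \<inter> (space S - hahn_set S \<mu>) = E - hahn_set S \<mu>" if "E \<in> sets S" for E
    using sets.sets_into_space[OF that] by auto
  ultimately show "countably_additive (sets (neg_part S \<mu>)) (\<lambda>E. ennreal (- \<mu> (E - hahn_set S \<mu>)))"
    unfolding countably_additive_def by (auto simp: image_subset_iff)
qed (use E sets.space_closed in auto)

lemma measure_pos_part:
  assumes "signed_measure S \<mu>" "E \<in> sets S"
  shows "measure (pos_part S \<mu>) E = \<mu> (E \<inter> hahn_set S \<mu>)"
  unfolding measure_def emeasure_pos_part[OF assms]
  using hahn_set_pos[OF assms(1), of "E \<inter> hahn_set S \<mu>"] hahn_set_sets[OF assms(1)] assms(2) by simp

lemma measure_neg_part:
  assumes "signed_measure S \<mu>" "E \<in> sets S"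
  shows "measure (neg_part S \<mu>) E = - \<mu> (E - hahn_set S \<mu>)"
proof -
  have "\<mu> (E - hahn_set S \<mu>) \<le> 0"
    using sets.sets_into_space[OF assms(2)] hahn_set_sets[OF assms(1)] assms(2)
    by (intro hahn_set_neg[OF assms(1)]) auto
  then show ?thesis unfolding measure_def emeasure_neg_part[OF assms] by simp
qed

lemma finite_measure_pos_part: "signed_measure S \<mu> \<Longrightarrow> finite_measure (pos_part S \<mu>)"
  and finite_measure_neg_part: "signed_measure S \<mu> \<Longrightarrow> finite_measure (neg_part S \<mu>)"
  by (auto intro!: finite_measureI simp: emeasure_pos_part emeasure_neg_part)

lemma jordan_decomposition:
  assumes "signed_measure S \<mu>"
  shows "\<mu> E = measure (pos_part S \<mu>) E - measure (neg_part S \<mu>) E"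
proof (cases "E \<in> sets S")
  case True
  have "\<mu> (E \<inter> hahn_set S \<mu> \<union> (E - hahn_set S \<mu>)) = \<mu> (E \<inter> hahn_set S \<mu>) + \<mu> (E - hahn_set S \<mu>)"
    using True hahn_set_sets[OF assms] by (intro signed_measure_Un[OF assms]) auto
  then show ?thesis using True by (simp add: measure_pos_part measure_neg_part assms Int_Diff_Un)
next
  case False
  then show ?thesis using assms by (simp add: measure_notin_sets signed_measure_def)
qed

section \<open>Integrals against signed measures\<close>

lemma signed_measure_diff:
  assumes "finite_measure A" "finite_measure B" "sets A = sets S" "sets B = sets S"
  shows "signed_measure S (\<lambda>E. measure A E - measure B E)"
  unfolding signed_measure_def
proof (intro conjI allI impI)
  fix E assume "E \<notin> sets S" then show "measure A E - measure B E = 0"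
    using assms by (simp add: measure_notin_sets)
next
  fix X :: "nat \<Rightarrow> 'a set" assume X: "range X \<subseteq> sets S" "disjoint_family X"
  show "(\<lambda>n. measure A (X n) - measure B (X n)) sums (measure A (\<Union>n. X n) - measure B (\<Union>n. X n))"
    using X assms by (intro sums_diff finite_measure.finite_measure_UNION) auto
qed

text \<open>The relation holds for simple functions by linearity and passes to bounded functions by
  dominated convergence. It takes the place of a uniqueness argument for the Jordan
  decomposition.\<close>

lemma integral_linear_relation:
  fixes h :: "'a \<Rightarrow> real" and c :: "'i \<Rightarrow> real" and M :: "'i \<Rightarrow> 'a measure"
  assumes "finite J" and fin: "\<And>j. j \<in> J \<Longrightarrow> finite_measure (M j)"
    and sets: "\<And>j. j \<in> J \<Longrightarrow> sets (M j) = sets S"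
    and rel: "\<And>E. E \<in> sets S \<Longrightarrow> (\<Sum>j\<in>J. c j * measure (M j) E) = 0"
    and h: "h \<in> borel_measurable S" and bd: "\<And>x. x \<in> space S \<Longrightarrow> \<bar>h x\<bar> \<le> B"
  shows "(\<Sum>j\<in>J. c j * integral\<^sup>L (M j) h) = 0"
proof -
  obtain s where s: "\<And>i. simple_function S (s i)" "\<And>x. x \<in> space S \<Longrightarrow> (\<lambda>i. s i x) \<longlonglongrightarrow> h x"
    "\<And>i x. x \<in> space S \<Longrightarrow> dist (s i x) 0 \<le> 2 * dist (h x) 0"
    using borel_measurable_implies_sequence_metric[OF h, of 0] by blast
  have sp: "space (M j) = space S" if "j \<in> J" for j using sets[OF that] by (rule sets_eq_imp_space_eq)
  have simple: "(\<Sum>j\<in>J. c j * integral\<^sup>L (M j) (s i)) = 0" for i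
  proof -
    have int: "integral\<^sup>L (M j) (s i) = (\<Sum>y\<in>s i ` space S. y * measure (M j) (s i -` {y} \<inter> space S))" if j: "j \<in> J" for j
    proof -
      interpret finite_measure "M j" by (rule fin[OF j])
      have "simple_function (M j) (s i)"
        using s(1)[of i] sets[OF j] sp[OF j] by (simp add: simple_function_def)
      then have "Bochner_Integration.simple_bochner_integrable (M j) (s i)"
        by (rule simple_bochner_integrable.intros) (simp add: emeasure_eq_measure)
      then show ?thesis using sp[OF j]
        by (simp add: simple_bochner_integrable_eq_integral[symmetric] simple_bochner_integral_def mult.commute vimage_def Int_def conj_commute)
    qed
    have "(\<Sum>j\<in>J. c j * integral\<^sup>L (M j) (s i)) =
      (\<Sum>j\<in>J. \<Sum>y\<in>s i ` space S. c j * (y * measure (M j) (s i -` {y} \<inter> space S)))"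
      by (simp add: int sum_distrib_left)
    also have "\<dots> = (\<Sum>y\<in>s i ` space S. \<Sum>j\<in>J. c j * (y * measure (M j) (s i -` {y} \<inter> space S)))"
      by (rule sum.swap)
    also have "\<dots> = (\<Sum>y\<in>s i ` space S. y * (\<Sum>j\<in>J. c j * measure (M j) (s i -` {y} \<inter> space S)))"
      by (simp add: sum_distrib_left mult_ac)
    also have "\<dots> = 0"
      using s(1)[of i] rel by (intro sum.neutral ballI) (auto simp: simple_function_def)
    finally show ?thesis .
  qed
  have lim: "(\<lambda>i. integral\<^sup>L (M j) (s i)) \<longlonglongrightarrow> integral\<^sup>L (M j) h" if j: "j \<in> J" for j
  proof (rule integral_dominated_convergence[where w = "\<lambda>_. 2 * B"])
    interpret finite_measure "M j" by (rule fin[OF j])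
    show "integrable (M j) (\<lambda>_. 2 * B)" by simp
    show "h \<in> borel_measurable (M j)" using h sets[OF j] by (simp cong: measurable_cong_sets)
    show "s i \<in> borel_measurable (M j)" for i
      using borel_measurable_simple_function[OF s(1)[of i]] sets[OF j] by (simp cong: measurable_cong_sets)
    show "AE x in M j. (\<lambda>i. s i x) \<longlonglongrightarrow> h x" using s(2) sp[OF j] by auto
    show "AE x in M j. norm (s i x) \<le> 2 * B" for i
      using s(3)[of _ i] bd sp[OF j] by (intro AE_I2) (force simp: dist_real_def)
  qed
  have "(\<lambda>i. \<Sum>j\<in>J. c j * integral\<^sup>L (M j) (s i)) \<longlonglongrightarrow> (\<Sum>j\<in>J. c j * integral\<^sup>L (M j) h)"
    by (intro tendsto_sum tendsto_mult tendsto_const lim)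
  then show ?thesis unfolding simple by (simp add: LIMSEQ_const_iff)
qed

text \<open>Any representation of \<open>\<mu>\<close> as a combination of finite measures computes
  the integral. The Jordan parts join the linear relation as two further indices, tagged by
  \<open>Inr\<close>, with opposite signs.\<close>

lemma signed_integral_eq:
  fixes h :: "'a \<Rightarrow> real" and c :: "'i \<Rightarrow> real" and M :: "'i \<Rightarrow> 'a measure"
  assumes s: "signed_measure S \<mu>" and J: "finite J" and fin: "\<And>j. j \<in> J \<Longrightarrow> finite_measure (M j)"
    and sets: "\<And>j. j \<in> J \<Longrightarrow> sets (M j) = sets S"
    and rel: "\<And>E. E \<in> sets S \<Longrightarrow> \<mu> E = (\<Sum>j\<in>J. c j * measure (M j) E)"
    and h: "h \<in> borel_measurable S" and bd: "\<And>x. x \<in> space S \<Longrightarrow> \<bar>h x\<bar> \<le> B"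
  shows "signed_integral S \<mu> h = (\<Sum>j\<in>J. c j * integral\<^sup>L (M j) h)"
proof -
  let ?J = "Inl ` J \<union> {Inr True, Inr False}"
  let ?M = "case_sum M (\<lambda>b. if b then pos_part S \<mu> else neg_part S \<mu>)"
  let ?c = "case_sum c (\<lambda>b. if b then -1 else 1)"
  have sum: "(\<Sum>j\<in>?J. ?c j * F (?M j)) = (\<Sum>j\<in>J. c j * F (M j)) - F (pos_part S \<mu>) + F (neg_part S \<mu>)" for F :: "'a measure \<Rightarrow> real"
    using J by (subst sum.union_disjoint) (auto simp: sum.reindex)
  have "(\<Sum>j\<in>?J. ?c j * integral\<^sup>L (?M j) h) = 0"
  proof (rule integral_linear_relation[where S = S and B = B])
    fix E assume "E \<in> sets S"
    then show "(\<Sum>j\<in>?J. ?c j * measure (?M j) E) = 0"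
      using sum[of "\<lambda>M. measure M E"] rel jordan_decomposition[OF s, of E] by simp
  qed (use J fin sets h bd finite_measure_pos_part[OF s] finite_measure_neg_part[OF s] in auto)
  then show ?thesis using sum[of "\<lambda>M. integral\<^sup>L M h"] unfolding signed_integral_def by simp
qed

section \<open>Disintegration along the fibres\<close>

lemma Int_in_sets_restrict_space: "B \<in> sets M \<Longrightarrow> B \<inter> S \<in> sets (restrict_space M S)"
  unfolding sets_restrict_space by (rule image_eqI[of _ _ B]) auto

lemma compact_dense_sequence:
  fixes K :: "'k::metric_space set"
  assumes "compact K" "K \<noteq> {}"
  shows "\<exists>d :: nat \<Rightarrow> 'k. range d \<subseteq> K \<and> (\<forall>y\<in>K. \<forall>e>0. \<exists>n. dist y (d n) < e)"
proof -
  have "\<exists>F. finite F \<and> F \<subseteq> K \<and> K \<subseteq> (\<Union>x\<in>F. ball x (1 / real (Suc n)))" for n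
    using seq_compact_imp_totally_bounded[OF compact_imp_seq_compact[OF assms(1)]] by simp
  then obtain F where F: "\<And>n. finite (F n)" "\<And>n. F n \<subseteq> K" "\<And>n. K \<subseteq> (\<Union>x\<in>F n. ball x (1 / real (Suc n)))"
    by metis
  define D where "D = (\<Union>n. F n)"
  have cD: "countable D" using F by (auto simp: D_def intro: countable_finite)
  have neD: "D \<noteq> {}" using F(3)[of 0] assms(2) by (auto simp: D_def)
  have "\<exists>n. dist y (from_nat_into D n) < e" if "y \<in> K" "e > 0" for y e
  proof -
    obtain n where n: "1 / real (Suc n) < e" using nat_approx_posE[OF \<open>e > 0\<close>] by auto
    obtain x where x: "x \<in> F n" "dist x y < 1 / real (Suc n)" using F(3)[of n] \<open>y \<in> K\<close> by (auto simp: subset_eq)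
    then obtain m where "from_nat_into D m = x"
      using from_nat_into_surj[OF cD, of x] by (auto simp: D_def)
    then show ?thesis using x n by (intro exI[of _ m]) (simp add: dist_commute)
  qed
  moreover have "range (from_nat_into D) \<subseteq> K"
    using from_nat_into[OF neD] F(2) by (auto simp: D_def)
  ultimately show ?thesis by (intro exI[of _ "from_nat_into D"]) blast
qed

lemma space_Sigma_borel [simp]: "space (Sigma_borel K) = {0..1} \<times> K"
  by (simp add: Sigma_borel_def space_restrict_space)

lemma fst_measurable_Sigma: "fst \<in> measurable (Sigma_borel K) unit_leb"
proof -
  have "fst \<in> measurable (Sigma_borel K) (restrict_space borel {0..1})"
    unfolding Sigma_borel_def
    by (rule measurable_restrict_space2)
       (auto simp: space_restrict_space intro!: measurable_restrict_space1 borel_measurable_continuous_onI continuous_on_fst continuous_on_id)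
  then show ?thesis by (simp add: measurable_def sets_unit_leb space_restrict_space)
qed

lemma snd_measurable_Sigma: "snd \<in> measurable (Sigma_borel K) (restrict_space borel K)"
  unfolding Sigma_borel_def
  by (rule measurable_restrict_space2)
     (auto simp: space_restrict_space intro!: measurable_restrict_space1 borel_measurable_continuous_onI continuous_on_snd continuous_on_id)

text \<open>The ambient type of \<open>K\<close> need not be second countable, hence not
  \<open>borel_prod\<close>.\<close>

lemma sets_Sigma_borel_pair:
  fixes K :: "'k::metric_space set"
  assumes K: "compact K" "K \<noteq> {}"
  shows "sets (Sigma_borel K) = sets (unit_leb \<Otimes>\<^sub>M restrict_space borel K)"
proof (rule antisym)
  have "(\<lambda>z. (fst z, snd z)) \<in> measurable (Sigma_borel K) (unit_leb \<Otimes>\<^sub>M restrict_space borel K)"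
    by (intro measurable_Pair fst_measurable_Sigma snd_measurable_Sigma)
  then have m: "(\<lambda>z. z) \<in> measurable (Sigma_borel K) (unit_leb \<Otimes>\<^sub>M restrict_space borel K)" by simp
  show "sets (unit_leb \<Otimes>\<^sub>M restrict_space borel K) \<subseteq> sets (Sigma_borel K)"
  proof
    fix E assume E: "E \<in> sets (unit_leb \<Otimes>\<^sub>M restrict_space borel K)"
    have "(\<lambda>z. z) -` E \<inter> space (Sigma_borel K) \<in> sets (Sigma_borel K)" by (rule measurable_sets[OF m E])
    moreover have "E \<subseteq> space (Sigma_borel K)"
      using sets.sets_into_space[OF E] by (simp add: space_pair_measure space_restrict_space)
    ultimately show "E \<in> sets (Sigma_borel K)" by (simp add: Int_absorb2)
  qed
next
  obtain d :: "nat \<Rightarrow> 'k" where d: "range d \<subseteq> K" "\<And>y e. y \<in> K \<Longrightarrow> e > 0 \<Longrightarrow> \<exists>n. dist y (d n) < e"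
    using compact_dense_sequence[OF K] by metis
  let ?P = "unit_leb \<Otimes>\<^sub>M restrict_space borel K"
  let ?S = "{0..1::real} \<times> K"
  have rect: "(ball x r \<times> ball y r) \<inter> ?S \<in> sets ?P" for x y r
  proof -
    have "(ball x r \<inter> {0..1}) \<times> (ball y r \<inter> K) \<in> sets ?P"
      by (intro pair_measureI) (simp_all add: sets_unit_leb Int_in_sets_restrict_space)
    moreover have "(ball x r \<inter> {0..1}) \<times> (ball y r \<inter> K) = (ball x r \<times> ball y r) \<inter> ?S" by auto
    ultimately show ?thesis by simp
  qed
  have op: "U \<inter> ?S \<in> sets ?P" if U: "open U" for U :: "(real \<times> 'k) set"
  proof -
    \<comment> \<open>Products of balls of equal radius, one centre rational and the other in the
      dense sequence: countably many of them exhaust the part of \<open>U\<close> above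
      \<open>K\<close>.\<close>
    define N where "N = {(q, n, m) :: rat \<times> nat \<times> nat | q n m.
       ball (of_rat q) (1 / real (Suc m)) \<times> ball (d n) (1 / real (Suc m)) \<subseteq> U}"
    have "U \<inter> ?S = (\<Union>(q, n, m)\<in>N. (ball (of_rat q) (1 / real (Suc m)) \<times> ball (d n) (1 / real (Suc m))) \<inter> ?S)"
    proof (intro equalityI subsetI)
      fix z assume z: "z \<in> U \<inter> ?S"
      obtain x y where xy: "z = (x, y)" "x \<in> {0..1}" "y \<in> K" using z by auto
      obtain A B where AB: "open A" "open B" "(x, y) \<in> A \<times> B" "A \<times> B \<subseteq> U"
        by (rule open_prod_elim[OF U, of "(x, y)"]) (use z xy in auto)
      obtain e1 where e1: "e1 > 0" "ball x e1 \<subseteq> A" by (rule openE[of A x]) (use AB in auto)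
      obtain e2 where e2: "e2 > 0" "ball y e2 \<subseteq> B" by (rule openE[of B y]) (use AB in auto)
      obtain m where m: "1 / real (Suc m) < min e1 e2 / 2" using nat_approx_posE[of "min e1 e2 / 2"] e1 e2 by auto
      define r where "r = 1 / real (Suc m)"
      have r: "0 < r" "2 * r < e1" "2 * r < e2" using m by (auto simp: r_def)
      obtain q where q: "x - r < of_rat q" "of_rat q < x + r" using of_rat_dense[of "x - r" "x + r"] r by auto
      obtain n where n: "dist y (d n) < r" using d(2)[OF xy(3) r(1)] by blast
      have "ball (of_rat q) r \<subseteq> ball x e1"
      proof
        fix t :: real assume "t \<in> ball (of_rat q) r"
        then show "t \<in> ball x e1" using q r by (auto simp: dist_real_def)
      qed
      moreover have "ball (d n) r \<subseteq> ball y e2"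
      proof
        fix t assume "t \<in> ball (d n) r"
        then have "dist y t < r + r" using n by (intro dist_triangle_less_add[of y "d n" r t r]) (auto simp: dist_commute)
        then show "t \<in> ball y e2" using r by simp
      qed
      ultimately have "ball (of_rat q) r \<times> ball (d n) r \<subseteq> U" using e1 e2 AB by blast
      then have "(q, n, m) \<in> N" by (simp add: N_def r_def)
      moreover have "z \<in> (ball (of_rat q) (1 / real (Suc m)) \<times> ball (d n) (1 / real (Suc m))) \<inter> ?S"
        using q n xy unfolding r_def by (auto simp: dist_real_def dist_commute)
      ultimately show "z \<in> (\<Union>(q, n, m)\<in>N. (ball (of_rat q) (1 / real (Suc m)) \<times> ball (d n) (1 / real (Suc m))) \<inter> ?S)"
        by (intro UN_I[of "(q, n, m)"]) auto
    qed (auto simp: N_def)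
    also have "\<dots> \<in> sets ?P"
      using rect by (intro sets.countable_UN') (auto simp: split_beta)
    finally show ?thesis .
  qed
  have sp: "space ?P = ?S" by (simp add: space_pair_measure space_restrict_space)
  have id: "(\<lambda>z. z) \<in> borel_measurable ?P"
    by (rule borel_measurableI) (simp add: sp op)
  show "sets (Sigma_borel K) \<subseteq> sets ?P"
  proof
    fix E assume "E \<in> sets (Sigma_borel K)"
    then obtain B where "B \<in> sets borel" "E = B \<inter> ?S"
      by (auto simp: Sigma_borel_def sets_restrict_space)
    then show "E \<in> sets ?P" using measurable_sets[OF id, of B] by (simp add: sp)
  qed
qed

text \<open>Base-3 expansions with digits 0 and 1 code a countable family of events into one real number.\<close>

lemma base3_digit:
  fixes c :: "nat \<Rightarrow> bool"
  defines "r \<equiv> (\<Sum>n. of_bool (c n) / 3 ^ Suc n :: real)"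
  shows "\<lfloor>3 ^ Suc m * r\<rfloor> mod 3 = of_bool (c m)"
proof -
  let ?t = "\<lambda>n. of_bool (c n) / 3 ^ Suc n :: real"
  have sm: "summable ?t"
    by (rule summable_comparison_test'[of "\<lambda>n. (1/3) ^ n", OF summable_geometric]) (auto simp: power_divide field_simps)
  \<comment> \<open>With digits 0 and 1 in base 3 the tail is at most 1/2, so the floor recovers
    every digit; in base 2 a tail of ones would carry over.\<close>
  define tail where "tail = (\<Sum>n. of_bool (c (n + Suc m)) / 3 ^ Suc n :: real)"
  have g: "(\<lambda>n. 1 / 3 ^ Suc n :: real) sums (1/2)"
    using sums_mult[OF geometric_sums[of "1/3::real"], of "1/3"] by (simp add: power_divide)
  have st: "summable (\<lambda>n. of_bool (c (n + Suc m)) / 3 ^ Suc n :: real)"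
    by (rule summable_comparison_test'[of "\<lambda>n. 1 / 3 ^ Suc n"]) (use g in \<open>auto simp: sums_iff\<close>)
  have tail: "0 \<le> tail" "tail \<le> 1/2"
  proof -
    show "0 \<le> tail" unfolding tail_def using st by (intro suminf_nonneg) auto
    show "tail \<le> 1/2" unfolding tail_def by (rule sums_le[OF _ summable_sums[OF st] g]) (auto simp: divide_right_mono)
  qed
  have "r = (\<Sum>n. ?t (n + Suc m)) + (\<Sum>n<Suc m. ?t n)"
    unfolding r_def by (rule suminf_split_initial_segment[OF sm])
  also have "(\<Sum>n. ?t (n + Suc m)) = tail / 3 ^ Suc m"
    unfolding tail_def suminf_divide[OF st, symmetric] by (simp add: power_add mult_ac)
  finally have "3 ^ Suc m * r = tail + (\<Sum>n<Suc m. 3 ^ Suc m * ?t n)"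
    by (simp add: distrib_left sum_distrib_left)
  also have "(\<Sum>n<Suc m. 3 ^ Suc m * ?t n) = of_int (\<Sum>n<Suc m. of_bool (c n) * 3 ^ (m - n))"
    unfolding of_int_sum
  proof (rule sum.cong)
    fix n assume "n \<in> {..<Suc m}"
    then have "(3::real) ^ Suc m = 3 ^ (m - n) * 3 ^ Suc n" by (simp add: power_add[symmetric])
    then show "3 ^ Suc m * ?t n = real_of_int (of_bool (c n) * 3 ^ (m - n))" by simp
  qed simp
  finally have "\<lfloor>3 ^ Suc m * r\<rfloor> = (\<Sum>n<Suc m. of_bool (c n) * 3 ^ (m - n))"
    using tail by (intro floor_unique) auto
  also have "\<dots> = (\<Sum>n<m. of_bool (c n) * 3 ^ (m - n)) + of_bool (c m)" by simp
  also have "(\<Sum>n<m. of_bool (c n) * 3 ^ (m - n) :: int) = 3 * (\<Sum>n<m. of_bool (c n) * 3 ^ (m - Suc n))"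
    unfolding sum_distrib_left
  proof (rule sum.cong)
    fix n assume "n \<in> {..<m}"
    then have "m - n = Suc (m - Suc n)" by auto
    then show "of_bool (c n) * 3 ^ (m - n) = 3 * (of_bool (c n) * 3 ^ (m - Suc n) :: int)" by simp
  qed simp
  finally show ?thesis by simp
qed

text \<open>\<open>\<psi> y\<close> records which balls of radius \<open>(1/2) ^ n\<close> around
  the dense points contain \<open>y\<close>. Decoding takes, for each \<open>n\<close>, the first
  dense point whose ball is recorded and passes to the limit. Digits are Borel functions of the
  number, hence so is the decoder; off the set \<open>R\<close> of codes giving a fast Cauchy
  sequence it returns the default \<open>d 0\<close>, so its values stay in
  \<open>K\<close>.\<close>

lemma borel_coding:
  fixes K :: "'k::metric_space set"
  assumes K: "compact K" "K \<noteq> {}"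
  shows "\<exists>\<psi> \<theta>. \<psi> \<in> borel_measurable (restrict_space borel K) \<and>
     \<theta> \<in> measurable borel (restrict_space borel K) \<and>
     (\<forall>y\<in>K. \<theta> (\<psi> y) = y \<and> \<psi> y \<in> {0..(1::real)})"
proof -
  obtain d :: "nat \<Rightarrow> 'k" where d: "range d \<subseteq> K" "\<And>y e. y \<in> K \<Longrightarrow> e > 0 \<Longrightarrow> \<exists>n. dist y (d n) < e"
    using compact_dense_sequence[OF K] by metis
  define c where "c y k \<longleftrightarrow> dist y (d (snd (prod_decode k))) < (1/2) ^ fst (prod_decode k)" for y :: 'k and k
  define \<psi> where "\<psi> y = (\<Sum>k. of_bool (c y k) / 3 ^ Suc k :: real)" for y
  define dig where "dig r k \<longleftrightarrow> \<lfloor>3 ^ Suc k * r\<rfloor> mod 3 = (1::int)" for r :: real and k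
  have dig: "dig (\<psi> y) k \<longleftrightarrow> c y k" for y k
    using base3_digit[of k "c y"] by (simp add: dig_def \<psi>_def)
  define i where "i n r = (LEAST j. dig r (prod_encode (n, j)))" for n r
  define p where "p n r = d (i n r)" for n r
  \<comment> \<open>Approximants within \<open>(1/2) ^ n\<close> and \<open>(1/2) ^ Suc n\<close> of
    the same point are closer to each other than \<open>2 * (1/2) ^ n\<close>, so genuine codes
    belong to \<open>R\<close>.\<close>
  define R where "R = {r. \<forall>n. dist (p n r) (p (Suc n) r) \<le> 2 * (1/2) ^ n}"
  have psi: "dist y (p n (\<psi> y)) < (1/2) ^ n" if y: "y \<in> K" for y n
  proof -
    obtain j where "dist y (d j) < (1/2) ^ n" using d(2)[OF y, of "(1/2)^n"] by auto
    then have "dig (\<psi> y) (prod_encode (n, j))" by (simp add: dig c_def)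
    then have "dig (\<psi> y) (prod_encode (n, i n (\<psi> y)))" unfolding i_def by (rule LeastI)
    then show ?thesis by (simp add: dig c_def p_def)
  qed
  have psiR: "\<psi> y \<in> R" if y: "y \<in> K" for y
    unfolding R_def
  proof (intro CollectI allI)
    fix n
    have "dist (p n (\<psi> y)) (p (Suc n) (\<psi> y)) \<le> dist y (p n (\<psi> y)) + dist y (p (Suc n) (\<psi> y))"
      by (metis dist_commute dist_triangle)
    also have "\<dots> \<le> (1/2) ^ n + (1/2) ^ Suc n"
      using psi[OF y, of n] psi[OF y, of "Suc n"] by linarith
    also have "\<dots> \<le> 2 * (1/2) ^ n" by simp
    finally show "dist (p n (\<psi> y)) (p (Suc n) (\<psi> y)) \<le> 2 * (1/2) ^ n" .
  qed
  define \<theta> where "\<theta> r = lim (\<lambda>n. if r \<in> R then p n r else d 0)" for r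
  have conv: "\<exists>z\<in>K. (\<lambda>n. if r \<in> R then p n r else d 0) \<longlonglongrightarrow> z" for r
  proof (cases "r \<in> R")
    case True
    have "Cauchy (\<lambda>n. p n r)"
    proof (rule metric_CauchyI)
      fix e :: real assume e: "0 < e"
      have le: "dist (p n r) (p (n + k) r) \<le> 4 * (1/2) ^ n - 4 * (1/2) ^ (n + k)" for n k
      proof (induction k)
        case (Suc k)
        have "dist (p n r) (p (n + Suc k) r) \<le> dist (p n r) (p (n + k) r) + dist (p (n + k) r) (p (Suc (n + k)) r)"
          using dist_triangle[of "p n r" "p (Suc (n + k)) r" "p (n + k) r"] by simp
        also have "dist (p (n + k) r) (p (Suc (n + k)) r) \<le> 2 * (1/2) ^ (n + k)" using True unfolding R_def by blast
        finally show ?case using Suc by simp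
      qed simp
      obtain N where N: "(1/2::real) ^ N < e / 8" using real_arch_pow_inv[of "e/8" "1/2"] e by auto
      have "dist (p m r) (p N r) < e / 2" if "m \<ge> N" for m
        using le[of N "m - N"] that N by (simp add: dist_commute) (smt (verit) zero_le_power zero_less_power zero_less_divide_1_iff)
      then show "\<exists>N. \<forall>m\<ge>N. \<forall>n\<ge>N. dist (p m r) (p n r) < e"
        by (intro exI[of _ N]) (meson dist_triangle_half_l)
    qed
    moreover have "\<forall>n. p n r \<in> K" using d by (auto simp: p_def)
    ultimately show ?thesis
      using completeE[OF compact_imp_complete[OF K(1)], of "\<lambda>n. p n r"] True by auto
  next
    case False
    then show ?thesis using d by (intro bexI[of _ "d 0"]) auto
  qed
  then have thetalim: "(\<lambda>n. if r \<in> R then p n r else d 0) \<longlonglongrightarrow> \<theta> r" and thetaK: "\<theta> r \<in> K" for r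
    unfolding \<theta>_def by (metis limI)+
  have digm[measurable]: "Measurable.pred borel (\<lambda>r. dig r k)" for k
    unfolding dig_def by measurable
  have im[measurable]: "i n \<in> measurable borel (count_space UNIV)" for n
    unfolding i_def by measurable
  have pm[measurable]: "p n \<in> borel_measurable borel" for n
    unfolding p_def by (rule measurable_compose[OF im]) simp
  have Rm: "R \<in> sets borel"
  proof -
    have "Measurable.pred borel (\<lambda>r. dist (p n r) (p (Suc n) r) \<le> 2 * (1/2) ^ n)" for n
    proof -
      \<comment> \<open>The distance is viewed as a function of a pair of indices from a countable
        set, so its measurability does not depend on a countable base of the ambient type.\<close>
      have "(\<lambda>r. (i n r, i (Suc n) r)) \<in> measurable borel (count_space UNIV \<Otimes>\<^sub>M count_space UNIV)" by measurable
      then have "(\<lambda>r. (i n r, i (Suc n) r)) \<in> measurable borel (count_space UNIV)"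
        by (simp add: pair_measure_countable)
      from measurable_compose[OF this, of "\<lambda>(j, k). dist (d j) (d k) \<le> 2 * (1/2) ^ n" "count_space UNIV"]
      show ?thesis by (simp add: p_def)
    qed
    then have "Measurable.pred borel (\<lambda>r. \<forall>n. dist (p n r) (p (Suc n) r) \<le> 2 * (1/2) ^ n)" by measurable
    then show ?thesis unfolding R_def by (simp add: pred_def)
  qed
  have "\<theta> \<in> borel_measurable borel"
  proof (rule borel_measurable_LIMSEQ_metric)
    show "(\<lambda>r. if r \<in> R then p n r else d 0) \<in> borel_measurable borel" for n
      using Rm by measurable
  qed (rule thetalim)
  then have "\<theta> \<in> measurable borel (restrict_space borel K)"
    using thetaK by (intro measurable_restrict_space2) auto
  moreover have "\<psi> \<in> borel_measurable (restrict_space borel K)"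
    unfolding \<psi>_def
  proof (rule borel_measurable_suminf)
    fix k
    have "{y \<in> space (restrict_space borel K). c y k} = ball (d (snd (prod_decode k))) ((1/2) ^ fst (prod_decode k)) \<inter> K"
      by (auto simp: c_def space_restrict_space dist_commute)
    also have "\<dots> \<in> sets (restrict_space borel K)" by (simp add: Int_in_sets_restrict_space)
    finally have "Measurable.pred (restrict_space borel K) (\<lambda>y. c y k)" by (simp add: pred_def)
    then show "(\<lambda>y. of_bool (c y k) / 3 ^ Suc k) \<in> borel_measurable (restrict_space borel K)" by measurable
  qed
  moreover have "\<theta> (\<psi> y) = y" if y: "y \<in> K" for y
  proof -
    have "(\<lambda>n. p n (\<psi> y)) \<longlonglongrightarrow> y"
    proof (rule metric_LIMSEQ_I)
      fix e :: real assume "0 < e"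
      then obtain N where N: "(1/2::real) ^ N < e" using real_arch_pow_inv[of e "1/2"] by auto
      have "dist (p n (\<psi> y)) y < e" if "n \<ge> N" for n
      proof -
        have "(1/2::real) ^ n \<le> (1/2) ^ N" by (rule power_decreasing[OF that]) auto
        then show ?thesis using psi[OF y, of n] N unfolding dist_commute[of _ y] by linarith
      qed
      then show "\<exists>N. \<forall>n\<ge>N. dist (p n (\<psi> y)) y < e" by blast
    qed
    then show ?thesis using thetalim[of "\<psi> y"] psiR[OF y] by (simp add: LIMSEQ_unique)
  qed
  moreover have "\<psi> y \<in> {0..1}" for y
  proof -
    have g: "(\<lambda>n. 1 / 3 ^ Suc n :: real) sums (1/2)"
      using sums_mult[OF geometric_sums[of "1/3::real"], of "1/3"] by (simp add: power_divide)
    have st: "summable (\<lambda>n. of_bool (c y n) / 3 ^ Suc n :: real)"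
      by (rule summable_comparison_test'[of "\<lambda>n. 1 / 3 ^ Suc n"]) (use g in \<open>auto simp: sums_iff\<close>)
    have "\<psi> y \<le> 1/2" unfolding \<psi>_def by (rule sums_le[OF _ summable_sums[OF st] g]) (auto simp: divide_right_mono)
    moreover have "0 \<le> \<psi> y" unfolding \<psi>_def using st by (intro suminf_nonneg) auto
    ultimately show ?thesis by simp
  qed
  ultimately show ?thesis by blast
qed

section \<open>Marginal densities and conditional laws\<close>

lemma marginal_density_measurable [measurable]: "marginal_density M \<in> borel_measurable unit_leb"
  unfolding marginal_density_def by measurable

lemma marginal_density_nonneg [simp]: "0 \<le> marginal_density M x"
  by (simp add: marginal_density_def)

lemma sets_Sigma_vertical:
  assumes "A \<in> sets unit_leb" shows "A \<times> K \<in> sets (Sigma_borel K)"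
proof -
  have "fst -` A \<inter> space (Sigma_borel K) \<in> sets (Sigma_borel K)"
    by (rule measurable_sets[OF fst_measurable_Sigma assms])
  moreover have "fst -` A \<inter> space (Sigma_borel K) = A \<times> K"
    using sets.sets_into_space[OF assms] by auto
  ultimately show ?thesis by simp
qed

lemma emeasure_marginal:
  assumes "sets M = sets (Sigma_borel K)" "A \<in> sets unit_leb"
  shows "emeasure (marginal M) A = emeasure M (A \<times> K)"
proof -
  have "fst \<in> measurable M unit_leb" using fst_measurable_Sigma assms(1) measurable_cong_sets by blast
  moreover have "fst -` A \<inter> space M = A \<times> K"
    using sets.sets_into_space[OF assms(2)] sets_eq_imp_space_eq[OF assms(1)] by auto
  ultimately show ?thesis unfolding marginal_def using assms(2) by (simp add: emeasure_distr)
qed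

lemma sets_marginal [simp]: "sets (marginal M) = sets unit_leb"
  by (simp add: marginal_def)

lemma finite_measure_marginal:
  assumes "finite_measure M" "sets M = sets (Sigma_borel K)"
  shows "finite_measure (marginal M)"
  unfolding marginal_def
  using fst_measurable_Sigma assms measurable_cong_sets[OF assms(2) refl]
  by (intro finite_measure.finite_measure_distr) auto

text \<open>The marginal is finite, so its Radon-Nikodym derivative is finite almost everywhere and
  passing to real values in \<open>marginal_density\<close> loses nothing.\<close>

lemma emeasure_vertical:
  assumes M: "finite_measure M" "sets M = sets (Sigma_borel K)" "absolutely_continuous unit_leb (marginal M)"
    and A: "A \<in> sets unit_leb"
  shows "emeasure M (A \<times> K) = (\<integral>\<^sup>+x\<in>A. ennreal (marginal_density M x) \<partial>unit_leb)"
proof -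
  interpret prob_space unit_leb by (rule prob_space_unit_leb)
  interpret m: finite_measure "marginal M" by (rule finite_measure_marginal[OF M(1,2)])
  have "emeasure M (A \<times> K) = emeasure (density unit_leb (RN_deriv unit_leb (marginal M))) A"
    using density_RN_deriv[OF M(3)] by (simp add: emeasure_marginal[OF M(2) A])
  also have "\<dots> = (\<integral>\<^sup>+x\<in>A. RN_deriv unit_leb (marginal M) x \<partial>unit_leb)"
    using A by (simp add: emeasure_density)
  also have "\<dots> = (\<integral>\<^sup>+x\<in>A. ennreal (marginal_density M x) \<partial>unit_leb)"
  proof (rule nn_integral_cong_AE)
    have "AE x in unit_leb. RN_deriv unit_leb (marginal M) x \<noteq> \<infinity>"
      using RN_deriv_finite[OF m.sigma_finite_measure_axioms M(3)] by simp
    then show "AE x in unit_leb. RN_deriv unit_leb (marginal M) x * indicator A x =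
        ennreal (marginal_density M x) * indicator A x"
      by eventually_elim (simp add: marginal_density_def less_top)
  qed
  finally show ?thesis .
qed

lemma integrable_marginal_density:
  assumes "finite_measure M" "sets M = sets (Sigma_borel K)" "absolutely_continuous unit_leb (marginal M)"
  shows "integrable unit_leb (marginal_density M)"
proof (rule integrableI_nonneg)
  have "(\<integral>\<^sup>+x. ennreal (marginal_density M x) \<partial>unit_leb) =
      (\<integral>\<^sup>+x\<in>space unit_leb. ennreal (marginal_density M x) \<partial>unit_leb)"
    by (rule nn_integral_cong) simp
  also have "\<dots> = emeasure M (space unit_leb \<times> K)"
    by (rule emeasure_vertical[OF assms, symmetric]) (rule sets.top)
  also have "\<dots> < \<infinity>" using finite_measure.emeasure_finite[OF assms(1)] by (simp add: less_top)
  finally show "(\<integral>\<^sup>+x. ennreal (marginal_density M x) \<partial>unit_leb) < \<infinity>" .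
qed auto

lemma measure_vertical:
  assumes M: "finite_measure M" "sets M = sets (Sigma_borel K)" "absolutely_continuous unit_leb (marginal M)"
    and A: "A \<in> sets unit_leb"
  shows "measure M (A \<times> K) = (LINT x:A|unit_leb. marginal_density M x)"
proof -
  have "(LINT x:A|unit_leb. marginal_density M x) =
      enn2real (\<integral>\<^sup>+x. ennreal (indicator A x *\<^sub>R marginal_density M x) \<partial>unit_leb)"
    unfolding set_lebesgue_integral_def using A
    by (intro integral_eq_nn_integral) auto
  also have "(\<integral>\<^sup>+x. ennreal (indicator A x *\<^sub>R marginal_density M x) \<partial>unit_leb) =
      (\<integral>\<^sup>+x\<in>A. ennreal (marginal_density M x) \<partial>unit_leb)"
    by (intro nn_integral_cong) (auto simp: indicator_def)
  finally show ?thesis unfolding measure_def emeasure_vertical[OF assms] by simp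
qed

lemma AE_le_if_set_integrals_le:
  assumes "integrable M f" "integrable M (g :: _ \<Rightarrow> real)"
    and "\<And>A. A \<in> sets M \<Longrightarrow> (LINT x:A|M. f x) \<le> (LINT x:A|M. g x)"
    and "finite_measure M"
  shows "AE x in M. f x \<le> g x"
proof -
  interpret finite_measure M by fact
  have "AE x in M. 0 \<le> g x - f x"
  proof (rule density_nonneg)
    show "integrable M (\<lambda>x. g x - f x)" using assms by simp
    fix A assume A: "A \<in> sets M"
    have "(LINT x:A|M. g x - f x) = (LINT x:A|M. g x) - (LINT x:A|M. f x)"
      using A assms(1,2) by (intro set_integral_diff) (simp_all only: set_integrable_def integrable_mult_indicator)
    then show "0 \<le> (LINT x:A|M. g x - f x)" using assms(3)[OF A] by simp
  qed
  then show ?thesis by eventually_elim simp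
qed

lemma finite_borel_eqI_lessThan:
  fixes M N :: "real measure"
  assumes "sets M = sets borel" "sets N = sets borel" "finite_measure M"
    and eq: "\<And>t. emeasure M {..<t} = emeasure N {..<t}"
  shows "M = N"
proof (rule measure_eqI_generator_eq[of "range lessThan" UNIV M N "\<lambda>n. {..<real n}"])
  show "Int_stable (range lessThan :: real set set)"
  proof (rule Int_stableI)
    fix A B :: "real set" assume "A \<in> range lessThan" "B \<in> range lessThan"
    then obtain s t where "A = {..<s}" "B = {..<t}" by auto
    then have "A \<inter> B = {..<min s t}" by auto
    then show "A \<inter> B \<in> range lessThan" by simp
  qed
  show "(\<Union>i. {..<real i}) = UNIV" using reals_Archimedean2 by auto
  show "emeasure M {..<real i} \<noteq> \<infinity>" for i using assms(3) by (simp add: finite_measure.emeasure_finite)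
qed (use assms in \<open>auto simp: borel_Iio\<close>)

text \<open>The fibre coordinate is coded by a real number \<open>\<psi>\<close>. For rational
  \<open>q\<close>, the Radon-Nikodym density \<open>F q\<close> of the part of \<open>M\<close>
  where \<open>\<psi> < q\<close> acts as an unnormalized conditional distribution function. Its
  generalized inverse \<open>Q x\<close> transports Lebesgue measure to the conditional law, and
  decoding by \<open>\<theta>\<close> returns to \<open>K\<close>. A kernel defined as an image
  measure is a probability for every \<open>x\<close>, so no set function has to be
  extended.\<close>

lemma disintegration_exists:
  fixes K :: "'k::metric_space set"
  assumes K: "compact K" "K \<noteq> {}"
    and M: "finite_measure M" "sets M = sets (Sigma_borel K)" "absolutely_continuous unit_leb (marginal M)"
  shows "\<exists>\<kappa>. is_disintegration K M \<kappa>"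
proof -
  interpret M: finite_measure M by (rule M(1))
  interpret U: prob_space unit_leb by (rule prob_space_unit_leb)
  interpret UU: pair_sigma_finite unit_leb unit_leb by standard
  let ?S = "Sigma_borel K" and ?BK = "restrict_space borel K" and ?UU = "unit_leb \<Otimes>\<^sub>M unit_leb"
  obtain \<psi> :: "'k \<Rightarrow> real" and \<theta> where psi[measurable]: "\<psi> \<in> borel_measurable ?BK"
    and theta[measurable]: "\<theta> \<in> measurable borel ?BK"
    and inv: "\<And>y. y \<in> K \<Longrightarrow> \<theta> (\<psi> y) = y" "\<And>y. y \<in> K \<Longrightarrow> \<psi> y \<in> {0..1}"
    using borel_coding[OF K] by blast
  have spM: "space M = {0..1} \<times> K" using sets_eq_imp_space_eq[OF M(2)] by simp
  have fstM[measurable]: "fst \<in> measurable M unit_leb"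
    using fst_measurable_Sigma measurable_cong_sets[OF M(2) refl] by blast
  have sndM[measurable]: "snd \<in> measurable M ?BK"
    using snd_measurable_Sigma measurable_cong_sets[OF M(2) refl] by blast
  have psiM[measurable]: "(\<lambda>z. \<psi> (snd z)) \<in> borel_measurable M" by measurable
  define W where "W B = {z \<in> space M. \<psi> (snd z) \<in> B}" for B
  have W[measurable]: "W B \<in> sets M" if "B \<in> sets borel" for B
    unfolding W_def using measurable_sets[OF psiM that] by (simp add: vimage_def Int_def conj_commute)
  define R where "R q = density M (indicator (W {..< real_of_rat q}))" for q
  have setsR: "sets (R q) = sets ?S" for q by (simp add: R_def M(2))
  have emR: "emeasure (R q) E = emeasure M (W {..<real_of_rat q} \<inter> E)" if "E \<in> sets M" for q E
    using that by (simp add: R_def emeasure_density indicator_inter_arith[symmetric])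
  have finR: "finite_measure (R q)" for q
    by (rule finite_measureI) (simp add: R_def emeasure_density M.emeasure_finite nn_integral_indicator flip: nn_integral_indicator, simp add: R_def emR[unfolded R_def] M.emeasure_finite)
  have leR: "measure (R q) E \<le> measure M E" if "E \<in> sets M" for q E
  proof -
    have "measure (R q) E = measure M (W {..<real_of_rat q} \<inter> E)" by (simp add: measure_def emR that)
    also have "\<dots> \<le> measure M E" using that by (intro M.finite_measure_mono) auto
    finally show ?thesis .
  qed
  have monoR: "measure (R p) E \<le> measure (R q) E" if "E \<in> sets M" "p \<le> q" for p q E
  proof -
    have "W {..<real_of_rat p} \<subseteq> W {..<real_of_rat q}"
      using that(2) by (auto simp: W_def) (metis of_rat_less_eq order_less_le_trans)
    then have "measure M (W {..<real_of_rat p} \<inter> E) \<le> measure M (W {..<real_of_rat q} \<inter> E)"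
      using that by (intro M.finite_measure_mono) auto
    then show ?thesis by (simp add: measure_def emR that)
  qed
  have vert: "A \<times> K \<in> sets M" if "A \<in> sets unit_leb" for A
    using sets_Sigma_vertical[OF that] by (simp add: M(2))
  have acR: "absolutely_continuous unit_leb (marginal (R q))" for q
    unfolding absolutely_continuous_def
  proof
    fix A assume A: "A \<in> null_sets unit_leb"
    then have s: "A \<in> sets unit_leb" by auto
    have "emeasure (marginal M) A = 0" using A M(3) by (auto simp: absolutely_continuous_def null_sets_def)
    then have "emeasure M (A \<times> K) = 0" by (simp add: emeasure_marginal[OF M(2) s])
    then have "emeasure M (W {..<real_of_rat q} \<inter> A \<times> K) = 0"
      using emeasure_mono[of "W {..<real_of_rat q} \<inter> A \<times> K" "A \<times> K" M] vert[OF s] by simp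
    then show "A \<in> null_sets (marginal (R q))"
      using s vert[OF s] by (intro null_setsI) (auto simp: emeasure_marginal[OF setsR s] emR)
  qed
  let ?F = "\<lambda>q. marginal_density (R q)" and ?\<phi> = "marginal_density M"
  have intF: "integrable unit_leb (?F q)" for q by (rule integrable_marginal_density[OF finR setsR acR])
  have int\<phi>: "integrable unit_leb ?\<phi>" by (rule integrable_marginal_density[OF M])
  have AE1: "AE x in unit_leb. ?F q x \<le> ?\<phi> x" for q
    by (rule AE_le_if_set_integrals_le[OF intF int\<phi>])
       (auto simp: measure_vertical[OF finR setsR acR, symmetric] measure_vertical[OF M, symmetric] leR vert U.finite_measure_axioms)
  have AE2: "AE x in unit_leb. p \<le> q \<longrightarrow> ?F p x \<le> ?F q x" for p q
  proof (cases "p \<le> q")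
    case True
    have "AE x in unit_leb. ?F p x \<le> ?F q x"
      by (rule AE_le_if_set_integrals_le[OF intF intF])
         (auto simp: measure_vertical[OF finR setsR acR, symmetric] monoR[OF _ True] vert U.finite_measure_axioms)
    then show ?thesis by eventually_elim simp
  qed simp
  \<comment> \<open>Countably many almost sure inequalities hold simultaneously off one null set. At
    all other points the functions are set to 0, after which the inequalities hold
    everywhere.\<close>
  define good where "good x \<longleftrightarrow> (\<forall>q. ?F q x \<le> ?\<phi> x) \<and> (\<forall>p q. p \<le> q \<longrightarrow> ?F p x \<le> ?F q x)" for x
  have AEgood: "AE x in unit_leb. good x"
    unfolding good_def using AE1 AE2 by (simp add: AE_all_countable AE_conj_iff)
  have [measurable]: "Measurable.pred unit_leb good" unfolding good_def by measurable
  define F where "F q x = (if good x then ?F q x else 0)" for q x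
  define \<phi> where "\<phi> x = (if good x then ?\<phi> x else 0)" for x
  have Fm[measurable]: "F q \<in> borel_measurable unit_leb" for q unfolding F_def by measurable
  have \<phi>m[measurable]: "\<phi> \<in> borel_measurable unit_leb" unfolding \<phi>_def by measurable
  have F: "0 \<le> F q x" "F q x \<le> \<phi> x" "p \<le> q \<Longrightarrow> F p x \<le> F q x" "0 \<le> \<phi> x" for p q x
    by (auto simp: F_def \<phi>_def good_def)
  have AE\<phi>: "AE x in unit_leb. \<phi> x = ?\<phi> x" using AEgood by eventually_elim (simp add: \<phi>_def)
  have intF': "(\<integral>\<^sup>+x\<in>A. ennreal (F q x) \<partial>unit_leb) = emeasure M (W {..<real_of_rat q} \<inter> A \<times> K)"
    if A: "A \<in> sets unit_leb" for A q
  proof -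
    have "(\<integral>\<^sup>+x\<in>A. ennreal (F q x) \<partial>unit_leb) = (\<integral>\<^sup>+x\<in>A. ennreal (?F q x) \<partial>unit_leb)"
      by (rule nn_integral_cong_AE, use AEgood in eventually_elim) (simp add: F_def)
    then show ?thesis by (simp add: emeasure_vertical[OF finR setsR acR A, symmetric] emR vert A)
  qed
  have int\<phi>': "(\<integral>\<^sup>+x\<in>A. ennreal (\<phi> x) \<partial>unit_leb) = emeasure M (A \<times> K)"
    if A: "A \<in> sets unit_leb" for A
  proof -
    have "(\<integral>\<^sup>+x\<in>A. ennreal (\<phi> x) \<partial>unit_leb) = (\<integral>\<^sup>+x\<in>A. ennreal (?\<phi> x) \<partial>unit_leb)"
      by (rule nn_integral_cong_AE, use AE\<phi> in eventually_elim) simp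
    then show ?thesis by (simp add: emeasure_vertical[OF M A, symmetric])
  qed
  \<comment> \<open>The conditional quantile function: for almost every \<open>x\<close>, it transports
    Lebesgue measure to the conditional law of \<open>\<psi>\<close> given \<open>x\<close>.\<close>
  define J where "J x u = insert 2 (real_of_rat ` {q. 0 \<le> q \<and> q < 2 \<and> u * \<phi> x \<le> F q x})" for x u
  \<comment> \<open>The number 2, beyond every code, keeps \<open>J x u\<close> nonempty, so the
    infimum is a real number between 0 and 2.\<close>
  define Q where "Q x u = Inf (J x u)" for x u
  have bddJ: "bdd_below (J x u)" for x u by (rule bdd_belowI[of _ 0]) (auto simp: J_def)
  have Qless: "Q x u < t \<longleftrightarrow> 2 < t \<or> (\<exists>q. 0 \<le> q \<and> q < 2 \<and> real_of_rat q < t \<and> u * \<phi> x \<le> F q x)" for x u t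
    unfolding Q_def using bddJ[of x u] by (subst cInf_less_iff) (auto simp: J_def)
  have Qnn: "0 \<le> Q x u" for x u unfolding Q_def by (rule cInf_greatest) (auto simp: J_def)
  have Qm[measurable]: "(\<lambda>(x, u). Q x u) \<in> borel_measurable ?UU"
  proof (rule borel_measurable_iff_less[THEN iffD2], intro allI)
    fix t
    have "Measurable.pred ?UU (\<lambda>z. 2 < t \<or> (\<exists>q. 0 \<le> q \<and> q < 2 \<and> real_of_rat q < t \<and> snd z * \<phi> (fst z) \<le> F q (fst z)))"
    proof -
      have [measurable]: "snd \<in> borel_measurable ?UU"
        by (rule measurable_compose[OF measurable_snd borel_measurable_unit_lebI]) simp
      have [measurable]: "(\<lambda>z. F q (fst z)) \<in> borel_measurable ?UU" "(\<lambda>z. \<phi> (fst z)) \<in> borel_measurable ?UU" for q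
        by (rule measurable_compose[OF measurable_fst Fm], rule measurable_compose[OF measurable_fst \<phi>m])
      show ?thesis by measurable
    qed
    then show "{w \<in> space ?UU. (case w of (x, u) \<Rightarrow> Q x u) < t} \<in> sets ?UU"
      unfolding pred_def by (simp only: split_beta Qless)
  qed
  define \<nu> where "\<nu> = density ?UU (\<lambda>z. ennreal (\<phi> (fst z)))"
  have sets\<nu>: "sets \<nu> = sets ?UU" by (simp add: \<nu>_def)
  have Qm\<nu>: "(\<lambda>(x, u). Q x u) \<in> borel_measurable \<nu>" using Qm by (simp add: \<nu>_def)
  have em\<nu>: "emeasure \<nu> E = (\<integral>\<^sup>+x. ennreal (\<phi> x) * emeasure unit_leb (Pair x -` E) \<partial>unit_leb)" if E: "E \<in> sets ?UU" for E
  proof -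
    have "emeasure \<nu> E = (\<integral>\<^sup>+z. ennreal (\<phi> (fst z)) * indicator E z \<partial>?UU)"
      using E by (simp add: \<nu>_def emeasure_density)
    also have "\<dots> = (\<integral>\<^sup>+x. \<integral>\<^sup>+u. ennreal (\<phi> x) * indicator E (x, u) \<partial>unit_leb \<partial>unit_leb)"
      using E by (subst U.nn_integral_fst[symmetric]) auto
    also have "\<dots> = (\<integral>\<^sup>+x. ennreal (\<phi> x) * emeasure unit_leb (Pair x -` E) \<partial>unit_leb)"
    proof (rule nn_integral_cong)
      fix x assume "x \<in> space unit_leb"
      have s: "Pair x -` E \<in> sets unit_leb" using E by (rule sets_Pair1)
      have "(\<integral>\<^sup>+u. ennreal (\<phi> x) * indicator E (x, u) \<partial>unit_leb) =
          (\<integral>\<^sup>+u. ennreal (\<phi> x) * indicator (Pair x -` E) u \<partial>unit_leb)"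
        by (intro nn_integral_cong) (auto simp: indicator_def)
      then show "(\<integral>\<^sup>+u. ennreal (\<phi> x) * indicator E (x, u) \<partial>unit_leb) = ennreal (\<phi> x) * emeasure unit_leb (Pair x -` E)"
        unfolding nn_integral_cmult_indicator[OF s] .
    qed
    finally show ?thesis .
  qed
  \<comment> \<open>Comparing \<open>u * \<phi> x\<close> with \<open>F q x\<close>, rather than
    \<open>u\<close> with a quotient, keeps this valid at points where the marginal density
    vanishes.\<close>
  have finite_slice: "ennreal (\<phi> x) * emeasure unit_leb {u \<in> {0..1}. u * \<phi> x \<le> F q x} = ennreal (F q x)" for x q
  proof (cases "\<phi> x = 0")
    case True
    then show ?thesis using F(1,2)[of q x] by simp
  next
    case False
    then have pos: "0 < \<phi> x" using F(4)[of x] by simp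
    have le1: "F q x / \<phi> x \<le> 1" using F(2) pos by simp
    have "{u \<in> {0..1}. u * \<phi> x \<le> F q x} = {0..F q x / \<phi> x}"
    proof -
      have "u \<le> 1" if "u \<le> F q x / \<phi> x" for u using that le1 by linarith
      then show ?thesis using pos by (auto simp: pos_le_divide_eq[symmetric])
    qed
    then show ?thesis using F(1)[of q x] pos le1
      by (simp add: emeasure_unit_leb ennreal_mult[symmetric])
  qed
  have key: "emeasure \<nu> (A \<times> {0..1} \<inter> {z. Q (fst z) (snd z) < t}) = emeasure M (W {..<t} \<inter> A \<times> K)"
    if A: "A \<in> sets unit_leb" for A t
  proof -
    have A01: "A \<subseteq> {0..1}" using sets.sets_into_space[OF A] by simp
    have A2: "A \<times> {0..1} \<in> sets ?UU" using A sets.top[of unit_leb] by (intro pair_measureI) auto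
    \<comment> \<open>Codes lie in [0,1] and quantiles in [0,2], so outside these thresholds both
      events are empty or full.\<close>
    consider "t \<le> 0" | "0 < t" "t \<le> 2" | "2 < t" by linarith
    then show ?thesis
    proof cases
      case 1
      have "\<not> Q x u < t" for x u using 1 Qnn[of x u] by simp
      then have "A \<times> {0..1} \<inter> {z. Q (fst z) (snd z) < t} = {}" by auto
      moreover have "W {..<t} \<inter> A \<times> K = {}" using 1 inv(2) by (fastforce simp: W_def spM)
      ultimately show ?thesis by simp
    next
      case 3
      have "A \<times> {0..1} \<inter> {z. Q (fst z) (snd z) < t} = A \<times> {0..1}" using 3 by (auto simp: Qless)
      moreover have "W {..<t} \<inter> A \<times> K = A \<times> K" using 3 inv(2) A01 by (fastforce simp: W_def spM)
      moreover have "emeasure \<nu> (A \<times> {0..1}) = emeasure M (A \<times> K)"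
      proof -
        have "Pair x -` (A \<times> {0..1}) = (if x \<in> A then {0..1} else {})" for x :: real by auto
        then have "emeasure \<nu> (A \<times> {0..1}) = (\<integral>\<^sup>+x\<in>A. ennreal (\<phi> x) \<partial>unit_leb)"
          unfolding em\<nu>[OF A2] by (intro nn_integral_cong) (auto simp: emeasure_unit_leb)
        then show ?thesis using int\<phi>'[OF A] by simp
      qed
      ultimately show ?thesis by simp
    next
      case 2
      define D where "D = {q. 0 \<le> q \<and> real_of_rat q < t}"
      have cD: "countable D" by simp
      have D0: "0 \<in> D" using 2 by (simp add: D_def)
      \<comment> \<open>Running maxima of an enumeration of \<open>D\<close>: an increasing sequence
        cofinal in the rationals of [0,t), so that both events become increasing unions and
        continuity from below applies.\<close>
      define r where "r n = Max (from_nat_into D ` {..n})" for n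
      have rD: "r n \<in> D" for n
      proof -
        have "r n \<in> from_nat_into D ` {..n}" unfolding r_def by (rule Max_in) auto
        moreover have "from_nat_into D k \<in> D" for k using from_nat_into[of D k] D0 by blast
        ultimately show ?thesis by auto
      qed
      have rmono: "r m \<le> r n" if "m \<le> n" for m n
        unfolding r_def using that by (intro Max_mono) auto
      have rcof: "\<exists>n. q \<le> r n" if "q \<in> D" for q
      proof -
        obtain n where "from_nat_into D n = q" using from_nat_into_surj[OF cD \<open>q \<in> D\<close>] by auto
        then show ?thesis unfolding r_def by (intro exI[of _ n] Max_ge) auto
      qed
      have D2: "q < 2" if "q \<in> D" for q
      proof -
        have "real_of_rat q < real_of_rat 2" using that 2 by (simp add: D_def)
        then show ?thesis using of_rat_less by blast
      qed
      let ?E = "\<lambda>n. A \<times> {0..1} \<inter> {z. snd z * \<phi> (fst z) \<le> F (r n) (fst z)}"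
      have EQ: "A \<times> {0..1} \<inter> {z. Q (fst z) (snd z) < t} = (\<Union>n. ?E n)"
      proof -
        have "Q x u < t \<longleftrightarrow> (\<exists>n. u * \<phi> x \<le> F (r n) x)" for x u
        proof
          assume "Q x u < t"
          then obtain q where "q \<in> D" "u * \<phi> x \<le> F q x" using 2 by (auto simp: Qless D_def)
          then show "\<exists>n. u * \<phi> x \<le> F (r n) x" using rcof F(3) by (meson order_trans)
        next
          assume "\<exists>n. u * \<phi> x \<le> F (r n) x"
          then show "Q x u < t" using rD D2 unfolding Qless by (auto simp: D_def)
        qed
        then show ?thesis by auto
      qed
      have Em: "?E n \<in> sets ?UU" for n
      proof -
        have [measurable]: "snd \<in> borel_measurable ?UU"
          by (rule measurable_compose[OF measurable_snd borel_measurable_unit_lebI]) simp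
        have "{z \<in> space ?UU. snd z * \<phi> (fst z) \<le> F (r n) (fst z)} \<in> sets ?UU" by measurable
        then have "A \<times> {0..1} \<inter> {z \<in> space ?UU. snd z * \<phi> (fst z) \<le> F (r n) (fst z)} \<in> sets ?UU"
          using A2 by auto
        moreover have "A \<times> {0..1} \<inter> {z \<in> space ?UU. snd z * \<phi> (fst z) \<le> F (r n) (fst z)} = ?E n"
          using A01 by (auto simp: space_pair_measure)
        ultimately show ?thesis by simp
      qed
      have incE: "incseq ?E"
      proof (rule incseq_SucI, rule Int_mono[OF order_refl], rule subsetI)
        fix n z assume "z \<in> {z. snd z * \<phi> (fst z) \<le> F (r n) (fst z)}"
        moreover have "F (r n) (fst z) \<le> F (r (Suc n)) (fst z)" using F(3) rmono by simp
        ultimately show "z \<in> {z. snd z * \<phi> (fst z) \<le> F (r (Suc n)) (fst z)}" by auto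
      qed
      have emE: "emeasure \<nu> (?E n) = emeasure M (W {..<real_of_rat (r n)} \<inter> A \<times> K)" for n
      proof -
        have sl: "Pair x -` ?E n = (if x \<in> A then {u \<in> {0..1}. u * \<phi> x \<le> F (r n) x} else {})" for x by auto
        have "emeasure \<nu> (?E n) = (\<integral>\<^sup>+x\<in>A. ennreal (F (r n) x) \<partial>unit_leb)"
          unfolding em\<nu>[OF Em] sl using finite_slice by (intro nn_integral_cong) (simp add: indicator_def)
        then show ?thesis using intF'[OF A] by simp
      qed
      have "emeasure \<nu> (\<Union>n. ?E n) = (SUP n. emeasure \<nu> (?E n))"
        using Em incE by (intro SUP_emeasure_incseq[symmetric]) (auto simp: sets\<nu>)
      also have "\<dots> = (SUP n. emeasure M (W {..<real_of_rat (r n)} \<inter> A \<times> K))" by (simp add: emE)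
      also have "\<dots> = emeasure M (\<Union>n. W {..<real_of_rat (r n)} \<inter> A \<times> K)"
      proof (rule SUP_emeasure_incseq)
        show "range (\<lambda>n. W {..<real_of_rat (r n)} \<inter> A \<times> K) \<subseteq> sets M" using vert[OF A] by auto
        show "incseq (\<lambda>n. W {..<real_of_rat (r n)} \<inter> A \<times> K)"
        proof (rule incseq_SucI, rule Int_mono[OF _ order_refl])
          fix n have "real_of_rat (r n) \<le> real_of_rat (r (Suc n))" using rmono[of n "Suc n"] by (simp add: of_rat_less_eq)
          then show "W {..<real_of_rat (r n)} \<subseteq> W {..<real_of_rat (r (Suc n))}" by (auto simp: W_def)
        qed
      qed
      also have "(\<Union>n. W {..<real_of_rat (r n)} \<inter> A \<times> K) = W {..<t} \<inter> A \<times> K"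
      proof -
        have "\<psi> y < t \<longleftrightarrow> (\<exists>n. \<psi> y < real_of_rat (r n))" if "y \<in> K" for y
        proof
          assume "\<psi> y < t"
          then obtain q where q: "\<psi> y < real_of_rat q" "real_of_rat q < t" using of_rat_dense by blast
          have "0 \<le> real_of_rat q" using q inv(2)[OF \<open>y \<in> K\<close>] unfolding atLeastAtMost_iff by linarith
          then have "q \<in> D" using q by (simp add: D_def)
          then obtain n where "q \<le> r n" using rcof by blast
          then have "real_of_rat q \<le> real_of_rat (r n)" by (simp add: of_rat_less_eq)
          then show "\<exists>n. \<psi> y < real_of_rat (r n)" using q by (intro exI[of _ n]) linarith
        next
          assume "\<exists>n. \<psi> y < real_of_rat (r n)"
          then show "\<psi> y < t" using rD by (auto simp: D_def intro: less_trans)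
        qed
        then show ?thesis by (auto simp: W_def)
      qed
      finally show ?thesis by (simp add: EQ)
    qed
  qed
  let ?P = "unit_leb \<Otimes>\<^sub>M (borel :: real measure)"
  define f1 :: "real \<times> 'k \<Rightarrow> real \<times> real" where "f1 = (\<lambda>z. (fst z, \<psi> (snd z)))"
  define f2 :: "real \<times> real \<Rightarrow> real \<times> real" where "f2 = (\<lambda>z. (fst z, Q (fst z) (snd z)))"
  have f1[measurable]: "f1 \<in> measurable M ?P" unfolding f1_def by measurable
  have f2: "f2 \<in> measurable ?UU ?P" unfolding f2_def using Qm by (simp add: split_beta)
  have f2\<nu>: "f2 \<in> measurable \<nu> ?P" using f2 by (simp add: \<nu>_def)
  have rect: "emeasure M (W B \<inter> A \<times> K) = emeasure \<nu> (A \<times> {0..1} \<inter> {z. Q (fst z) (snd z) \<in> B})"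
    if A: "A \<in> sets unit_leb" and B: "B \<in> sets borel" for A B
  proof -
    have A01: "A \<subseteq> {0..1}" using sets.sets_into_space[OF A] by simp
    have A2: "A \<times> {0..1} \<in> sets \<nu>" unfolding sets\<nu> using A sets.top[of unit_leb] by (intro pair_measureI) auto
    have sp\<nu>: "space \<nu> = {0..1} \<times> {0..1}" by (simp add: \<nu>_def space_pair_measure)
    define N1 where "N1 = distr (density M (indicator (A \<times> K))) borel (\<lambda>z. \<psi> (snd z))"
    define N2 where "N2 = distr (density \<nu> (indicator (A \<times> {0..1}))) borel (\<lambda>(x, u). Q x u)"
    have e1: "emeasure N1 B = emeasure M (W B \<inter> A \<times> K)" if "B \<in> sets borel" for B
    proof -
      have "emeasure N1 B = emeasure (density M (indicator (A \<times> K))) (W B)"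
        unfolding N1_def using that by (subst emeasure_distr) (auto simp: W_def vimage_def Int_def conj_commute)
      then show ?thesis using that vert[OF A] W[OF that]
        by (simp add: emeasure_density indicator_inter_arith[symmetric] Int_commute)
    qed
    have e2: "emeasure N2 B = emeasure \<nu> (A \<times> {0..1} \<inter> {z. Q (fst z) (snd z) \<in> B})" if "B \<in> sets borel" for B
    proof -
      have s: "(\<lambda>(x, u). Q x u) -` B \<inter> space \<nu> \<in> sets \<nu>" by (rule measurable_sets[OF Qm\<nu> that])
      have "emeasure N2 B = emeasure (density \<nu> (indicator (A \<times> {0..1}))) ((\<lambda>(x, u). Q x u) -` B \<inter> space \<nu>)"
        unfolding N2_def using that Qm\<nu> by (subst emeasure_distr) auto
      also have "\<dots> = emeasure \<nu> (A \<times> {0..1} \<inter> ((\<lambda>(x, u). Q x u) -` B \<inter> space \<nu>))"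
        using s A2 by (simp add: emeasure_density indicator_inter_arith[symmetric])
      also have "A \<times> {0..1} \<inter> ((\<lambda>(x, u). Q x u) -` B \<inter> space \<nu>) = A \<times> {0..1} \<inter> {z. Q (fst z) (snd z) \<in> B}"
        using A01 by (auto simp: sp\<nu>)
      finally show ?thesis .
    qed
    have "N1 = N2"
    proof (rule finite_borel_eqI_lessThan)
      show "finite_measure N1"
        by (rule finite_measureI) (simp add: N1_def, simp add: e1[unfolded N1_def] M.emeasure_finite)
      fix t show "emeasure N1 {..<t} = emeasure N2 {..<t}"
        using key[OF A, of t] by (simp add: e1 e2 lessThan_def)
    qed (simp_all add: N1_def N2_def)
    then show ?thesis using e1[OF B] e2[OF B] by simp
  qed
  \<comment> \<open>It suffices to compare rectangles, which are stable under intersection. The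
    comparison takes place in real coordinates; the decoder is applied only afterwards.\<close>
  have distr_eq: "distr M ?P f1 = distr \<nu> ?P f2"
  proof (rule measure_eqI_generator_eq[where E = "{A \<times> B | A B. A \<in> sets unit_leb \<and> B \<in> sets (borel :: real measure)}"
        and \<Omega> = "space unit_leb \<times> space borel" and A = "\<lambda>_. space unit_leb \<times> space borel"])
    show "Int_stable {A \<times> B | A B. A \<in> sets unit_leb \<and> B \<in> sets (borel :: real measure)}"
      by (rule Int_stable_pair_measure_generator)
    show "{A \<times> B | A B. A \<in> sets unit_leb \<and> B \<in> sets (borel :: real measure)} \<subseteq> Pow (space unit_leb \<times> space borel)"
      by (rule pair_measure_closed)
    show "sets (distr M ?P f1) = sigma_sets (space unit_leb \<times> space borel) {A \<times> B | A B. A \<in> sets unit_leb \<and> B \<in> sets (borel :: real measure)}"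
      "sets (distr \<nu> ?P f2) = sigma_sets (space unit_leb \<times> space borel) {A \<times> B | A B. A \<in> sets unit_leb \<and> B \<in> sets (borel :: real measure)}"
      by (simp_all add: sets_pair_measure)
    show "range (\<lambda>_. space unit_leb \<times> space borel) \<subseteq> {A \<times> B | A B. A \<in> sets unit_leb \<and> B \<in> sets (borel :: real measure)}"
      using sets.top[of unit_leb] sets.top[of "borel :: real measure"] by blast
    show "(\<Union>i. space unit_leb \<times> space borel) = space unit_leb \<times> (space borel :: real set)" by simp
    interpret d: finite_measure "distr M ?P f1" by (rule M.finite_measure_distr[OF f1])
    show "emeasure (distr M ?P f1) (space unit_leb \<times> space borel) \<noteq> \<infinity>" by (simp add: d.emeasure_finite)
    fix X assume "X \<in> {A \<times> B | A B. A \<in> sets unit_leb \<and> B \<in> sets (borel :: real measure)}"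
    then obtain A B where X: "X = A \<times> B" and A: "A \<in> sets unit_leb" and B: "B \<in> sets borel" by blast
    have A01: "A \<subseteq> {0..1}" using sets.sets_into_space[OF A] by simp
    have sX: "X \<in> sets ?P" unfolding X using A B by (rule pair_measureI)
    have "f1 -` X \<inter> space M = W B \<inter> A \<times> K" using A01 by (auto simp: X f1_def W_def spM)
    moreover have "f2 -` X \<inter> space \<nu> = A \<times> {0..1} \<inter> {z. Q (fst z) (snd z) \<in> B}"
      using A01 by (auto simp: X f2_def \<nu>_def space_pair_measure)
    ultimately show "emeasure (distr M ?P f1) X = emeasure (distr \<nu> ?P f2) X"
      using rect[OF A B] by (simp add: emeasure_distr[OF f1 sX] emeasure_distr[OF f2\<nu> sX])
  qed
  define \<kappa> where "\<kappa> x = distr unit_leb ?S (\<lambda>u. (x, \<theta> (Q x u)))" for x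
  have Tm: "(\<lambda>(x, u). (x, \<theta> (Q x u))) \<in> measurable ?UU ?S"
  proof -
    have "(\<lambda>z. (fst z, \<theta> ((\<lambda>(x, u). Q x u) z))) \<in> measurable ?UU (unit_leb \<Otimes>\<^sub>M ?BK)"
      by (intro measurable_Pair measurable_fst measurable_compose[OF Qm theta])
    then show ?thesis using measurable_cong_sets[OF refl sets_Sigma_borel_pair[OF K], of ?UU] by (simp add: split_beta)
  qed
  have Tx: "(\<lambda>u. (x, \<theta> (Q x u))) \<in> measurable unit_leb ?S" if "x \<in> {0..1}" for x
    using measurable_compose[OF measurable_Pair1', of x unit_leb, OF _ Tm] that by simp
  have "is_disintegration K M \<kappa>"
    unfolding is_disintegration_def
  proof (intro conjI ballI)
    show "\<kappa> \<in> measurable unit_leb (prob_algebra ?S)"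
    proof (rule measurable_prob_algebraI)
      show "prob_space (\<kappa> x)" if "x \<in> space unit_leb" for x
        unfolding \<kappa>_def using that by (intro U.prob_space_distr Tx) simp
      have c: "(\<lambda>_. unit_leb) \<in> measurable unit_leb (subprob_algebra unit_leb)"
        using U.subprob_space_axioms by (intro measurable_const) (simp add: space_subprob_algebra)
      show "\<kappa> \<in> measurable unit_leb (subprob_algebra ?S)"
        unfolding \<kappa>_def by (rule measurable_distr2[OF Tm c])
    qed
    fix x :: real assume x: "x \<in> {0..1}"
    have sx: "{x} \<times> K \<in> sets ?S"
    proof (rule sets_Sigma_vertical)
      have "{x} \<inter> {0..1} \<in> sets (restrict_space borel {0..1})" by (rule Int_in_sets_restrict_space) simp
      then show "{x} \<in> sets unit_leb" using x by (simp add: sets_unit_leb)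
    qed
    have "(\<lambda>u. (x, \<theta> (Q x u))) -` ({x} \<times> K) \<inter> space unit_leb = space unit_leb"
      using measurable_space[OF theta] by (auto simp: space_restrict_space)
    then show "emeasure (\<kappa> x) ({x} \<times> K) = 1"
      unfolding \<kappa>_def using U.emeasure_space_1 by (simp add: emeasure_distr[OF Tx[OF x] sx])
  next
    fix E assume E: "E \<in> sets ?S"
    define f3 where "f3 = (\<lambda>z :: real \<times> real. (fst z, \<theta> (snd z)))"
    have f3: "f3 \<in> measurable ?P ?S"
    proof -
      have "f3 \<in> measurable ?P (unit_leb \<Otimes>\<^sub>M ?BK)" unfolding f3_def by measurable
      then show ?thesis using measurable_cong_sets[OF refl sets_Sigma_borel_pair[OF K], of ?P] by simp
    qed
    have EM: "E \<in> sets M" using E by (simp add: M(2))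
    have s3: "f3 -` E \<inter> space ?P \<in> sets ?P" by (rule measurable_sets[OF f3 E])
    have sE: "(\<lambda>(x, u). (x, \<theta> (Q x u))) -` E \<inter> space ?UU \<in> sets ?UU" by (rule measurable_sets[OF Tm E])
    have "f1 -` (f3 -` E \<inter> space ?P) \<inter> space M = E"
      using sets.sets_into_space[OF E] inv(1) by (auto simp: f1_def f3_def spM space_pair_measure)
    then have "emeasure M E = emeasure (distr M ?P f1) (f3 -` E \<inter> space ?P)"
      by (simp add: emeasure_distr[OF f1 s3])
    also have "\<dots> = emeasure \<nu> (f2 -` (f3 -` E \<inter> space ?P) \<inter> space \<nu>)"
      unfolding distr_eq by (rule emeasure_distr[OF f2\<nu> s3])
    also have "f2 -` (f3 -` E \<inter> space ?P) \<inter> space \<nu> = (\<lambda>(x, u). (x, \<theta> (Q x u))) -` E \<inter> space ?UU"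
      by (auto simp: f2_def f3_def \<nu>_def space_pair_measure)
    also have "emeasure \<nu> \<dots> = (\<integral>\<^sup>+x. ennreal (\<phi> x) * emeasure unit_leb (Pair x -` ((\<lambda>(x, u). (x, \<theta> (Q x u))) -` E \<inter> space ?UU)) \<partial>unit_leb)"
      by (rule em\<nu>[OF sE])
    also have "\<dots> = (\<integral>\<^sup>+x. ennreal (\<phi> x) * emeasure (\<kappa> x) E \<partial>unit_leb)"
    proof (rule nn_integral_cong)
      fix x assume "x \<in> space unit_leb"
      then have x: "x \<in> {0..1}" by simp
      have "Pair x -` ((\<lambda>(x, u). (x, \<theta> (Q x u))) -` E \<inter> space ?UU) = (\<lambda>u. (x, \<theta> (Q x u))) -` E \<inter> space unit_leb"
        using x by (auto simp: space_pair_measure)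
      then show "ennreal (\<phi> x) * emeasure unit_leb (Pair x -` ((\<lambda>(x, u). (x, \<theta> (Q x u))) -` E \<inter> space ?UU)) =
         ennreal (\<phi> x) * emeasure (\<kappa> x) E"
        unfolding \<kappa>_def by (simp add: emeasure_distr[OF Tx[OF x] E])
    qed
    also have "\<dots> = (\<integral>\<^sup>+x. emeasure (\<kappa> x) E * ennreal (?\<phi> x) \<partial>unit_leb)"
      by (rule nn_integral_cong_AE, use AE\<phi> in eventually_elim) (simp add: mult.commute)
    finally show "emeasure M E = (\<integral>\<^sup>+x. emeasure (\<kappa> x) E * ennreal (?\<phi> x) \<partial>unit_leb)" .
  qed
  then show ?thesis by blast
qed

section \<open>The dual norm on fibres\<close>

lemma signed_measure_measure:
  assumes "finite_measure A" "sets A = sets S"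
  shows "signed_measure S (measure A)"
proof -
  have "signed_measure S (\<lambda>E. measure A E - measure (null_measure S) E)"
    using assms by (intro signed_measure_diff) (auto intro!: finite_measureI)
  moreover have "measure A E - measure (null_measure S) E = measure A E" for E
    by (simp add: measure_def)
  ultimately show ?thesis by simp
qed

lemma signed_measure_add:
  assumes "signed_measure S \<mu>" "signed_measure S \<nu>"
  shows "signed_measure S (\<mu> + \<nu>)"
  using assms unfolding signed_measure_def by (auto intro!: sums_add)

lemma signed_measure_scale:
  assumes "signed_measure S \<mu>"
  shows "signed_measure S (c *\<^sub>R \<mu>)"
  using assms unfolding signed_measure_def by (auto simp: scaleR_fun_def intro!: sums_mult)

lemma bounded_measurable_integrable:
  fixes h :: "'a \<Rightarrow> real"
  assumes "finite_measure M" "h \<in> borel_measurable M" "\<And>x. x \<in> space M \<Longrightarrow> \<bar>h x\<bar> \<le> B"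
  shows "integrable M h"
proof -
  interpret finite_measure M by fact
  show ?thesis using assms by (intro integrable_const_bound[of _ B]) auto
qed

lemma signed_integral_linear_integrand:
  assumes s: "signed_measure S \<mu>"
    and h: "h \<in> borel_measurable S" "\<And>x. x \<in> space S \<Longrightarrow> \<bar>h x\<bar> \<le> B"
    and k: "k \<in> borel_measurable S" "\<And>x. x \<in> space S \<Longrightarrow> \<bar>k x\<bar> \<le> C"
  shows "signed_integral S \<mu> (\<lambda>x. h x + c * k x) = signed_integral S \<mu> h + c * signed_integral S \<mu> k"
proof -
  have "integrable (pos_part S \<mu>) h" "integrable (neg_part S \<mu>) h"
    "integrable (pos_part S \<mu>) k" "integrable (neg_part S \<mu>) k"
    using h k finite_measure_pos_part[OF s] finite_measure_neg_part[OF s]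
    by (auto intro: bounded_measurable_integrable[where B = B] bounded_measurable_integrable[where B = C])
  then show ?thesis unfolding signed_integral_def by (simp add: algebra_simps)
qed

lemma signed_integral_add:
  assumes s: "signed_measure S \<mu>" "signed_measure S \<nu>"
    and h: "h \<in> borel_measurable S" "\<And>x. x \<in> space S \<Longrightarrow> \<bar>h x\<bar> \<le> B"
  shows "signed_integral S (\<mu> + \<nu>) h = signed_integral S \<mu> h + signed_integral S \<nu> h"
proof -
  let ?M = "\<lambda>j :: nat. if j = 0 then pos_part S \<mu> else if j = 1 then neg_part S \<mu> else if j = 2 then pos_part S \<nu> else neg_part S \<nu>"
  let ?c = "\<lambda>j :: nat. if j = 0 \<or> j = 2 then 1 else -1 :: real"
  have "signed_integral S (\<mu> + \<nu>) h = (\<Sum>j\<in>{0,1,2,3}. ?c j * integral\<^sup>L (?M j) h)"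
  proof (rule signed_integral_eq[OF signed_measure_add[OF s] _ _ _ _ h])
    fix E assume "E \<in> sets S"
    show "(\<mu> + \<nu>) E = (\<Sum>j\<in>{0,1,2,3}. ?c j * measure (?M j) E)"
      using jordan_decomposition[OF s(1), of E] jordan_decomposition[OF s(2), of E] by simp
  qed (use s finite_measure_pos_part finite_measure_neg_part in auto)
  then show ?thesis by (simp add: signed_integral_def)
qed

lemma signed_integral_scale:
  assumes s: "signed_measure S \<mu>"
    and h: "h \<in> borel_measurable S" "\<And>x. x \<in> space S \<Longrightarrow> \<bar>h x\<bar> \<le> B"
  shows "signed_integral S (c *\<^sub>R \<mu>) h = c * signed_integral S \<mu> h"
proof -
  let ?M = "\<lambda>j :: bool. if j then pos_part S \<mu> else neg_part S \<mu>"
  let ?c = "\<lambda>j :: bool. if j then c else - c"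
  have "signed_integral S (c *\<^sub>R \<mu>) h = (\<Sum>j\<in>{True, False}. ?c j * integral\<^sup>L (?M j) h)"
  proof (rule signed_integral_eq[OF signed_measure_scale[OF s] _ _ _ _ h])
    fix E assume "E \<in> sets S"
    show "(c *\<^sub>R \<mu>) E = (\<Sum>j\<in>{True, False}. ?c j * measure (?M j) E)"
      unfolding scaleR_fun_def jordan_decomposition[OF s, of E] by (simp add: algebra_simps)
  qed (use s finite_measure_pos_part finite_measure_neg_part in auto)
  then show ?thesis by (simp add: signed_integral_def algebra_simps)
qed

lemma signed_measure_push_forward:
  assumes s: "signed_measure S \<mu>" and F: "F \<in> measurable S S"
  shows "signed_measure S (push_forward S F \<mu>)"
  unfolding signed_measure_def
proof (intro conjI allI impI)
  fix X :: "nat \<Rightarrow> 'a set" assume X: "range X \<subseteq> sets S" "disjoint_family X"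
  have "(\<lambda>n. \<mu> (F -` X n \<inter> space S)) sums \<mu> (\<Union>n. F -` X n \<inter> space S)"
    using X measurable_sets[OF F] by (intro signed_measure_sums[OF s]) (auto simp: disjoint_family_on_def)
  moreover have "(\<Union>n. F -` X n \<inter> space S) = F -` (\<Union>n. X n) \<inter> space S" by auto
  ultimately show "(\<lambda>n. push_forward S F \<mu> (X n)) sums push_forward S F \<mu> (\<Union>n. X n)"
    using X by (auto simp: push_forward_def image_subset_iff)
qed (simp add: push_forward_def)

lemma signed_integral_push_forward:
  assumes s: "signed_measure S \<mu>" and F: "F \<in> measurable S S"
    and h: "h \<in> borel_measurable S" "\<And>x. x \<in> space S \<Longrightarrow> \<bar>h x\<bar> \<le> B"
  shows "signed_integral S (push_forward S F \<mu>) h = signed_integral S \<mu> (\<lambda>x. h (F x))"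
proof -
  let ?M = "\<lambda>j :: bool. if j then distr (pos_part S \<mu>) S F else distr (neg_part S \<mu>) S F"
  let ?c = "\<lambda>j :: bool. if j then 1 else - 1 :: real"
  have "signed_integral S (push_forward S F \<mu>) h = (\<Sum>j\<in>{True, False}. ?c j * integral\<^sup>L (?M j) h)"
  proof (rule signed_integral_eq[OF signed_measure_push_forward[OF s F] _ _ _ _ h])
    fix E assume E: "E \<in> sets S"
    show "push_forward S F \<mu> E = (\<Sum>j\<in>{True, False}. ?c j * measure (?M j) E)"
      using E F jordan_decomposition[OF s, of "F -` E \<inter> space S"]
      by (simp add: push_forward_def measure_distr)
  qed (use F finite_measure_pos_part[OF s] finite_measure_neg_part[OF s] in
      \<open>auto intro!: finite_measure.finite_measure_distr\<close>)
  then show ?thesis using F h by (simp add: signed_integral_def integral_distr)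
qed

text \<open>Stated through Jordan parts the condition is not visibly linear. Here it says that
  \<open>\<mu>\<close> vanishes on every measurable set above a null set, which is evidently
  preserved by sums, multiples and push-forwards over a nonsingular base map.\<close>

lemma AB_iff:
  "\<mu> \<in> AB K \<longleftrightarrow> signed_measure (Sigma_borel K) \<mu> \<and>
     (\<forall>A\<in>null_sets unit_leb. \<forall>X\<in>sets (Sigma_borel K). X \<subseteq> A \<times> K \<longrightarrow> \<mu> X = 0)"
  (is "_ \<longleftrightarrow> ?s \<and> ?null")
proof (cases ?s)
  case s: True
  let ?S = "Sigma_borel K"
  have "absolutely_continuous unit_leb (marginal (pos_part ?S \<mu>)) \<and>
      absolutely_continuous unit_leb (marginal (neg_part ?S \<mu>)) \<longleftrightarrow> ?null"
  proof (intro iffI ballI impI conjI)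
    fix A X assume ac: "absolutely_continuous unit_leb (marginal (pos_part ?S \<mu>)) \<and>
      absolutely_continuous unit_leb (marginal (neg_part ?S \<mu>))"
      and A: "A \<in> null_sets unit_leb" and X: "X \<in> sets ?S" "X \<subseteq> A \<times> K"
    have sA: "A \<in> sets unit_leb" using A by auto
    have 0: "measure M X = 0"
      if M: "absolutely_continuous unit_leb (marginal M)" "sets M = sets ?S" for M
    proof -
      have "emeasure M (A \<times> K) = 0"
      proof -
        have "A \<in> null_sets (marginal M)" using M(1) A unfolding absolutely_continuous_def by (rule subsetD)
        then show ?thesis using emeasure_marginal[OF M(2) sA] null_setsD1 by metis
      qed
      moreover have "emeasure M X \<le> emeasure M (A \<times> K)"
        using X(2) sets_Sigma_vertical[OF sA] by (intro emeasure_mono) (auto simp: M(2))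
      ultimately show ?thesis by (simp add: measure_def)
    qed
    show "\<mu> X = 0" using 0 ac jordan_decomposition[OF s, of X] by simp
  next
    assume n: ?null
    have "emeasure (pos_part ?S \<mu>) (A \<times> K) = 0 \<and> emeasure (neg_part ?S \<mu>) (A \<times> K) = 0"
      if A: "A \<in> null_sets unit_leb" for A
    proof -
      have "A \<times> K \<in> sets ?S" using A by (intro sets_Sigma_vertical) auto
      moreover have "A \<times> K \<inter> hahn_set ?S \<mu> \<in> sets ?S" "A \<times> K - hahn_set ?S \<mu> \<in> sets ?S"
        using calculation hahn_set_sets[OF s] by auto
      moreover have "\<mu> (A \<times> K \<inter> hahn_set ?S \<mu>) = 0" "\<mu> (A \<times> K - hahn_set ?S \<mu>) = 0"
        using n A calculation by auto
      ultimately show ?thesis by (simp add: emeasure_pos_part[OF s] emeasure_neg_part[OF s])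
    qed
    then have "emeasure (marginal (pos_part ?S \<mu>)) A = 0 \<and> emeasure (marginal (neg_part ?S \<mu>)) A = 0"
      if "A \<in> null_sets unit_leb" for A
      using emeasure_marginal[OF sets_pos_part[of ?S \<mu>] null_setsD2[OF that]]
        emeasure_marginal[OF sets_neg_part[of ?S \<mu>] null_setsD2[OF that]] that by simp
    then show "absolutely_continuous unit_leb (marginal (pos_part ?S \<mu>))"
      "absolutely_continuous unit_leb (marginal (neg_part ?S \<mu>))"
      unfolding absolutely_continuous_def by (auto intro!: null_setsI)
  qed
  then show ?thesis using s by (simp add: AB_def)
qed (simp add: AB_def)

lemma AB_signed_measure: "\<mu> \<in> AB K \<Longrightarrow> signed_measure (Sigma_borel K) \<mu>"
  by (simp add: AB_def)

lemma AB_add: "\<mu> \<in> AB K \<Longrightarrow> \<nu> \<in> AB K \<Longrightarrow> \<mu> + \<nu> \<in> AB K"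
  unfolding AB_iff by (auto intro!: signed_measure_add)

lemma AB_scale: "\<mu> \<in> AB K \<Longrightarrow> c *\<^sub>R \<mu> \<in> AB K"
  unfolding AB_iff using signed_measure_scale[of "Sigma_borel K" \<mu> c] by (auto simp: scaleR_fun_def)

lemma AB_parts:
  assumes "\<mu> \<in> AB K"
  shows "finite_measure (pos_part (Sigma_borel K) \<mu>)" "finite_measure (neg_part (Sigma_borel K) \<mu>)"
    "absolutely_continuous unit_leb (marginal (pos_part (Sigma_borel K) \<mu>))"
    "absolutely_continuous unit_leb (marginal (neg_part (Sigma_borel K) \<mu>))"
  using assms finite_measure_pos_part finite_measure_neg_part unfolding AB_def by auto

lemma integrable_signed_density:
  assumes "\<mu> \<in> AB K" shows "integrable unit_leb (signed_density K \<mu>)"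
  unfolding signed_density_def
  by (intro Bochner_Integration.integrable_diff integrable_marginal_density[where K = K] AB_parts[OF assms]) auto

lemma signed_density_integral:
  assumes "\<mu> \<in> AB K" "A \<in> sets unit_leb"
  shows "\<mu> (A \<times> K) = (LINT x:A|unit_leb. signed_density K \<mu> x)"
proof -
  have int: "set_integrable unit_leb A (marginal_density (pos_part (Sigma_borel K) \<mu>))"
     "set_integrable unit_leb A (marginal_density (neg_part (Sigma_borel K) \<mu>))"
    unfolding set_integrable_def using assms(2)
    by (intro integrable_mult_indicator integrable_marginal_density[where K = K] AB_parts[OF assms(1)]; simp)+
  show ?thesis
    unfolding signed_density_def set_integral_diff(2)[OF int]
    using jordan_decomposition[OF AB_signed_measure[OF assms(1)], of "A \<times> K"]
      measure_vertical[OF AB_parts(1)[OF assms(1)] _ AB_parts(3)[OF assms(1)] assms(2)]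
      measure_vertical[OF AB_parts(2)[OF assms(1)] _ AB_parts(4)[OF assms(1)] assms(2)]
    by simp
qed

text \<open>The Jordan parts of a sum or of an image are in general not the sums or images of the
  parts. Densities are therefore identified by the values of the measure on vertical sets
  \<open>A \<times> K\<close>.\<close>

lemma signed_density_unique:
  assumes "\<mu> \<in> AB K" "integrable unit_leb \<phi>"
    and "\<And>A. A \<in> sets unit_leb \<Longrightarrow> \<mu> (A \<times> K) = (LINT x:A|unit_leb. \<phi> x)"
  shows "AE x in unit_leb. signed_density K \<mu> x = \<phi> x"
proof -
  interpret prob_space unit_leb by (rule prob_space_unit_leb)
  have "AE x in unit_leb. signed_density K \<mu> x \<le> \<phi> x" "AE x in unit_leb. \<phi> x \<le> signed_density K \<mu> x"
    by (intro AE_le_if_set_integrals_le integrable_signed_density assms finite_measure_axioms;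
        simp add: assms(3)[symmetric] signed_density_integral[OF assms(1)])+
  then show ?thesis by eventually_elim simp
qed

lemma signed_density_add:
  assumes "\<mu> \<in> AB K" "\<nu> \<in> AB K"
  shows "AE x in unit_leb. signed_density K (\<mu> + \<nu>) x = signed_density K \<mu> x + signed_density K \<nu> x"
proof (rule signed_density_unique[OF AB_add[OF assms]])
  fix A assume A: "A \<in> sets unit_leb"
  then have "set_integrable unit_leb A (signed_density K \<mu>)" "set_integrable unit_leb A (signed_density K \<nu>)"
    unfolding set_integrable_def using assms by (auto intro!: integrable_mult_indicator integrable_signed_density simp del: real_scaleR_def)
  then show "(\<mu> + \<nu>) (A \<times> K) = (LINT x:A|unit_leb. signed_density K \<mu> x + signed_density K \<nu> x)"
    using A assms by (simp add: set_integral_add signed_density_integral)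
qed (use assms integrable_signed_density in auto)

lemma signed_density_scale:
  assumes "\<mu> \<in> AB K"
  shows "AE x in unit_leb. signed_density K (c *\<^sub>R \<mu>) x = c * signed_density K \<mu> x"
proof (rule signed_density_unique[OF AB_scale[OF assms]])
  fix A assume A: "A \<in> sets unit_leb"
  then show "(c *\<^sub>R \<mu>) (A \<times> K) = (LINT x:A|unit_leb. c * signed_density K \<mu> x)"
    using assms by (simp add: scaleR_fun_def signed_density_integral)
qed (use assms integrable_signed_density in auto)

text \<open>Stays on the product instead of projecting to \<open>K\<close>, so that the test
  function may vary with the base point.\<close>

definition fibre_integral ::
    "'k::metric_space set \<Rightarrow> ((real \<times> 'k) set \<Rightarrow> real) \<Rightarrow> (real \<times> 'k \<Rightarrow> real) \<Rightarrow> real \<Rightarrow> real" where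
  "fibre_integral K \<mu> H x =
     marginal_density (pos_part (Sigma_borel K) \<mu>) x * integral\<^sup>L (fibre_measure K (pos_part (Sigma_borel K) \<mu>) x) H -
     marginal_density (neg_part (Sigma_borel K) \<mu>) x * integral\<^sup>L (fibre_measure K (neg_part (Sigma_borel K) \<mu>) x) H"

lemma is_disintegration_fibre_measure:
  assumes "compact K" "K \<noteq> {}" "\<mu> \<in> AB K"
  shows "is_disintegration K (pos_part (Sigma_borel K) \<mu>) (fibre_measure K (pos_part (Sigma_borel K) \<mu>))"
    "is_disintegration K (neg_part (Sigma_borel K) \<mu>) (fibre_measure K (neg_part (Sigma_borel K) \<mu>))"
  unfolding fibre_measure_def
  using someI_ex[OF disintegration_exists[OF assms(1,2) AB_parts(1)[OF assms(3)] sets_pos_part AB_parts(3)[OF assms(3)]]]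
    someI_ex[OF disintegration_exists[OF assms(1,2) AB_parts(2)[OF assms(3)] sets_neg_part AB_parts(4)[OF assms(3)]]]
  by simp_all

lemma disintegrationD:
  assumes d: "is_disintegration K M \<kappa>" and x: "x \<in> {0..1}"
  shows "prob_space (\<kappa> x)" "sets (\<kappa> x) = sets (Sigma_borel K)" "AE z in \<kappa> x. fst z = x"
proof -
  have "\<kappa> x \<in> space (prob_algebra (Sigma_borel K))"
    using d x unfolding is_disintegration_def by (intro measurable_space[of \<kappa> unit_leb]) simp_all
  then show p: "prob_space (\<kappa> x)" and s: "sets (\<kappa> x) = sets (Sigma_borel K)"
    by (auto simp: space_prob_algebra)
  interpret prob_space "\<kappa> x" by (rule p)
  have e: "emeasure (\<kappa> x) ({x} \<times> K) = 1" using d x by (auto simp: is_disintegration_def)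
  then have "{x} \<times> K \<in> sets (\<kappa> x)" by (metis emeasure_notin_sets zero_neq_one)
  moreover from this have "prob ({x} \<times> K) = 1" using e by (simp add: emeasure_eq_measure)
  ultimately have "AE z in \<kappa> x. z \<in> {x} \<times> K" by (simp add: prob_eq_1)
  then show "AE z in \<kappa> x. fst z = x" by eventually_elim auto
qed

text \<open>\<open>M\<close> is the monadic bind of its marginal, written as a density, with the
  kernel. The formula is then the one for integrals of a bind, and boundedness of \<open>H\<close>
  supplies integrability.\<close>

lemma disintegration_integral:
  assumes M: "finite_measure M" "sets M = sets (Sigma_borel K)" "absolutely_continuous unit_leb (marginal M)"
    and d: "is_disintegration K M \<kappa>" and K: "K \<noteq> {}"
    and H: "H \<in> borel_measurable (Sigma_borel K)" "\<And>z. z \<in> {0..1} \<times> K \<Longrightarrow> \<bar>H z\<bar> \<le> B"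
  shows "integrable unit_leb (\<lambda>x. marginal_density M x * integral\<^sup>L (\<kappa> x) H)"
    "integral\<^sup>L M H = (LINT x|unit_leb. marginal_density M x * integral\<^sup>L (\<kappa> x) H)"
proof -
  let ?S = "Sigma_borel K"
  let ?D = "density unit_leb (\<lambda>x. ennreal (marginal_density M x))"
  have km: "\<kappa> \<in> measurable unit_leb (subprob_algebra ?S)"
    using d by (auto simp: is_disintegration_def intro: measurable_prob_algebraD)
  then have kD: "\<kappa> \<in> measurable ?D (subprob_algebra ?S)" by simp
  have im: "(\<lambda>x. integral\<^sup>L (\<kappa> x) H) \<in> borel_measurable unit_leb"
    by (rule measurable_compose[OF km integral_measurable_subprob_algebra[OF H(1)]])
  have spx: "space (\<kappa> x) = {0..1} \<times> K" if "x \<in> {0..1}" for x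
    using sets_eq_imp_space_eq[OF disintegrationD(2)[OF d that]] by simp
  have bd: "\<bar>integral\<^sup>L (\<kappa> x) H\<bar> \<le> B" if x: "x \<in> {0..1}" for x
  proof -
    interpret prob_space "\<kappa> x" by (rule disintegrationD[OF d x])
    have "integrable (\<kappa> x) H"
      using H disintegrationD(2)[OF d x] spx[OF x]
      by (intro bounded_measurable_integrable[where B = B] finite_measure_axioms) (auto cong: measurable_cong_sets)
    then have "norm (integral\<^sup>L (\<kappa> x) H) \<le> (LINT z|\<kappa> x. \<bar>H z\<bar>)"
      using integral_norm_bound[of "\<kappa> x" H] by simp
    also have "\<dots> \<le> (LINT z|\<kappa> x. B)"
      using \<open>integrable (\<kappa> x) H\<close> H spx[OF x] by (intro integral_mono) auto
    also have "\<dots> = B" by (simp add: prob_space)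
    finally show ?thesis by simp
  qed
  show "integrable unit_leb (\<lambda>x. marginal_density M x * integral\<^sup>L (\<kappa> x) H)"
  proof (rule Bochner_Integration.integrable_bound)
    show "integrable unit_leb (\<lambda>x. B * marginal_density M x)"
      using integrable_marginal_density[OF M] by simp
    show "AE x in unit_leb. norm (marginal_density M x * integral\<^sup>L (\<kappa> x) H) \<le> norm (B * marginal_density M x)"
    proof (rule AE_I2)
      fix x assume "x \<in> space unit_leb"
      then have "\<bar>integral\<^sup>L (\<kappa> x) H\<bar> \<le> \<bar>B\<bar>" using bd[of x] by simp
      then have "marginal_density M x * \<bar>integral\<^sup>L (\<kappa> x) H\<bar> \<le> marginal_density M x * \<bar>B\<bar>"
        by (intro mult_left_mono) auto
      then show "norm (marginal_density M x * integral\<^sup>L (\<kappa> x) H) \<le> norm (B * marginal_density M x)"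
        by (simp add: abs_mult mult.commute)
    qed
  qed (use im in measurable)
  have "M = ?D \<bind> \<kappa>"
  proof (rule measure_eqI)
    show sets: "sets M = sets (?D \<bind> \<kappa>)" using sets_bind[OF sets_kernel[OF kD], of ?D] M(2) by simp
    fix E assume "E \<in> sets M"
    then have E: "E \<in> sets ?S" by (simp add: M(2))
    have em: "(\<lambda>x. emeasure (\<kappa> x) E) \<in> borel_measurable unit_leb"
      by (rule measurable_compose[OF km measurable_emeasure_subprob_algebra[OF E]])
    have "emeasure (?D \<bind> \<kappa>) E = (\<integral>\<^sup>+x. emeasure (\<kappa> x) E \<partial>?D)"
      by (rule emeasure_bind[OF _ kD E]) simp
    also have "\<dots> = (\<integral>\<^sup>+x. emeasure (\<kappa> x) E * ennreal (marginal_density M x) \<partial>unit_leb)"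
      using em by (simp add: nn_integral_density mult.commute)
    also have "\<dots> = emeasure M E" using d E by (auto simp: is_disintegration_def)
    finally show "emeasure M E = emeasure (?D \<bind> \<kappa>) E" by simp
  qed
  then have "integral\<^sup>L M H = integral\<^sup>L (?D \<bind> \<kappa>) H" by simp
  also have "\<dots> = (LINT x|?D. integral\<^sup>L (\<kappa> x) H)"
  proof (rule integral_bind)
    show "finite_measure ?D"
    proof (rule finite_measureI)
      have "emeasure ?D (space ?D) = (\<integral>\<^sup>+x. ennreal (marginal_density M x) \<partial>unit_leb)"
        by (subst emeasure_density) (auto intro!: nn_integral_cong sets.top[of unit_leb, simplified])
      then show "emeasure ?D (space ?D) \<noteq> \<infinity>"
        using integrable_marginal_density[OF M] by (simp add: integrable_iff_bounded)
    qed
    show "AE x in ?D. emeasure (\<kappa> x) (space (\<kappa> x)) \<le> ennreal 1"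
      using disintegrationD(1)[OF d] by (intro AE_I2) (auto simp: prob_space.emeasure_space_1)
    show "\<bar>H z\<bar> \<le> B" if "z \<in> space ?S" for z using H(2)[of z] that by simp
  qed (use H kD in auto)
  also have "\<dots> = (LINT x|unit_leb. marginal_density M x * integral\<^sup>L (\<kappa> x) H)"
    using im by (subst integral_density) auto
  finally show "integral\<^sup>L M H = (LINT x|unit_leb. marginal_density M x * integral\<^sup>L (\<kappa> x) H)" .
qed

lemma signed_integral_fibre:
  assumes K: "compact K" "K \<noteq> {}" and \<mu>: "\<mu> \<in> AB K"
    and H: "H \<in> borel_measurable (Sigma_borel K)" "\<And>z. z \<in> {0..1} \<times> K \<Longrightarrow> \<bar>H z\<bar> \<le> B"
  shows "integrable unit_leb (fibre_integral K \<mu> H)"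
    "signed_integral (Sigma_borel K) \<mu> H = (LINT x|unit_leb. fibre_integral K \<mu> H x)"
  using disintegration_integral[OF AB_parts(1)[OF \<mu>] sets_pos_part AB_parts(3)[OF \<mu>] is_disintegration_fibre_measure(1)[OF K \<mu>] K(2) H]
    disintegration_integral[OF AB_parts(2)[OF \<mu>] sets_neg_part AB_parts(4)[OF \<mu>] is_disintegration_fibre_measure(2)[OF K \<mu>] K(2) H]
  unfolding fibre_integral_def signed_integral_def by auto

text \<open>The kernel at \<open>x\<close> is concentrated on the fibre over
  \<open>x\<close>.\<close>

lemma fibre_integral_cong:
  assumes K: "compact K" "K \<noteq> {}" and \<mu>: "\<mu> \<in> AB K" and x: "x \<in> {0..1}"
    and H: "H \<in> borel_measurable (Sigma_borel K)" "H' \<in> borel_measurable (Sigma_borel K)"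
    and eq: "\<And>y. y \<in> K \<Longrightarrow> H (x, y) = H' (x, y)"
  shows "fibre_integral K \<mu> H x = fibre_integral K \<mu> H' x"
proof -
  have "integral\<^sup>L (\<kappa> x) H = integral\<^sup>L (\<kappa> x) H'" if d: "is_disintegration K M \<kappa>" for M \<kappa>
  proof (rule integral_cong_AE)
    have s: "sets (\<kappa> x) = sets (Sigma_borel K)" by (rule disintegrationD[OF d x])
    show "H \<in> borel_measurable (\<kappa> x)" "H' \<in> borel_measurable (\<kappa> x)"
      using H by (simp_all cong: measurable_cong_sets add: measurable_cong_sets[OF s refl])
    have "AE z in \<kappa> x. z \<in> space (\<kappa> x)" by (rule AE_space)
    then show "AE z in \<kappa> x. H z = H' z"
      using disintegrationD(3)[OF d x] by eventually_elim (use eq sets_eq_imp_space_eq[OF s] in auto)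
  qed
  then show ?thesis unfolding fibre_integral_def
    using is_disintegration_fibre_measure[OF K \<mu>] by metis
qed

section \<open>Lipschitz test functions and the dual form of the fibre norm\<close>

definition unit_ball_Lip :: "'k::metric_space set \<Rightarrow> ('k \<Rightarrow> real) set" where
  "unit_ball_Lip K = {h. 1-lipschitz_on K h \<and> (\<forall>y\<in>K. \<bar>h y\<bar> \<le> 1)}"

lemma unit_ball_Lip_measurable:
  "h \<in> unit_ball_Lip K \<Longrightarrow> h \<in> borel_measurable (restrict_space borel K)"
  unfolding unit_ball_Lip_def
  by (auto intro!: borel_measurable_continuous_on_restrict lipschitz_on_continuous_on)

lemma signed_integral_fibre_restr:
  assumes K: "compact K" "K \<noteq> {}" and \<mu>: "\<mu> \<in> AB K" and x: "x \<in> {0..1}"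
    and h: "h \<in> borel_measurable (restrict_space borel K)" "\<And>y. y \<in> K \<Longrightarrow> \<bar>h y\<bar> \<le> B"
  shows "signed_integral (restrict_space borel K) (fibre_restr K \<mu> x) h = fibre_integral K \<mu> (\<lambda>z. h (snd z)) x"
proof -
  let ?BK = "restrict_space borel K" and ?S = "Sigma_borel K"
  let ?kp = "fibre_measure K (pos_part ?S \<mu>) x" and ?kn = "fibre_measure K (neg_part ?S \<mu>) x"
  let ?M = "\<lambda>j :: bool. if j then distr ?kp ?BK snd else distr ?kn ?BK snd"
  let ?c = "\<lambda>j :: bool. if j then marginal_density (pos_part ?S \<mu>) x else - marginal_density (neg_part ?S \<mu>) x"
  note d = is_disintegration_fibre_measure[OF K \<mu>]
  have sp: "snd \<in> measurable ?kp ?BK" "snd \<in> measurable ?kn ?BK"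
    using snd_measurable_Sigma[of K] measurable_cong_sets[OF disintegrationD(2)[OF d(1) x] refl]
      measurable_cong_sets[OF disintegrationD(2)[OF d(2) x] refl] by auto
  have fin: "finite_measure (distr ?kp ?BK snd)" "finite_measure (distr ?kn ?BK snd)"
    by (intro finite_measure.finite_measure_distr prob_space.finite_measure sp
        disintegrationD(1)[OF d(1) x] disintegrationD(1)[OF d(2) x])+
  have eq: "fibre_restr K \<mu> x = (marginal_density (pos_part ?S \<mu>) x *\<^sub>R measure (distr ?kp ?BK snd)) +
     (- marginal_density (neg_part ?S \<mu>) x *\<^sub>R measure (distr ?kn ?BK snd))"
    by (auto simp: fibre_restr_def fibre_restr_pos_def scaleR_fun_def)
  have sm: "signed_measure ?BK (fibre_restr K \<mu> x)"
    unfolding eq by (intro signed_measure_add signed_measure_scale signed_measure_measure fin) auto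
  have "signed_integral ?BK (fibre_restr K \<mu> x) h = (\<Sum>j\<in>{True, False}. ?c j * integral\<^sup>L (?M j) h)"
  proof (rule signed_integral_eq[OF sm _ _ _ _ h(1)])
    show "(fibre_restr K \<mu> x) E = (\<Sum>j\<in>{True, False}. ?c j * measure (?M j) E)" for E
      by (simp add: eq scaleR_fun_def)
    show "\<bar>h y\<bar> \<le> B" if "y \<in> space ?BK" for y using h(2) that by (simp add: space_restrict_space)
  qed (use fin in auto)
  then show ?thesis using sp h by (simp add: fibre_integral_def integral_distr)
qed

lemma W_norm_fibre:
  assumes K: "compact K" "K \<noteq> {}" and \<mu>: "\<mu> \<in> AB K" and x: "x \<in> {0..1}"
  shows "W_norm K (fibre_restr K \<mu> x) = (SUP h\<in>unit_ball_Lip K. ennreal \<bar>fibre_integral K \<mu> (\<lambda>z. h (snd z)) x\<bar>)"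
  unfolding W_norm_def unit_ball_Lip_def[symmetric]
proof (rule SUP_cong[OF refl])
  fix h assume h: "h \<in> unit_ball_Lip K"
  have "signed_integral (restrict_space borel K) (fibre_restr K \<mu> x) h = fibre_integral K \<mu> (\<lambda>z. h (snd z)) x"
    by (rule signed_integral_fibre_restr[OF K \<mu> x unit_ball_Lip_measurable[OF h], of 1])
       (use h in \<open>auto simp: unit_ball_Lip_def\<close>)
  then show "ennreal \<bar>signed_integral (restrict_space borel K) (fibre_restr K \<mu> x) h\<bar> =
      ennreal \<bar>fibre_integral K \<mu> (\<lambda>z. h (snd z)) x\<bar>" by simp
qed

lemma snd_measurable_fun:
  assumes "h \<in> borel_measurable (restrict_space borel K)"
  shows "(\<lambda>z. h (snd z)) \<in> borel_measurable (Sigma_borel K)"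
  by (rule measurable_compose[OF snd_measurable_Sigma assms])

text \<open>On each good fibre \<open>H\<close> is one of the competitors in the supremum defining
  \<open>W_norm\<close>. The Lipschitz condition is asked on almost every fibre, because the
  contraction in \<open>H1\<close> holds almost everywhere.\<close>

lemma signed_integral_le_L1:
  assumes K: "compact K" "K \<noteq> {}" and \<mu>: "\<mu> \<in> AB K"
    and H: "H \<in> borel_measurable (Sigma_borel K)" "\<And>z. z \<in> {0..1} \<times> K \<Longrightarrow> \<bar>H z\<bar> \<le> B"
    and Lip: "AE x in unit_leb. (\<lambda>y. H (x, y)) \<in> unit_ball_Lip K"
  shows "ennreal \<bar>signed_integral (Sigma_borel K) \<mu> H\<bar> \<le> L1_enorm K \<mu>"
proof -
  have int: "integrable unit_leb (fibre_integral K \<mu> H)" by (rule signed_integral_fibre(1)[OF K \<mu> H])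
  have eq: "signed_integral (Sigma_borel K) \<mu> H = (LINT x|unit_leb. fibre_integral K \<mu> H x)"
    by (rule signed_integral_fibre(2)[OF K \<mu> H])
  have "ennreal \<bar>signed_integral (Sigma_borel K) \<mu> H\<bar> \<le> (\<integral>\<^sup>+x. ennreal \<bar>fibre_integral K \<mu> H x\<bar> \<partial>unit_leb)"
    using integral_norm_bound_ennreal[OF int] by (simp add: eq)
  also have "\<dots> \<le> L1_enorm K \<mu>"
    unfolding L1_enorm_def
  proof (rule nn_integral_mono_AE)
    have "AE x in unit_leb. x \<in> space unit_leb" by (rule AE_space)
    with Lip show "AE x in unit_leb. ennreal \<bar>fibre_integral K \<mu> H x\<bar> \<le> W_norm K (fibre_restr K \<mu> x)"
    proof eventually_elim
      case (elim x)
      then have x: "x \<in> {0..1}" by simp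
      have "fibre_integral K \<mu> H x = fibre_integral K \<mu> (\<lambda>z. H (x, snd z)) x"
        using snd_measurable_fun[OF unit_ball_Lip_measurable[OF elim(1)]]
        by (intro fibre_integral_cong[OF K \<mu> x H(1)]) auto
      then show ?case unfolding W_norm_fibre[OF K \<mu> x] using elim(1)
        by (auto intro!: SUP_upper2[of "\<lambda>y. H (x, y)"])
    qed
  qed
  finally show ?thesis .
qed

lemma unit_ball_Lip_uminus_sgn:
  assumes "h \<in> unit_ball_Lip K" shows "(\<lambda>y. sgn c * h y) \<in> unit_ball_Lip K"
proof -
  have "\<bar>sgn c\<bar> \<le> (1::real)" by (simp add: sgn_if)
  then have *: "dist (sgn c * h x) (sgn c * h y) \<le> dist (h x) (h y)" "\<bar>sgn c * h x\<bar> \<le> \<bar>h x\<bar>" for x y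
    by (auto simp: dist_real_def right_diff_distrib[symmetric] abs_mult mult_left_le_one_le)
  show ?thesis using assms unfolding unit_ball_Lip_def lipschitz_on_def
    by (auto intro: order_trans[OF *(1)] order_trans[OF *(2)])
qed

text \<open>McShane extensions of rational data on finite sets.\<close>

lemma unit_ball_Lip_separable:
  fixes K :: "'k::metric_space set"
  assumes K: "compact K" "K \<noteq> {}"
  shows "\<exists>h :: nat \<Rightarrow> 'k \<Rightarrow> real. (\<forall>n. h n \<in> unit_ball_Lip K) \<and>
     (\<forall>k\<in>unit_ball_Lip K. \<forall>e>0. \<exists>n. \<forall>y\<in>K. \<bar>k y - h n y\<bar> \<le> e)"
proof -
  obtain d :: "nat \<Rightarrow> 'k" where d: "range d \<subseteq> K" "\<And>y e. y \<in> K \<Longrightarrow> e > 0 \<Longrightarrow> \<exists>n. dist y (d n) < e"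
    using compact_dense_sequence[OF K] by metis
  define M where "M l y = Min ((\<lambda>(q, j). of_rat q + dist y (d j)) ` set l)" for l :: "(rat \<times> nat) list" and y
  define h where "h l y = (if l = [] then 0 else max (-1) (min 1 (M l y)))" for l y
  have M_lip: "M l x \<le> M l y + dist x y" if "l \<noteq> []" for l x y
  proof -
    have "M l y \<in> (\<lambda>(q, j). of_rat q + dist y (d j)) ` set l"
      unfolding M_def using that by (intro Min_in) auto
    then obtain q j where qj: "(q, j) \<in> set l" "M l y = of_rat q + dist y (d j)" by auto
    have "M l x \<le> of_rat q + dist x (d j)"
      unfolding M_def using qj(1) by (intro Min_le) force+
    also have "\<dots> \<le> of_rat q + (dist x y + dist y (d j))" by (simp add: dist_triangle)
    finally show ?thesis using qj by simp
  qed
  have h_lip: "h l x \<le> h l y + dist x y" for l x y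
  proof (cases "l = []")
    case False
    then show ?thesis using M_lip[of l x y] zero_le_dist[of x y]
      unfolding h_def min_def max_def by (smt (verit))
  qed (simp add: h_def)
  have hl: "h l \<in> unit_ball_Lip K" for l
    unfolding unit_ball_Lip_def lipschitz_on_def
  proof (intro CollectI conjI ballI)
    fix x y
    show "dist (h l x) (h l y) \<le> 1 * dist x y"
      using h_lip[of l x y] h_lip[of l y x] by (simp add: dist_real_def dist_commute abs_le_iff)
    show "\<bar>h l y\<bar> \<le> 1" by (auto simp: h_def)
  qed simp
  have dense: "\<exists>l. \<forall>y\<in>K. \<bar>k y - h l y\<bar> \<le> e" if k: "k \<in> unit_ball_Lip K" and e: "e > 0" for k e
  proof -
    \<comment> \<open>One \<open>r\<close> for the rational approximation of \<open>k (d j)\<close>,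
      and two for the distance from \<open>y\<close> to a nearby centre \<open>d j\<close>, counted
      once in \<open>k\<close> and once in the cone at \<open>d j\<close>.\<close>
    define r where "r = e / 3"
    have r: "r > 0" using e by (simp add: r_def)
    have klip: "\<bar>k x - k y\<bar> \<le> dist x y" if "x \<in> K" "y \<in> K" for x y
      using k that by (auto simp: unit_ball_Lip_def lipschitz_on_def dist_real_def)
    have "K \<subseteq> \<Union> ((\<lambda>j. ball (d j) r) ` UNIV)" using d(2) r by (fastforce simp: dist_commute)
    then obtain J where J: "finite J" "K \<subseteq> \<Union> ((\<lambda>j. ball (d j) r) ` J)"
      using compactE_image[OF K(1), of UNIV "\<lambda>j. ball (d j) r"] by auto
    have "\<exists>q. k (d j) < of_rat q \<and> of_rat q < k (d j) + r" for j
      using of_rat_dense[of "k (d j)" "k (d j) + r"] r by auto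
    then obtain q where q: "\<And>j. k (d j) < of_rat (q j)" "\<And>j. of_rat (q j) < k (d j) + r" by metis
    obtain js where js: "set js = J" using finite_list[OF J(1)] by auto
    define l where "l = map (\<lambda>j. (q j, j)) js"
    have "J \<noteq> {}" using J(2) K(2) by auto
    then have l: "l \<noteq> []" using js by (auto simp: l_def)
    have "\<bar>k y - h l y\<bar> \<le> e" if y: "y \<in> K" for y
    proof -
      have dK: "d j \<in> K" for j using d(1) by auto
      obtain j where j: "j \<in> J" "dist y (d j) < r" using J(2) y by (auto simp: dist_commute subset_eq)
      have "M l y \<le> of_rat (q j) + dist y (d j)"
        unfolding M_def using j(1) js by (intro Min_le) (auto simp: l_def)
      moreover have "k (d j) \<le> k y + dist y (d j)" using klip[OF dK[of j] y] by (simp add: dist_commute abs_le_iff)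
      ultimately have up: "M l y \<le> k y + e" using q(2)[of j] j(2) unfolding r_def by linarith
      have "M l y \<in> (\<lambda>(q, j). of_rat q + dist y (d j)) ` set l"
        unfolding M_def using l by (intro Min_in) auto
      then obtain i where i: "M l y = of_rat (q i) + dist y (d i)" by (auto simp: l_def)
      have "k y \<le> k (d i) + dist y (d i)" using klip[OF y dK[of i]] by (simp add: abs_le_iff)
      then have low: "k y \<le> M l y" using i q(1)[of i] by linarith
      have "\<bar>k y\<bar> \<le> 1" using k y by (auto simp: unit_ball_Lip_def)
      then show ?thesis using up low l e by (auto simp: h_def min_def max_def abs_le_iff)
    qed
    then show ?thesis by blast
  qed
  show ?thesis
  proof (intro exI[of _ "\<lambda>n. h (from_nat n)"] conjI allI ballI impI)
    show "h (from_nat n) \<in> unit_ball_Lip K" for n by (rule hl)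
    fix k :: "'k \<Rightarrow> real" and e :: real assume "k \<in> unit_ball_Lip K" "0 < e"
    then obtain l where "\<forall>y\<in>K. \<bar>k y - h l y\<bar> \<le> e" using dense by blast
    then show "\<exists>n. \<forall>y\<in>K. \<bar>k y - h (from_nat n) y\<bar> \<le> e" by (intro exI[of _ "to_nat l"]) simp
  qed
qed

lemma fibre_integral_bound:
  assumes K: "compact K" "K \<noteq> {}" and \<mu>: "\<mu> \<in> AB K" and x: "x \<in> {0..1}"
    and h: "h \<in> borel_measurable (restrict_space borel K)" "\<And>y. y \<in> K \<Longrightarrow> \<bar>h y\<bar> \<le> e"
  shows "\<bar>fibre_integral K \<mu> (\<lambda>z. h (snd z)) x\<bar> \<le> e *
     (marginal_density (pos_part (Sigma_borel K) \<mu>) x + marginal_density (neg_part (Sigma_borel K) \<mu>) x)"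
proof -
  have b: "\<bar>integral\<^sup>L (\<kappa> x) (\<lambda>z. h (snd z))\<bar> \<le> e" if d: "is_disintegration K M \<kappa>" for M \<kappa>
  proof -
    interpret prob_space "\<kappa> x" by (rule disintegrationD[OF d x])
    have s: "sets (\<kappa> x) = sets (Sigma_borel K)" by (rule disintegrationD[OF d x])
    have m: "(\<lambda>z. h (snd z)) \<in> borel_measurable (\<kappa> x)"
      using snd_measurable_fun[OF h(1)] measurable_cong_sets[OF s refl] by blast
    have sp: "space (\<kappa> x) = {0..1} \<times> K" using sets_eq_imp_space_eq[OF s] by simp
    have i: "integrable (\<kappa> x) (\<lambda>z. h (snd z))"
      using m h sp by (intro bounded_measurable_integrable[where B = e] finite_measure_axioms) auto
    have "norm (integral\<^sup>L (\<kappa> x) (\<lambda>z. h (snd z))) \<le> (LINT z|\<kappa> x. \<bar>h (snd z)\<bar>)"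
      using integral_norm_bound[of "\<kappa> x" "\<lambda>z. h (snd z)"] by simp
    also have "\<dots> \<le> (LINT z|\<kappa> x. e)" using i h sp by (intro integral_mono) auto
    finally show ?thesis by (simp add: prob_space)
  qed
  let ?p = "marginal_density (pos_part (Sigma_borel K) \<mu>) x"
  let ?n = "marginal_density (neg_part (Sigma_borel K) \<mu>) x"
  let ?ip = "integral\<^sup>L (fibre_measure K (pos_part (Sigma_borel K) \<mu>) x) (\<lambda>z. h (snd z))"
  let ?in = "integral\<^sup>L (fibre_measure K (neg_part (Sigma_borel K) \<mu>) x) (\<lambda>z. h (snd z))"
  have "\<bar>?p * ?ip - ?n * ?in\<bar> \<le> ?p * \<bar>?ip\<bar> + ?n * \<bar>?in\<bar>"
    using abs_triangle_ineq4[of "?p * ?ip" "?n * ?in"] by (simp add: abs_mult)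
  also have "\<dots> \<le> ?p * e + ?n * e"
    using b is_disintegration_fibre_measure[OF K \<mu>] by (intro add_mono mult_left_mono) auto
  finally show ?thesis by (simp add: fibre_integral_def algebra_simps)
qed

lemma fibre_integral_diff:
  assumes K: "compact K" "K \<noteq> {}" and \<mu>: "\<mu> \<in> AB K" and x: "x \<in> {0..1}"
    and h: "h \<in> borel_measurable (restrict_space borel K)" "\<And>y. y \<in> K \<Longrightarrow> \<bar>h y\<bar> \<le> B"
    and k: "k \<in> borel_measurable (restrict_space borel K)" "\<And>y. y \<in> K \<Longrightarrow> \<bar>k y\<bar> \<le> C"
  shows "fibre_integral K \<mu> (\<lambda>z. h (snd z) - k (snd z)) x =
    fibre_integral K \<mu> (\<lambda>z. h (snd z)) x - fibre_integral K \<mu> (\<lambda>z. k (snd z)) x"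
proof -
  have "integral\<^sup>L (\<kappa> x) (\<lambda>z. h (snd z) - k (snd z)) =
      integral\<^sup>L (\<kappa> x) (\<lambda>z. h (snd z)) - integral\<^sup>L (\<kappa> x) (\<lambda>z. k (snd z))" if d: "is_disintegration K M \<kappa>" for M \<kappa>
  proof -
    interpret prob_space "\<kappa> x" by (rule disintegrationD[OF d x])
    have s: "sets (\<kappa> x) = sets (Sigma_borel K)" by (rule disintegrationD[OF d x])
    have sp: "space (\<kappa> x) = {0..1} \<times> K" using sets_eq_imp_space_eq[OF s] by simp
    have m: "(\<lambda>z. u (snd z)) \<in> borel_measurable (\<kappa> x)" if "u \<in> borel_measurable (restrict_space borel K)" for u :: "_ \<Rightarrow> real"
      using snd_measurable_fun[OF that] measurable_cong_sets[OF s refl] by blast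
    show ?thesis
      using m[OF h(1)] m[OF k(1)] h k sp
      by (intro Bochner_Integration.integral_diff bounded_measurable_integrable[where B = B]
          bounded_measurable_integrable[where B = C] finite_measure_axioms) auto
  qed
  from this[OF is_disintegration_fibre_measure(1)[OF K \<mu>]] this[OF is_disintegration_fibre_measure(2)[OF K \<mu>]]
  show ?thesis unfolding fibre_integral_def by (simp only:) (simp add: algebra_simps)
qed

text \<open>Uniformly close test functions have close fibre integrals, so a countable dense family
  already yields the supremum; this opens the way to monotone convergence.\<close>

lemma W_norm_fibre_countable:
  assumes K: "compact K" "K \<noteq> {}" and \<mu>: "\<mu> \<in> AB K" and x: "x \<in> {0..1}"
    and h: "\<And>n. h n \<in> unit_ball_Lip K"
    and dense: "\<And>k e. k \<in> unit_ball_Lip K \<Longrightarrow> e > 0 \<Longrightarrow> \<exists>n :: nat. \<forall>y\<in>K. \<bar>k y - h n y\<bar> \<le> e"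
  shows "W_norm K (fibre_restr K \<mu> x) \<le> (SUP n. ennreal \<bar>fibre_integral K \<mu> (\<lambda>z. h n (snd z)) x\<bar>)"
  unfolding W_norm_fibre[OF K \<mu> x]
proof (rule SUP_least, rule ennreal_le_epsilon)
  fix k e assume k: "k \<in> unit_ball_Lip K" and e: "0 < (e::real)"
  let ?t = "marginal_density (pos_part (Sigma_borel K) \<mu>) x + marginal_density (neg_part (Sigma_borel K) \<mu>) x"
  have t: "0 \<le> ?t" by simp
  \<comment> \<open>\<open>?t\<close> is the total mass of the two parts on the fibre; the summand 1
    avoids division by zero.\<close>
  define r where "r = e / (?t + 1)"
  have r: "0 < r" "r * ?t \<le> e"
  proof -
    show "0 < r" unfolding r_def using e t by (intro divide_pos_pos) linarith+
    have "r * ?t \<le> r * (?t + 1)" using \<open>0 < r\<close> by simp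
    also have "\<dots> = e" using t unfolding r_def by (intro nonzero_eq_divide_eq[THEN iffD1]) linarith+
    finally show "r * ?t \<le> e" .
  qed
  obtain n where n: "\<And>y. y \<in> K \<Longrightarrow> \<bar>k y - h n y\<bar> \<le> r" using dense[OF k r(1)] by blast
  have mk: "k \<in> borel_measurable (restrict_space borel K)" "h n \<in> borel_measurable (restrict_space borel K)"
    using k h unit_ball_Lip_measurable by blast+
  have "fibre_integral K \<mu> (\<lambda>z. k (snd z)) x - fibre_integral K \<mu> (\<lambda>z. h n (snd z)) x =
      fibre_integral K \<mu> (\<lambda>z. k (snd z) - h n (snd z)) x"
    using k h[of n] by (intro fibre_integral_diff[symmetric, OF K \<mu> x mk(1) _ mk(2), of 1 1]) (auto simp: unit_ball_Lip_def)
  also have "\<bar>\<dots>\<bar> \<le> r * ?t"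
    using fibre_integral_bound[OF K \<mu> x, of "\<lambda>y. k y - h n y" r] mk n by simp
  finally have "\<bar>fibre_integral K \<mu> (\<lambda>z. k (snd z)) x\<bar> \<le> \<bar>fibre_integral K \<mu> (\<lambda>z. h n (snd z)) x\<bar> + e"
    using r(2) by linarith
  then have "ennreal \<bar>fibre_integral K \<mu> (\<lambda>z. k (snd z)) x\<bar> \<le>
      ennreal \<bar>fibre_integral K \<mu> (\<lambda>z. h n (snd z)) x\<bar> + ennreal e"
    using e by (simp add: ennreal_plus[symmetric] ennreal_leI del: ennreal_plus)
  also have "\<dots> \<le> (SUP n. ennreal \<bar>fibre_integral K \<mu> (\<lambda>z. h n (snd z)) x\<bar>) + ennreal e"
    by (intro add_right_mono SUP_upper) simp
  finally show "ennreal \<bar>fibre_integral K \<mu> (\<lambda>z. k (snd z)) x\<bar> \<le>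
      (SUP n. ennreal \<bar>fibre_integral K \<mu> (\<lambda>z. h n (snd z)) x\<bar>) + ennreal e" .
qed

text \<open>The dual description of the norm of \<open>L\<^sup>1\<close>, together with \<open>signed_integral_le_L1\<close>. For finitely
  many test functions, the best one can be selected measurably on each fibre.\<close>

lemma L1_enorm_le:
  assumes K: "compact K" "K \<noteq> {}" and \<mu>: "\<mu> \<in> AB K" and C: "0 \<le> C"
    and bound: "\<And>H. H \<in> borel_measurable (Sigma_borel K) \<Longrightarrow>
      (\<And>x. x \<in> {0..1} \<Longrightarrow> (\<lambda>y. H (x, y)) \<in> unit_ball_Lip K) \<Longrightarrow>
      signed_integral (Sigma_borel K) \<mu> H \<le> C"
  shows "L1_enorm K \<mu> \<le> ennreal C"
proof -
  obtain h :: "nat \<Rightarrow> _ \<Rightarrow> real" where h: "\<And>n. h n \<in> unit_ball_Lip K"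
    and dense: "\<And>k e. k \<in> unit_ball_Lip K \<Longrightarrow> e > 0 \<Longrightarrow> \<exists>n. \<forall>y\<in>K. \<bar>k y - h n y\<bar> \<le> e"
    using unit_ball_Lip_separable[OF K] by metis
  define \<Phi> where "\<Phi> n x = fibre_integral K \<mu> (\<lambda>z. h n (snd z)) x" for n x
  define m where "m N x = Max ((\<lambda>n. \<bar>\<Phi> n x\<bar>) ` {..N})" for N x
  have hb: "\<bar>h n y\<bar> \<le> 1" if "y \<in> K" for n y using h[of n] that by (auto simp: unit_ball_Lip_def)
  have hm: "(\<lambda>z. h n (snd z)) \<in> borel_measurable (Sigma_borel K)" for n
    by (rule snd_measurable_fun[OF unit_ball_Lip_measurable[OF h]])
  have \<Phi>int: "integrable unit_leb (\<Phi> n)" for n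
    unfolding \<Phi>_def using signed_integral_fibre(1)[OF K \<mu> hm, of n 1] hb by auto
  then have \<Phi>m[measurable]: "\<Phi> n \<in> borel_measurable unit_leb" for n by blast
  have m0: "0 \<le> m N x" for N x unfolding m_def by (rule Max_ge_iff[THEN iffD2]) auto
  have le_m: "\<bar>\<Phi> n x\<bar> \<le> m N x" if "n \<le> N" for n N x unfolding m_def using that by (intro Max_ge) auto
  have m_mono: "m M x \<le> m N x" if "M \<le> N" for M N x unfolding m_def using that by (intro Max_mono) auto
  have mm[measurable]: "m N \<in> borel_measurable unit_leb" for N
    unfolding m_def by (intro borel_measurable_Max) auto
  have bound_N: "(\<integral>\<^sup>+x. ennreal (m N x) \<partial>unit_leb) \<le> ennreal C" for N
  proof -
    define i where "i x = (LEAST n. n \<le> N \<and> \<bar>\<Phi> n x\<bar> = m N x)" for x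
    have ex: "\<exists>n. n \<le> N \<and> \<bar>\<Phi> n x\<bar> = m N x" for x
    proof -
      have "m N x \<in> (\<lambda>n. \<bar>\<Phi> n x\<bar>) ` {..N}" unfolding m_def by (intro Max_in) auto
      then show ?thesis by auto
    qed
    have i: "\<bar>\<Phi> (i x) x\<bar> = m N x" for x using LeastI_ex[OF ex[of x]] by (simp add: i_def)
    have im[measurable]: "i \<in> measurable unit_leb (count_space UNIV)" unfolding i_def by measurable
    \<comment> \<open>Index and sign depend on the base point only, so \<open>H\<close> stays in the
      unit ball on each fibre, and the sign makes its fibre integral equal to
      \<open>m N\<close>.\<close>
    define H where "H z = sgn (\<Phi> (i (fst z)) (fst z)) * h (i (fst z)) (snd z)" for z
    have HM: "H \<in> borel_measurable (Sigma_borel K)"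
      unfolding H_def
    proof (rule measurable_compose_countable)
      show "(\<lambda>z. i (fst z)) \<in> measurable (Sigma_borel K) (count_space UNIV)"
        by (rule measurable_compose[OF fst_measurable_Sigma im])
      have "(\<lambda>z. \<Phi> n (fst z)) \<in> borel_measurable (Sigma_borel K)" for n
        by (rule measurable_compose[OF fst_measurable_Sigma \<Phi>m])
      then show "(\<lambda>z. sgn (\<Phi> n (fst z)) * h n (snd z)) \<in> borel_measurable (Sigma_borel K)" for n
        using hm[of n] by measurable
    qed
    have HL: "(\<lambda>y. H (x, y)) \<in> unit_ball_Lip K" for x
      unfolding H_def by (simp add: unit_ball_Lip_uminus_sgn[OF h])
    have Hb: "\<bar>H z\<bar> \<le> 1" if "z \<in> {0..1} \<times> K" for z
      using HL[of "fst z"] that by (auto simp: unit_ball_Lip_def)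
    have \<Phi>H: "fibre_integral K \<mu> H x = m N x" if x: "x \<in> {0..1}" for x
    proof -
      let ?c = "sgn (\<Phi> (i x) x)"
      have "fibre_integral K \<mu> H x = fibre_integral K \<mu> (\<lambda>z. ?c * h (i x) (snd z)) x"
        using hm[of "i x"] by (intro fibre_integral_cong[OF K \<mu> x HM]) (auto simp: H_def)
      also have "\<dots> = ?c * \<Phi> (i x) x" by (simp add: fibre_integral_def \<Phi>_def algebra_simps)
      also have "\<dots> = m N x" using i[of x] by (simp add: sgn_mult_self_eq mult_sgn_abs[symmetric] linordered_idom_class.mult_sgn_abs abs_sgn mult.commute)
      finally show ?thesis .
    qed
    have int: "integrable unit_leb (m N)"
      using signed_integral_fibre(1)[OF K \<mu> HM Hb]
      by (rule integrable_cong_AE_imp) (use \<Phi>H in auto)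
    have "(\<integral>\<^sup>+x. ennreal (m N x) \<partial>unit_leb) = ennreal (LINT x|unit_leb. m N x)"
      using int m0 by (intro nn_integral_eq_integral) auto
    also have "(LINT x|unit_leb. m N x) = (LINT x|unit_leb. fibre_integral K \<mu> H x)"
      using \<Phi>H by (intro Bochner_Integration.integral_cong) auto
    also have "\<dots> = signed_integral (Sigma_borel K) \<mu> H"
      by (rule signed_integral_fibre(2)[OF K \<mu> HM Hb, symmetric])
    also have "ennreal \<dots> \<le> ennreal C" using bound[OF HM HL] by (rule ennreal_leI)
    finally show ?thesis .
  qed
  have "L1_enorm K \<mu> \<le> (\<integral>\<^sup>+x. (SUP N. ennreal (m N x)) \<partial>unit_leb)"
    unfolding L1_enorm_def
  proof (rule nn_integral_mono)
    fix x assume "x \<in> space unit_leb"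
    then have x: "x \<in> {0..1}" by simp
    have "W_norm K (fibre_restr K \<mu> x) \<le> (SUP n. ennreal \<bar>\<Phi> n x\<bar>)"
      unfolding \<Phi>_def by (rule W_norm_fibre_countable[OF K \<mu> x h dense])
    also have "\<dots> \<le> (SUP N. ennreal (m N x))"
      using le_m by (intro SUP_mono) (meson UNIV_I ennreal_leI order_refl)
    finally show "W_norm K (fibre_restr K \<mu> x) \<le> (SUP N. ennreal (m N x))" .
  qed
  also have "\<dots> = (SUP N. \<integral>\<^sup>+x. ennreal (m N x) \<partial>unit_leb)"
    using m_mono by (intro nn_integral_monotone_convergence_SUP) (auto simp: incseq_def le_fun_def intro: ennreal_leI)
  also have "\<dots> \<le> ennreal C" by (intro SUP_least bound_N)
  finally show ?thesis .
qed

lemma unit_ball_Lip_bound: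
  assumes "\<And>x. x \<in> {0..1} \<Longrightarrow> (\<lambda>y. H (x, y)) \<in> unit_ball_Lip K" "z \<in> {0..1} \<times> K"
  shows "\<bar>H z\<bar> \<le> 1"
  using assms(1)[of "fst z"] assms(2) by (auto simp: unit_ball_Lip_def)

text \<open>Test functions are bounded by 1, so their integrals are at most the total variation.
  From here on the norm can be treated as a real number.\<close>

lemma L1_enorm_finite:
  assumes K: "compact K" "K \<noteq> {}" and \<mu>: "\<mu> \<in> AB K"
  shows "L1_enorm K \<mu> < \<infinity>"
proof -
  let ?S = "Sigma_borel K"
  interpret p: finite_measure "pos_part ?S \<mu>" by (rule AB_parts[OF \<mu>])
  interpret n: finite_measure "neg_part ?S \<mu>" by (rule AB_parts[OF \<mu>])
  have "L1_enorm K \<mu> \<le> ennreal (measure (pos_part ?S \<mu>) (space ?S) + measure (neg_part ?S \<mu>) (space ?S))"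
  proof (rule L1_enorm_le[OF K \<mu>])
    fix H assume H: "H \<in> borel_measurable ?S" "\<And>x. x \<in> {0..1} \<Longrightarrow> (\<lambda>y. H (x, y)) \<in> unit_ball_Lip K"
    have b: "\<bar>H z\<bar> \<le> 1" if "z \<in> space ?S" for z using unit_ball_Lip_bound[OF H(2)] that by auto
    have i: "integrable (pos_part ?S \<mu>) H" "integrable (neg_part ?S \<mu>) H"
      using H(1) b by (auto intro!: bounded_measurable_integrable[where B = 1] p.finite_measure_axioms n.finite_measure_axioms)
    have "integral\<^sup>L (pos_part ?S \<mu>) H \<le> (LINT z|pos_part ?S \<mu>. 1)"
      using i b by (intro integral_mono) (auto simp: abs_le_iff)
    moreover have "(LINT z|neg_part ?S \<mu>. -1) \<le> integral\<^sup>L (neg_part ?S \<mu>) H"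
      using i b by (intro integral_mono) (auto simp: abs_le_iff minus_le_iff)
    ultimately show "signed_integral ?S \<mu> H \<le> measure (pos_part ?S \<mu>) (space ?S) + measure (neg_part ?S \<mu>) (space ?S)"
      by (simp add: signed_integral_def)
  qed simp
  then show ?thesis by (simp add: order_le_less_trans)
qed

lemma signed_integral_le_L1_real:
  assumes K: "compact K" "K \<noteq> {}" and \<mu>: "\<mu> \<in> AB K"
    and H: "H \<in> borel_measurable (Sigma_borel K)" "\<And>z. z \<in> {0..1} \<times> K \<Longrightarrow> \<bar>H z\<bar> \<le> B"
    and Lip: "AE x in unit_leb. (\<lambda>y. H (x, y)) \<in> unit_ball_Lip K"
  shows "\<bar>signed_integral (Sigma_borel K) \<mu> H\<bar> \<le> enn2real (L1_enorm K \<mu>)"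
  using enn2real_mono[OF signed_integral_le_L1[OF assms]] L1_enorm_finite[OF K \<mu>] by simp

text \<open>Both summands are tested with the same \<open>H\<close>, which avoids comparing the
  disintegration of a sum with those of its terms.\<close>

lemma L1_norm_add:
  assumes K: "compact K" "K \<noteq> {}" and \<mu>: "\<mu> \<in> AB K" and \<nu>: "\<nu> \<in> AB K"
  shows "enn2real (L1_enorm K (\<mu> + \<nu>)) \<le> enn2real (L1_enorm K \<mu>) + enn2real (L1_enorm K \<nu>)"
proof -
  have "L1_enorm K (\<mu> + \<nu>) \<le> ennreal (enn2real (L1_enorm K \<mu>) + enn2real (L1_enorm K \<nu>))"
  proof (rule L1_enorm_le[OF K AB_add[OF \<mu> \<nu>]])
    fix H assume H: "H \<in> borel_measurable (Sigma_borel K)" "\<And>x. x \<in> {0..1} \<Longrightarrow> (\<lambda>y. H (x, y)) \<in> unit_ball_Lip K"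
    have b: "\<bar>H z\<bar> \<le> 1" if "z \<in> {0..1} \<times> K" for z by (rule unit_ball_Lip_bound[OF H(2) that])
    have "signed_integral (Sigma_borel K) (\<mu> + \<nu>) H = signed_integral (Sigma_borel K) \<mu> H + signed_integral (Sigma_borel K) \<nu> H"
      using b by (intro signed_integral_add[where B = 1] AB_signed_measure \<mu> \<nu> H(1)) auto
    moreover have "\<bar>signed_integral (Sigma_borel K) \<mu> H\<bar> \<le> enn2real (L1_enorm K \<mu>)"
      "\<bar>signed_integral (Sigma_borel K) \<nu> H\<bar> \<le> enn2real (L1_enorm K \<nu>)"
      using H(2) by (auto intro!: signed_integral_le_L1_real[OF K _ H(1) b] \<mu> \<nu> AE_I2)
    ultimately show "signed_integral (Sigma_borel K) (\<mu> + \<nu>) H \<le> enn2real (L1_enorm K \<mu>) + enn2real (L1_enorm K \<nu>)"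
      by linarith
  qed simp
  then show ?thesis by (intro enn2real_leI) auto
qed

lemma L1_norm_scale:
  assumes K: "compact K" "K \<noteq> {}" and \<mu>: "\<mu> \<in> AB K"
  shows "enn2real (L1_enorm K (c *\<^sub>R \<mu>)) \<le> \<bar>c\<bar> * enn2real (L1_enorm K \<mu>)"
proof -
  have "L1_enorm K (c *\<^sub>R \<mu>) \<le> ennreal (\<bar>c\<bar> * enn2real (L1_enorm K \<mu>))"
  proof (rule L1_enorm_le[OF K AB_scale[OF \<mu>]])
    fix H assume H: "H \<in> borel_measurable (Sigma_borel K)" "\<And>x. x \<in> {0..1} \<Longrightarrow> (\<lambda>y. H (x, y)) \<in> unit_ball_Lip K"
    have b: "\<bar>H z\<bar> \<le> 1" if "z \<in> {0..1} \<times> K" for z by (rule unit_ball_Lip_bound[OF H(2) that])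
    have "signed_integral (Sigma_borel K) (c *\<^sub>R \<mu>) H = c * signed_integral (Sigma_borel K) \<mu> H"
      using b by (intro signed_integral_scale[where B = 1] AB_signed_measure \<mu> H(1)) auto
    also have "\<dots> \<le> \<bar>c\<bar> * \<bar>signed_integral (Sigma_borel K) \<mu> H\<bar>"
      by (simp add: abs_mult[symmetric])
    also have "\<dots> \<le> \<bar>c\<bar> * enn2real (L1_enorm K \<mu>)"
      using H(2) by (intro mult_left_mono signed_integral_le_L1_real[OF K \<mu> H(1) b] AE_I2) auto
    finally show "signed_integral (Sigma_borel K) (c *\<^sub>R \<mu>) H \<le> \<bar>c\<bar> * enn2real (L1_enorm K \<mu>)" .
  qed simp
  then show ?thesis by (intro enn2real_leI) auto
qed

text \<open>For a test function \<open>H\<close>, the function \<open>u\<close> is the composition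
  with \<open>F\<close> after freezing the fibre coordinate at \<open>y0\<close>. The remainder,
  divided by \<open>\<alpha>\<close>, is 1-Lipschitz on almost every fibre by the contraction and
  vanishes at \<open>y0\<close>, so diameter 1 bounds it by 1 there. The fibre integral of
  \<open>u\<close> is its constant value on the fibre times the signed density, which gives the
  second term.\<close>

lemma L1_norm_push_forward:
  fixes K :: "'k::metric_space set"
  assumes K: "compact K" "diameter K = 1" and \<mu>: "\<mu> \<in> AB K"
    and F: "\<And>x y. F (x, y) = (f x, G (x, y))" "F \<in> measurable (Sigma_borel K) (Sigma_borel K)"
    and \<alpha>: "0 < \<alpha>"
    and G: "AE x in unit_leb. \<forall>z1\<in>K. \<forall>z2\<in>K. dist (G (x, z1)) (G (x, z2)) \<le> \<alpha> * dist z1 z2"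
    and push: "push_forward (Sigma_borel K) F \<mu> \<in> AB K"
  shows "enn2real (L1_enorm K (push_forward (Sigma_borel K) F \<mu>)) \<le>
    \<alpha> * enn2real (L1_enorm K \<mu>) + (LINT x|unit_leb. \<bar>signed_density K \<mu> x\<bar>)"
proof -
  let ?S = "Sigma_borel K"
  have K0: "K \<noteq> {}" using K(2) by auto
  then obtain y0 where y0: "y0 \<in> K" by auto
  have dist1: "dist y z \<le> 1" if "y \<in> K" "z \<in> K" for y z
    using diameter_bounded_bound[OF compact_imp_bounded[OF K(1)] that] K(2) by simp
  have FS: "F z \<in> {0..1} \<times> K" if "z \<in> {0..1} \<times> K" for z
    using measurable_space[OF F(2), of z] that by simp
  have "L1_enorm K (push_forward ?S F \<mu>) \<le>
     ennreal (\<alpha> * enn2real (L1_enorm K \<mu>) + (LINT x|unit_leb. \<bar>signed_density K \<mu> x\<bar>))"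
  proof (rule L1_enorm_le[OF K(1) K0 push])
    fix H assume H: "H \<in> borel_measurable ?S" "\<And>x. x \<in> {0..1} \<Longrightarrow> (\<lambda>y. H (x, y)) \<in> unit_ball_Lip K"
    have b: "\<bar>H z\<bar> \<le> 1" if "z \<in> {0..1} \<times> K" for z by (rule unit_ball_Lip_bound[OF H(2) that])
    define u where "u z = H (F (fst z, y0))" for z :: "real \<times> 'k"
    define H' where "H' z = (H (F z) - u z) / \<alpha>" for z
    have HFm: "(\<lambda>z. H (F z)) \<in> borel_measurable ?S" by (rule measurable_compose[OF F(2) H(1)])
    have um: "u \<in> borel_measurable ?S"
    proof -
      have "(\<lambda>z. (fst z, y0)) \<in> measurable ?S ?S"
      proof -
        have "(\<lambda>z. (fst z, y0)) \<in> measurable ?S (unit_leb \<Otimes>\<^sub>M restrict_space borel K)"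
          using y0 by (intro measurable_Pair fst_measurable_Sigma) (auto simp: space_restrict_space)
        then show ?thesis using measurable_cong_sets[OF refl sets_Sigma_borel_pair[OF K(1) K0], of ?S] by simp
      qed
      then show ?thesis unfolding u_def by (rule measurable_compose[OF _ HFm])
    qed
    have ub: "\<bar>u z\<bar> \<le> 1" if "z \<in> {0..1} \<times> K" for z
      unfolding u_def using that y0 by (intro b FS) auto
    have HFb: "\<bar>H (F z)\<bar> \<le> 1" if "z \<in> {0..1} \<times> K" for z by (intro b FS that)
    have H'm: "H' \<in> borel_measurable ?S" unfolding H'_def using HFm um by measurable
    have H'b: "\<bar>H' z\<bar> \<le> 2 / \<alpha>" if "z \<in> {0..1} \<times> K" for z
    proof -
      have "\<bar>H (F z) - u z\<bar> \<le> 2" using HFb[OF that] ub[OF that] by linarith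
      then show ?thesis using \<alpha> by (simp add: H'_def divide_right_mono)
    qed
    have AE': "AE x in unit_leb. x \<in> {0..1::real}" by (rule AE_I2) simp
    have H'L: "AE x in unit_leb. (\<lambda>y. H' (x, y)) \<in> unit_ball_Lip K"
      using G AE'
    proof eventually_elim
      case (elim x)
      have fx: "f x \<in> {0..1}" and GK: "G (x, y) \<in> K" if "y \<in> K" for y
        using FS[of "(x, y)"] elim(2) that F(1) by auto
      have lip: "\<bar>H (F (x, y)) - H (F (x, z))\<bar> \<le> \<alpha> * dist y z" if "y \<in> K" "z \<in> K" for y z
      proof -
        have "\<bar>H (F (x, y)) - H (F (x, z))\<bar> \<le> dist (G (x, y)) (G (x, z))"
          using H(2)[OF fx[OF y0]] GK that F(1) by (auto simp: unit_ball_Lip_def lipschitz_on_def dist_real_def)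
        then show ?thesis using elim(1) that by force
      qed
      have "dist (H' (x, y)) (H' (x, z)) \<le> 1 * dist y z" if "y \<in> K" "z \<in> K" for y z
      proof -
        have "H' (x, y) - H' (x, z) = (H (F (x, y)) - H (F (x, z))) / \<alpha>"
          by (simp add: H'_def u_def diff_divide_distrib)
        then show ?thesis using lip[OF that] \<alpha> by (simp add: dist_real_def pos_divide_le_eq mult.commute)
      qed
      moreover have "\<bar>H' (x, y)\<bar> \<le> 1" if "y \<in> K" for y
      proof -
        have "\<bar>H (F (x, y)) - H (F (x, y0))\<bar> \<le> \<alpha> * 1"
          using lip[OF that y0] mult_left_mono[OF dist1[OF that y0], of \<alpha>] \<alpha> by linarith
        then show ?thesis using \<alpha> by (simp add: H'_def u_def)
      qed
      ultimately show ?case by (simp add: unit_ball_Lip_def lipschitz_on_def)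
    qed
    have "signed_integral ?S (push_forward ?S F \<mu>) H = signed_integral ?S \<mu> (\<lambda>z. H (F z))"
      using b by (intro signed_integral_push_forward[where B = 1] AB_signed_measure \<mu> F(2) H(1)) auto
    also have "(\<lambda>z. H (F z)) = (\<lambda>z. u z + \<alpha> * H' z)" using \<alpha> by (simp add: H'_def)
    also have "signed_integral ?S \<mu> (\<lambda>z. u z + \<alpha> * H' z) = signed_integral ?S \<mu> u + \<alpha> * signed_integral ?S \<mu> H'"
      using ub H'b by (intro signed_integral_linear_integrand[where B = 1 and C = "2 / \<alpha>"] AB_signed_measure \<mu> um H'm) auto
    also have "\<alpha> * signed_integral ?S \<mu> H' \<le> \<alpha> * enn2real (L1_enorm K \<mu>)"
      using signed_integral_le_L1_real[OF K(1) K0 \<mu> H'm H'b H'L] \<alpha> by (intro mult_left_mono) auto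
    also have "signed_integral ?S \<mu> u = (LINT x|unit_leb. fibre_integral K \<mu> u x)"
      by (rule signed_integral_fibre(2)[OF K(1) K0 \<mu> um ub])
    also have "\<dots> \<le> (LINT x|unit_leb. \<bar>signed_density K \<mu> x\<bar>)"
    proof (rule integral_mono_AE)
      show "integrable unit_leb (fibre_integral K \<mu> u)" by (rule signed_integral_fibre(1)[OF K(1) K0 \<mu> um ub])
      show "integrable unit_leb (\<lambda>x. \<bar>signed_density K \<mu> x\<bar>)" using integrable_signed_density[OF \<mu>] by simp
      show "AE x in unit_leb. fibre_integral K \<mu> u x \<le> \<bar>signed_density K \<mu> x\<bar>"
      proof (rule AE_I2)
        fix x assume "x \<in> space unit_leb"
        then have x: "x \<in> {0..1}" by simp
        note d = is_disintegration_fibre_measure[OF K(1) K0 \<mu>]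
        have "fibre_integral K \<mu> u x = fibre_integral K \<mu> (\<lambda>_. u (x, y0)) x"
          by (intro fibre_integral_cong[OF K(1) K0 \<mu> x um]) (auto simp: u_def)
        also have "\<dots> = u (x, y0) * signed_density K \<mu> x"
          using prob_space.prob_space[OF disintegrationD(1)[OF d(1) x]] prob_space.prob_space[OF disintegrationD(1)[OF d(2) x]]
          by (simp add: fibre_integral_def signed_density_def algebra_simps)
        also have "\<dots> \<le> \<bar>u (x, y0)\<bar> * \<bar>signed_density K \<mu> x\<bar>" by (simp add: abs_mult[symmetric])
        also have "\<dots> \<le> 1 * \<bar>signed_density K \<mu> x\<bar>" using ub[of "(x, y0)"] x y0 by (intro mult_right_mono) auto
        finally show "fibre_integral K \<mu> u x \<le> \<bar>signed_density K \<mu> x\<bar>" by simp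
      qed
    qed
    finally show "signed_integral ?S (push_forward ?S F \<mu>) H \<le>
      \<alpha> * enn2real (L1_enorm K \<mu>) + (LINT x|unit_leb. \<bar>signed_density K \<mu> x\<bar>)" by simp
  qed (use \<alpha> in simp)
  then show ?thesis using \<alpha> by (intro enn2real_leI) auto
qed

section \<open>The invariant measure of the skew product\<close>

text \<open>The natural extension of a measure-preserving map, obtained from Kolmogorov's theorem.\<close>

lemma backward_orbit_measure:
  fixes \<nu> :: "real measure" and \<phi> :: "real \<Rightarrow> real"
  assumes \<nu>: "prob_space \<nu>" "sets \<nu> = sets borel" and \<phi>: "\<phi> \<in> borel_measurable borel"
    and inv: "distr \<nu> borel \<phi> = \<nu>"
  shows "\<exists>\<Omega> :: (nat \<Rightarrow> real) measure. prob_space \<Omega> \<and> sets \<Omega> = sets (PiM UNIV (\<lambda>_. borel)) \<and>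
    (\<forall>k. AE \<omega> in \<Omega>. \<omega> k = \<phi> (\<omega> (Suc k))) \<and> (\<forall>k. distr \<Omega> borel (\<lambda>\<omega>. \<omega> k) = \<nu>) \<and>
    distr \<Omega> \<Omega> (\<lambda>\<omega> n. \<omega> (Suc n)) = \<Omega>"
proof -
  interpret \<nu>: prob_space \<nu> by (rule \<nu>(1))
  have [measurable]: "\<phi> \<in> borel_measurable borel" by (rule \<phi>)
  have pm[measurable]: "(\<phi> ^^ n) \<in> borel_measurable borel" for n by (induction n) (auto simp: measurable_comp[of _ borel borel])
  have \<nu>m: "measurable \<nu> N = measurable borel N" for N :: "'z measure" by (rule measurable_cong_sets[OF \<nu>(2) refl])
  have sp\<nu>: "space \<nu> = UNIV" using sets_eq_imp_space_eq[OF \<nu>(2)] by simp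
  \<comment> \<open>The law of the coordinates in \<open>J\<close> when a
    \<open>\<nu>\<close>-distributed point is placed at index \<open>N\<close> and iterated:
    coordinate \<open>i\<close> is its image after \<open>N - i\<close> steps. Invariance of
    \<open>\<nu>\<close> makes the law independent of \<open>N\<close>.\<close>
  define X where "X J N = distr \<nu> (PiM J (\<lambda>_. borel)) (\<lambda>x. \<lambda>i\<in>J. (\<phi> ^^ (N - i)) x)" for J :: "nat set" and N
  have Xm: "(\<lambda>x. \<lambda>i\<in>J. (\<phi> ^^ (N - i)) x) \<in> measurable \<nu> (PiM J (\<lambda>_. borel))" for J and N :: nat
    unfolding \<nu>m by (rule measurable_restrict) simp
  have XS: "X J (Suc N) = X J N" if "\<And>i. i \<in> J \<Longrightarrow> i \<le> N" for J N
  proof -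
    have "X J N = distr (distr \<nu> borel \<phi>) (PiM J (\<lambda>_. borel)) (\<lambda>x. \<lambda>i\<in>J. (\<phi> ^^ (N - i)) x)"
      by (simp add: X_def inv)
    also have "\<dots> = distr \<nu> (PiM J (\<lambda>_. borel)) ((\<lambda>x. \<lambda>i\<in>J. (\<phi> ^^ (N - i)) x) \<circ> \<phi>)"
      using Xm[of N J] by (intro distr_distr) (simp_all add: \<nu>m)
    also have "(\<lambda>x. \<lambda>i\<in>J. (\<phi> ^^ (N - i)) x) \<circ> \<phi> = (\<lambda>x. \<lambda>i\<in>J. (\<phi> ^^ (Suc N - i)) x)"
      using that by (auto simp: fun_eq_iff Suc_diff_le funpow_swap1)
    finally show ?thesis unfolding X_def by (rule sym)
  qed
  have Xeq: "X J N = X J N'" if "\<And>i. i \<in> J \<Longrightarrow> i \<le> N'" "N' \<le> N" for J N N'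
    using that(2)
  proof (induction rule: dec_induct)
    case (step n)
    have "X J (Suc n) = X J n" using that(1) step by (intro XS) (meson order_trans)
    then show ?case using step by simp
  qed simp
  define top where "top J = Max (insert 0 J)" for J :: "nat set"
  have top: "i \<le> top J" if "finite J" "i \<in> J" for i J using that by (simp add: top_def)
  define P where "P J = X J (top J)" for J
  have PX: "P J = X J N" if "finite J" "\<And>i. i \<in> J \<Longrightarrow> i \<le> N" for J N
  proof -
    have "top J \<le> N" using that by (simp add: top_def)
    then show ?thesis unfolding P_def using top[OF that(1)] by (intro Xeq[symmetric]) auto
  qed
  interpret P: polish_projective UNIV P
  proof (intro polish_projective.intro projective_family.intro)
    fix J H :: "nat set" assume JH: "J \<subseteq> H" "finite H"
    have "distr (P H) (PiM J (\<lambda>_. borel)) (\<lambda>f. restrict f J) =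
        distr \<nu> (PiM J (\<lambda>_. borel)) ((\<lambda>f. restrict f J) \<circ> (\<lambda>x. \<lambda>i\<in>H. (\<phi> ^^ (top H - i)) x))"
      unfolding P_def X_def by (intro distr_distr measurable_restrict_subset[OF JH(1)] Xm)
    also have "(\<lambda>f. restrict f J) \<circ> (\<lambda>x. \<lambda>i\<in>H. (\<phi> ^^ (top H - i)) x) = (\<lambda>x. \<lambda>i\<in>J. (\<phi> ^^ (top H - i)) x)"
      using JH by (auto simp: fun_eq_iff restrict_def)
    also have "distr \<nu> (PiM J (\<lambda>_. borel)) \<dots> = X J (top H)" by (simp add: X_def)
    also have "\<dots> = P J" using JH top by (intro PX[symmetric]) (auto intro: finite_subset)
    finally show "P J = distr (P H) (PiM J (\<lambda>_. borel)) (\<lambda>f. restrict f J)" by (rule sym)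
  next
    fix J :: "nat set" show "prob_space (P J)"
      unfolding P_def X_def by (rule \<nu>.prob_space_distr[OF Xm])
  qed
  define \<Omega> where "\<Omega> = P.lim"
  have s\<Omega>: "sets \<Omega> = sets (PiM UNIV (\<lambda>_. borel))" by (simp add: \<Omega>_def)
  have sp\<Omega>: "space \<Omega> = UNIV" using sets_eq_imp_space_eq[OF s\<Omega>] by (simp add: space_PiM)
  have p\<Omega>: "prob_space \<Omega>" unfolding \<Omega>_def by (rule P.P.prob_space_axioms)
  interpret \<Omega>: prob_space \<Omega> by (rule p\<Omega>)
  have \<Omega>m: "measurable \<Omega> M = measurable (PiM UNIV (\<lambda>_. borel)) M" for M :: "'z measure"
    by (rule measurable_cong_sets[OF s\<Omega> refl])
  have m\<Omega>: "measurable M \<Omega> = measurable M (PiM UNIV (\<lambda>_. borel))" for M :: "'z measure"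
    by (rule measurable_cong_sets[OF refl s\<Omega>])
  have cm[measurable]: "(\<lambda>\<omega>. \<omega> k) \<in> borel_measurable \<Omega>" for k
    unfolding \<Omega>m by (rule measurable_component_singleton) simp
  have em: "emeasure \<Omega> (prod_emb UNIV (\<lambda>_. borel) J Y) = emeasure \<nu> {x. (\<lambda>i\<in>J. (\<phi> ^^ (N - i)) x) \<in> Y}"
    if "finite J" "\<And>i. i \<in> J \<Longrightarrow> i \<le> N" "Y \<in> sets (PiM J (\<lambda>_. borel))" for J N Y
  proof -
    have "emeasure \<Omega> (prod_emb UNIV (\<lambda>_. borel) J Y) = emeasure (P J) Y"
      unfolding \<Omega>_def using that by (intro P.emeasure_lim_emb) auto
    also have "\<dots> = emeasure \<nu> ((\<lambda>x. \<lambda>i\<in>J. (\<phi> ^^ (N - i)) x) -` Y \<inter> space \<nu>)"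
      using PX[OF that(1,2)] emeasure_distr[OF Xm that(3), of N] by (simp only: X_def)
    finally show ?thesis by (simp add: sp\<nu> vimage_def)
  qed
  have emR: "emeasure \<Omega> {\<omega>. \<forall>i\<in>J. \<omega> i \<in> A i} = emeasure \<nu> {x. \<forall>i\<in>J. (\<phi> ^^ (N - i)) x \<in> A i}"
    if "finite J" "\<And>i. i \<in> J \<Longrightarrow> i \<le> N" "\<And>i. i \<in> J \<Longrightarrow> A i \<in> sets borel" for J N A
  proof -
    have "PiE J A \<in> sets (PiM J (\<lambda>_. borel))" using that by (intro sets_PiM_I_finite) auto
    from em[OF that(1,2) this]
    have "emeasure \<Omega> (prod_emb UNIV (\<lambda>_. borel) J (PiE J A)) = emeasure \<nu> {x. (\<lambda>i\<in>J. (\<phi> ^^ (N - i)) x) \<in> PiE J A}" .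
    moreover have "prod_emb UNIV (\<lambda>_. borel) J (PiE J A) = {\<omega>. \<forall>i\<in>J. \<omega> i \<in> A i}"
      by (auto simp: prod_emb_def PiE_iff)
    moreover have "{x. (\<lambda>i\<in>J. (\<phi> ^^ (N - i)) x) \<in> PiE J A} = {x. \<forall>i\<in>J. (\<phi> ^^ (N - i)) x \<in> A i}"
      by (auto simp: PiE_iff)
    ultimately show ?thesis by simp
  qed
  have c2: "distr \<Omega> borel (\<lambda>\<omega>. \<omega> k) = \<nu>" for k
  proof (rule measure_eqI)
    fix A assume "A \<in> sets (distr \<Omega> borel (\<lambda>\<omega>. \<omega> k))"
    then have A: "A \<in> sets borel" by simp
    have "emeasure (distr \<Omega> borel (\<lambda>\<omega>. \<omega> k)) A = emeasure \<Omega> {\<omega>. \<forall>i\<in>{k}. \<omega> i \<in> A}"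
      using A by (simp add: emeasure_distr sp\<Omega> vimage_def)
    also have "\<dots> = emeasure \<nu> {x. \<forall>i\<in>{k}. (\<phi> ^^ (k - i)) x \<in> A}" using A by (intro emR) auto
    finally show "emeasure (distr \<Omega> borel (\<lambda>\<omega>. \<omega> k)) A = emeasure \<nu> A" by simp
  qed (simp add: \<nu>(2))
  \<comment> \<open>The relation is an event in the two coordinates \<open>k\<close> and
    \<open>Suc k\<close>, whose joint law charges only pairs \<open>(\<phi> x, x)\<close>.\<close>
  have c1: "AE \<omega> in \<Omega>. \<omega> k = \<phi> (\<omega> (Suc k))" for k
  proof -
    let ?J = "{k, Suc k}"
    define Y where "Y = {g \<in> space (PiM ?J (\<lambda>_. borel :: real measure)). g k = \<phi> (g (Suc k))}"
    have [measurable]: "(\<lambda>g. g k) \<in> borel_measurable (PiM ?J (\<lambda>_. borel :: real measure))"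
      "(\<lambda>g. g (Suc k)) \<in> borel_measurable (PiM ?J (\<lambda>_. borel :: real measure))"
      by (rule measurable_component_singleton; simp)+
    have Y: "Y \<in> sets (PiM ?J (\<lambda>_. borel))" unfolding Y_def by measurable
    have "emeasure \<Omega> (prod_emb UNIV (\<lambda>_. borel) ?J Y) = emeasure \<nu> {x. (\<lambda>i\<in>?J. (\<phi> ^^ (Suc k - i)) x) \<in> Y}"
      using Y by (intro em) auto
    also have "{x. (\<lambda>i\<in>?J. (\<phi> ^^ (Suc k - i)) x) \<in> Y} = UNIV"
      by (auto simp: Y_def space_PiM)
    also have "emeasure \<nu> UNIV = 1" using \<nu>.emeasure_space_1 sp\<nu> by simp
    finally have e: "emeasure \<Omega> (prod_emb UNIV (\<lambda>_. borel) ?J Y) = 1" .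
    have sm: "prod_emb UNIV (\<lambda>_. borel) ?J Y \<in> sets \<Omega>"
      unfolding s\<Omega> using Y by (intro measurable_prod_emb) auto
    have "AE \<omega> in \<Omega>. \<omega> \<in> prod_emb UNIV (\<lambda>_. borel) ?J Y"
      using e sm by (subst \<Omega>.prob_eq_1[symmetric]) (auto simp: \<Omega>.emeasure_eq_measure)
    then show ?thesis by eventually_elim (auto simp: prod_emb_def Y_def)
  qed
  have shm: "(\<lambda>\<omega> n. \<omega> (Suc n)) \<in> measurable \<Omega> \<Omega>"
  proof -
    have "(\<lambda>\<omega>. \<lambda>n\<in>UNIV. \<omega> (Suc n)) \<in> measurable \<Omega> (PiM UNIV (\<lambda>_. borel))"
      by (rule measurable_restrict) (rule cm)
    then show ?thesis unfolding m\<Omega> restrict_UNIV .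
  qed
  have c3: "distr \<Omega> \<Omega> (\<lambda>\<omega> n. \<omega> (Suc n)) = \<Omega>"
  proof (rule measure_eqI_PiM_infinite)
    show "finite_measure (distr \<Omega> \<Omega> (\<lambda>\<omega> n. \<omega> (Suc n)))" by (rule \<Omega>.finite_measure_distr[OF shm])
    fix A :: "nat \<Rightarrow> real set" and J :: "nat set"
    assume J: "finite J" and A: "\<And>i. i \<in> J \<Longrightarrow> A i \<in> sets borel"
    have pe: "prod_emb UNIV (\<lambda>_. borel) J (PiE J A) = {\<omega>. \<forall>i\<in>J. \<omega> i \<in> A i}"
      by (auto simp: prod_emb_def PiE_iff)
    have sm: "{\<omega>. \<forall>i\<in>J. \<omega> i \<in> A i} \<in> sets \<Omega>"
      unfolding pe[symmetric] s\<Omega> using A J by (intro measurable_prod_emb sets_PiM_I_finite) auto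
    have "emeasure (distr \<Omega> \<Omega> (\<lambda>\<omega> n. \<omega> (Suc n))) {\<omega>. \<forall>i\<in>J. \<omega> i \<in> A i} =
        emeasure \<Omega> {\<omega>. \<forall>i\<in>Suc ` J. \<omega> i \<in> A (i - 1)}"
      using emeasure_distr[OF shm sm] by (simp add: sp\<Omega> vimage_def)
    also have "\<dots> = emeasure \<nu> {x. \<forall>i\<in>Suc ` J. (\<phi> ^^ (Suc (top J) - i)) x \<in> A (i - 1)}"
      using J A top by (intro emR) auto
    also have "\<dots> = emeasure \<nu> {x. \<forall>i\<in>J. (\<phi> ^^ (top J - i)) x \<in> A i}" by simp
    also have "\<dots> = emeasure \<Omega> {\<omega>. \<forall>i\<in>J. \<omega> i \<in> A i}"
      using J A top by (intro emR[symmetric]) auto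
    finally show "emeasure (distr \<Omega> \<Omega> (\<lambda>\<omega> n. \<omega> (Suc n))) (prod_emb UNIV (\<lambda>_. borel) J (PiE J A)) =
      emeasure \<Omega> (prod_emb UNIV (\<lambda>_. borel) J (PiE J A))" by (simp add: pe)
  qed (simp_all add: s\<Omega>)
  show ?thesis using p\<Omega> s\<Omega> c1 c2 c3 by blast
qed

text \<open>Along a backward orbit \<open>\<omega>\<close> the compositions
  \<open>G (\<omega> 1, G (\<omega> 2, ...))\<close> started at \<open>y0\<close> converge almost
  surely, since each outer map contracts by \<open>\<alpha>\<close>; the limit satisfies
  \<open>Z \<omega> = G (\<omega> 1, Z (sh \<omega>))\<close>. Thus \<open>F\<close> maps
  \<open>q (sh \<omega>)\<close> to \<open>q \<omega>\<close> almost surely, and shift invariance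
  makes the law of \<open>q\<close> invariant.\<close>

lemma skew_product_invariant_measure:
  fixes K :: "'k::metric_space set" and G :: "real \<times> 'k \<Rightarrow> 'k"
  assumes K: "compact K" "diameter K = 1"
    and F: "\<And>x y. F (x, y) = (f x, G (x, y))" "F \<in> measurable (Sigma_borel K) (Sigma_borel K)"
    and \<alpha>: "0 \<le> \<alpha>" "\<alpha> < 1"
    and G: "AE x in unit_leb. \<forall>z1\<in>K. \<forall>z2\<in>K. dist (G (x, z1)) (G (x, z2)) \<le> \<alpha> * dist z1 z2"
    and f: "f \<in> measurable unit_leb unit_leb"
    and \<rho>: "prob_space \<rho>" "sets \<rho> = sets unit_leb" "absolutely_continuous unit_leb \<rho>" "distr \<rho> unit_leb f = \<rho>"
  shows "\<exists>M. prob_space M \<and> sets M = sets (Sigma_borel K) \<and> distr M (Sigma_borel K) F = M \<and> distr M unit_leb fst = \<rho>"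
proof -
  let ?S = "Sigma_borel K" and ?BK = "restrict_space borel K"
  have K0: "K \<noteq> {}" using K(2) by auto
  then obtain y0 where y0: "y0 \<in> K" by auto
  have dist1: "dist y z \<le> 1" if "y \<in> K" "z \<in> K" for y z
    using diameter_bounded_bound[OF compact_imp_bounded[OF K(1)] that] K(2) by simp
  interpret \<rho>: prob_space \<rho> by (rule \<rho>(1))
  have sp\<rho>: "space \<rho> = {0..1}" using sets_eq_imp_space_eq[OF \<rho>(2)] by simp
  have \<rho>m: "measurable \<rho> N = measurable unit_leb N" for N :: "'z measure" by (rule measurable_cong_sets[OF \<rho>(2) refl])
  have m\<rho>: "measurable N \<rho> = measurable N unit_leb" for N :: "'z measure" by (rule measurable_cong_sets[OF refl \<rho>(2)])
  have f01: "f x \<in> {0..1}" if "x \<in> {0..1}" for x using measurable_space[OF f, of x] that by simp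
  have idm: "(\<lambda>x. x) \<in> measurable unit_leb borel" by (rule borel_measurable_unit_lebI) simp
  \<comment> \<open>Orbits are constructed on the whole real line; \<open>clip\<close> brings
    coordinates back to the unit interval and is the identity there.\<close>
  define clip where "clip x = (if x \<in> {0..1} then x else 0)" for x :: real
  have clip01: "clip x \<in> {0..1}" for x by (simp add: clip_def)
  have clipm: "clip \<in> measurable borel unit_leb"
  proof -
    have "clip \<in> borel_measurable borel" unfolding clip_def by measurable
    then have "clip \<in> measurable borel (restrict_space borel {0..1})"
      using clip01 by (intro measurable_restrict_space2) auto
    then show ?thesis unfolding measurable_cong_sets[OF refl sets_unit_leb, of borel] .
  qed
  define \<nu> where "\<nu> = distr \<rho> borel (\<lambda>x. x)"
  define \<phi> where "\<phi> x = f (clip x)" for x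
  have \<phi>m: "\<phi> \<in> borel_measurable borel"
    unfolding \<phi>_def by (rule measurable_compose[OF measurable_compose[OF clipm f] idm])
  have \<nu>: "prob_space \<nu>" unfolding \<nu>_def using idm by (intro \<rho>.prob_space_distr) (simp add: \<rho>m)
  have \<nu>inv: "distr \<nu> borel \<phi> = \<nu>"
  proof -
    have "distr \<nu> borel \<phi> = distr \<rho> borel (\<phi> \<circ> (\<lambda>x. x))"
      unfolding \<nu>_def using idm \<phi>m by (intro distr_distr) (simp_all add: \<rho>m)
    also have "\<dots> = distr \<rho> borel ((\<lambda>x. x) \<circ> f)"
      by (intro distr_cong) (auto simp: sp\<rho> \<phi>_def clip_def)
    also have "\<dots> = distr (distr \<rho> unit_leb f) borel (\<lambda>x. x)"
      using f idm by (intro distr_distr[symmetric]) (simp_all add: \<rho>m)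
    finally show ?thesis by (simp add: \<rho>(4) \<nu>_def)
  qed
  obtain \<Omega> :: "(nat \<Rightarrow> real) measure" where p\<Omega>: "prob_space \<Omega>" and s\<Omega>: "sets \<Omega> = sets (PiM UNIV (\<lambda>_. borel))"
    and orbit: "\<And>k. AE \<omega> in \<Omega>. \<omega> k = \<phi> (\<omega> (Suc k))" and proj: "\<And>k. distr \<Omega> borel (\<lambda>\<omega>. \<omega> k) = \<nu>"
    and shift: "distr \<Omega> \<Omega> (\<lambda>\<omega> n. \<omega> (Suc n)) = \<Omega>"
    using backward_orbit_measure[OF \<nu> _ \<phi>m \<nu>inv] unfolding \<nu>_def by auto
  interpret \<Omega>: prob_space \<Omega> by (rule p\<Omega>)
  have \<Omega>m: "measurable \<Omega> M = measurable (PiM UNIV (\<lambda>_. borel)) M" for M :: "'z measure"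
    by (rule measurable_cong_sets[OF s\<Omega> refl])
  have m\<Omega>: "measurable M \<Omega> = measurable M (PiM UNIV (\<lambda>_. borel))" for M :: "'z measure"
    by (rule measurable_cong_sets[OF refl s\<Omega>])
  have cm[measurable]: "(\<lambda>\<omega>. \<omega> k) \<in> borel_measurable \<Omega>" for k
    unfolding \<Omega>m by (rule measurable_component_singleton) simp
  define sh where "sh \<omega> = (\<lambda>n. \<omega> (Suc n))" for \<omega> :: "nat \<Rightarrow> real"
  have shm: "sh \<in> measurable \<Omega> \<Omega>"
  proof -
    have "(\<lambda>\<omega>. \<lambda>n\<in>UNIV. \<omega> (Suc n)) \<in> measurable \<Omega> (PiM UNIV (\<lambda>_. borel))"
      by (rule measurable_restrict) (rule cm)
    then show ?thesis unfolding m\<Omega> sh_def[abs_def] restrict_UNIV .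
  qed
  have shift': "distr \<Omega> \<Omega> sh = \<Omega>" using shift by (simp add: sh_def[abs_def])
  define C where "C x \<longleftrightarrow> x \<in> {0..1} \<and> (\<forall>z1\<in>K. \<forall>z2\<in>K. dist (G (x, z1)) (G (x, z2)) \<le> \<alpha> * dist z1 z2)" for x
  have "AE x in unit_leb. C x" using G AE_space[of unit_leb] by eventually_elim (simp add: C_def)
  then have "AE x in \<rho>. C x" using absolutely_continuous_AE[OF \<rho>(2,3)] by blast
  then obtain NC where NC: "NC \<in> null_sets \<rho>" "{x \<in> space \<rho>. \<not> C x} \<subseteq> NC" by (elim AE_E3) blast
  have "AE x in \<nu>. clip x \<notin> NC \<and> x \<in> {0..1}"
  proof -
    have "{x. clip x \<notin> NC \<and> x \<in> {0..1}} = clip -` ({0..1} - NC) \<inter> {0..1}" using clip01 by auto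
    moreover have "clip -` ({0..1} - NC) \<inter> space borel \<in> sets borel"
      using NC(1) sets.top[of \<rho>] by (intro measurable_sets[OF clipm]) (auto simp: \<rho>(2)[symmetric] sp\<rho>)
    ultimately have m: "{x \<in> space borel. clip x \<notin> NC \<and> x \<in> {0..1}} \<in> sets borel" by simp
    have "AE x in \<rho>. clip x \<notin> NC \<and> x \<in> {0..1}"
      using AE_not_in[OF NC(1)] AE_space[of \<rho>] by eventually_elim (auto simp: clip_def sp\<rho>)
    then show ?thesis unfolding \<nu>_def using idm m by (subst AE_distr_iff) (auto simp: \<rho>m)
  qed
  then have "AE x in \<nu>. C x"
    by eventually_elim (use NC(2) sp\<rho> in \<open>auto simp: clip_def\<close>)
  then have "AE x in distr \<Omega> borel (\<lambda>\<omega>. \<omega> k). C x" for k unfolding proj .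
  then have AEC: "AE \<omega> in \<Omega>. C (\<omega> k)" for k by (rule AE_distrD[OF cm])
  have "AE \<omega> in \<Omega>. \<forall>k. C (\<omega> k)" using AEC by (simp add: AE_all_countable)
  then obtain N0 where N0: "N0 \<in> null_sets \<Omega>" "{\<omega> \<in> space \<Omega>. \<not> (\<forall>k. C (\<omega> k))} \<subseteq> N0"
    by (elim AE_E3) blast
  have sp\<Omega>: "space \<Omega> = UNIV" using sets_eq_imp_space_eq[OF s\<Omega>] by (simp add: space_PiM)
  have N0C: "C (\<omega> k)" if "\<omega> \<notin> N0" for \<omega> k using N0(2) that by (auto simp: sp\<Omega>)
  have GK: "G (x, y) \<in> K" if "x \<in> {0..1}" "y \<in> K" for x y
    using measurable_space[OF F(2), of "(x, y)"] that F(1) by auto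
  \<comment> \<open>\<open>Y n \<omega>\<close> applies the fibre maps over
    \<open>\<omega> n\<close> down to \<open>\<omega> 1\<close>, in this order, to
    \<open>y0\<close>. The recursion peels off the outermost map and evaluates the rest along the
    shifted orbit.\<close>
  define Y where "Y = rec_nat (\<lambda>\<omega>. y0) (\<lambda>n Yn \<omega>. G (clip (\<omega> 1), Yn (sh \<omega>)))"
  have Y0: "Y 0 \<omega> = y0" and YS: "Y (Suc n) \<omega> = G (clip (\<omega> 1), Y n (sh \<omega>))" for n \<omega> by (simp_all add: Y_def)
  have YK: "Y n \<omega> \<in> K" for n \<omega> by (induction n arbitrary: \<omega>) (auto simp: Y0 YS y0 intro!: GK clip01)
  have Ym: "Y n \<in> measurable \<Omega> ?BK" for n
  proof (induction n)
    case 0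
    have "Y 0 = (\<lambda>_. y0)" using Y0 by auto
    then show ?case using y0 by (simp add: space_restrict_space)
  next
    case (Suc n)
    have "(\<lambda>\<omega>. (clip (\<omega> 1), Y n (sh \<omega>))) \<in> measurable \<Omega> (unit_leb \<Otimes>\<^sub>M ?BK)"
      by (intro measurable_Pair measurable_compose[OF cm clipm] measurable_compose[OF shm Suc])
    then have "(\<lambda>\<omega>. (clip (\<omega> 1), Y n (sh \<omega>))) \<in> measurable \<Omega> ?S"
      using measurable_cong_sets[OF refl sets_Sigma_borel_pair[OF K(1) K0], of \<Omega>] by simp
    from measurable_compose[OF measurable_compose[OF this F(2)] snd_measurable_Sigma]
    show ?case by (simp add: F(1) YS[abs_def])
  qed
  have Yc: "dist (Y n \<omega>) (Y (n + k) \<omega>) \<le> \<alpha> ^ n" if "\<And>k. C (\<omega> k)" for n k \<omega>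
    using that
  proof (induction n arbitrary: \<omega>)
    case 0
    then show ?case using dist1[OF YK YK] by simp
  next
    case (Suc n)
    have "dist (Y (Suc n) \<omega>) (Y (Suc n + k) \<omega>) \<le> \<alpha> * dist (Y n (sh \<omega>)) (Y (n + k) (sh \<omega>))"
      using Suc.prems[of 1] YK by (simp add: YS C_def clip_def)
    also have "\<dots> \<le> \<alpha> * \<alpha> ^ n" using \<alpha> Suc.prems by (intro mult_left_mono Suc.IH) (auto simp: sh_def)
    finally show ?case by simp
  qed
  have conv: "\<exists>z\<in>K. (\<lambda>n. Y n \<omega>) \<longlonglongrightarrow> z" if "\<And>k. C (\<omega> k)" for \<omega>
  proof -
    have "Cauchy (\<lambda>n. Y n \<omega>)"
    proof (rule metric_CauchyI)
      fix e :: real assume "0 < e"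
      then obtain N where N: "\<alpha> ^ N < e / 2" using real_arch_pow_inv[of "e / 2" \<alpha>] \<alpha> by auto
      have "dist (Y m \<omega>) (Y N \<omega>) < e / 2" if "m \<ge> N" for m
        using Yc[of \<omega> N "m - N", OF \<open>\<And>k. C (\<omega> k)\<close>] N that by (simp add: dist_commute)
      then show "\<exists>N. \<forall>m\<ge>N. \<forall>n\<ge>N. dist (Y m \<omega>) (Y n \<omega>) < e"
        by (intro exI[of _ N]) (meson dist_triangle_half_l)
    qed
    then show ?thesis using completeE[OF compact_imp_complete[OF K(1)], of "\<lambda>n. Y n \<omega>"] YK by blast
  qed
  define Z where "Z \<omega> = (if \<omega> \<in> N0 then y0 else lim (\<lambda>n. Y n \<omega>))" for \<omega>
  have Zlim: "(\<lambda>n. Y n \<omega>) \<longlonglongrightarrow> Z \<omega>" "Z \<omega> \<in> K" if "\<omega> \<notin> N0" for \<omega>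
  proof -
    obtain z where z: "z \<in> K" "(\<lambda>n. Y n \<omega>) \<longlonglongrightarrow> z" using conv[of \<omega>] N0C[OF \<open>\<omega> \<notin> N0\<close>] by blast
    then have "Z \<omega> = z" using that by (simp add: Z_def limI)
    then show "(\<lambda>n. Y n \<omega>) \<longlonglongrightarrow> Z \<omega>" "Z \<omega> \<in> K" using z by simp_all
  qed
  have ZK: "Z \<omega> \<in> K" for \<omega> using Zlim(2)[of \<omega>] y0 by (cases "\<omega> \<in> N0") (auto simp: Z_def)
  have Zm: "Z \<in> measurable \<Omega> ?BK"
  proof (rule measurable_restrict_space2)
    show "Z \<in> space \<Omega> \<rightarrow> K" using ZK by auto
    show "Z \<in> borel_measurable \<Omega>"
    proof (rule borel_measurable_LIMSEQ_metric)
      show "(\<lambda>\<omega>. if \<omega> \<in> N0 then y0 else Y n \<omega>) \<in> borel_measurable \<Omega>" for n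
      proof (rule measurable_If_set)
        show "Y n \<in> borel_measurable \<Omega>" using Ym[of n] by (simp add: measurable_restrict_space2_iff)
        show "N0 \<inter> space \<Omega> \<in> sets \<Omega>" using N0(1) by auto
      qed simp
      show "(\<lambda>n. if \<omega> \<in> N0 then y0 else Y n \<omega>) \<longlonglongrightarrow> Z \<omega>" for \<omega>
        using Zlim(1)[of \<omega>] by (cases "\<omega> \<in> N0") (auto simp: Z_def)
    qed
  qed
  have AEN0: "AE \<omega> in \<Omega>. \<omega> \<notin> N0" using N0(1) by (rule AE_not_in)
  have "AE \<omega> in distr \<Omega> \<Omega> sh. \<omega> \<notin> N0" unfolding shift' by (rule AEN0)
  then have AEshN0: "AE \<omega> in \<Omega>. sh \<omega> \<notin> N0" by (rule AE_distrD[OF shm])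
  have Zeq: "AE \<omega> in \<Omega>. Z \<omega> = G (\<omega> 1, Z (sh \<omega>))"
    using AEN0 AEshN0
  proof eventually_elim
    case (elim \<omega>)
    have C1: "C (\<omega> 1)" by (rule N0C[OF elim(1)])
    then have c1: "clip (\<omega> 1) = \<omega> 1" by (simp add: C_def clip_def)
    have "(\<lambda>n. dist (Y n (sh \<omega>)) (Z (sh \<omega>))) \<longlonglongrightarrow> 0"
      by (rule tendsto_dist_iff[THEN iffD1]) (rule Zlim(1)[OF elim(2)])
    then have l: "(\<lambda>n. \<alpha> * dist (Y n (sh \<omega>)) (Z (sh \<omega>))) \<longlonglongrightarrow> 0" by (rule tendsto_mult_right_zero)
    have "(\<lambda>n. dist (Y (Suc n) \<omega>) (G (\<omega> 1, Z (sh \<omega>)))) \<longlonglongrightarrow> 0"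
    proof (rule Lim_null_comparison[OF _ l], rule always_eventually, rule allI)
      fix n
      show "norm (dist (Y (Suc n) \<omega>) (G (\<omega> 1, Z (sh \<omega>)))) \<le> \<alpha> * dist (Y n (sh \<omega>)) (Z (sh \<omega>))"
        using C1 YK ZK unfolding YS c1 C_def by simp
    qed
    then have "(\<lambda>n. Y (Suc n) \<omega>) \<longlonglongrightarrow> G (\<omega> 1, Z (sh \<omega>))" by (rule tendsto_dist_iff[THEN iffD2])
    moreover have "(\<lambda>n. Y (Suc n) \<omega>) \<longlonglongrightarrow> Z \<omega>" using Zlim(1)[OF elim(1)] by (rule LIMSEQ_Suc)
    ultimately show ?case by (rule LIMSEQ_unique[symmetric])
  qed
  define q where "q \<omega> = (clip (\<omega> 0), Z \<omega>)" for \<omega> :: "nat \<Rightarrow> real"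
  have qm: "q \<in> measurable \<Omega> ?S"
  proof -
    have "q \<in> measurable \<Omega> (unit_leb \<Otimes>\<^sub>M ?BK)"
      unfolding q_def by (intro measurable_Pair measurable_compose[OF cm clipm] Zm)
    then show ?thesis using measurable_cong_sets[OF refl sets_Sigma_borel_pair[OF K(1) K0], of \<Omega>] by simp
  qed
  define M where "M = distr \<Omega> ?S q"
  have Fq: "AE \<omega> in \<Omega>. F (q (sh \<omega>)) = q \<omega>"
    using Zeq orbit[of 0] AEN0
  proof eventually_elim
    case (elim \<omega>)
    have "C (\<omega> 1)" by (rule N0C[OF elim(3)])
    then have c: "clip (\<omega> 1) = \<omega> 1" "\<omega> 1 \<in> {0..1}" by (auto simp: C_def clip_def)
    have "\<omega> 0 = f (\<omega> 1)" using elim(2) c by (simp add: \<phi>_def)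
    moreover from this have "clip (\<omega> 0) = \<omega> 0" using f01[OF c(2)] by (simp add: clip_def)
    ultimately show ?case using elim(1) c by (simp add: q_def F(1) sh_def)
  qed
  have "prob_space M" unfolding M_def by (rule \<Omega>.prob_space_distr[OF qm])
  moreover have "sets M = sets ?S" by (simp add: M_def)
  moreover have "distr M ?S F = M"
  proof -
    have "M = distr (distr \<Omega> \<Omega> sh) ?S q" by (simp add: M_def shift')
    also have "\<dots> = distr \<Omega> ?S (q \<circ> sh)" by (rule distr_distr[OF qm shm])
    finally have "distr M ?S F = distr (distr \<Omega> ?S (q \<circ> sh)) ?S F" by simp
    also have "\<dots> = distr \<Omega> ?S (F \<circ> (q \<circ> sh))"
      by (rule distr_distr[OF F(2) measurable_comp[OF shm qm]])
    also have "\<dots> = distr \<Omega> ?S q"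
      using Fq by (intro distr_cong_AE) (auto simp: measurable_comp[OF measurable_comp[OF shm qm] F(2)] qm)
    finally show ?thesis by (simp add: M_def)
  qed
  moreover have "distr M unit_leb fst = \<rho>"
  proof -
    have "distr M unit_leb fst = distr \<Omega> unit_leb (fst \<circ> q)"
      unfolding M_def by (rule distr_distr[OF fst_measurable_Sigma qm])
    also have "fst \<circ> q = clip \<circ> (\<lambda>\<omega>. \<omega> 0)" by (auto simp: q_def)
    also have "distr \<Omega> unit_leb (clip \<circ> (\<lambda>\<omega>. \<omega> 0)) = distr (distr \<Omega> borel (\<lambda>\<omega>. \<omega> 0)) unit_leb clip"
      by (rule distr_distr[OF clipm cm, symmetric])
    also have "\<dots> = distr \<rho> unit_leb (clip \<circ> (\<lambda>x. x))"
      unfolding proj \<nu>_def using idm by (intro distr_distr clipm) (simp add: \<rho>m)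
    also have "\<dots> = distr \<rho> \<rho> (\<lambda>x. x)"
      by (intro distr_cong) (auto simp: \<rho>(2) sp\<rho> clip_def)
    also have "\<dots> = \<rho>" by (rule distr_id2) simp
    finally show ?thesis .
  qed
  ultimately show ?thesis by blast
qed

section \<open>Bounded variation and the spectral decomposition\<close>

context class_T_map
begin

section \<open>Real-valued densities and nonsingularity of the base map\<close>

lemma dens_real_integrable: assumes "dens s m p" shows "integrable unit_leb (\<lambda>x. enn2real (p x))"
proof -
  interpret prob_space unit_leb by (rule prob_space_unit_leb)
  have "p \<in> borel_measurable unit_leb" using assms by (intro borel_measurable_unit_lebI dens_measurable)
  then show ?thesis
  proof (intro integrable_const_bound[of _ s])
    show "AE x in unit_leb. norm (enn2real (p x)) \<le> s"
      using AE_unit_leb_interior by eventually_elim (use assms in \<open>auto simp: dens_def intro!: enn2real_leI\<close>)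
  qed measurable
qed

lemma dens_set_integral:
  assumes d: "dens s m p" and A: "A \<in> sets unit_leb"
  shows "(LINT x:A|unit_leb. enn2real (p x)) = enn2real (\<integral>\<^sup>+x. indicator A x * p x \<partial>unit_leb)"
proof -
  have [measurable]: "p \<in> borel_measurable unit_leb" using d by (intro borel_measurable_unit_lebI dens_measurable)
  have "(LINT x:A|unit_leb. enn2real (p x)) = enn2real (\<integral>\<^sup>+x. ennreal (indicator A x *\<^sub>R enn2real (p x)) \<partial>unit_leb)"
    unfolding set_lebesgue_integral_def using A by (intro integral_eq_nn_integral) auto
  also have "(\<integral>\<^sup>+x. ennreal (indicator A x *\<^sub>R enn2real (p x)) \<partial>unit_leb) = (\<integral>\<^sup>+x. indicator A x * p x \<partial>unit_leb)"
  proof (rule nn_integral_cong_AE, use AE_unit_leb_interior in eventually_elim)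
    case (elim x)
    then have "p x \<le> ennreal s" using d by (simp add: dens_def)
    then have "p x < \<top>" by (simp add: order_le_less_trans)
    then show ?case by (simp add: indicator_def)
  qed
  finally show ?thesis .
qed

lemma dens_integral:
  assumes d: "dens s m p"
  shows "(LINT x|unit_leb. enn2real (p x)) = m"
proof -
  have "(LINT x|unit_leb. enn2real (p x)) = (LINT x:space unit_leb|unit_leb. enn2real (p x))"
    by (intro set_integral_space[symmetric] dens_real_integrable[OF d])
  also have "\<dots> = enn2real (\<integral>\<^sup>+x. indicator (space unit_leb) x * p x \<partial>unit_leb)"
    by (rule dens_set_integral[OF d]) (rule sets.top)
  also have "(\<integral>\<^sup>+x. indicator (space unit_leb) x * p x \<partial>unit_leb) = (\<integral>\<^sup>+x. p x \<partial>unit_leb)"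
    by (intro nn_integral_cong) (simp add: indicator_def)
  also have "enn2real \<dots> = m" using d by (simp add: dens_def)
  finally show ?thesis .
qed

lemma unit_leb_borel_subset: assumes "A \<in> sets unit_leb" shows "A \<in> sets borel" "A \<subseteq> {0..1}"
proof -
  show "A \<subseteq> {0..1}" using sets.sets_into_space[OF assms] by simp
  have "A \<in> sets (restrict_space borel {0..1})" using assms by (simp add: sets_unit_leb)
  then show "A \<in> sets borel" by (subst (asm) sets_restrict_space_iff) auto
qed

lemma dens_T_set_integral:
  assumes d: "dens s m p" and A: "A \<in> sets unit_leb"
  shows "(LINT x:A|unit_leb. enn2real (T p x)) = (LINT x:f -` A \<inter> {0..1}|unit_leb. enn2real (p x))"
proof -
  obtain s' where d': "dens s' m (T p)" using dens_T_pow[OF d, of 1] by auto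
  have fA: "f -` A \<inter> {0..1} \<in> sets unit_leb" using measurable_sets[OF f_meas A] by simp
  have "(\<integral>\<^sup>+x. indicator A x * T p x \<partial>unit_leb) = (\<integral>\<^sup>+x. indicator A (f x) * p x \<partial>unit_leb)"
    using dens_measurable[OF d] unit_leb_borel_subset[OF A] by (intro nn_integral_T) auto
  also have "\<dots> = (\<integral>\<^sup>+x. indicator (f -` A \<inter> {0..1}) x * p x \<partial>unit_leb)"
    by (intro nn_integral_cong) (auto simp: indicator_def)
  finally show ?thesis by (simp add: dens_set_integral[OF d' A] dens_set_integral[OF d fA])
qed

text \<open>Duality applied to the constant 1: the measure of the preimage is an integral over the
  null set \<open>A\<close>.\<close>

lemma f_nonsingular:
  assumes "A \<in> null_sets unit_leb" shows "f -` A \<inter> {0..1} \<in> null_sets unit_leb"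
proof -
  have A: "A \<in> sets unit_leb" and A0: "emeasure unit_leb A = 0" using assms by auto
  have fA: "f -` A \<inter> {0..1} \<in> sets unit_leb" using measurable_sets[OF f_meas A] by simp
  have "emeasure unit_leb (f -` A \<inter> {0..1}) = (\<integral>\<^sup>+x. indicator (f -` A \<inter> {0..1}) x \<partial>unit_leb)"
    using fA by simp
  also have "\<dots> = (\<integral>\<^sup>+x. indicator A (f x) * 1 \<partial>unit_leb)"
    by (intro nn_integral_cong) (auto simp: indicator_def)
  also have "\<dots> = (\<integral>\<^sup>+x. indicator A x * T (\<lambda>_. 1) x \<partial>unit_leb)"
    using unit_leb_borel_subset[OF A] by (intro nn_integral_T[symmetric]) auto
  also have "\<dots> = (\<integral>\<^sup>+x. 0 \<partial>unit_leb)"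
    using AE_not_in[OF assms] by (intro nn_integral_cong_AE) (auto elim!: eventually_mono)
  finally show ?thesis using fA by (intro null_setsI) auto
qed

lemma total_variation_dens_diff:
  assumes p: "dens s m p" and q: "dens s' m' q"
  shows "ess_variation (\<lambda>x. enn2real (p x) - enn2real (q x)) \<le> ennreal (s + s')"
proof -
  \<comment> \<open>Extends a density to a decreasing function on the line with values in [0,s], by
    \<open>s\<close> on the left and 0 on the right. Its variation is then at most \<open>s\<close>,
    whatever the values of the density at 0 and 1.\<close>
  define e where "e s p x = (if x \<le> 0 then s else if 1 \<le> x then 0 else enn2real (p x))" for s p and x :: real
  have e: "e s p y \<le> e s p x" "0 \<le> e s p x" "e s p x \<le> s" if d: "dens s m p" and "x \<le> y" for s m p x y
  proof -
    have b: "0 \<le> enn2real (p z) \<and> enn2real (p z) \<le> s" if "0 < z" "z < 1" for z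
      using d that by (auto simp: dens_def intro!: enn2real_leI)
    have s: "0 \<le> s" using d by (simp add: dens_def)
    have "enn2real (p y) \<le> enn2real (p x)" if "0 < x" "y < 1"
    proof (rule enn2real_mono)
      show "p y \<le> p x" using d that \<open>x \<le> y\<close> by (auto simp: dens_def decreasing_def)
      have "p x \<le> ennreal s" using d that \<open>x \<le> y\<close> by (auto simp: dens_def)
      then show "p x < \<top>" by (simp add: order_le_less_trans)
    qed
    then show "e s p y \<le> e s p x" "0 \<le> e s p x" "e s p x \<le> s"
      using b s \<open>x \<le> y\<close> by (auto simp: e_def)
  qed
  have "total_variation (\<lambda>x. e s p x - e s' q x) \<le> ennreal (s + s')"
    unfolding total_variation_def
  proof (rule SUP_least, clarsimp)
    fix n and t :: "nat \<Rightarrow> real" assume t: "mono_on {..n} t"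
    have tm: "t i \<le> t (Suc i)" if "i < n" for i using t that by (auto simp: mono_on_def)
    have "(\<Sum>i<n. \<bar>e s p (t (Suc i)) - e s' q (t (Suc i)) - (e s p (t i) - e s' q (t i))\<bar>)
      \<le> (\<Sum>i<n. (e s p (t i) - e s p (t (Suc i))) + (e s' q (t i) - e s' q (t (Suc i))))"
    proof (rule sum_mono)
      fix i assume "i \<in> {..<n}"
      then have "e s p (t (Suc i)) \<le> e s p (t i)" "e s' q (t (Suc i)) \<le> e s' q (t i)"
        using e(1)[OF p tm] e(1)[OF q tm] by auto
      then show "\<bar>e s p (t (Suc i)) - e s' q (t (Suc i)) - (e s p (t i) - e s' q (t i))\<bar> \<le>
        (e s p (t i) - e s p (t (Suc i))) + (e s' q (t i) - e s' q (t (Suc i)))" by linarith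
    qed
    also have "\<dots> = (e s p (t 0) - e s p (t n)) + (e s' q (t 0) - e s' q (t n))"
      unfolding sum.distrib sum_lessThan_telescope'[of "\<lambda>i. e s p (t i)"]
        sum_lessThan_telescope'[of "\<lambda>i. e s' q (t i)"] ..
    also have "\<dots> \<le> s + s'"
      using e(2,3)[OF p order_refl] e(2,3)[OF q order_refl] by (smt (verit))
    finally show "ennreal (\<Sum>i<n. \<bar>e s p (t (Suc i)) - e s' q (t (Suc i)) - (e s p (t i) - e s' q (t i))\<bar>) \<le> ennreal (s + s')"
      by (rule ennreal_leI)
  qed
  moreover have "AE x in unit_leb. e s p x - e s' q x = enn2real (p x) - enn2real (q x)"
    using AE_unit_leb_interior by eventually_elim (simp add: e_def)
  ultimately show ?thesis unfolding ess_variation_def by (intro INF_lower2) auto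
qed

lemma ess_variation_cong_AE:
  assumes "AE x in unit_leb. h x = k x" shows "ess_variation h = ess_variation k"
proof -
  have "{h'. AE x in unit_leb. h' x = h x} = {h'. AE x in unit_leb. h' x = k x}"
  proof (rule Collect_cong, rule iffI)
    fix h' assume "AE x in unit_leb. h' x = h x"
    then show "AE x in unit_leb. h' x = k x" using assms by eventually_elim simp
  next
    fix h' assume "AE x in unit_leb. h' x = k x"
    then show "AE x in unit_leb. h' x = h x" using assms by eventually_elim simp
  qed
  then show ?thesis by (simp add: ess_variation_def)
qed

lemma BV_of_dens:
  assumes p: "dens s m p" and q: "dens s' m' q" and h: "integrable unit_leb h"
    and eq: "AE x in unit_leb. h x = enn2real (p x) - enn2real (q x)"
  shows "h \<in> BV_m" "BV_norm h \<le> 2 * (s + s')" "(LINT x|unit_leb. \<bar>h x\<bar>) \<le> s + s'"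
proof -
  have ev: "ess_variation h \<le> ennreal (s + s')"
    using total_variation_dens_diff[OF p q] ess_variation_cong_AE[OF eq] by simp
  then show "h \<in> BV_m" using h by (simp add: BV_m_def order_le_less_trans)
  have s: "0 \<le> s" "0 \<le> s'" using p q by (auto simp: dens_def)
  have ip: "integrable unit_leb (\<lambda>x. enn2real (p x))" "integrable unit_leb (\<lambda>x. enn2real (q x))"
    using dens_real_integrable[OF p] dens_real_integrable[OF q] .
  have "(LINT x|unit_leb. \<bar>h x\<bar>) \<le> (LINT x|unit_leb. enn2real (p x) + enn2real (q x))"
  proof (rule integral_mono_AE)
    show "AE x in unit_leb. \<bar>h x\<bar> \<le> enn2real (p x) + enn2real (q x)"
      using eq by eventually_elim (simp add: abs_le_iff)
  qed (use h ip in auto)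
  also have "\<dots> = m + m'" using ip by (simp add: dens_integral[OF p] dens_integral[OF q])
  also have "\<dots> \<le> s + s'" using dens_mass_le[OF p] dens_mass_le[OF q] by simp
  finally show i: "(LINT x|unit_leb. \<bar>h x\<bar>) \<le> s + s'" .
  have "enn2real (ess_variation h) \<le> s + s'" using ev s by (intro enn2real_leI) auto
  then show "BV_norm h \<le> 2 * (s + s')" using i by (simp add: BV_norm_def)
qed

section \<open>Functions of bounded variation as differences of decreasing functions\<close>

lemma total_variation_pair:
  assumes "x \<in> {0..1}" "y \<in> {0..1}" "x \<le> y"
  shows "ennreal \<bar>h y - h x\<bar> \<le> total_variation h"
proof -
  have "ennreal (\<Sum>i<1. \<bar>h ((\<lambda>i. if i = 0 then x else y) (Suc i)) - h ((\<lambda>i. if i = 0 then x else y) i)\<bar>) \<le> total_variation h"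
    unfolding total_variation_def
    by (rule SUP_upper2[of "(1, \<lambda>i :: nat. if i = 0 then x else y)"]) (use assms in \<open>auto simp: mono_on_def\<close>)
  then show ?thesis by simp
qed

text \<open>The variation of \<open>h\<close> on \<open>[x, 1]\<close> is the total variation of \<open>h\<close> frozen to the left of \<open>x\<close>.\<close>

lemma total_variation_tail:
  assumes "x \<in> {0..1}" "y \<in> {0..1}" "x \<le> y"
  shows "ennreal \<bar>h y - h x\<bar> + total_variation (\<lambda>t. h (max y t)) \<le> total_variation (\<lambda>t. h (max x t))"
proof -
  let ?A = "{(n :: nat, t :: nat \<Rightarrow> real). mono_on {..n} t \<and> t ` {..n} \<subseteq> {0..1}}"
  have ne: "?A \<noteq> {}" by (intro ex_in_conv[THEN iffD1] exI[of _ "(0, \<lambda>_. 0)"]) (auto simp: mono_on_def)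
  have "ennreal \<bar>h y - h x\<bar> + total_variation (\<lambda>t. h (max y t)) =
      (SUP (n, t)\<in>?A. ennreal \<bar>h y - h x\<bar> + ennreal (\<Sum>i<n. \<bar>h (max y (t (Suc i))) - h (max y (t i))\<bar>))"
    unfolding total_variation_def by (subst ennreal_SUP_add_right[OF ne]) (simp add: split_beta)
  also have "\<dots> \<le> total_variation (\<lambda>t. h (max x t))"
  proof (rule SUP_least, clarsimp simp del: ennreal_plus)
    fix n and t :: "nat \<Rightarrow> real" assume t: "mono_on {..n} t" "t ` {..n} \<subseteq> {0..1}"
    \<comment> \<open>The points \<open>x\<close> and \<open>y\<close> are put in front of the given
      partition, whose points are pushed to the right of \<open>y\<close>. This adds the jump from
      \<open>x\<close> to \<open>y\<close> and one more nonnegative term, which the estimate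
      drops.\<close>
    define u where "u i = (case i of 0 \<Rightarrow> x | Suc 0 \<Rightarrow> y | Suc (Suc j) \<Rightarrow> max y (t j))" for i
    have u: "u 0 = x" "u (Suc 0) = y" "u (Suc (Suc j)) = max y (t j)" for j by (simp_all add: u_def)
    have um: "mono_on {..Suc (Suc n)} u"
    proof (rule mono_onI)
      fix i j assume ij: "i \<in> {..Suc (Suc n)}" "j \<in> {..Suc (Suc n)}" "i \<le> j"
      consider "i = 0" "j = 0" | "i = 0" "j = Suc 0" | j' where "i = 0" "j = Suc (Suc j')"
        | "i = Suc 0" "j = Suc 0" | j' where "i = Suc 0" "j = Suc (Suc j')"
        | i' j' where "i = Suc (Suc i')" "j = Suc (Suc j')"
        using ij(3) by (metis Suc_le_D Suc_le_mono le_zero_eq not0_implies_Suc)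
      then show "u i \<le> u j"
      proof cases
        case 6
        then have "t i' \<le> t j'" using t(1) ij by (auto simp: mono_on_def)
        then show ?thesis using 6 by (simp add: u max.coboundedI2)
      qed (use assms in \<open>auto simp: u intro: order_trans\<close>)
    qed
    have ur: "u ` {..Suc (Suc n)} \<subseteq> {0..1}"
    proof (rule image_subsetI)
      fix i assume i: "i \<in> {..Suc (Suc n)}"
      show "u i \<in> {0..1}"
      proof (cases i)
        case (Suc i')
        show ?thesis
        proof (cases i')
          case (Suc j)
          then have "t j \<in> {0..1}" using t(2) i \<open>i = Suc i'\<close> by auto
          then show ?thesis using assms Suc \<open>i = Suc i'\<close> by (auto simp: u max_def)
        qed (use assms Suc in \<open>simp add: u\<close>)
      qed (use assms in \<open>simp add: u\<close>)
    qed
    have mx: "max x (u i) = u i" for i using um assms by (auto simp: u_def max_def split: nat.splits)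
    have "ennreal \<bar>h y - h x\<bar> + ennreal (\<Sum>i<n. \<bar>h (max y (t (Suc i))) - h (max y (t i))\<bar>) \<le>
       ennreal (\<Sum>i<Suc (Suc n). \<bar>h (max x (u (Suc i))) - h (max x (u i))\<bar>)"
    proof -
      have "(\<Sum>i<Suc (Suc n). \<bar>h (u (Suc i)) - h (u i)\<bar>) =
         \<bar>h y - h x\<bar> + (\<bar>h (max y (t 0)) - h y\<bar> + (\<Sum>i<n. \<bar>h (max y (t (Suc i))) - h (max y (t i))\<bar>))"
        by (simp only: sum.lessThan_Suc_shift u)
      then show ?thesis unfolding mx
        by (subst ennreal_plus[symmetric]) (auto intro!: ennreal_leI sum_nonneg)
    qed
    also have "\<dots> \<le> total_variation (\<lambda>t. h (max x t))"
      unfolding total_variation_def by (rule SUP_upper2[of "(Suc (Suc n), u)"]) (use um ur in auto)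
    finally show "ennreal \<bar>h y - h x\<bar> + ennreal (\<Sum>i<n. \<bar>h (max y (t (Suc i))) - h (max y (t i))\<bar>) \<le>
      total_variation (\<lambda>t. h (max x t))" .
  qed
  finally show ?thesis .
qed

lemma dens_of_decreasing:
  fixes u :: "real \<Rightarrow> real"
  assumes "\<And>x y. 0 < x \<Longrightarrow> x \<le> y \<Longrightarrow> y < 1 \<Longrightarrow> u y \<le> u x" "\<And>x. 0 < x \<Longrightarrow> x < 1 \<Longrightarrow> 0 \<le> u x \<and> u x \<le> s" "0 \<le> s"
  shows "\<exists>m. dens s m (\<lambda>x. if x \<in> {0<..<1} then ennreal (u x) else 0)"
proof -
  let ?p = "\<lambda>x. if x \<in> {0<..<1} then ennreal (u x) else 0"
  have "mono_on {0<..<1} (\<lambda>x. - u x)" using assms(1) by (intro mono_onI) auto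
  then have "(\<lambda>x. - u x) \<in> borel_measurable (restrict_space borel {0<..<1})" by (rule borel_measurable_mono_on_fnc)
  then have "(\<lambda>x. if x \<in> {0<..<1} then - u x else 0) \<in> borel_measurable borel"
    by (subst (asm) measurable_restrict_space_iff[of _ _ 0]) auto
  then have "(\<lambda>x. ennreal (- (if x \<in> {0<..<1} then - u x else 0))) \<in> borel_measurable borel" by measurable
  also have "(\<lambda>x. ennreal (- (if x \<in> {0<..<1} then - u x else 0))) = ?p" by auto
  finally have pm: "?p \<in> borel_measurable borel" .
  have "(\<integral>\<^sup>+x. ?p x \<partial>unit_leb) \<le> (\<integral>\<^sup>+x. ennreal s \<partial>unit_leb)"
    using assms(2,3) by (intro nn_integral_mono) (auto intro: ennreal_leI)
  also have "\<dots> = ennreal s" by (simp add: emeasure_unit_leb)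
  finally have "(\<integral>\<^sup>+x. ?p x \<partial>unit_leb) < \<top>" by (simp add: order_le_less_trans)
  then have "(\<integral>\<^sup>+x. ?p x \<partial>unit_leb) = ennreal (enn2real (\<integral>\<^sup>+x. ?p x \<partial>unit_leb))" by simp
  then show ?thesis using pm assms unfolding dens_def decreasing_def
    by (intro exI[of _ "enn2real (\<integral>\<^sup>+x. ?p x \<partial>unit_leb)"]) (auto intro: ennreal_leI)
qed

text \<open>Jordan's decomposition with \<open>r x\<close>, the variation on [x,1]: both
  \<open>r\<close> and \<open>r + k\<close> decrease, and adding \<open>c\<close> makes them
  nonnegative. The representative \<open>k\<close> is chosen within \<open>b + v\<close> of the
  infimum in \<open>ess_variation\<close>; this takes a positive slack, so the case of norm zero is
  treated apart.\<close>

lemma BV_m_decomposition: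
  assumes h: "h \<in> BV_m"
  shows "\<exists>p q m m'. dens (6 * BV_norm h) m p \<and> dens (6 * BV_norm h) m' q \<and>
     (AE x in unit_leb. h x = enn2real (p x) - enn2real (q x))"
proof -
  have hi: "integrable unit_leb h" and hv: "ess_variation h < \<infinity>" using h by (auto simp: BV_m_def)
  define b where "b = (LINT x|unit_leb. \<bar>h x\<bar>)"
  define v where "v = enn2real (ess_variation h)"
  have b0: "0 \<le> b" and v0: "0 \<le> v" by (simp_all add: b_def v_def)
  have bv: "BV_norm h = b + v" by (simp add: BV_norm_def b_def v_def)
  show ?thesis
  proof (cases "b + v = 0")
    case True
    then have "b = 0" using b0 v0 by simp
    then have "AE x in unit_leb. \<bar>h x\<bar> = 0" unfolding b_def using hi
      by (subst integral_nonneg_eq_0_iff_AE[symmetric]) auto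
    then show ?thesis using True dens_const[of 0] bv
      by (intro exI[of _ "\<lambda>_. ennreal 0"] exI[of _ 0]) auto
  next
    case False
    then have pos: "0 < b + v" using b0 v0 by simp
    have "ess_variation h < ess_variation h + ennreal (b + v)"
      using hv pos by (cases "ess_variation h") (auto simp: ennreal_plus[symmetric] ennreal_less_iff simp del: ennreal_plus)
    then obtain k where k: "AE x in unit_leb. k x = h x" "total_variation k < ess_variation h + ennreal (b + v)"
      unfolding ess_variation_def by (subst (asm) INF_less_iff) auto
    have ev: "ess_variation h = ennreal v" using hv by (simp add: v_def)
    then have "total_variation k < ennreal (v + (b + v))"
      using k(2) ennreal_plus[of v "b + v"] v0 pos by (simp del: ennreal_plus)
    then have tvfin: "total_variation k < \<top>" by (auto intro: less_trans)
    define V where "V = enn2real (total_variation k)"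
    have V: "total_variation k = ennreal V" "0 \<le> V" using tvfin by (auto simp: V_def)
    have Vle: "V \<le> 2 * v + b" using \<open>total_variation k < ennreal (v + (b + v))\<close> V v0 b0
      by (simp add: ennreal_less_iff del: ennreal_plus)
    define w where "w x = total_variation (\<lambda>t. k (max x t))" for x
    have w0: "w 0 = total_variation k"
      unfolding w_def total_variation_def by (intro SUP_cong refl) (force simp: max_def image_subset_iff split: if_splits intro!: arg_cong[where f = ennreal] sum.cong)
    have wstep: "ennreal \<bar>k y - k x\<bar> + w y \<le> w x" if "x \<in> {0..1}" "y \<in> {0..1}" "x \<le> y" for x y
      unfolding w_def by (rule total_variation_tail[OF that])
    have wle: "w x \<le> ennreal V" if "x \<in> {0..1}" for x
      using wstep[of 0 x] that by (auto simp: w0 V(1)[symmetric] intro: order_trans[rotated] add_increasing)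
    define r where "r x = enn2real (w x)" for x
    have wr: "w x = ennreal (r x)" "0 \<le> r x" "r x \<le> V" if "x \<in> {0..1}" for x
    proof -
      have "w x < \<top>" using wle[OF that] by (simp add: order_le_less_trans)
      then show "w x = ennreal (r x)" "0 \<le> r x" by (simp_all add: r_def)
      show "r x \<le> V" unfolding r_def using wle[OF that] V(2) by (rule enn2real_leI[rotated])
    qed
    have rstep: "\<bar>k y - k x\<bar> + r y \<le> r x" if "x \<in> {0..1}" "y \<in> {0..1}" "x \<le> y" for x y
      using wstep[OF that] wr[OF that(1)] wr[OF that(2)] by (simp add: ennreal_plus[symmetric] del: ennreal_plus)
    \<comment> \<open>The values of \<open>k\<close> differ by at most \<open>V\<close> and the mean
      of its modulus is \<open>b\<close>, so \<open>V + b\<close> bounds \<open>k\<close>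
      everywhere.\<close>
    define c where "c = V + b"
    have kc: "\<bar>k x\<bar> \<le> c" if x: "x \<in> {0..1}" for x
    proof -
      interpret prob_space unit_leb by (rule prob_space_unit_leb)
      have low: "\<bar>k x\<bar> - V \<le> \<bar>k y\<bar>" if y: "y \<in> {0..1}" for y
      proof -
        have "\<bar>k y - k x\<bar> \<le> V"
        proof (cases "x \<le> y")
          case True
          then show ?thesis using total_variation_pair[OF x y True, of k] V by simp
        next
          case False
          then have "\<bar>k x - k y\<bar> \<le> V" using total_variation_pair[OF y x, of k] V by simp
          then show ?thesis by (simp add: abs_minus_commute)
        qed
        then show ?thesis by linarith
      qed
      have "AE y in unit_leb. \<bar>k x\<bar> - V \<le> \<bar>h y\<bar>"
        using k(1) AE_space[of unit_leb]
      proof eventually_elim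
        case (elim y)
        then show ?case using low[of y] by simp
      qed
      then have l: "(LINT y|unit_leb. \<bar>k x\<bar> - V) \<le> b"
        unfolding b_def using hi by (intro integral_mono_AE) auto
      have e: "(LINT y|unit_leb. \<bar>k x\<bar> - V) = \<bar>k x\<bar> - V"
        unfolding lebesgue_integral_const prob_space by simp
      from l[unfolded e] show ?thesis by (simp add: c_def)
    qed
    \<comment> \<open>This is \<open>3 * V + 2 * b\<close>, and \<open>V \<le> 2 * v + b\<close>
      turns it into at most \<open>6 * (b + v)\<close>, the origin of the factor 6.\<close>
    define s where "s = V + 2 * c"
    have c0: "0 \<le> c" using V b0 by (simp add: c_def)
    have s: "0 \<le> s" "s \<le> 6 * BV_norm h" using V c0 Vle b0 v0 by (auto simp: s_def c_def bv)
    let ?u = "\<lambda>x. r x + k x + c" and ?v = "\<lambda>x. r x + c"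
    obtain m where p: "dens s m (\<lambda>x. if x \<in> {0<..<1} then ennreal (?u x) else 0)"
    proof -
      have "\<exists>m. dens s m (\<lambda>x. if x \<in> {0<..<1} then ennreal (?u x) else 0)"
      proof (rule dens_of_decreasing)
        show "?u y \<le> ?u x" if "0 < x" "x \<le> y" "y < 1" for x y
          using rstep[of x y] that by auto
        show "0 \<le> ?u x \<and> ?u x \<le> s" if "0 < x" "x < 1" for x
          using wr[of x] kc[of x] that by (auto simp: s_def abs_le_iff)
      qed (rule s)
      then show ?thesis using that by blast
    qed
    obtain m' where q: "dens s m' (\<lambda>x. if x \<in> {0<..<1} then ennreal (?v x) else 0)"
    proof -
      have "\<exists>m. dens s m (\<lambda>x. if x \<in> {0<..<1} then ennreal (?v x) else 0)"
      proof (rule dens_of_decreasing)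
        show "?v y \<le> ?v x" if "0 < x" "x \<le> y" "y < 1" for x y
          using rstep[of x y] that by auto
        show "0 \<le> ?v x \<and> ?v x \<le> s" if "0 < x" "x < 1" for x
          using wr[of x] c0 that by (auto simp: s_def)
      qed (rule s)
      then show ?thesis using that by blast
    qed
    have "AE x in unit_leb. h x = enn2real (if x \<in> {0<..<1} then ennreal (?u x) else 0) -
        enn2real (if x \<in> {0<..<1} then ennreal (?v x) else 0)"
      using k(1) AE_unit_leb_interior
    proof eventually_elim
      case (elim x)
      then have "0 \<le> ?u x" "0 \<le> ?v x" using wr[of x] kc[of x] c0 by (auto simp: abs_le_iff)
      then show ?case using elim by simp
    qed
    then show ?thesis using dens_mono[OF p s(2)] dens_mono[OF q s(2)] by blast
  qed
qed

end

section \<open>The skew product acting on signed measures with densities of bounded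
  variation\<close>

lemma push_forward_add: "push_forward S F (\<mu> + \<nu>) = push_forward S F \<mu> + push_forward S F \<nu>"
  by (auto simp: push_forward_def)

lemma push_forward_scale: "push_forward S F (c *\<^sub>R \<mu>) = c *\<^sub>R push_forward S F \<mu>"
  by (auto simp: push_forward_def scaleR_fun_def)

locale skew_product = class_T_map f a b for f :: "real \<Rightarrow> real" and a b :: "nat \<Rightarrow> real" +
  fixes K :: "'k::metric_space set" and G :: "real \<times> 'k \<Rightarrow> 'k" and F :: "real \<times> 'k \<Rightarrow> real \<times> 'k" and \<alpha> :: real
  assumes K: "compact K" "diameter K = 1"
    and F: "\<And>x y. F (x, y) = (f x, G (x, y))" "F \<in> measurable (Sigma_borel K) (Sigma_borel K)"
    and \<alpha>: "0 < \<alpha>" "\<alpha> < 1"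
    and G: "AE x in unit_leb. \<forall>z1\<in>K. \<forall>z2\<in>K. dist (G (x, z1)) (G (x, z2)) \<le> \<alpha> * dist z1 z2"
begin

abbreviation "S \<equiv> Sigma_borel K"
abbreviation "push \<equiv> push_forward S F"
abbreviation "\<Phi> \<equiv> signed_density K"
abbreviation "L1 \<mu> \<equiv> enn2real (L1_enorm K \<mu>)"

lemma K_nonempty: "K \<noteq> {}"
  using K(2) by auto

lemma vertical_preimage: "F -` (A \<times> K) \<inter> space S = (f -` A \<inter> {0..1}) \<times> K"
proof -
  have "G (x, y) \<in> K" if "x \<in> {0..1}" "y \<in> K" for x y
    using measurable_space[OF F(2), of "(x, y)"] that F(1) by auto
  then show ?thesis using F(1) by auto
qed

lemma push_AB: assumes "\<mu> \<in> AB K" shows "push \<mu> \<in> AB K"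
  unfolding AB_iff
proof (intro conjI ballI impI)
  show "signed_measure S (push \<mu>)" by (rule signed_measure_push_forward[OF AB_signed_measure[OF assms] F(2)])
  fix A X assume A: "A \<in> null_sets unit_leb" and X: "X \<in> sets S" "X \<subseteq> A \<times> K"
  have "F -` X \<inter> space S \<subseteq> (f -` A \<inter> {0..1}) \<times> K" using X(2) vertical_preimage[of A] by blast
  then have "\<mu> (F -` X \<inter> space S) = 0"
    using assms f_nonsingular[OF A] measurable_sets[OF F(2) X(1)] unfolding AB_iff by blast
  then show "push \<mu> X = 0" using X(1) by (simp add: push_forward_def)
qed

lemma S1_iff: "\<mu> \<in> S1_space K \<longleftrightarrow> \<mu> \<in> AB K \<and> \<Phi> \<mu> \<in> BV_m"
  using L1_enorm_finite[OF K(1) K_nonempty] by (auto simp: S1_space_def L1_space_def)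

lemma BV_norm_nonneg: "0 \<le> BV_norm h"
  by (simp add: BV_norm_def)

text \<open>Stands in for the norm of bounded variation: up to constant factors the best
  \<open>s\<close> is that norm of the density, but the two parts can be followed through
  \<open>T\<close> separately. The masses are left open since they differ in general.\<close>

definition decreasing_rep :: "real \<Rightarrow> (real \<Rightarrow> ennreal) \<Rightarrow> (real \<Rightarrow> ennreal) \<Rightarrow> ((real \<times> 'k) set \<Rightarrow> real) \<Rightarrow> bool" where
  "decreasing_rep s p q \<mu> \<longleftrightarrow> \<mu> \<in> AB K \<and> (\<exists>m. dens s m p) \<and> (\<exists>m. dens s m q) \<and>
     (AE x in unit_leb. \<Phi> \<mu> x = enn2real (p x) - enn2real (q x))"

lemma decreasing_rep_norms:
  assumes "decreasing_rep s p q \<mu>"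
  shows "\<mu> \<in> S1_space K" "BV_norm (\<Phi> \<mu>) \<le> 4 * s" "(LINT x|unit_leb. \<bar>\<Phi> \<mu> x\<bar>) \<le> 2 * s"
proof -
  obtain m m' where *: "dens s m p" "dens s m' q" using assms by (auto simp: decreasing_rep_def)
  have "integrable unit_leb (\<Phi> \<mu>)" using assms by (auto simp: decreasing_rep_def intro: integrable_signed_density)
  from BV_of_dens[OF * this] assms
  show "\<mu> \<in> S1_space K" "BV_norm (\<Phi> \<mu>) \<le> 4 * s" "(LINT x|unit_leb. \<bar>\<Phi> \<mu> x\<bar>) \<le> 2 * s"
    by (auto simp: S1_iff decreasing_rep_def)
qed

lemma S1_decreasing_rep: assumes "\<mu> \<in> S1_space K" shows "\<exists>p q. decreasing_rep (6 * BV_norm (\<Phi> \<mu>)) p q \<mu>"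
  using assms BV_m_decomposition[of "\<Phi> \<mu>"] unfolding S1_iff decreasing_rep_def by blast

lemma decreasing_rep_add:
  assumes "decreasing_rep s p q \<mu>" "decreasing_rep s' p' q' \<nu>"
  shows "decreasing_rep (s + s') (\<lambda>x. p x + p' x) (\<lambda>x. q x + q' x) (\<mu> + \<nu>)"
proof -
  obtain m1 m2 m1' m2' where d: "dens s m1 p" "dens s m2 q" "dens s' m1' p'" "dens s' m2' q'"
    using assms by (auto simp: decreasing_rep_def)
  have "AE x in unit_leb. \<Phi> (\<mu> + \<nu>) x = enn2real (p x + p' x) - enn2real (q x + q' x)"
    using signed_density_add[of \<mu> K \<nu>] assms AE_unit_leb_interior unfolding decreasing_rep_def
  proof (elim conjE)
    assume a: "\<mu> \<in> AB K" "\<nu> \<in> AB K"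
      and b: "AE x in unit_leb. \<Phi> \<mu> x = enn2real (p x) - enn2real (q x)"
        "AE x in unit_leb. \<Phi> \<nu> x = enn2real (p' x) - enn2real (q' x)"
    show ?thesis using signed_density_add[OF a] b AE_unit_leb_interior
    proof eventually_elim
      case (elim x)
      have "u x < \<top>" if "dens t m u" for t m u
      proof -
        have "u x \<le> ennreal t" using that elim(4) by (simp add: dens_def)
        then show ?thesis by (simp add: order_le_less_trans)
      qed
      from this[OF d(1)] this[OF d(2)] this[OF d(3)] this[OF d(4)]
      show ?case using elim by (simp add: enn2real_plus)
    qed
  qed
  then show ?thesis using assms dens_add[OF d(1,3)] dens_add[OF d(2,4)]
    unfolding decreasing_rep_def by (auto intro: AB_add)
qed

lemma dens_cmult:
  assumes "dens s m p" "0 \<le> c" shows "dens (c * s) (c * m) (\<lambda>x. ennreal c * p x)"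
  using assms unfolding dens_def decreasing_def
  by (auto simp: nn_integral_cmult borel_measurable_unit_lebI ennreal_mult intro!: mult_left_mono)

text \<open>A negative factor exchanges the two parts.\<close>

lemma decreasing_rep_scale:
  assumes "decreasing_rep s p q \<mu>"
  shows "\<exists>p' q'. decreasing_rep (\<bar>c\<bar> * s) p' q' (c *\<^sub>R \<mu>)"
proof -
  obtain m1 m2 where d: "dens s m1 p" "dens s m2 q" using assms by (auto simp: decreasing_rep_def)
  have \<mu>: "\<mu> \<in> AB K" and ae: "AE x in unit_leb. \<Phi> \<mu> x = enn2real (p x) - enn2real (q x)"
    using assms by (auto simp: decreasing_rep_def)
  have d': "dens (\<bar>c\<bar> * s) (\<bar>c\<bar> * m1) (\<lambda>x. ennreal \<bar>c\<bar> * p x)" "dens (\<bar>c\<bar> * s) (\<bar>c\<bar> * m2) (\<lambda>x. ennreal \<bar>c\<bar> * q x)"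
    using d by (auto intro: dens_cmult)
  show ?thesis
  proof (cases "0 \<le> c")
    case True
    have "AE x in unit_leb. \<Phi> (c *\<^sub>R \<mu>) x = enn2real (ennreal \<bar>c\<bar> * p x) - enn2real (ennreal \<bar>c\<bar> * q x)"
      using signed_density_scale[OF \<mu>, of c] ae
      by eventually_elim (use True in \<open>simp add: enn2real_mult right_diff_distrib\<close>)
    then show ?thesis using d' AB_scale[OF \<mu>] unfolding decreasing_rep_def by blast
  next
    case False
    have "AE x in unit_leb. \<Phi> (c *\<^sub>R \<mu>) x = enn2real (ennreal \<bar>c\<bar> * q x) - enn2real (ennreal \<bar>c\<bar> * p x)"
      using signed_density_scale[OF \<mu>, of c] ae
      by eventually_elim (use False in \<open>simp add: enn2real_mult algebra_simps\<close>)
    then show ?thesis using d' AB_scale[OF \<mu>] unfolding decreasing_rep_def by blast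
  qed
qed

lemma S1_add: "\<mu> \<in> S1_space K \<Longrightarrow> \<nu> \<in> S1_space K \<Longrightarrow> \<mu> + \<nu> \<in> S1_space K"
  using S1_decreasing_rep decreasing_rep_add decreasing_rep_norms(1) by meson

lemma S1_scale: "\<mu> \<in> S1_space K \<Longrightarrow> c *\<^sub>R \<mu> \<in> S1_space K"
  using S1_decreasing_rep decreasing_rep_scale decreasing_rep_norms(1) by meson

text \<open>Above \<open>A\<close> the push-forward takes the value of \<open>\<mu>\<close> above
  the preimage of \<open>A\<close>; duality turns the integrals of \<open>p\<close> and
  \<open>q\<close> over the preimage into those of \<open>T p\<close> and \<open>T q\<close> over
  \<open>A\<close>.\<close>

lemma decreasing_rep_push:
  assumes "decreasing_rep s p q \<mu>"
  shows "AE x in unit_leb. \<Phi> (push \<mu>) x = enn2real (T p x) - enn2real (T q x)"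
    "\<exists>s'. decreasing_rep s' (T p) (T q) (push \<mu>)"
proof -
  obtain m1 m2 where d: "dens s m1 p" "dens s m2 q" using assms by (auto simp: decreasing_rep_def)
  have \<mu>: "\<mu> \<in> AB K" and ae: "AE x in unit_leb. \<Phi> \<mu> x = enn2real (p x) - enn2real (q x)"
    using assms by (auto simp: decreasing_rep_def)
  obtain s1 s2 where s1: "dens s1 m1 (T p)" and s2: "dens s2 m2 (T q)"
    using dens_T_pow[OF d(1), of 1] dens_T_pow[OF d(2), of 1] by auto
  have si: "set_integrable unit_leb A (\<lambda>x. enn2real (u x))" if "dens t m u" "A \<in> sets unit_leb" for t m u A
    unfolding set_integrable_def by (intro integrable_mult_indicator dens_real_integrable[OF that(1)] that(2))
  show ae': "AE x in unit_leb. \<Phi> (push \<mu>) x = enn2real (T p x) - enn2real (T q x)"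
  proof (rule signed_density_unique[OF push_AB[OF \<mu>]])
    show "integrable unit_leb (\<lambda>x. enn2real (T p x) - enn2real (T q x))"
      using dens_real_integrable[OF s1] dens_real_integrable[OF s2] by simp
    fix A assume A: "A \<in> sets unit_leb"
    have fA: "f -` A \<inter> {0..1} \<in> sets unit_leb" using measurable_sets[OF f_meas A] by simp
    have "push \<mu> (A \<times> K) = \<mu> ((f -` A \<inter> {0..1}) \<times> K)"
      using sets_Sigma_vertical[OF A, of K] by (simp add: push_forward_def vertical_preimage[symmetric])
    also have "\<dots> = (LINT x:f -` A \<inter> {0..1}|unit_leb. \<Phi> \<mu> x)" by (rule signed_density_integral[OF \<mu> fA])
    also have "\<dots> = (LINT x:f -` A \<inter> {0..1}|unit_leb. enn2real (p x) - enn2real (q x))"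
      using ae integrable_signed_density[OF \<mu>] dens_real_integrable[OF d(1)] dens_real_integrable[OF d(2)] fA
      unfolding set_lebesgue_integral_def by (intro integral_cong_AE) (auto elim!: eventually_mono)
    also have "\<dots> = (LINT x:f -` A \<inter> {0..1}|unit_leb. enn2real (p x)) - (LINT x:f -` A \<inter> {0..1}|unit_leb. enn2real (q x))"
      by (rule set_integral_diff(2)[OF si[OF d(1) fA] si[OF d(2) fA]])
    also have "\<dots> = (LINT x:A|unit_leb. enn2real (T p x)) - (LINT x:A|unit_leb. enn2real (T q x))"
      by (simp add: dens_T_set_integral[OF d(1) A] dens_T_set_integral[OF d(2) A])
    also have "\<dots> = (LINT x:A|unit_leb. enn2real (T p x) - enn2real (T q x))"
      by (rule set_integral_diff(2)[OF si[OF s1 A] si[OF s2 A], symmetric])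
    finally show "push \<mu> (A \<times> K) = (LINT x:A|unit_leb. enn2real (T p x) - enn2real (T q x))" .
  qed
  have "dens (max s1 s2) m1 (T p)" "dens (max s1 s2) m2 (T q)"
    using dens_mono[OF s1] dens_mono[OF s2] by auto
  then show "\<exists>s'. decreasing_rep s' (T p) (T q) (push \<mu>)" using ae' push_AB[OF \<mu>] unfolding decreasing_rep_def by blast
qed

lemma decreasing_rep_push_pow:
  assumes "decreasing_rep s p q \<mu>" shows "\<exists>s'. decreasing_rep s' ((T ^^ n) p) ((T ^^ n) q) ((push ^^ n) \<mu>)"
proof (induction n)
  case (Suc n)
  then obtain s' where "decreasing_rep s' ((T ^^ n) p) ((T ^^ n) q) ((push ^^ n) \<mu>)" by blast
  from decreasing_rep_push(2)[OF this] show ?case by simp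
qed (use assms in auto)

lemma push_S1: "\<mu> \<in> S1_space K \<Longrightarrow> push \<mu> \<in> S1_space K"
  using S1_decreasing_rep decreasing_rep_push(2) decreasing_rep_norms(1) by meson

lemma mass_eq_integral:
  assumes "\<mu> \<in> AB K" shows "\<mu> (space S) = (LINT x|unit_leb. \<Phi> \<mu> x)"
proof -
  have "\<mu> (space unit_leb \<times> K) = (LINT x:space unit_leb|unit_leb. \<Phi> \<mu> x)"
    by (rule signed_density_integral[OF assms]) (rule sets.top)
  also have "\<dots> = (LINT x|unit_leb. \<Phi> \<mu> x)" by (rule set_integral_space[OF integrable_signed_density[OF assms]])
  finally show ?thesis by simp
qed

lemma decreasing_rep_mass:
  assumes r: "decreasing_rep s p q \<mu>" and d: "dens s m p" "dens s m' q"
  shows "\<mu> (space S) = m - m'"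
proof -
  have "\<mu> (space S) = (LINT x|unit_leb. \<Phi> \<mu> x)" using r by (intro mass_eq_integral) (simp add: decreasing_rep_def)
  also have "\<dots> = (LINT x|unit_leb. enn2real (p x) - enn2real (q x))"
    using r integrable_signed_density[of \<mu> K] dens_real_integrable[OF d(1)] dens_real_integrable[OF d(2)]
    by (intro integral_cong_AE) (auto simp: decreasing_rep_def)
  also have "\<dots> = m - m'"
    using dens_real_integrable[OF d(1)] dens_real_integrable[OF d(2)] by (simp add: dens_integral[OF d(1)] dens_integral[OF d(2)])
  finally show ?thesis .
qed

lemma push_mass: "\<mu> (space S) = push \<mu> (space S)"
proof -
  have "F -` space S \<inter> space S = space S" using measurable_space[OF F(2)] by blast
  then show ?thesis unfolding push_forward_def using sets.top[of S] by simp
qed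

lemma mass_le_norm: assumes "\<mu> \<in> S1_space K" shows "\<bar>\<mu> (space S)\<bar> \<le> S1_norm K \<mu>"
proof -
  have \<mu>: "\<mu> \<in> AB K" using assms by (simp add: S1_iff)
  have "\<bar>\<mu> (space S)\<bar> \<le> (LINT x|unit_leb. \<bar>\<Phi> \<mu> x\<bar>)"
    unfolding mass_eq_integral[OF \<mu>] using integral_norm_bound[of unit_leb "\<Phi> \<mu>"] by simp
  also have "\<dots> \<le> S1_norm K \<mu>" by (simp add: S1_norm_def BV_norm_def)
  finally show ?thesis .
qed

text \<open>Zero total mass means that the two decreasing parts have equal mass, so their difference
  contracts. The fibre norm then obeys a recursion with factor \<open>\<alpha>\<close> and an
  exponentially small inhomogeneous term.\<close>

lemma zero_mass_decay:
  "\<exists>l0 U. 0 \<le> l0 \<and> l0 < 1 \<and> 0 \<le> U \<and>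
    (\<forall>\<mu>\<in>S1_space K. \<mu> (space S) = 0 \<longrightarrow> (\<forall>n. S1_norm K ((push ^^ n) \<mu>) \<le> U * l0 ^ n * S1_norm K \<mu>))"
proof -
  obtain \<eta> C where \<eta>: "0 < \<eta>" "\<eta> < 1" "0 \<le> C" and
    contr: "\<And>p q s m n. dens s m p \<Longrightarrow> dens s m q \<Longrightarrow>
      \<exists>p' q' m'. dens (C * \<eta> ^ n * s) m' p' \<and> dens (C * \<eta> ^ n * s) m' q' \<and>
        (\<forall>x\<in>{0<..<1}. enn2real ((T ^^ n) p x) - enn2real ((T ^^ n) q x) =
            enn2real (p' x) - enn2real (q' x))"
    using density_contraction by blast
  define r where "r = max \<alpha> \<eta>"
  \<comment> \<open>Strictly above both rates: if \<open>\<alpha>\<close> and \<open>\<eta>\<close>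
    coincide, unrolling the recursion produces an extra factor \<open>n\<close>.\<close>
  define r0 where "r0 = (1 + r) / 2"
  have r: "0 < r" "r < 1" "\<alpha> \<le> r" "\<eta> \<le> r" using \<alpha> \<eta> by (auto simp: r_def)
  have r0: "r < r0" "r0 < 1" "0 < r0" using r by (auto simp: r0_def)
  \<comment> \<open>Solves \<open>E * (r0 - r) = 12 * C\<close>, which is what closes the induction
    for \<open>l1\<close>. The 12 is the 6 of the decomposition into decreasing densities, doubled
    for the two parts.\<close>
  define E where "E = 12 * C / (r0 - r)"
  have E: "0 \<le> E" "E * (r0 - r) = 12 * C" using \<eta> r0 by (auto simp: E_def)
  define U where "U = 24 * C + 1 + E"
  have U: "0 \<le> U" using E \<eta> by (simp add: U_def)
  have "S1_norm K ((push ^^ n) \<mu>) \<le> U * r0 ^ n * S1_norm K \<mu>"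
    if \<mu>: "\<mu> \<in> S1_space K" and zero: "\<mu> (space S) = 0" for \<mu> n
  proof -
    define B where "B = BV_norm (\<Phi> \<mu>)"
    have B: "0 \<le> B" by (simp add: B_def BV_norm_nonneg)
    obtain p q where decreasing_rep: "decreasing_rep (6 * B) p q \<mu>" using S1_decreasing_rep[OF \<mu>] by (auto simp: B_def)
    then obtain m m' where d: "dens (6 * B) m p" "dens (6 * B) m' q" by (auto simp: decreasing_rep_def)
    have "m = m'" using decreasing_rep_mass[OF decreasing_rep d] zero by simp
    then have d2: "dens (6 * B) m q" using d by simp
    have rn: "\<exists>p' q'. decreasing_rep (C * \<eta> ^ n * (6 * B)) p' q' ((push ^^ n) \<mu>)" for n
    proof -
      obtain s' where s': "decreasing_rep s' ((T ^^ n) p) ((T ^^ n) q) ((push ^^ n) \<mu>)" using decreasing_rep_push_pow[OF decreasing_rep] by blast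
      obtain p' q' m' where *: "dens (C * \<eta> ^ n * (6 * B)) m' p'" "dens (C * \<eta> ^ n * (6 * B)) m' q'"
        "\<forall>x\<in>{0<..<1}. enn2real ((T ^^ n) p x) - enn2real ((T ^^ n) q x) = enn2real (p' x) - enn2real (q' x)"
        using contr[OF d(1) d2, of n] by blast
      have "AE x in unit_leb. \<Phi> ((push ^^ n) \<mu>) x = enn2real ((T ^^ n) p x) - enn2real ((T ^^ n) q x)"
        using s' by (simp add: decreasing_rep_def)
      then have "AE x in unit_leb. \<Phi> ((push ^^ n) \<mu>) x = enn2real (p' x) - enn2real (q' x)"
        using AE_unit_leb_interior by eventually_elim (simp add: *(3))
      then have "decreasing_rep (C * \<eta> ^ n * (6 * B)) p' q' ((push ^^ n) \<mu>)"
        using s' *(1,2) unfolding decreasing_rep_def by blast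
      then show ?thesis by blast
    qed
    have pow: "\<eta> ^ n \<le> r0 ^ n" for n using \<eta> r r0 by (intro power_mono) auto
    have bv: "BV_norm (\<Phi> ((push ^^ n) \<mu>)) \<le> 24 * C * r0 ^ n * B" for n
    proof -
      obtain p' q' where "decreasing_rep (C * \<eta> ^ n * (6 * B)) p' q' ((push ^^ n) \<mu>)" using rn by blast
      from decreasing_rep_norms(2)[OF this] have "BV_norm (\<Phi> ((push ^^ n) \<mu>)) \<le> 24 * C * \<eta> ^ n * B" by simp
      also have "\<dots> \<le> 24 * C * r0 ^ n * B" using pow[of n] \<eta> B by (intro mult_right_mono mult_left_mono) auto
      finally show ?thesis .
    qed
    have int: "(LINT x|unit_leb. \<bar>\<Phi> ((push ^^ n) \<mu>) x\<bar>) \<le> 12 * C * r0 ^ n * B" for n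
    proof -
      obtain p' q' where "decreasing_rep (C * \<eta> ^ n * (6 * B)) p' q' ((push ^^ n) \<mu>)" using rn by blast
      from decreasing_rep_norms(3)[OF this] have "(LINT x|unit_leb. \<bar>\<Phi> ((push ^^ n) \<mu>) x\<bar>) \<le> 12 * C * \<eta> ^ n * B" by simp
      also have "\<dots> \<le> 12 * C * r0 ^ n * B" using pow[of n] \<eta> B by (intro mult_right_mono mult_left_mono) auto
      finally show ?thesis .
    qed
    have ab: "(push ^^ n) \<mu> \<in> AB K" for n
      using \<mu> by (induction n) (auto simp: S1_iff intro: push_AB)
    have l1: "L1 ((push ^^ n) \<mu>) \<le> r0 ^ n * (L1 \<mu> + E * B)" for n
    proof (induction n)
      case 0
      then show ?case using E B by simp
    next
      case (Suc n)
      have "L1 (push ((push ^^ n) \<mu>)) \<le> \<alpha> * L1 ((push ^^ n) \<mu>) + (LINT x|unit_leb. \<bar>\<Phi> ((push ^^ n) \<mu>) x\<bar>)"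
        by (rule L1_norm_push_forward[OF K ab F \<alpha>(1) G push_AB[OF ab]])
      also have "\<dots> \<le> r * (r0 ^ n * (L1 \<mu> + E * B)) + 12 * C * r0 ^ n * B"
        using Suc int[of n] r \<alpha> by (intro add_mono mult_mono) auto
      also have "\<dots> = r0 ^ n * (r * L1 \<mu> + (r * E + E * (r0 - r)) * B)"
        unfolding E(2) by (simp add: algebra_simps)
      also have "\<dots> \<le> r0 ^ n * (r0 * L1 \<mu> + (r0 * E) * B)"
        using r0 B E(1) by (intro mult_left_mono add_mono mult_right_mono) (auto simp: algebra_simps)
      also have "\<dots> = r0 ^ Suc n * (L1 \<mu> + E * B)" by (simp add: algebra_simps)
      finally show ?case by simp
    qed
    have "S1_norm K ((push ^^ n) \<mu>) \<le> 24 * C * r0 ^ n * B + r0 ^ n * (L1 \<mu> + E * B)"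
      unfolding S1_norm_def using bv[of n] l1[of n] by linarith
    also have "\<dots> = r0 ^ n * ((24 * C + E) * B + 1 * L1 \<mu>)" by (simp add: algebra_simps)
    also have "\<dots> \<le> r0 ^ n * (U * B + U * L1 \<mu>)"
      using B r0 E \<eta> by (intro mult_left_mono add_mono mult_right_mono) (auto simp: U_def)
    also have "\<dots> = U * r0 ^ n * S1_norm K \<mu>" by (simp add: S1_norm_def B_def algebra_simps)
    finally show ?thesis .
  qed
  then show ?thesis using r0 U by (intro exI[of _ r0] exI[of _ U]) auto
qed

text \<open>The invariant density gives the base measure that is lifted to the skew product. With
  zero as second part it is its own decreasing representation, which places the lift in
  \<open>S1_space\<close>.\<close>

lemma invariant_measure:
  "\<exists>\<mu>0\<in>S1_space K. push \<mu>0 = \<mu>0 \<and> \<mu>0 (space S) = 1"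
proof -
  obtain s h where h: "dens s 1 h" and Th: "\<And>x. x \<in> {0<..<1} \<Longrightarrow> T h x = h x" using invariant_density by blast
  have hm[measurable]: "h \<in> borel_measurable borel" by (rule dens_measurable[OF h])
  have hu: "h \<in> borel_measurable unit_leb" by (rule borel_measurable_unit_lebI[OF hm])
  define \<rho> where "\<rho> = density unit_leb h"
  have em\<rho>: "emeasure \<rho> A = (\<integral>\<^sup>+x. indicator A x * h x \<partial>unit_leb)" if "A \<in> sets unit_leb" for A
    unfolding \<rho>_def using that hu by (simp add: emeasure_density mult.commute)
  have p\<rho>: "prob_space \<rho>"
  proof
    have "emeasure \<rho> (space \<rho>) = emeasure \<rho> (space unit_leb)" by (simp add: \<rho>_def)
    also have "\<dots> = (\<integral>\<^sup>+x. indicator (space unit_leb) x * h x \<partial>unit_leb)" by (rule em\<rho>) (rule sets.top)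
    also have "\<dots> = (\<integral>\<^sup>+x. h x \<partial>unit_leb)" by (intro nn_integral_cong) (simp add: indicator_def)
    finally show "emeasure \<rho> (space \<rho>) = 1" using h by (simp add: dens_def)
  qed
  have ac: "absolutely_continuous unit_leb \<rho>"
    unfolding \<rho>_def by (rule absolutely_continuousI_density[OF hu])
  have inv: "distr \<rho> unit_leb f = \<rho>"
  proof (rule measure_eqI)
    fix A assume "A \<in> sets (distr \<rho> unit_leb f)"
    then have A: "A \<in> sets unit_leb" by simp
    have fA: "f -` A \<inter> {0..1} \<in> sets unit_leb" using measurable_sets[OF f_meas A] by simp
    have "emeasure (distr \<rho> unit_leb f) A = emeasure \<rho> (f -` A \<inter> {0..1})"
      using f_meas A by (subst emeasure_distr) (simp_all add: \<rho>_def)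
    also have "\<dots> = (\<integral>\<^sup>+x. indicator (f -` A \<inter> {0..1}) x * h x \<partial>unit_leb)" by (rule em\<rho>[OF fA])
    also have "\<dots> = (\<integral>\<^sup>+x. indicator A (f x) * h x \<partial>unit_leb)"
      by (intro nn_integral_cong) (auto simp: indicator_def)
    also have "\<dots> = (\<integral>\<^sup>+x. indicator A x * T h x \<partial>unit_leb)"
      using unit_leb_borel_subset[OF A] by (intro nn_integral_T[symmetric]) auto
    also have "\<dots> = (\<integral>\<^sup>+x. indicator A x * h x \<partial>unit_leb)"
      by (rule nn_integral_cong_AE, use AE_unit_leb_interior in eventually_elim) (simp add: Th)
    also have "\<dots> = emeasure \<rho> A" by (rule em\<rho>[OF A, symmetric])
    finally show "emeasure (distr \<rho> unit_leb f) A = emeasure \<rho> A" .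
  qed (simp add: \<rho>_def)
  obtain M where M: "prob_space M" "sets M = sets S" "distr M S F = M" "distr M unit_leb fst = \<rho>"
    using skew_product_invariant_measure[OF K F less_imp_le[OF \<alpha>(1)] \<alpha>(2) G f_meas p\<rho> _ ac inv] by (auto simp: \<rho>_def)
  interpret M: prob_space M by (rule M(1))
  have spM: "space M = space S" by (rule sets_eq_imp_space_eq[OF M(2)])
  have Mm: "measurable M N = measurable S N" for N :: "'z measure" by (rule measurable_cong_sets[OF M(2) refl])
  have vert: "emeasure M (A \<times> K) = emeasure \<rho> A" if A: "A \<in> sets unit_leb" for A
  proof -
    have "emeasure \<rho> A = emeasure (marginal M) A" by (simp add: marginal_def M(4))
    then show ?thesis using emeasure_marginal[OF M(2) A] by simp
  qed
  define \<mu>0 where "\<mu>0 = measure M"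
  have sm: "signed_measure S \<mu>0" unfolding \<mu>0_def by (rule signed_measure_measure[OF M.finite_measure_axioms M(2)])
  have ab: "\<mu>0 \<in> AB K"
    unfolding AB_iff
  proof (intro conjI sm ballI impI)
    fix A X assume A: "A \<in> null_sets unit_leb" and X: "X \<in> sets S" "X \<subseteq> A \<times> K"
    have sA: "A \<in> sets unit_leb" using A by auto
    have "A \<in> null_sets \<rho>" using A ac by (auto simp: absolutely_continuous_def)
    then have "emeasure M (A \<times> K) = 0" using vert[OF sA] by (simp add: null_setsD1)
    moreover have "emeasure M X \<le> emeasure M (A \<times> K)"
      using X sets_Sigma_vertical[OF sA, of K] by (intro emeasure_mono) (auto simp: M(2))
    ultimately show "\<mu>0 X = 0" by (simp add: \<mu>0_def measure_def)
  qed
  have d0: "dens s 0 (\<lambda>_. 0)" using dens_mono[OF dens_const[of 0], of s] h by (simp add: dens_def)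
  have "AE x in unit_leb. \<Phi> \<mu>0 x = enn2real (h x)"
  proof (rule signed_density_unique[OF ab dens_real_integrable[OF h]])
    fix A assume A: "A \<in> sets unit_leb"
    have "\<mu>0 (A \<times> K) = enn2real (\<integral>\<^sup>+x. indicator A x * h x \<partial>unit_leb)"
      unfolding \<mu>0_def measure_def vert[OF A] em\<rho>[OF A] ..
    then show "\<mu>0 (A \<times> K) = (LINT x:A|unit_leb. enn2real (h x))"
      using dens_set_integral[OF h A] by simp
  qed
  then have "decreasing_rep s h (\<lambda>_. 0) \<mu>0" using ab h d0 unfolding decreasing_rep_def by auto
  then have "\<mu>0 \<in> S1_space K" by (rule decreasing_rep_norms)
  moreover have "push \<mu>0 = \<mu>0"
  proof
    fix E show "push \<mu>0 E = \<mu>0 E"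
    proof (cases "E \<in> sets S")
      case True
      have "measure M E = measure (distr M S F) E" by (simp add: M(3))
      also have "\<dots> = measure M (F -` E \<inter> space S)"
        using True F(2) by (subst measure_distr) (simp_all add: Mm spM)
      finally show ?thesis using True by (simp add: push_forward_def \<mu>0_def)
    next
      case False
      then show ?thesis using sm by (simp add: push_forward_def signed_measure_def)
    qed
  qed
  moreover have "\<mu>0 (space S) = 1" unfolding \<mu>0_def spM[symmetric] by (rule M.prob_space)
  ultimately show ?thesis by blast
qed

text \<open>Push-forward preserves total mass, so the kernel of \<open>P\<close>, the measures of
  mass zero, is invariant under it. This makes both products of \<open>P\<close> and
  \<open>N\<close> vanish and reduces powers of \<open>N\<close> to powers of the
  push-forward.\<close>

theorem spectral_decomposition:
  "\<exists>P N :: ((real \<times> 'k) set \<Rightarrow> real) \<Rightarrow> ((real \<times> 'k) set \<Rightarrow> real).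
    linear_operator_on (S1_space K) P \<and>
    linear_operator_on (S1_space K) N \<and>
    (\<forall>\<mu>\<in>S1_space K. push \<mu> \<in> S1_space K \<and> push \<mu> = P \<mu> + N \<mu>) \<and>
    (\<forall>\<mu>\<in>S1_space K. P (P \<mu>) = P \<mu>) \<and>
    dim (P ` S1_space K) = 1 \<and>
    (\<exists>l0 U :: real. 0 \<le> l0 \<and> l0 < 1 \<and> 0 \<le> U \<and>
      (\<forall>\<mu>\<in>S1_space K. \<forall>n\<ge>1. S1_norm K ((N ^^ n) \<mu>) \<le> S1_norm K \<mu> * l0 ^ n * U)) \<and>
    (\<forall>\<mu>\<in>S1_space K. P (N \<mu>) = 0 \<and> N (P \<mu>) = 0)"
proof -
  obtain \<mu>0 where \<mu>0: "\<mu>0 \<in> S1_space K" "push \<mu>0 = \<mu>0" "\<mu>0 (space S) = 1" using invariant_measure by blast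
  obtain l0 U where l0: "0 \<le> l0" "l0 < 1" "0 \<le> U" and
    decay: "\<And>\<mu> n. \<mu> \<in> S1_space K \<Longrightarrow> \<mu> (space S) = 0 \<Longrightarrow> S1_norm K ((push ^^ n) \<mu>) \<le> U * l0 ^ n * S1_norm K \<mu>"
    using zero_mass_decay by blast
  define P where "P \<mu> = \<mu> (space S) *\<^sub>R \<mu>0" for \<mu>
  define N where "N \<mu> = push \<mu> + (-1) *\<^sub>R P \<mu>" for \<mu>
  have P_S1: "P \<mu> \<in> S1_space K" for \<mu> unfolding P_def by (intro S1_scale \<mu>0)
  have P_add: "P (\<mu> + \<nu>) = P \<mu> + P \<nu>" for \<mu> \<nu> by (simp add: P_def scaleR_add_left)
  have P_scale: "P (c *\<^sub>R \<mu>) = c *\<^sub>R P \<mu>" for c \<mu> by (simp add: P_def scaleR_fun_def mult_ac)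
  have mass_P: "P \<mu> (space S) = \<mu> (space S)" for \<mu> unfolding P_def scaleR_fun_def \<mu>0(3) by simp
  have PP: "P (P \<mu>) = P \<mu>" for \<mu> using mass_P[of \<mu>] by (simp add: P_def)
  have pushP: "push (P \<mu>) = P \<mu>" for \<mu> by (simp add: P_def push_forward_scale \<mu>0)
  have N_S1: "N \<mu> \<in> S1_space K" if "\<mu> \<in> S1_space K" for \<mu>
    unfolding N_def by (intro S1_add S1_scale push_S1 P_S1 that)
  have N_add: "N (\<mu> + \<nu>) = N \<mu> + N \<nu>" for \<mu> \<nu>
    by (simp add: N_def P_add push_forward_add scaleR_add_right)
  have N_scale: "N (c *\<^sub>R \<mu>) = c *\<^sub>R N \<mu>" for c \<mu>
    by (simp add: N_def P_scale push_forward_scale scaleR_diff_right scaleR_left_commute)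
  have PN: "P (N \<mu>) = 0" for \<mu>
  proof -
    have "N \<mu> (space S) = push \<mu> (space S) - P \<mu> (space S)" by (simp add: N_def)
    then have "N \<mu> (space S) = 0" using mass_P[of \<mu>] push_mass[of \<mu>] by simp
    then show ?thesis unfolding P_def[of "N \<mu>"] by simp
  qed
  have NP: "N (P \<mu>) = 0" for \<mu> by (simp add: N_def PP pushP)
  define \<nu> where "\<nu> \<mu> = \<mu> + (-1) *\<^sub>R P \<mu>" for \<mu>
  have \<nu>_S1: "\<nu> \<mu> \<in> S1_space K" if "\<mu> \<in> S1_space K" for \<mu>
    unfolding \<nu>_def by (intro S1_add S1_scale P_S1 that)
  have \<nu>_mass: "\<nu> \<mu> (space S) = 0" for \<mu> using mass_P[of \<mu>] by (simp add: \<nu>_def scaleR_fun_def[of "-1"])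
  have N_push: "N \<mu> = push (\<nu> \<mu>)" for \<mu>
    by (simp only: N_def \<nu>_def push_forward_add push_forward_scale pushP)
  have push_mass0: "(push ^^ n) (\<nu> \<mu>) (space S) = 0" for n \<mu>
    by (induction n) (simp_all add: \<nu>_mass push_mass[symmetric] del: space_Sigma_borel)
  \<comment> \<open>Only from the first power on: the zeroth power of \<open>N\<close> is the
    identity and keeps the mass part.\<close>
  have N_pow: "(N ^^ Suc n) \<mu> = (push ^^ Suc n) (\<nu> \<mu>)" for n \<mu>
  proof (induction n)
    case (Suc n)
    have "P ((push ^^ Suc n) (\<nu> \<mu>)) = 0" using push_mass0[of "Suc n" \<mu>] by (simp add: P_def)
    then have "N ((push ^^ Suc n) (\<nu> \<mu>)) = push ((push ^^ Suc n) (\<nu> \<mu>))" by (simp add: N_def)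
    then show ?case using Suc by simp
  qed (simp add: N_push)
  define B0 where "B0 = BV_norm (\<Phi> \<mu>0)"
  have B0: "0 \<le> B0" by (simp add: B0_def BV_norm_nonneg)
  \<comment> \<open>24 is the 6 of the decomposition into decreasing densities times the 4 that
    leads back to the norm, once for \<open>\<mu>\<close> and once for the multiple of
    \<open>\<mu>0\<close>; \<open>1 + L1 \<mu>0\<close> does the same for the fibre norm.\<close>
  define C where "C = 24 + 24 * B0 + 1 + L1 \<mu>0"
  have C: "0 \<le> C" using B0 by (simp add: C_def)
  have \<nu>_norm: "S1_norm K (\<nu> \<mu>) \<le> C * S1_norm K \<mu>" if \<mu>: "\<mu> \<in> S1_space K" for \<mu>
  proof -
    let ?c = "- \<mu> (space S)"
    have \<nu>_eq: "\<nu> \<mu> = \<mu> + ?c *\<^sub>R \<mu>0" by (simp add: \<nu>_def P_def)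
    have ab: "\<mu> \<in> AB K" "\<mu>0 \<in> AB K" using \<mu> \<mu>0 by (auto simp: S1_iff)
    have c: "\<bar>?c\<bar> \<le> S1_norm K \<mu>" using mass_le_norm[OF \<mu>] by simp
    obtain p q where r1: "decreasing_rep (6 * BV_norm (\<Phi> \<mu>)) p q \<mu>" using S1_decreasing_rep[OF \<mu>] by blast
    obtain p0 q0 where "decreasing_rep (6 * B0) p0 q0 \<mu>0" using S1_decreasing_rep[OF \<mu>0(1)] by (auto simp: B0_def)
    from decreasing_rep_scale[OF this] obtain p' q' where r2: "decreasing_rep (\<bar>?c\<bar> * (6 * B0)) p' q' (?c *\<^sub>R \<mu>0)" by blast
    have "BV_norm (\<Phi> (\<nu> \<mu>)) \<le> 4 * (6 * BV_norm (\<Phi> \<mu>) + \<bar>?c\<bar> * (6 * B0))"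
      unfolding \<nu>_eq by (rule decreasing_rep_norms(2)[OF decreasing_rep_add[OF r1 r2]])
    also have "\<dots> \<le> 24 * S1_norm K \<mu> + 24 * B0 * S1_norm K \<mu>"
    proof -
      have "BV_norm (\<Phi> \<mu>) \<le> S1_norm K \<mu>" by (simp add: S1_norm_def)
      moreover have "\<bar>?c\<bar> * B0 \<le> S1_norm K \<mu> * B0" using c B0 by (rule mult_right_mono)
      ultimately show ?thesis by (simp add: algebra_simps)
    qed
    finally have 1: "BV_norm (\<Phi> (\<nu> \<mu>)) \<le> 24 * S1_norm K \<mu> + 24 * B0 * S1_norm K \<mu>" .
    have "L1 (\<nu> \<mu>) \<le> L1 \<mu> + L1 (?c *\<^sub>R \<mu>0)"
      unfolding \<nu>_eq by (rule L1_norm_add[OF K(1) K_nonempty ab(1) AB_scale[OF ab(2)]])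
    also have "L1 (?c *\<^sub>R \<mu>0) \<le> \<bar>?c\<bar> * L1 \<mu>0" by (rule L1_norm_scale[OF K(1) K_nonempty ab(2)])
    also have "\<dots> \<le> S1_norm K \<mu> * L1 \<mu>0" using c by (intro mult_right_mono) auto
    also have "L1 \<mu> \<le> S1_norm K \<mu>" using BV_norm_nonneg by (simp add: S1_norm_def)
    finally have "L1 (\<nu> \<mu>) \<le> S1_norm K \<mu> + S1_norm K \<mu> * L1 \<mu>0" by simp
    then show ?thesis using 1 unfolding S1_norm_def[of K "\<nu> \<mu>"] by (simp add: C_def algebra_simps)
  qed
  have decayN: "S1_norm K ((N ^^ n) \<mu>) \<le> S1_norm K \<mu> * l0 ^ n * (U * C)" if \<mu>: "\<mu> \<in> S1_space K" and n: "n \<ge> 1" for \<mu> n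
  proof -
    obtain k where k: "n = Suc k" using n by (cases n) auto
    have "S1_norm K ((N ^^ n) \<mu>) = S1_norm K ((push ^^ n) (\<nu> \<mu>))" unfolding k N_pow ..
    also have "\<dots> \<le> U * l0 ^ n * S1_norm K (\<nu> \<mu>)" by (rule decay[OF \<nu>_S1[OF \<mu>] \<nu>_mass])
    also have "\<dots> \<le> U * l0 ^ n * (C * S1_norm K \<mu>)" using \<nu>_norm[OF \<mu>] l0 by (intro mult_left_mono) auto
    finally show ?thesis by (simp add: mult_ac)
  qed
  have "P ` S1_space K = span {\<mu>0}"
  proof -
    have "c *\<^sub>R \<mu>0 \<in> P ` S1_space K" for c
    proof (rule image_eqI)
      show "c *\<^sub>R \<mu>0 = P (c *\<^sub>R \<mu>0)" unfolding P_scale unfolding P_def \<mu>0(3) by simp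
    qed (intro S1_scale \<mu>0)
    then show ?thesis by (auto simp: span_singleton P_def)
  qed
  moreover have "\<mu>0 \<noteq> 0" using \<mu>0(3) by auto
  ultimately have dimP: "dim (P ` S1_space K) = 1"
    by (simp add: dim_eq_card_independent)
  show ?thesis
  proof (rule exI[of _ P], rule exI[of _ N], intro conjI)
    show "linear_operator_on (S1_space K) P"
      unfolding linear_operator_on_def using P_S1 P_add P_scale by blast
    show "linear_operator_on (S1_space K) N"
      unfolding linear_operator_on_def using N_S1 N_add N_scale by blast
    show "\<forall>\<mu>\<in>S1_space K. push \<mu> \<in> S1_space K \<and> push \<mu> = P \<mu> + N \<mu>"
      using push_S1 by (simp add: N_def)
    show "\<exists>l0 U :: real. 0 \<le> l0 \<and> l0 < 1 \<and> 0 \<le> U \<and>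
      (\<forall>\<mu>\<in>S1_space K. \<forall>n\<ge>1. S1_norm K ((N ^^ n) \<mu>) \<le> S1_norm K \<mu> * l0 ^ n * U)"
      using l0 C decayN by (intro exI[of _ l0] exI[of _ "U * C"]) auto
  qed (use PP dimP PN NP in auto)
qed

end

theorem theoremB:
  fixes K :: "'k::metric_space set"
    and f :: "real \<Rightarrow> real"
    and G :: "real \<times> 'k \<Rightarrow> 'k"
    and F :: "real \<times> 'k \<Rightarrow> real \<times> 'k"
  assumes "compact K" and "diameter K = 1"
    and "\<And>x y. F (x, y) = (f x, G (x, y))"
    and "F \<in> measurable (Sigma_borel K) (Sigma_borel K)"
    and "class_T f"
    and "H1 K G"
  shows "\<exists>P N :: ((real \<times> 'k) set \<Rightarrow> real) \<Rightarrow> ((real \<times> 'k) set \<Rightarrow> real).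
    linear_operator_on (S1_space K) P \<and>
    linear_operator_on (S1_space K) N \<and>
    (\<forall>\<mu>\<in>S1_space K. push_forward (Sigma_borel K) F \<mu> \<in> S1_space K \<and>
        push_forward (Sigma_borel K) F \<mu> = P \<mu> + N \<mu>) \<and>
    (\<forall>\<mu>\<in>S1_space K. P (P \<mu>) = P \<mu>) \<and>
    dim (P ` S1_space K) = 1 \<and>
    (\<exists>l0 U :: real. 0 \<le> l0 \<and> l0 < 1 \<and> 0 \<le> U \<and>
      (\<forall>\<mu>\<in>S1_space K. \<forall>n\<ge>1. S1_norm K ((N ^^ n) \<mu>) \<le> S1_norm K \<mu> * l0 ^ n * U)) \<and>
    (\<forall>\<mu>\<in>S1_space K. P (N \<mu>) = 0 \<and> N (P \<mu>) = 0)"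
proof -
  have K0: "K \<noteq> {}" using assms(2) by auto
  then obtain y0 where y0: "y0 \<in> K" by auto
  have f: "f \<in> measurable unit_leb unit_leb"
  proof -
    \<comment> \<open>\<open>f\<close> is the first coordinate of \<open>F\<close> along the section
      at height \<open>y0\<close>, which gives its measurability.\<close>
    have "(\<lambda>x. (x, y0)) \<in> measurable unit_leb (unit_leb \<Otimes>\<^sub>M restrict_space borel K)"
      using y0 by (intro measurable_Pair2') (simp add: space_restrict_space)
    then have "(\<lambda>x. (x, y0)) \<in> measurable unit_leb (Sigma_borel K)"
      unfolding measurable_cong_sets[OF refl sets_Sigma_borel_pair[OF assms(1) K0], of unit_leb] .
    from measurable_compose[OF measurable_compose[OF this assms(4)] fst_measurable_Sigma]
    show ?thesis by (simp add: assms(3))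
  qed
  from assms(5) obtain a b :: "nat \<Rightarrow> real" where c:
    "(\<forall>i. a i < b i \<and> {a i<..<b i} \<subseteq> {0..1}) \<and>
     disjoint_family (\<lambda>i. {a i<..<b i}) \<and>
     emeasure unit_leb ({0..1} - (\<Union>i. {a i<..<b i})) = 0 \<and>
     (\<forall>i. f ` {a i<..<b i} \<subseteq> {0..1} \<and>
        mono_on {a i<..<b i} f \<and>
        convex_on {a i<..<b i} f \<and>
        f differentiable_on {a i<..<b i} \<and>
        (f \<longlongrightarrow> 0) (at_right (a i))) \<and>
     (\<Sum>i. 1 / ennreal (right_deriv_lim f (a i))) < \<infinity> \<and>
     (\<not> 0 islimpt (range a \<union> range b) \<longrightarrow>
        (\<exists>\<beta>. 0 < \<beta> \<and> \<beta> < 1 \<and> right_deriv_lim f 0 = 1 / \<beta>))"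
    unfolding class_T_def by (elim exE)
  have T: "class_T_map f a b"
    by (rule class_T_map.intro) (use c f in simp_all)
  obtain \<alpha>0 where \<alpha>0: "0 \<le> \<alpha>0" "\<alpha>0 < 1"
    "AE x in unit_leb. \<forall>z1\<in>K. \<forall>z2\<in>K. dist (G (x, z1)) (G (x, z2)) \<le> \<alpha>0 * dist z1 z2"
    using assms(6) unfolding H1_def by blast
  \<comment> \<open>Keeps the contraction factor away from 0, since the fibre estimate divides by
    it.\<close>
  define \<alpha> where "\<alpha> = max \<alpha>0 (1/2)"
  have "AE x in unit_leb. \<forall>z1\<in>K. \<forall>z2\<in>K. dist (G (x, z1)) (G (x, z2)) \<le> \<alpha> * dist z1 z2"
    using \<alpha>0(3)
  proof eventually_elim
    case (elim x)
    have "\<alpha>0 * dist z1 z2 \<le> \<alpha> * dist z1 z2" for z1 z2 :: 'k by (intro mult_right_mono) (auto simp: \<alpha>_def)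
    then show ?case using elim by (meson order_trans)
  qed
  then have "skew_product f a b K G F \<alpha>"
    using T assms \<alpha>0 by (intro skew_product.intro skew_product_axioms.intro) (auto simp: \<alpha>_def)
  then show ?thesis by (rule skew_product.spectral_decomposition)
qed

end
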